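(* Let $X=(X_t)_{t\ge 0}$ be a real-valued Lévy process with Lévy symbol $\eta$. Suppose that (A) $\dfrac{1}{q-\eta(u)}\in L^1(\mathbb{R})$ (as a function of $u$) for all $q>0$, and (B) $\displaystyle\int_0^1\left|\mathrm{Im}\left(\frac{u}{\eta(u)}\right)\right|du<\infty$. Let $$h(y):=\frac1\pi\int_0^\infty \mathrm{Re}\left(\frac{e^{iuy}-1}{\eta(u)}\right)du,\qquad y\in\mathbb{R},$$ and let $M^{q,x}$ and $L^x$ be the processes defined in the context. Then for each $t\ge 0$ and $x\in\mathbb{R}$ the limit $\tilde N^x_t:=-\lim_{q\downarrow 0}M^{q,x}_t$ exists a.s., it holds a.s. that $$h(X_t-x)=h(X_0-x)+\tilde N^x_t+L^x_t,$$ and for each $x\in\mathbb{R}$ the process $(\tilde N^x_t)_{t\ge0}$ is a martingale with respect to the natural filtration of $X$ (under $\mathbb{P}_y$, for every starting point $y\in\mathbb{R}$).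
   Context: $\mathbb{P}_y$, $\mathbb{E}_y$ denote the law of $X$ started at $y$ and its expectation. The Lévy symbol $\eta$ is defined by $\mathbb{E}_0[e^{iuX_t}]=e^{t\eta(u)}$, with $$\eta(u)=ibu-\tfrac12au^2+\int_{\mathbb{R}\setminus\{0\}}\left(e^{iuy}-1-iuy1_{|y|\le1}\right)\nu(dy),$$ where $b\in\mathbb{R}$, $a\ge0$ and $\nu$ is a measure on $\mathbb{R}\setminus\{0\}$ with $\int(|y|^2\wedge1)\,\nu(dy)<\infty$. Resolvent: $R_qf(x):=\mathbb{E}_x\left[\int_0^\infty e^{-qt}f(X_t)\,dt\right]$ for bounded Borel $f$ and $q>0$. Under (A) there is, for each $q>0$, a (unique) bounded continuous resolvent density $r_q$, i.e. $R_qf(x)=\int_{\mathbb{R}}f(y)\,r_q(y-x)\,dy$ for all bounded Borel $f$ and all $x\in\mathbb{R}$. Local time: $L=\{L^x_t\}$ is the occupation density, $\int_0^tf(X_s)\,ds=\int_{\mathbb{R}}f(a)L^a_t\,da$ a.s. for every nonnegative Borel $f$ and $t\ge0$, chosen as $$L^x_t:=\limsup_{\varepsilon\downarrow0}\frac1{2\varepsilon}\int_0^t1_{\{|X_s-x|<\varepsilon\}}\,ds.$$ The process $M^{q,x}$ ($q>0$, $x\in\mathbb{R}$) is defined by $$M^{q,x}_t:=r_q(-X_t+x)-r_q(-X_0+x)-q\int_0^tr_q(-X_s+x)\,ds+L^x_t.$$ *)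

theory Defs
  imports "HOL-Probability.Probability"
begin

definition cadlag_path :: "(real \<Rightarrow> real) \<Rightarrow> bool" where
  "cadlag_path f \<longleftrightarrow>
     (\<forall>t\<ge>0. (f \<longlongrightarrow> f t) (at_right t)) \<and> (\<forall>t>0. \<exists>l. (f \<longlongrightarrow> l) (at_left t))"

text \<open>
  Time is \<^term>\<open>{0::real..}\<close>; the values \<open>X t\<close> for negative \<open>t\<close> play no role.
\<close>

definition levy_process_from_zero :: "'w measure \<Rightarrow> (real \<Rightarrow> 'w \<Rightarrow> real) \<Rightarrow> bool" where
  "levy_process_from_zero M X \<longleftrightarrow>
     prob_space M \<and>
     (\<forall>t\<ge>0. X t \<in> borel_measurable M) \<and>
     (\<forall>\<omega>\<in>space M. cadlag_path (\<lambda>t. X t \<omega>)) \<and>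
     (AE \<omega> in M. X 0 \<omega> = 0) \<and>
     (\<forall>(\<tau> :: nat \<Rightarrow> real) n. 0 \<le> \<tau> 0 \<and> incseq \<tau> \<longrightarrow>
        prob_space.indep_vars M (\<lambda>_. borel) (\<lambda>i \<omega>. X (\<tau> (Suc i)) \<omega> - X (\<tau> i) \<omega>) {..<n}) \<and>
     (\<forall>s t. 0 \<le> s \<and> s \<le> t \<longrightarrow>
        distr M borel (\<lambda>\<omega>. X t \<omega> - X s \<omega>) = distr M borel (\<lambda>\<omega>. X (t - s) \<omega> - X 0 \<omega>))"

text \<open>
  The family \<open>P y\<close> lives on one measurable space that carries the single process \<open>X\<close>.
  Under \<open>P y\<close> the path \<open>X\<close> is distributed as \<open>y + X\<close> under \<open>P 0\<close>.
\<close>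

definition levy_process :: "(real \<Rightarrow> 'w measure) \<Rightarrow> (real \<Rightarrow> 'w \<Rightarrow> real) \<Rightarrow> bool" where
  "levy_process P X \<longleftrightarrow>
     levy_process_from_zero (P 0) X \<and>
     (\<forall>y. sets (P y) = sets (P 0) \<and>
        distr (P y) (Pi\<^sub>M {0..} (\<lambda>_. borel)) (\<lambda>\<omega>. \<lambda>t\<in>{0..}. X t \<omega>) =
        distr (P 0) (Pi\<^sub>M {0..} (\<lambda>_. borel)) (\<lambda>\<omega>. \<lambda>t\<in>{0..}. y + X t \<omega>))"

definition levy_measure :: "real measure \<Rightarrow> bool" where
  "levy_measure \<nu> \<longleftrightarrow>
     sets \<nu> = sets (restrict_space borel (- {0})) \<and>
     (\<integral>\<^sup>+y. ennreal (min (\<bar>y\<bar>\<^sup>2) 1) \<partial>\<nu>) < \<infinity>"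

definition levy_khintchine :: "real \<Rightarrow> real \<Rightarrow> real measure \<Rightarrow> real \<Rightarrow> complex" where
  "levy_khintchine b a \<nu> u =
     \<i> * of_real (b * u) - of_real (a * u\<^sup>2 / 2) +
     (\<integral>y. (iexp (u * y) - 1 - (if \<bar>y\<bar> \<le> 1 then \<i> * of_real (u * y) else 0)) \<partial>\<nu>)"

definition has_levy_symbol ::
    "(real \<Rightarrow> 'w measure) \<Rightarrow> (real \<Rightarrow> 'w \<Rightarrow> real) \<Rightarrow> (real \<Rightarrow> complex) \<Rightarrow> bool" where
  "has_levy_symbol P X \<eta> \<longleftrightarrow>
     (\<exists>b a \<nu>. a \<ge> 0 \<and> levy_measure \<nu> \<and> \<eta> = levy_khintchine b a \<nu>) \<and>
     (\<forall>t\<ge>0. \<forall>u. (\<integral>\<omega>. iexp (u * X t \<omega>) \<partial>P 0) = exp (of_real t * \<eta> u))"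

definition resolvent ::
    "(real \<Rightarrow> 'w measure) \<Rightarrow> (real \<Rightarrow> 'w \<Rightarrow> real) \<Rightarrow> real \<Rightarrow> (real \<Rightarrow> real) \<Rightarrow> real \<Rightarrow> real" where
  "resolvent P X q f x = (\<integral>\<omega>. (LBINT t:{0..}. exp (- q * t) * f (X t \<omega>)) \<partial>P x)"

text \<open>
  Taking \<open>f = 1\<close> below shows that any such \<open>r\<close> is integrable with integral \<open>1 / q\<close>,
  so the default value of the Bochner integral does not interfere, and \<open>r\<close> is unique by
  continuity.
\<close>

definition resolvent_density ::
    "(real \<Rightarrow> 'w measure) \<Rightarrow> (real \<Rightarrow> 'w \<Rightarrow> real) \<Rightarrow> real \<Rightarrow> real \<Rightarrow> real" where
  "resolvent_density P X q =
     (THE r. bounded (range r) \<and> continuous_on UNIV r \<and>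
        (\<forall>f x. f \<in> borel_measurable borel \<and> bounded (range f) \<longrightarrow>
           resolvent P X q f x = (\<integral>y. f y * r (y - x) \<partial>lborel)))"

text \<open>
  The limsup is taken in the extended reals and may a priori be infinite.
\<close>

definition local_time :: "(real \<Rightarrow> 'w \<Rightarrow> real) \<Rightarrow> real \<Rightarrow> real \<Rightarrow> 'w \<Rightarrow> ereal" where
  "local_time X x t \<omega> =
     Limsup (at_right 0) (\<lambda>\<epsilon>::real.
       ereal (1 / (2 * \<epsilon>) * (LBINT s:{0..t}. indicator {s. \<bar>X s \<omega> - x\<bar> < \<epsilon>} s)))"

text \<open>
  In the next definition \<^const>\<open>real_of_ereal\<close> only matters on the null event that the local time
  is infinite, where it returns 0.
\<close>

definition M_proc ::
    "(real \<Rightarrow> 'w measure) \<Rightarrow> (real \<Rightarrow> 'w \<Rightarrow> real) \<Rightarrow> real \<Rightarrow> real \<Rightarrow> real \<Rightarrow> 'w \<Rightarrow> real" where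
  "M_proc P X q x t \<omega> =
     resolvent_density P X q (- X t \<omega> + x) - resolvent_density P X q (- X 0 \<omega> + x)
     - q * (LBINT s:{0..t}. resolvent_density P X q (- X s \<omega> + x))
     + real_of_ereal (local_time X x t \<omega>)"

definition N_tilde ::
    "(real \<Rightarrow> 'w measure) \<Rightarrow> (real \<Rightarrow> 'w \<Rightarrow> real) \<Rightarrow> real \<Rightarrow> real \<Rightarrow> 'w \<Rightarrow> real" where
  "N_tilde P X x t \<omega> = - Lim (at_right 0) (\<lambda>q. M_proc P X q x t \<omega>)"

definition h_fun :: "(real \<Rightarrow> complex) \<Rightarrow> real \<Rightarrow> real" where
  "h_fun \<eta> y = 1 / pi * (LBINT u:{0..}. Re ((iexp (u * y) - 1) / \<eta> u))"

text \<open>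
  The raw natural filtration, without completion by null sets.
\<close>

definition natural_filtration :: "'w measure \<Rightarrow> (real \<Rightarrow> 'w \<Rightarrow> real) \<Rightarrow> real \<Rightarrow> 'w measure" where
  "natural_filtration M X t =
     sigma (space M) (\<Union>s\<in>{0..t}. {X s -` A \<inter> space M | A. A \<in> sets borel})"

definition martingale :: "'w measure \<Rightarrow> (real \<Rightarrow> 'w measure) \<Rightarrow> (real \<Rightarrow> 'w \<Rightarrow> real) \<Rightarrow> bool" where
  "martingale M F N \<longleftrightarrow>
     (\<forall>t\<ge>0. subalgebra M (F t)) \<and>
     (\<forall>s t. 0 \<le> s \<and> s \<le> t \<longrightarrow> subalgebra (F t) (F s)) \<and>
     (\<forall>t\<ge>0. N t \<in> borel_measurable (F t) \<and> integrable M (N t)) \<and>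
     (\<forall>s t. 0 \<le> s \<and> s \<le> t \<longrightarrow> (AE \<omega> in M. real_cond_exp M (F s) (N t) \<omega> = N s \<omega>))"

end

theory Submission
  imports Defs
begin

text \<open>
  Write \<open>h\<^sub>q(y) = r\<^sub>q(0) - r\<^sub>q(-y)\<close>. For every \<open>\<omega>\<close> the quantity \<open>M\<close> equals
  \<open>h\<^sub>q(X\<^sub>0 - x) - h\<^sub>q(X\<^sub>t - x)\<close> plus the local time minus an integral of \<open>q r\<^sub>q\<close>, and \<open>q r\<^sub>q\<close> tends to 0
  uniformly while \<open>h\<^sub>q\<close> tends to \<open>h\<close> by (B) and dominated convergence. So the limit exists everywhere, the
  decomposition only needs the local time to be finite, and the point is the martingale property of
  \<open>h(X\<^sub>t - x) - h(X\<^sub>0 - x) - L\<^sub>t\<close>.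

  Let \<open>l\<^sub>\<tau>\<close> be the density of the mean occupation measure on \<open>[0,\<tau>]\<close>. Comparing Fourier transforms,
  \<open>E h(v + X\<^sub>\<tau>) = h(v) + l\<^sub>\<tau>(-v)\<close>; integrability comes from \<open>h\<^sub>q \<ge> 0\<close>, which is the maximum principle
  \<open>r\<^sub>q(z) \<le> r\<^sub>q(0)\<close>. The occupation averages over windows of radius \<open>\<epsilon>\<close> are Cauchy in \<open>L\<^sup>2\<close>, uniformly in the level,
  because \<open>l\<^sub>\<tau>\<close> is uniformly continuous; their limit has conditional increments with mean \<open>l\<^sub>t\<^sub>-\<^sub>s(x - X\<^sub>s)\<close>,
  which cancel those of \<open>h\<close>.

  It remains to identify the limsup over all radii with the limit along a sequence of radii. For almost every level this is
  Lebesgue differentiation. A fixed level is reduced to that case by restarting at a small time \<open>d\<close>,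
  since for almost every \<open>d\<close> the level seen from \<open>X\<^sub>d\<close> is almost surely not exceptional; the contribution of the time
  before \<open>d\<close> is negligible by a Markov property estimate at a good level.
\<close>

section \<open>Fourier inversion of integrable characteristic functions\<close>

text \<open>Two estimates on the symbol carry the proof. Away from 0, \<open>1 / \<eta>\<close> is
  integrable by (A). Near 0 it may be singular, but \<open>|\<eta> u| >= c * u^2\<close>, again from
  (A): at an exponential time the process has the integrable characteristic function
  \<open>1 / (1 - \<eta>)\<close>, which therefore tends to 0. The factor \<open>1 - cos\<close>
  compensates the quadratic singularity; (B) serves the sine part. The maximum principle matters
  because the process may lack a first moment. The sine part of \<open>h_q(y)\<close> is controlled
  only by a multiple of \<open>|y|\<close>; as \<open>h_q >= 0\<close>, the sum
  \<open>h_q(y) + h_q(-y)\<close> is a majorant without that part, and its mean is finite. At a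
  fixed level no maximal inequality over the radii is used. A path that comes close to a good level
  \<open>w\<close> restarts there and sees \<open>w\<close> almost as its own starting point. So the
  limsup at 0 over a short time is bounded by the limsup at \<open>w\<close>, weighted with the time
  spent near \<open>w\<close>; there it is the limit along the sequence, and second moments bound
  it. Under \<open>P y\<close> everything is applied to \<open>X - y\<close> and the level
  \<open>x - y\<close>.\<close>

definition finv :: "(real \<Rightarrow> complex) \<Rightarrow> real \<Rightarrow> real" where
  "finv \<phi> z = Re (\<integral>u. iexp (-(u*z)) * \<phi> u \<partial>lborel) / (2*pi)"

lemma integrable_iexp_mult:
  assumes "integrable lborel \<phi>"
  shows "integrable lborel (\<lambda>u::real. iexp (u*z) * \<phi> u)"
proof (rule Bochner_Integration.integrable_bound[OF assms])
  have [measurable]: "\<phi> \<in> borel_measurable borel" using borel_measurable_integrable[OF assms] by simp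
  show "(\<lambda>u::real. iexp (u*z) * \<phi> u) \<in> borel_measurable lborel" by measurable
qed (auto simp: norm_mult)

lemma integrable_iexp_mult':
  assumes "integrable lborel \<phi>"
  shows "integrable lborel (\<lambda>u::real. iexp (-(u*z)) * \<phi> u)"
  using integrable_iexp_mult[OF assms, of "-z"] by simp

lemma finv_bound:
  assumes "integrable lborel \<phi>"
  shows "\<bar>finv \<phi> z\<bar> \<le> (\<integral>u. norm (\<phi> u) \<partial>lborel) / (2*pi)"
proof -
  have "\<bar>Re (\<integral>u. iexp (-(u*z)) * \<phi> u \<partial>lborel)\<bar> \<le> norm (\<integral>u. iexp (-(u*z)) * \<phi> u \<partial>lborel)"
    by (rule abs_Re_le_cmod)
  also have "\<dots> \<le> (\<integral>u. norm (iexp (-(u*z)) * \<phi> u) \<partial>lborel)"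
    by (rule integral_norm_bound)
  also have "\<dots> = (\<integral>u. norm (\<phi> u) \<partial>lborel)" by (simp add: norm_mult)
  finally show ?thesis unfolding finv_def by (simp add: divide_right_mono)
qed

text \<open>The right side depends on \<open>z - w\<close> and on \<open>norm (\<phi> u)\<close>
  only. So one integrable majorant of a whole family of \<open>\<phi>\<close> yields a common
  modulus of continuity, as used in \<open>occ_equicont\<close>.\<close>

lemma finv_diff_bound:
  assumes "integrable lborel \<phi>"
  shows "\<bar>finv \<phi> z - finv \<phi> w\<bar> \<le> (\<integral>u. norm (iexp (u*(z-w)) - 1) * norm (\<phi> u) \<partial>lborel) / (2*pi)"
proof -
  have e: "norm (iexp (-(u*z)) - iexp (-(u*w))) = norm (iexp (u*(z-w)) - 1)" for u :: real
  proof -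
    have "iexp (-(u*w)) = iexp (-(u*z)) * iexp (u*(z-w))"
      by (simp add: exp_add[symmetric] algebra_simps)
    then have "iexp (-(u*z)) - iexp (-(u*w)) = - iexp (-(u*z)) * (iexp (u*(z-w)) - 1)"
      by (simp add: algebra_simps)
    then show ?thesis by (simp add: norm_mult norm_minus_commute)
  qed
  have "finv \<phi> z - finv \<phi> w = Re ((\<integral>u. iexp (-(u*z)) * \<phi> u \<partial>lborel) - (\<integral>u. iexp (-(u*w)) * \<phi> u \<partial>lborel)) / (2*pi)"
    unfolding finv_def by (simp add: diff_divide_distrib)
  also have "(\<integral>u. iexp (-(u*z)) * \<phi> u \<partial>lborel) - (\<integral>u. iexp (-(u*w)) * \<phi> u \<partial>lborel) =
     (\<integral>u. iexp (-(u*z)) * \<phi> u - iexp (-(u*w)) * \<phi> u \<partial>lborel)"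
    using integrable_iexp_mult'[OF assms] by (intro Bochner_Integration.integral_diff[symmetric])
  finally have "\<bar>finv \<phi> z - finv \<phi> w\<bar> = \<bar>Re (\<integral>u. iexp (-(u*z)) * \<phi> u - iexp (-(u*w)) * \<phi> u \<partial>lborel)\<bar>/(2*pi)"
    by simp
  also have "\<dots> \<le> norm (\<integral>u. iexp (-(u*z)) * \<phi> u - iexp (-(u*w)) * \<phi> u \<partial>lborel) / (2*pi)"
    by (intro divide_right_mono abs_Re_le_cmod) auto
  also have "\<dots> \<le> (\<integral>u. norm (iexp (-(u*z)) * \<phi> u - iexp (-(u*w)) * \<phi> u) \<partial>lborel) / (2*pi)"
    by (intro divide_right_mono integral_norm_bound) auto
  also have "(\<lambda>u. norm (iexp (-(u*z)) * \<phi> u - iexp (-(u*w)) * \<phi> u)) = (\<lambda>u. norm (iexp (u*(z-w)) - 1) * norm (\<phi> u))"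
    unfolding left_diff_distrib[symmetric] norm_mult e ..
  finally show ?thesis .
qed

lemma tendsto_integral_iexp_minus_1:
  fixes w :: "real \<Rightarrow> real"
  assumes w: "integrable lborel w" "\<And>u. 0 \<le> w u"
  shows "((\<lambda>d::real. (\<integral>u. norm (iexp (u*d) - 1) * w u \<partial>lborel)) \<longlongrightarrow> 0) (at 0)"
proof -
  have [measurable]: "w \<in> borel_measurable borel" using borel_measurable_integrable[OF w(1)] by simp
  have "((\<lambda>d::real. (\<integral>u. norm (iexp (u*d) - 1) * w u \<partial>lborel)) \<longlongrightarrow> (\<integral>u. 0 \<partial>(lborel::real measure))) (at 0)"
    unfolding tendsto_at_iff_sequentially comp_def
  proof (intro allI impI)
    fix X :: "nat \<Rightarrow> real" assume X: "X \<longlonglongrightarrow> 0"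
    show "(\<lambda>n. \<integral>u. norm (iexp (u * X n) - 1) * w u \<partial>lborel) \<longlonglongrightarrow> (\<integral>u. 0 \<partial>(lborel::real measure))"
    proof (rule integral_dominated_convergence[where w="\<lambda>u. 2 * w u"])
      show "integrable lborel (\<lambda>u. 2 * w u)" using w by simp
      have "(\<lambda>n. norm (iexp (u * X n) - 1) * w u) \<longlonglongrightarrow> norm (iexp (u * 0) - 1) * w u" for u
        using X by (intro tendsto_intros)
      then show "AE u in lborel. (\<lambda>n. norm (iexp (u * X n) - 1) * w u) \<longlonglongrightarrow> 0" by simp
      have "norm (iexp (u * X n) - 1) * w u \<le> 2 * w u" for u n
        using norm_triangle_ineq4[of "iexp (u * X n)" 1] w(2)[of u] by (intro mult_right_mono) auto
      then show "AE u in lborel. norm (norm (iexp (u * X n) - 1) * w u) \<le> 2 * w u" for n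
        using w(2) by (simp add: abs_mult)
    qed measurable
  qed
  then show ?thesis by simp
qed

lemma continuous_finv:
  assumes "integrable lborel \<phi>"
  shows "continuous_on UNIV (finv \<phi>)"
  unfolding continuous_on_eq_continuous_at[OF open_UNIV]
proof (rule ballI)
  fix w :: real
  have 1: "((\<lambda>d::real. (\<integral>u. norm (iexp (u*d) - 1) * norm (\<phi> u) \<partial>lborel) / (2*pi)) \<longlongrightarrow> 0 / (2*pi)) (at 0)"
    using assms by (intro tendsto_divide tendsto_integral_iexp_minus_1 tendsto_const) auto
  have "((\<lambda>z. finv \<phi> z - finv \<phi> w) \<longlongrightarrow> 0) (at w)"
  proof (rule Lim_null_comparison)
    show "\<forall>\<^sub>F z in at w. norm (finv \<phi> z - finv \<phi> w) \<le> (\<integral>u. norm (iexp (u*(z-w)) - 1) * norm (\<phi> u) \<partial>lborel) / (2*pi)"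
      using finv_diff_bound[OF assms] by auto
    show "((\<lambda>z. (\<integral>u. norm (iexp (u*(z-w)) - 1) * norm (\<phi> u) \<partial>lborel) / (2*pi)) \<longlongrightarrow> 0) (at w)"
      using 1 by (subst LIM_offset_zero_iff) (auto simp: algebra_simps)
  qed
  then show "isCont (finv \<phi>) w"
    unfolding isCont_def by (subst (asm) LIM_zero_iff)
qed

lemma measurable_finv:
  assumes "integrable lborel \<phi>"
  shows "finv \<phi> \<in> borel_measurable borel"
  using continuous_finv[OF assms] by (rule borel_measurable_continuous_onI)

lemma has_integral_iexp_interval:
  fixes a b t :: real assumes "a \<le> b" "t \<noteq> 0"
  shows "(LINT z|lborel. indicator {a..b} z *\<^sub>R iexp (-(t*z))) = (iexp (-(t*a)) - iexp (-(t*b))) / (\<i>*t)"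
proof -
  have "(\<integral>z. indicator {a..b} z *\<^sub>R iexp (-(t*z)) \<partial>lborel) = (- iexp (-(t*b)) / (\<i>*t)) - (- iexp (-(t*a)) / (\<i>*t))"
  proof (rule integral_FTC_Icc[OF assms(1), where F="\<lambda>z. - iexp (-(t*z)) / (\<i>*t)"])
    show "continuous_on {a..b} (\<lambda>z. iexp (-(t*z)))" by (intro continuous_intros)
    show "((\<lambda>z. - iexp (-(t*z)) / (\<i>*t)) has_vector_derivative iexp (-(t*x))) (at x within {a..b})" for x
    proof -
      have "((\<lambda>w. - exp (-(\<i>*t*w)) / (\<i>*t)) has_field_derivative exp (-(\<i>*t* of_real x))) (at (of_real x))"
        using assms(2) by (auto intro!: derivative_eq_intros)
      from has_vector_derivative_real_field[OF this, of "{a..b}"] show ?thesis by (simp add: mult.assoc)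
    qed
  qed
  then show ?thesis by (simp add: diff_divide_distrib)
qed

text \<open>Levy's inversion formula uses truncated integrals; integrability of
  \<open>char M\<close> removes the truncation by dominated convergence. The kernel
  \<open>?D t\<close> is the integral of \<open>iexp (-(t * z))\<close> over \<open>{a..b}\<close>,
  so Fubini turns the formula into an integral of \<open>finv\<close>.\<close>

lemma (in real_distribution) integrable_char_interval:
  assumes int: "integrable lborel (char M)" and ab: "a \<le> b" "measure M {a} = 0" "measure M {b} = 0"
  shows "measure M {a<..b} = (\<integral>z. indicator {a..b} z * finv (char M) z \<partial>lborel)"
proof -
  let ?D = "\<lambda>t. (iexp (-(t * a)) - iexp (-(t * b))) / (\<i> * t)"
  have D: "norm (?D t) \<le> b - a" if "t \<noteq> 0" for t
  proof -
    have "?D t = (iexp (t * (-a)) - iexp (t * (-b))) / (\<i> * t)" by simp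
    then show ?thesis using Levy_Inversion_aux2[of "-b" "-a" t] ab that by simp
  qed
  have D0: "norm (?D t) \<le> b - a" for t using D[of t] ab by (cases "t = 0") auto
  have intD: "integrable lborel (\<lambda>t. ?D t * char M t)"
  proof (rule Bochner_Integration.integrable_bound)
    show "integrable lborel (\<lambda>t. (b - a) * norm (char M t))" using int by simp
    show "AE t in lborel. norm (?D t * char M t) \<le> norm ((b - a) * norm (char M t))"
    proof (rule AE_I2)
      fix t
      have "norm (?D t * char M t) \<le> (b - a) * norm (char M t)"
        unfolding norm_mult by (intro mult_right_mono D0) auto
      then show "norm (?D t * char M t) \<le> norm ((b - a) * norm (char M t))" by simp
    qed
  qed measurable
  have lim: "(\<lambda>T. (CLBINT t=-real T..real T. ?D t * char M t)) \<longlonglongrightarrow> (\<integral>t. ?D t * char M t \<partial>lborel)"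
  proof -
    have "(\<lambda>T. (\<integral>t. indicator {- real T<..<real T} t *\<^sub>R (?D t * char M t) \<partial>lborel)) \<longlonglongrightarrow> (\<integral>t. ?D t * char M t \<partial>lborel)"
    proof (rule integral_dominated_convergence[where w="\<lambda>t. norm (?D t * char M t)"])
      show "AE t in lborel. (\<lambda>T. indicator {- real T<..<real T} t *\<^sub>R (?D t * char M t)) \<longlonglongrightarrow> ?D t * char M t"
      proof (rule AE_I2)
        fix t :: real
        obtain N where N: "\<bar>t\<bar> < real N" using reals_Archimedean2 by blast
        have "eventually (\<lambda>T. indicator {- real T<..<real T} t *\<^sub>R (?D t * char M t) = ?D t * char M t) sequentially"
          using N by (intro eventually_sequentiallyI[of N]) (auto simp: indicator_def)
        then show "(\<lambda>T. indicator {- real T<..<real T} t *\<^sub>R (?D t * char M t)) \<longlonglongrightarrow> ?D t * char M t"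
          by (rule tendsto_eventually)
      qed
      show "AE t in lborel. norm (indicator {- real T<..<real T} t *\<^sub>R (?D t * char M t)) \<le> norm (?D t * char M t)" for T
        by (auto simp: indicator_def)
      show "integrable lborel (\<lambda>t. norm (?D t * char M t))" using intD by simp
    qed (use intD in measurable)
    then show ?thesis
      by (simp add: interval_lebesgue_integral_def set_lebesgue_integral_def einterval_def greaterThanLessThan_def
            lessThan_def greaterThan_def Int_def conj_commute)
  qed
  have 1: "1 / (2 * pi) * (\<integral>t. ?D t * char M t \<partial>lborel) = measure M {a<..b}"
  proof (rule LIMSEQ_unique)
    show "(\<lambda>T. 1 / (2 * pi) * (CLBINT t=-real T..real T. ?D t * char M t)) \<longlonglongrightarrow> 1 / (2 * pi) * (\<integral>t. ?D t * char M t \<partial>lborel)"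
      by (intro tendsto_mult tendsto_const lim)
    show "(\<lambda>T. 1 / (2 * pi) * (CLBINT t=-real T..real T. ?D t * char M t)) \<longlonglongrightarrow> measure M {a<..b}"
      using Levy_Inversion[OF ab] by simp
  qed
  have pint: "integrable (lborel \<Otimes>\<^sub>M lborel) (\<lambda>(z, t). indicator {a..b} z *\<^sub>R (iexp (-(t*z)) * char M t))"
  proof (rule lborel_pair.Fubini_integrable)
    have "(\<lambda>z. \<integral>t. norm (case (z, t) of (z, t) \<Rightarrow> indicator {a..b} z *\<^sub>R (iexp (-(t*z)) * char M t)) \<partial>lborel)
      = (\<lambda>z. indicator {a..b} z * (\<integral>t. norm (char M t) \<partial>lborel))"
      by (simp add: norm_mult del: times_divide_eq_left)
    then show "integrable lborel (\<lambda>z. \<integral>t. norm (case (z, t) of (z, t) \<Rightarrow> indicator {a..b} z *\<^sub>R (iexp (-(t*z)) * char M t)) \<partial>lborel)"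
      by (simp add: emeasure_lborel_Icc_eq)
    show "AE z in lborel. integrable lborel (\<lambda>t. case (z, t) of (z, t) \<Rightarrow> indicator {a..b} z *\<^sub>R (iexp (-(t*z)) * char M t))"
      using integrable_iexp_mult'[OF int] by simp
  qed measurable
  have "(\<integral>t. ?D t * char M t \<partial>lborel) = (\<integral>t. (\<integral>z. indicator {a..b} z *\<^sub>R (iexp (-(t*z)) * char M t) \<partial>lborel) \<partial>lborel)"
  proof (rule integral_cong_AE)
    have "AE t in lborel. (t::real) \<noteq> 0" by (rule AE_lborel_singleton)
    then show "AE t in lborel. ?D t * char M t = (\<integral>z. indicator {a..b} z *\<^sub>R (iexp (-(t*z)) * char M t) \<partial>lborel)"
    proof eventually_elim
      case (elim t)
      have "(\<integral>z. indicator {a..b} z *\<^sub>R (iexp (-(t*z)) * char M t) \<partial>lborel) =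
        (\<integral>z. (indicator {a..b} z *\<^sub>R iexp (-(t*z))) * char M t \<partial>lborel)" by simp
      also have "\<dots> = (\<integral>z. (indicator {a..b} z *\<^sub>R iexp (-(t*z))) \<partial>lborel) * char M t"
        by (rule integral_mult_left_zero)
      also have "\<dots> = ?D t * char M t" unfolding has_integral_iexp_interval[OF ab(1) elim] ..
      finally show ?case by simp
    qed
  qed measurable
  also have "\<dots> = (\<integral>z. (\<integral>t. indicator {a..b} z *\<^sub>R (iexp (-(t*z)) * char M t) \<partial>lborel) \<partial>lborel)"
    by (rule lborel_pair.Fubini_integral[OF pint])
  finally have 2: "Re (\<integral>t. ?D t * char M t \<partial>lborel) = (\<integral>z. Re (\<integral>t. indicator {a..b} z *\<^sub>R (iexp (-(t*z)) * char M t) \<partial>lborel) \<partial>lborel)"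
    using lborel_pair.integrable_fst[OF pint] by (simp del: integral_scaleR_right)
  have "measure M {a<..b} = Re (of_real (1 / (2 * pi)) * (\<integral>t. ?D t * char M t \<partial>lborel))" using 1 by simp
  also have "\<dots> = 1 / (2 * pi) * Re (\<integral>t. ?D t * char M t \<partial>lborel)" by simp
  also have "\<dots> = (\<integral>z. 1 / (2 * pi) * Re (\<integral>t. indicator {a..b} z *\<^sub>R (iexp (-(t*z)) * char M t) \<partial>lborel) \<partial>lborel)"
    unfolding 2 by (rule integral_mult_right_zero[symmetric])
  also have "\<dots> = (\<integral>z. indicator {a..b} z * finv (char M) z \<partial>lborel)"
    unfolding finv_def by (intro Bochner_Integration.integral_cong refl) auto
  finally show ?thesis .
qed

text \<open>Atoms are countable, so every interval contains end points at which the inversion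
  formula applies. As \<open>finv\<close> is continuous and bounded, a negative value would give an
  interval of negative mass, and an atom would outweigh the bound \<open>(b - a) * C\<close> on
  short intervals.\<close>

lemma (in real_distribution) density_char:
  assumes int: "integrable lborel (char M)"
  shows "\<And>z. 0 \<le> finv (char M) z" and "M = density lborel (\<lambda>z. ennreal (finv (char M) z))"
proof -
  let ?f = "finv (char M)"
  note ms[measurable] = measurable_finv[OF int]
  define C where "C = (\<integral>u. norm (char M u) \<partial>lborel) / (2*pi)"
  have C: "\<bar>?f z\<bar> \<le> C" for z unfolding C_def by (rule finv_bound[OF int])
  have intf: "integrable lborel (\<lambda>z. indicator {a..b} z * ?f z)" for a b :: real
    by (rule integrableI_bounded_set[where A="{a..b}" and B=C]) (use C in \<open>auto simp: indicator_def abs_mult emeasure_lborel_Icc_eq\<close>)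
  have ex: "\<exists>a. x < a \<and> a < y \<and> measure M {a} = 0" if "x < y" for x y
  proof -
    have "countable {x. measure M {x} > 0}" by (rule countable_atoms)
    from open_minus_countable[OF this, of "{x<..<y}"] that show ?thesis
      by (auto simp: not_less measure_le_0_iff)
  qed
  show pos: "0 \<le> ?f z" for z
  proof (rule ccontr)
    assume "\<not> 0 \<le> ?f z"
    then have n: "?f z < 0" by simp
    have "isCont ?f z" using continuous_finv[OF int] by (simp add: continuous_on_eq_continuous_at)
    then obtain d where d: "d > 0" "\<And>w. \<bar>w - z\<bar> < d \<Longrightarrow> \<bar>?f w - ?f z\<bar> < - ?f z / 2"
      using n unfolding continuous_at_eps_delta dist_real_def by (elim allE[of _ "- ?f z / 2"]) auto
    obtain a where a: "z - d < a" "a < z" "measure M {a} = 0" using ex[of "z - d" z] d by auto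
    obtain b where b: "z < b" "b < z + d" "measure M {b} = 0" using ex[of "z" "z+d"] d by auto
    have "measure M {a<..b} = (\<integral>w. indicator {a..b} w * ?f w \<partial>lborel)"
      using a b by (intro integrable_char_interval[OF int]) auto
    also have "\<dots> \<le> (\<integral>w. indicator {a..b} w * (?f z / 2) \<partial>lborel)"
    proof (rule integral_mono[OF intf])
      fix w show "indicator {a..b} w * ?f w \<le> indicator {a..b} w * (?f z / 2)"
      proof (cases "w \<in> {a..b}")
        case True
        then have "\<bar>w - z\<bar> < d" using a b unfolding abs_less_iff by simp
        from d(2)[OF this] have "?f w \<le> ?f z / 2" unfolding abs_less_iff by (simp add: field_simps)
        with True show ?thesis by simp
      qed simp
    qed (simp add: emeasure_lborel_Icc_eq)
    also have "\<dots> = (b - a) * (?f z / 2)" using a b by simp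
    also have "\<dots> < 0" using a b n by (intro mult_pos_neg) auto
    finally show False using measure_nonneg[of M "{a<..b}"] by linarith
  qed
  have at: "measure M {x} = 0" for x
  proof (rule ccontr)
    assume "measure M {x} \<noteq> 0"
    then have p: "measure M {x} > 0" using measure_nonneg[of M "{x}"] by linarith
    have C0: "C \<ge> 0" using C[of 0] by linarith
    \<comment> \<open>Chosen so that an interval of length below \<open>2 * d\<close> has mass at
      most half of the atom; \<open>C + 1\<close> avoids a division by 0.\<close>
    define d where "d = measure M {x} / (4 * (C + 1))"
    have d: "d > 0" unfolding d_def using p C0 by simp
    obtain a where a: "x - d < a" "a < x" "measure M {a} = 0" using ex[of "x - d" x] d by auto
    obtain b where b: "x < b" "b < x + d" "measure M {b} = 0" using ex[of "x" "x+d"] d by auto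
    have "measure M {x} \<le> measure M {a<..b}" using a b by (intro finite_measure_mono) auto
    also have "\<dots> = (\<integral>w. indicator {a..b} w * ?f w \<partial>lborel)"
      using a b by (intro integrable_char_interval[OF int]) auto
    also have "\<dots> \<le> (\<integral>w. indicator {a..b} w * C \<partial>lborel)"
    proof (rule integral_mono[OF intf])
      fix w show "indicator {a..b} w * ?f w \<le> indicator {a..b} w * C"
        using C[of w] by (auto simp: indicator_def)
    qed (simp add: emeasure_lborel_Icc_eq)
    also have "\<dots> = (b - a) * C" using a b by simp
    also have "\<dots> \<le> 2 * d * C" using a b C0 by (intro mult_right_mono) auto
    also have "\<dots> < 2 * d * (C + 1)" using d by simp
    also have "\<dots> = measure M {x} / 2" unfolding d_def using C0 by (simp add: field_simps)
    finally show False using p by linarith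
  qed
  show "M = density lborel (\<lambda>z. ennreal (?f z))"
  proof (rule measure_eqI_lessThan)
    have 1: "emeasure M {a<..b} = emeasure (density lborel (\<lambda>z. ennreal (?f z))) {a<..b}" if "a \<le> b" for a b
    proof -
      have "emeasure M {a<..b} = ennreal (\<integral>z. indicator {a..b} z * ?f z \<partial>lborel)"
        unfolding emeasure_eq_measure integrable_char_interval[OF int that at at] ..
      also have "\<dots> = (\<integral>\<^sup>+z. ennreal (indicator {a..b} z * ?f z) \<partial>lborel)"
        by (intro nn_integral_eq_integral[symmetric] intf AE_I2 mult_nonneg_nonneg pos) auto
      also have "\<dots> = (\<integral>\<^sup>+z. ennreal (?f z) * indicator {a<..b} z \<partial>lborel)"
      proof (rule nn_integral_cong_AE)
        have "AE z in lborel. z \<noteq> a" by (rule AE_lborel_singleton)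
        then show "AE z in lborel. ennreal (indicator {a..b} z * ?f z) = ennreal (?f z) * indicator {a<..b} z"
          by eventually_elim (auto simp: indicator_def)
      qed
      also have "\<dots> = emeasure (density lborel (\<lambda>z. ennreal (?f z))) {a<..b}"
        by (subst emeasure_density) auto
      finally show ?thesis .
    qed
    show "emeasure M {x<..} = emeasure (density lborel (\<lambda>z. ennreal (?f z))) {x<..}" for x
    proof -
      have U: "{x<..} = (\<Union>n. {x<..x + real n})"
      proof safe
        fix y assume "x < y"
        obtain n where "y - x \<le> real n" using real_arch_simple by blast
        then show "y \<in> (\<Union>n. {x<..x + real n})" using \<open>x < y\<close> by (auto intro!: exI[of _ n])
      qed auto
      have i: "incseq (\<lambda>n. {x<..x + real n})" by (auto simp: incseq_def)
      have "emeasure M {x<..} = (SUP n. emeasure M {x<..x + real n})"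
        unfolding U using i by (intro SUP_emeasure_incseq[symmetric]) auto
      also have "\<dots> = (SUP n. emeasure (density lborel (\<lambda>z. ennreal (?f z))) {x<..x + real n})"
        by (intro SUP_cong refl 1) auto
      also have "\<dots> = emeasure (density lborel (\<lambda>z. ennreal (?f z))) {x<..}"
        unfolding U using i by (intro SUP_emeasure_incseq) auto
      finally show ?thesis .
    qed
  qed (auto simp: emeasure_eq_measure)
qed

text \<open>The Riemann-Lebesgue argument by translation: a shift by \<open>pi / u\<close> changes
  the sign of \<open>iexp (u * z)\<close>, so twice the transform is the transform of
  \<open>f z - f (z + pi / u)\<close>. The \<open>L1\<close> norm of that difference goes to 0 by
  Scheffe's lemma, as the density is continuous and translation keeps its total mass.\<close>

lemma (in real_distribution) char_tendsto_0:
  assumes int: "integrable lborel (char M)"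
  shows "(char M \<longlongrightarrow> 0) at_top"
proof (rule tendsto_at_topI_sequentially)
  fix X :: "nat \<Rightarrow> real" assume X: "filterlim X at_top sequentially"
  define f where "f = finv (char M)"
  have ms[measurable]: "f \<in> borel_measurable borel" unfolding f_def by (rule measurable_finv[OF int])
  have pos: "0 \<le> f z" for z unfolding f_def by (rule density_char(1)[OF int])
  have dens: "M = density lborel (\<lambda>z. ennreal (f z))" unfolding f_def by (rule density_char(2)[OF int])
  have cont: "isCont f z" for z
    using continuous_finv[OF int] unfolding f_def by (simp add: continuous_on_eq_continuous_at)
  have nn1: "(\<integral>\<^sup>+z. ennreal (f z) \<partial>lborel) = 1"
    using emeasure_space_1 by (subst (asm) dens) (simp add: emeasure_density)
  have intf: "integrable lborel f"
    by (rule integrableI_nonneg) (use nn1 pos in auto)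
  have ch: "char M u = (\<integral>z. iexp (u * z) * f z \<partial>lborel)" for u
  proof -
    have "char M u = (\<integral>z. iexp (u * z) \<partial>density lborel (\<lambda>z. ennreal (f z)))"
      unfolding char_def[of M u] by (rule arg_cong[where f="\<lambda>N. \<integral>z. iexp (u * z) \<partial>N", OF dens])
    also have "\<dots> = (\<integral>z. iexp (u * z) * f z \<partial>lborel)"
    proof (subst integral_density)
      show "AE z in lborel. 0 \<le> f z" using pos by (intro AE_I2)
      show "(\<integral>z. f z *\<^sub>R iexp (u * z) \<partial>lborel) = (\<integral>z. iexp (u * z) * f z \<partial>lborel)"
        unfolding scaleR_conv_of_real by (subst mult.commute) (rule refl)
    qed measurable
    finally show ?thesis .
  qed
  have ii: "integrable lborel (\<lambda>z. iexp (u * z) * f (z + d))" for u d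
  proof (rule Bochner_Integration.integrable_bound)
    show "integrable lborel (\<lambda>z. f (z + d))" using lborel_integrable_real_affine[OF intf, of 1 d] by (simp add: add.commute)
  qed (auto simp: norm_mult)
  have key: "norm (char M u) \<le> (\<integral>z. norm (f (z + pi/u) - f z) \<partial>lborel)" if "u > 0" for u
  proof -
    have "char M u = (\<integral>z. iexp (u * (pi/u + 1 * z)) * f (pi/u + 1 * z) \<partial>lborel)"
      unfolding ch using lborel_integral_real_affine[of 1 "\<lambda>z. iexp (u * z) * f z" "pi/u"] by simp
    also have "(\<lambda>z. iexp (u * (pi/u + 1 * z)) * f (pi/u + 1 * z)) = (\<lambda>z. - (iexp (u * z) * f (z + pi/u)))"
    proof
      fix z
      have r: "u * (pi/u + 1 * z) = pi + u * z" using that by (simp add: field_simps)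
      have "iexp (u * (pi/u + 1 * z)) = exp (\<i> * pi + \<i> * of_real (u * z))"
        unfolding r by (simp only: of_real_add distrib_left)
      also have "\<dots> = exp (\<i> * pi) * iexp (u * z)" by (rule exp_add)
      also have "\<dots> = - iexp (u * z)" by simp
      finally show "iexp (u * (pi/u + 1 * z)) * f (pi/u + 1 * z) = - (iexp (u * z) * f (z + pi/u))"
        by (simp add: add.commute)
    qed
    finally have c2: "char M u = - (\<integral>z. iexp (u * z) * f (z + pi/u) \<partial>lborel)" by simp
    have "2 * char M u = (\<integral>z. iexp (u * z) * f z \<partial>lborel) - (\<integral>z. iexp (u * z) * f (z + pi/u) \<partial>lborel)"
      using ch[of u] c2 by simp
    also have "\<dots> = (\<integral>z. iexp (u * z) * f z - iexp (u * z) * f (z + pi/u) \<partial>lborel)"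
      using ii[of u 0] ii[of u "pi/u"] by (intro Bochner_Integration.integral_diff[symmetric]) auto
    finally have eq: "2 * char M u = (\<integral>z. iexp (u * z) * f z - iexp (u * z) * f (z + pi/u) \<partial>lborel)" .
    have "norm (2 * char M u) \<le> (\<integral>z. norm (iexp (u * z) * f z - iexp (u * z) * f (z + pi/u)) \<partial>lborel)"
      unfolding eq by (rule integral_norm_bound)
    also have "\<dots> = (\<integral>z. norm (f (z + pi/u) - f z) \<partial>lborel)"
    proof (rule Bochner_Integration.integral_cong[OF refl])
      fix z
      have "iexp (u * z) * f z - iexp (u * z) * f (z + pi/u) = iexp (u * z) * of_real (f z - f (z + pi/u))"
        by (simp only: of_real_diff right_diff_distrib)
      then show "norm (iexp (u * z) * f z - iexp (u * z) * f (z + pi/u)) = norm (f (z + pi/u) - f z)"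
        by (simp only: norm_mult norm_exp_i_times norm_of_real real_norm_def mult_1 abs_minus_commute[of "f z"])
    qed
    finally have "2 * norm (char M u) \<le> (\<integral>z. norm (f (z + pi/u) - f z) \<partial>lborel)"
      by (simp add: norm_mult)
    then show ?thesis using norm_ge_zero[of "char M u"] by linarith
  qed
  have pX: "(\<lambda>n. pi / X n) \<longlonglongrightarrow> 0"
    using X by (intro tendsto_divide_0[OF tendsto_const] filterlim_at_top_imp_at_infinity)
  have "(\<lambda>n. \<integral>\<^sup>+z. norm (f (z + pi / X n) - f z) \<partial>lborel) \<longlonglongrightarrow> 0"
  proof (rule Scheffe_lemma2)
    show "AE z in lborel. (\<lambda>n. f (z + pi / X n)) \<longlonglongrightarrow> f z"
    proof (rule AE_I2)
      fix z
      have "(\<lambda>n. z + pi / X n) \<longlonglongrightarrow> z + 0" by (intro tendsto_intros pX)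
      from isCont_tendsto_compose[OF cont this] show "(\<lambda>n. f (z + pi / X n)) \<longlonglongrightarrow> f z"
        using cont[of z] isCont_tendsto_compose[of z f, OF _ \<open>(\<lambda>n. z + pi / X n) \<longlonglongrightarrow> z + 0\<close>[simplified]] by simp
    qed
    show "(\<integral>\<^sup>+z. norm (f (z + pi / X n)) \<partial>lborel) \<le> (\<integral>\<^sup>+z. norm (f z) \<partial>lborel)" for n
      using nn_integral_real_affine[of "\<lambda>z. ennreal (norm (f z))" 1 "pi / X n"] by (simp add: add.commute)
  qed (use intf in auto)
  moreover have "(\<integral>\<^sup>+z. norm (f (z + d) - f z) \<partial>lborel) = ennreal (\<integral>z. norm (f (z + d) - f z) \<partial>lborel)" for d
    using lborel_integrable_real_affine[OF intf, of 1 d] intf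
    by (intro nn_integral_eq_integral) (auto simp: add.commute)
  ultimately have "(\<lambda>n. ennreal (\<integral>z. norm (f (z + pi / X n) - f z) \<partial>lborel)) \<longlonglongrightarrow> ennreal 0" by simp
  then have "(\<lambda>n. (\<integral>z. norm (f (z + pi / X n) - f z) \<partial>lborel)) \<longlonglongrightarrow> 0"
    by (subst (asm) tendsto_ennreal_iff) auto
  then show "(\<lambda>n. char M (X n)) \<longlonglongrightarrow> 0"
  proof (rule Lim_null_comparison[rotated])
    have "eventually (\<lambda>n. X n > 0) sequentially" using X by (simp add: filterlim_at_top_dense)
    then show "eventually (\<lambda>n. norm (char M (X n)) \<le> (\<integral>z. norm (f (z + pi / X n) - f z) \<partial>lborel)) sequentially"
      by eventually_elim (rule key)
  qed
qed

section \<open>Independence and the Markov property on path space\<close>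

text \<open>Independence of increments is stated for increasing sequences indexed by all naturals,
  so the sorted enumeration of a finite set of times is continued as constant after its last
  element.\<close>

lemma finite_set_enum:
  fixes S :: "real set"
  assumes "finite S" "S \<noteq> {}"
  obtains r :: "nat \<Rightarrow> real" and idx where "incseq r" "\<And>i. r i \<in> S" "\<And>t. t \<in> S \<Longrightarrow> r (idx t) = t"
    "\<And>t. t \<in> S \<Longrightarrow> idx t < card S" "\<And>s t. s \<in> S \<Longrightarrow> t \<in> S \<Longrightarrow> s \<le> t \<Longrightarrow> idx s \<le> (idx t :: nat)"
    "\<And>t. t \<in> S \<Longrightarrow> r 0 \<le> t"
proof -
  define xs where "xs = sorted_list_of_set S"
  have xs: "set xs = S" "sorted xs" "length xs = card S" using assms by (auto simp: xs_def)
  have c: "card S > 0" using assms by (simp add: card_gt_0_iff)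
  define r where "r i = xs ! (min i (card S - 1))" for i
  have inc: "incseq r" unfolding incseq_def r_def using xs c by (auto intro!: sorted_nth_mono)
  have "\<forall>t\<in>S. \<exists>i<card S. r i = t"
  proof
    fix t assume "t \<in> S"
    then obtain i where "i < card S" "xs ! i = t" using xs by (metis in_set_conv_nth)
    then show "\<exists>i<card S. r i = t" by (intro exI[of _ i]) (auto simp: r_def min_def)
  qed
  then obtain idx where idx: "\<And>t. t \<in> S \<Longrightarrow> idx t < card S \<and> r (idx t) = t" by metis
  show ?thesis
  proof
    show "incseq r" by fact
    show "r i \<in> S" for i
    proof -
      have "min i (card S - 1) < length xs" using c xs(3) by auto
      from nth_mem[OF this] show ?thesis unfolding r_def xs(1) .
    qed
    show "r (idx t) = t" "idx t < card S" if "t \<in> S" for t using idx that by auto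
    show "idx s \<le> idx t" if "s \<in> S" "t \<in> S" "s \<le> t" for s t
    proof (cases "s = t")
      case False
      show ?thesis
      proof (rule ccontr)
        assume "\<not> idx s \<le> idx t"
        then have "r (idx t) \<le> r (idx s)" using inc by (auto simp: incseq_def)
        then show False using idx that False by auto
      qed
    qed simp
    show "r 0 \<le> t" if "t \<in> S" for t
    proof -
      have "r 0 \<le> r (idx t)" by (rule incseqD[OF inc]) simp
      also have "\<dots> = t" using idx[OF that] by (rule conjunct2)
      finally show ?thesis .
    qed
  qed
qed

locale levy0 = prob_space M for M :: "'w measure" +
  fixes Z :: "real \<Rightarrow> 'w \<Rightarrow> real"
  assumes levy: "levy_process_from_zero M Z"
begin

lemma Z_meas[measurable]: "0 \<le> t \<Longrightarrow> Z t \<in> borel_measurable M"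
  using levy by (auto simp: levy_process_from_zero_def)

lemma Z_right: "w \<in> space M \<Longrightarrow> 0 \<le> t \<Longrightarrow> ((\<lambda>s. Z s w) \<longlongrightarrow> Z t w) (at_right t)"
  using levy by (auto simp: levy_process_from_zero_def cadlag_path_def)

lemma Z_0: "AE w in M. Z 0 w = 0"
  using levy by (auto simp: levy_process_from_zero_def)

lemma Z_incr: "0 \<le> r 0 \<Longrightarrow> incseq r \<Longrightarrow>
        indep_vars (\<lambda>_. borel) (\<lambda>i w. Z (r (Suc i)) w - Z (r i) w) {..<n}" for r :: "nat \<Rightarrow> real"
  using levy by (auto simp: levy_process_from_zero_def)

lemma Z_stat: "0 \<le> s \<Longrightarrow> s \<le> t \<Longrightarrow>
        distr M borel (\<lambda>w. Z t w - Z s w) = distr M borel (\<lambda>w. Z (t - s) w - Z 0 w)"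
  using levy unfolding levy_process_from_zero_def by blast

lemma Z_sum:
  assumes "i \<le> j"
  shows "(\<Sum>k\<in>{i..<j}. Z (r (Suc k)) w - Z (r k) w) = Z (r j) w - Z (r i) w"
  by (rule sum_Suc_diff'[OF assms, where f="\<lambda>k. Z (r k) w"])

text \<open>All times involved are put on one grid. The first vector sums grid increments before the
  index of \<open>s\<close>, the second sums increments from that index on, so they are functions of
  disjoint blocks of independent variables.\<close>

lemma indep_fin:
  assumes s: "0 \<le> s" and J: "finite J" "J \<subseteq> {0..s}" and K: "finite K" "K \<subseteq> {0..}"
  shows "indep_var (PiM J (\<lambda>_. borel)) (\<lambda>w. \<lambda>t\<in>J. Z t w - Z 0 w)
                   (PiM K (\<lambda>_. borel)) (\<lambda>w. \<lambda>u\<in>K. Z (s + u) w - Z s w)"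
proof -
  define S where "S = {0, s} \<union> J \<union> (+) s ` K"
  have S: "finite S" "S \<noteq> {}" unfolding S_def using J K by auto
  obtain r idx where t: "incseq r" "\<And>i. r i \<in> S" "\<And>t. t \<in> S \<Longrightarrow> r (idx t) = t"
    "\<And>t. t \<in> S \<Longrightarrow> idx t < card S" "\<And>s t. s \<in> S \<Longrightarrow> t \<in> S \<Longrightarrow> s \<le> t \<Longrightarrow> idx s \<le> idx t"
    "\<And>t. t \<in> S \<Longrightarrow> r 0 \<le> t" using finite_set_enum[OF S] by metis
  have pos: "t \<in> S \<Longrightarrow> 0 \<le> t" for t using s J K by (auto simp: S_def)
  have t0: "r 0 = 0" using t(6)[of 0] pos[OF t(2)[of 0]] by (intro antisym) (auto simp: S_def)
  define D where "D i w = Z (r (Suc i)) w - Z (r i) w" for i w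
  define m n where "m = idx s" and "n = card S"
  have ind: "indep_vars (\<lambda>_. borel) D {..<n}" unfolding D_def by (rule Z_incr) (use t t0 in auto)
  have "indep_var (PiM {..<m} (\<lambda>_. borel)) (\<lambda>w. \<lambda>i\<in>{..<m}. D i w) (PiM {m..<n} (\<lambda>_. borel)) (\<lambda>w. \<lambda>i\<in>{m..<n}. D i w)"
    using t(4)[of s] by (intro indep_var_restrict[OF ind]) (auto simp: m_def n_def S_def)
  then have "indep_var (PiM J (\<lambda>_. borel)) ((\<lambda>d. \<lambda>t\<in>J. \<Sum>k\<in>{0..<idx t}. d k) \<circ> (\<lambda>w. \<lambda>i\<in>{..<m}. D i w))
                 (PiM K (\<lambda>_. borel)) ((\<lambda>d. \<lambda>u\<in>K. \<Sum>k\<in>{m..<idx (s+u)}. d k) \<circ> (\<lambda>w. \<lambda>i\<in>{m..<n}. D i w))"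
  proof (rule indep_var_compose)
    show "(\<lambda>d. \<lambda>t\<in>J. \<Sum>k\<in>{0..<idx t}. d k) \<in> Pi\<^sub>M {..<m} (\<lambda>_. borel) \<rightarrow>\<^sub>M Pi\<^sub>M J (\<lambda>_. borel::real measure)"
    proof (intro measurable_restrict borel_measurable_sum)
      fix t k assume "t \<in> J" "k \<in> {0..<idx t}"
      moreover have "idx t \<le> m" unfolding m_def using \<open>t \<in> J\<close> J by (intro t(5)) (auto simp: S_def)
      ultimately show "(\<lambda>d. d k) \<in> borel_measurable (Pi\<^sub>M {..<m} (\<lambda>_. borel))"
        by (intro measurable_component_singleton) auto
    qed
    show "(\<lambda>d. \<lambda>u\<in>K. \<Sum>k\<in>{m..<idx (s+u)}. d k) \<in> Pi\<^sub>M {m..<n} (\<lambda>_. borel) \<rightarrow>\<^sub>M Pi\<^sub>M K (\<lambda>_. borel::real measure)"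
    proof (intro measurable_restrict borel_measurable_sum)
      fix u k assume "u \<in> K" "k \<in> {m..<idx (s+u)}"
      moreover have "idx (s+u) < n" unfolding n_def using \<open>u \<in> K\<close> by (intro t(4)) (auto simp: S_def)
      ultimately show "(\<lambda>d. d k) \<in> borel_measurable (Pi\<^sub>M {m..<n} (\<lambda>_. borel))"
        by (intro measurable_component_singleton) auto
    qed
  qed
  moreover have "(\<lambda>d. \<lambda>t\<in>J. \<Sum>k\<in>{0..<idx t}. d k) \<circ> (\<lambda>w. \<lambda>i\<in>{..<m}. D i w) = (\<lambda>w. \<lambda>t\<in>J. Z t w - Z 0 w)"
  proof (intro ext)
    fix w t
    show "((\<lambda>d. \<lambda>t\<in>J. \<Sum>k\<in>{0..<idx t}. d k) \<circ> (\<lambda>w. \<lambda>i\<in>{..<m}. D i w)) w t = (\<lambda>t\<in>J. Z t w - Z 0 w) t"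
    proof (cases "t \<in> J")
      case True
      then have tS: "t \<in> S" by (auto simp: S_def)
      have "idx t \<le> m" unfolding m_def using True J by (intro t(5)) (auto simp: S_def)
      then have "(\<Sum>k\<in>{0..<idx t}. (\<lambda>i\<in>{..<m}. D i w) k) = (\<Sum>k\<in>{0..<idx t}. D k w)"
        by (intro sum.cong) auto
      also have "\<dots> = Z t w - Z 0 w" unfolding D_def using t(3)[OF tS] t0 by (subst Z_sum) auto
      finally show ?thesis using True by simp
    qed simp
  qed
  moreover have "(\<lambda>d. \<lambda>u\<in>K. \<Sum>k\<in>{m..<idx (s+u)}. d k) \<circ> (\<lambda>w. \<lambda>i\<in>{m..<n}. D i w) = (\<lambda>w. \<lambda>u\<in>K. Z (s + u) w - Z s w)"
  proof (intro ext)
    fix w u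
    show "((\<lambda>d. \<lambda>u\<in>K. \<Sum>k\<in>{m..<idx (s+u)}. d k) \<circ> (\<lambda>w. \<lambda>i\<in>{m..<n}. D i w)) w u = (\<lambda>u\<in>K. Z (s + u) w - Z s w) u"
    proof (cases "u \<in> K")
      case True
      then have uS: "s + u \<in> S" by (auto simp: S_def)
      have sS: "s \<in> S" by (auto simp: S_def)
      have mu: "m \<le> idx (s+u)" unfolding m_def using True K uS sS by (intro t(5)) auto
      have "idx (s+u) < n" unfolding n_def using uS by (rule t(4))
      then have "(\<Sum>k\<in>{m..<idx (s+u)}. (\<lambda>i\<in>{m..<n}. D i w) k) = (\<Sum>k\<in>{m..<idx (s+u)}. D k w)"
        by (intro sum.cong) auto
      also have "\<dots> = Z (s+u) w - Z s w" unfolding D_def Z_sum[OF mu] unfolding m_def t(3)[OF uS] t(3)[OF sS] ..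
      finally show ?thesis using True by simp
    qed simp
  qed
  ultimately show ?thesis by simp
qed

text \<open>On the grid of \<open>K\<close>, the increments of the path from \<open>s\<close> on are
  independent with laws that do not depend on \<open>s\<close>. Hence their joint law is the same
  product measure for \<open>s\<close> and for 0, and \<open>g\<close> recovers the path from the
  increments.\<close>

lemma law_fin:
  assumes s: "0 \<le> s" and K: "finite K" "K \<subseteq> {0..}"
  shows "distr M (PiM K (\<lambda>_. borel)) (\<lambda>w. \<lambda>u\<in>K. Z (s + u) w - Z s w)
       = distr M (PiM K (\<lambda>_. borel)) (\<lambda>w. \<lambda>u\<in>K. Z u w - Z 0 w)"
proof -
  define S where "S = {0} \<union> K"
  have S: "finite S" "S \<noteq> {}" unfolding S_def using K by auto
  obtain r idx where t: "incseq r" "\<And>i. r i \<in> S" "\<And>t. t \<in> S \<Longrightarrow> r (idx t) = t"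
    "\<And>t. t \<in> S \<Longrightarrow> idx t < card S" "\<And>s t. s \<in> S \<Longrightarrow> t \<in> S \<Longrightarrow> s \<le> t \<Longrightarrow> idx s \<le> idx t"
    "\<And>t. t \<in> S \<Longrightarrow> r 0 \<le> t" using finite_set_enum[OF S] by metis
  have pos: "t \<in> S \<Longrightarrow> 0 \<le> t" for t using s K by (auto simp: S_def)
  have t0: "r 0 = 0" using t(6)[of 0] pos[OF t(2)[of 0]] by (intro antisym) (auto simp: S_def)
  define n where "n = card S"
  have n: "{..<n} \<noteq> {}" using S by (simp add: n_def lessThan_empty_iff)
  define D where "D s i w = Z (s + r (Suc i)) w - Z (s + r i) w" for s i w
  have tp: "0 \<le> r i" for i using t(2) pos by auto
  have D[measurable]: "0 \<le> s \<Longrightarrow> D s i \<in> borel_measurable M" for s i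
    unfolding D_def using tp by (intro borel_measurable_diff Z_meas) auto
  have ind: "indep_vars (\<lambda>_. borel) (D s) {..<n}" if "0 \<le> s" for s
    unfolding D_def by (rule Z_incr[of "\<lambda>i. s + r i"]) (use t t0 that in \<open>auto simp: incseq_def\<close>)
  have eq: "distr M borel (D s i) = distr M borel (D 0 i)" if "0 \<le> s" for s i
  proof -
    have le: "r i \<le> r (Suc i)" using t(1) by (auto simp: incseq_def)
    show ?thesis unfolding D_def
      using Z_stat[of "s + r i" "s + r (Suc i)"] Z_stat[of "r i" "r (Suc i)"] that tp le by simp
  qed
  have law: "distr M (PiM {..<n} (\<lambda>_. borel)) (\<lambda>w. \<lambda>i\<in>{..<n}. D s i w) = (\<Pi>\<^sub>M i\<in>{..<n}. distr M borel (D 0 i))" if "0 \<le> s" for s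
  proof -
    have "distr M (PiM {..<n} (\<lambda>_. borel)) (\<lambda>w. \<lambda>i\<in>{..<n}. D s i w) = (\<Pi>\<^sub>M i\<in>{..<n}. distr M borel (D s i))"
      using ind[OF that] that by (subst (asm) indep_vars_iff_distr_eq_PiM'[OF n]) auto
    then show ?thesis unfolding eq[OF that] .
  qed
  define g :: "(nat \<Rightarrow> real) \<Rightarrow> real \<Rightarrow> real" where "g = (\<lambda>d. \<lambda>u\<in>K. \<Sum>k\<in>{0..<idx u}. d k)"
  have g[measurable]: "g \<in> Pi\<^sub>M {..<n} (\<lambda>_. borel) \<rightarrow>\<^sub>M Pi\<^sub>M K (\<lambda>_. borel::real measure)"
    unfolding g_def
  proof (intro measurable_restrict borel_measurable_sum)
    fix u k assume "u \<in> K" "k \<in> {0..<idx u}"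
    moreover have "idx u < n" unfolding n_def using \<open>u \<in> K\<close> by (intro t(4)) (auto simp: S_def)
    ultimately show "(\<lambda>d. d k) \<in> borel_measurable (Pi\<^sub>M {..<n} (\<lambda>_. borel))"
      by (intro measurable_component_singleton) auto
  qed
  have gD: "(\<lambda>w. \<lambda>u\<in>K. Z (s + u) w - Z s w) = (\<lambda>w. g (\<lambda>i\<in>{..<n}. D s i w))" for s
  proof (intro ext)
    fix w u
    show "(\<lambda>u\<in>K. Z (s + u) w - Z s w) u = g (\<lambda>i\<in>{..<n}. D s i w) u"
    proof (cases "u \<in> K")
      case True
      then have uS: "u \<in> S" by (auto simp: S_def)
      have "idx u < n" unfolding n_def using uS by (rule t(4))
      then have "(\<Sum>k\<in>{0..<idx u}. (\<lambda>i\<in>{..<n}. D s i w) k) = (\<Sum>k\<in>{0..<idx u}. D s k w)"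
        by (intro sum.cong) auto
      also have "\<dots> = Z (s+u) w - Z s w"
        using sum_Suc_diff'[of 0 "idx u" "\<lambda>k. Z (s + r k) w"] t(3)[OF uS] t0 unfolding D_def by simp
      finally show ?thesis using True by (simp add: g_def)
    qed (simp add: g_def)
  qed
  have "distr M (PiM K (\<lambda>_. borel)) (\<lambda>w. \<lambda>u\<in>K. Z (s + u) w - Z s w) =
     distr (\<Pi>\<^sub>M i\<in>{..<n}. distr M borel (D 0 i)) (PiM K (\<lambda>_. borel)) g" if "0 \<le> s" for s
    unfolding gD law[OF that, symmetric] using that by (subst distr_distr) (auto simp: comp_def)
  from this[OF s] this[of 0] show ?thesis by simp
qed

text \<open>The starting value is subtracted for \<open>s = 0\<close> too, since \<open>Z 0\<close>
  vanishes only almost surely; this way \<open>path s\<close> and \<open>path 0\<close> are treated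
  alike and both start at 0 at every outcome.\<close>

definition path :: "real \<Rightarrow> 'w \<Rightarrow> real \<Rightarrow> real" where
  "path s w = (\<lambda>u\<in>{0..}. Z (s + u) w - Z s w)"

abbreviation "PS \<equiv> Pi\<^sub>M {0::real..} (\<lambda>_. borel :: real measure)"

abbreviation "Fil \<equiv> natural_filtration M Z"

lemma path_meas[measurable]: "0 \<le> s \<Longrightarrow> path s \<in> M \<rightarrow>\<^sub>M PS"
  unfolding path_def by (intro measurable_restrict borel_measurable_diff Z_meas) auto

lemma space_Fil[simp]: "space (Fil s) = space M"
  unfolding natural_filtration_def by (intro space_measure_of) auto

lemma sets_Fil: "sets (Fil t) = sigma_sets (space M) (\<Union>s\<in>{0..t}. {Z s -` A \<inter> space M | A. A \<in> sets borel})"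
  unfolding natural_filtration_def by (intro sets_measure_of) auto

lemma Fil_sub: "subalgebra M (Fil t)"
proof -
  have "sets (Fil t) \<subseteq> sets M"
    unfolding sets_Fil by (intro sets.sigma_sets_subset) (auto intro!: measurable_sets[OF Z_meas])
  then show ?thesis by (simp add: subalgebra_def)
qed

lemma Fil_mono: "s \<le> t \<Longrightarrow> subalgebra (Fil t) (Fil s)"
  unfolding subalgebra_def sets_Fil by (intro conjI sigma_sets_mono' UN_mono) auto

lemma Z_Fil: "0 \<le> s \<Longrightarrow> s \<le> t \<Longrightarrow> Z s \<in> borel_measurable (Fil t)"
proof (rule measurableI)
  fix A :: "real set" assume "0 \<le> s" "s \<le> t" "A \<in> sets borel"
  then have "Z s -` A \<inter> space M \<in> (\<Union>s\<in>{0..t}. {Z s -` A \<inter> space M | A. A \<in> sets borel})"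
    by (intro UN_I[of s]) auto
  then show "Z s -` A \<inter> space (Fil t) \<in> sets (Fil t)"
    unfolding sets_Fil space_Fil by (rule sigma_sets.Basic)
qed simp

lemma id_Fil: "(\<lambda>w. w) \<in> M \<rightarrow>\<^sub>M Fil t"
  by (rule measurableI) (use Fil_sub[of t] in \<open>auto simp: subalgebra_def intro: sets.Int\<close>)

text \<open>A probability measure on path space is determined by its finite-dimensional marginals,
  and these agree by \<open>law_fin\<close>.\<close>

lemma path_law:
  assumes s: "0 \<le> s"
  shows "distr M PS (path s) = distr M PS (path 0)"
proof (rule measure_eqI_PiM_infinite)
  fix A J assume J: "finite J" "J \<subseteq> {0::real..}" and A: "\<And>i. i \<in> J \<Longrightarrow> A i \<in> sets (borel::real measure)"
  have [measurable]: "Pi\<^sub>E J A \<in> sets (Pi\<^sub>M J (\<lambda>_. borel))" using J A by (intro sets_PiM_I_finite) auto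
  have *: "emeasure (distr M PS (path s)) (prod_emb {0..} (\<lambda>_. borel) J (Pi\<^sub>E J A)) =
    emeasure (distr M (PiM J (\<lambda>_. borel)) (\<lambda>w. \<lambda>u\<in>J. Z (s + u) w - Z s w)) (Pi\<^sub>E J A)" if "0 \<le> s" for s
  proof -
    have pe: "prod_emb {0..} (\<lambda>_. borel) J (Pi\<^sub>E J A) \<in> sets PS"
      using J A by (intro sets_PiM_I) auto
    have "path s -` prod_emb {0..} (\<lambda>_. borel) J (Pi\<^sub>E J A) \<inter> space M
      = (\<lambda>w. \<lambda>u\<in>J. Z (s + u) w - Z s w) -` (Pi\<^sub>E J A) \<inter> space M"
      using J by (auto simp: path_def prod_emb_def PiE_def Pi_def space_PiM extensional_def subset_eq restrict_def)
    moreover have "(\<lambda>w. \<lambda>u\<in>J. Z (s + u) w - Z s w) \<in> M \<rightarrow>\<^sub>M Pi\<^sub>M J (\<lambda>_. borel)"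
      using J that by (intro measurable_restrict borel_measurable_diff Z_meas) auto
    ultimately show ?thesis using that pe by (simp add: emeasure_distr)
  qed
  show "emeasure (distr M PS (path s)) (prod_emb {0..} (\<lambda>_. borel) J (Pi\<^sub>E J A)) =
    emeasure (distr M PS (path 0)) (prod_emb {0..} (\<lambda>_. borel) J (Pi\<^sub>E J A))"
    unfolding *[OF s] *[OF order_refl] law_fin[OF s J] by simp
qed (use finite_measure_distr[OF path_meas[OF s]] in simp_all)

text \<open>Events seen at finitely many times form intersection-stable generators on both sides, so
  independence of the generators extends to the generated sigma-algebras.\<close>

lemma path_indep:
  assumes s: "0 \<le> s"
  shows "indep_set (sets (Fil s)) {path s -` A \<inter> space M |A. A \<in> sets PS}"
proof -
  define \<A> where "\<A> = (\<Union>J\<in>{J. finite J \<and> J \<subseteq> {0..s}}. {(\<lambda>w. \<lambda>t\<in>J. Z t w) -` A \<inter> space M | A. A \<in> sets (PiM J (\<lambda>_. borel))})"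
  define \<B> where "\<B> = (\<Union>K\<in>{K. finite K \<and> K \<subseteq> {0..}}. {(\<lambda>w. \<lambda>u\<in>K. Z (s+u) w - Z s w) -` A \<inter> space M | A. A \<in> sets (PiM K (\<lambda>_. borel))})"
  have mA: "(\<lambda>w. \<lambda>t\<in>J. Z t w) \<in> M \<rightarrow>\<^sub>M PiM J (\<lambda>_. borel)" if "J \<subseteq> {0..s}" for J
    using that by (intro measurable_restrict Z_meas) auto
  have mA0: "(\<lambda>w. \<lambda>t\<in>J. Z t w - Z 0 w) \<in> M \<rightarrow>\<^sub>M PiM J (\<lambda>_. borel)" if "J \<subseteq> {0..s}" for J
    using that by (intro measurable_restrict borel_measurable_diff Z_meas) auto
  have mB: "(\<lambda>w. \<lambda>u\<in>K. Z (s+u) w - Z s w) \<in> M \<rightarrow>\<^sub>M PiM K (\<lambda>_. borel)" if "K \<subseteq> {0..}" for K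
    using that s by (intro measurable_restrict borel_measurable_diff Z_meas) auto
  have "indep_set \<A> \<B>"
  proof (rule indep_setI)
    show "\<A> \<subseteq> events" unfolding \<A>_def using mA by (auto intro!: measurable_sets)
    show "\<B> \<subseteq> events" unfolding \<B>_def using mB by (auto intro!: measurable_sets)
    fix a b assume "a \<in> \<A>" "b \<in> \<B>"
    then obtain J A K B where a: "finite J" "J \<subseteq> {0..s}" "a = (\<lambda>w. \<lambda>t\<in>J. Z t w) -` A \<inter> space M" "A \<in> sets (PiM J (\<lambda>_. borel))"
      and b: "finite K" "K \<subseteq> {0..}" "b = (\<lambda>w. \<lambda>u\<in>K. Z (s+u) w - Z s w) -` B \<inter> space M" "B \<in> sets (PiM K (\<lambda>_. borel))"
      unfolding \<A>_def \<B>_def by blast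
    \<comment> \<open>\<open>Fil s\<close> is generated by \<open>Z\<close> itself, while
      \<open>indep_fin\<close> speaks of \<open>Z - Z 0\<close>; the two events differ by a null
      set.\<close>
    define a0 where "a0 = (\<lambda>w. \<lambda>t\<in>J. Z t w - Z 0 w) -` A \<inter> space M"
    have ae: "AE w in M. w \<in> a \<longleftrightarrow> w \<in> a0" using Z_0
      by eventually_elim (simp add: a(3) a0_def)
    have [measurable]: "a \<in> events" "a0 \<in> events" "b \<in> events"
      unfolding a(3) a0_def b(3) using measurable_sets[OF mA a(4)] measurable_sets[OF mA0 a(4)] measurable_sets[OF mB b(4)] a b by auto
    have "prob (a \<inter> b) = prob (a0 \<inter> b)" by (intro measure_eq_AE) (use ae in auto)
    also have "a0 \<inter> b = (\<lambda>w. (\<lambda>t\<in>J. Z t w - Z 0 w, \<lambda>u\<in>K. Z (s+u) w - Z s w)) -` (A \<times> B) \<inter> space M"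
      unfolding a0_def b(3) by auto
    also have "prob \<dots> = prob a0 * prob b" unfolding a0_def b(3)
      by (rule indep_varD[OF indep_fin[OF s a(1,2) b(1,2)] a(4) b(4)])
    also have "prob a0 = prob a" by (intro measure_eq_AE) (use ae in auto)
    finally show "prob (a \<inter> b) = prob a * prob b" .
  qed
  moreover have "Int_stable \<A>"
  proof (rule Int_stableI)
    fix a b assume "a \<in> \<A>" "b \<in> \<A>"
    then obtain J A K B where a: "finite J" "J \<subseteq> {0..s}" "a = (\<lambda>w. \<lambda>t\<in>J. Z t w) -` A \<inter> space M" "A \<in> sets (PiM J (\<lambda>_. borel))"
      and b: "finite K" "K \<subseteq> {0..s}" "b = (\<lambda>w. \<lambda>t\<in>K. Z t w) -` B \<inter> space M" "B \<in> sets (PiM K (\<lambda>_. borel))"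
      unfolding \<A>_def by blast
    define C where "C = ((\<lambda>f. restrict f J) -` A \<inter> space (PiM (J\<union>K) (\<lambda>_. borel))) \<inter> ((\<lambda>f. restrict f K) -` B \<inter> space (PiM (J\<union>K) (\<lambda>_. borel :: real measure)))"
    have C: "C \<in> sets (PiM (J\<union>K) (\<lambda>_. borel))" unfolding C_def using a b
      by (intro sets.Int measurable_sets[OF measurable_restrict_subset]) auto
    have "a \<inter> b = (\<lambda>w. \<lambda>t\<in>J\<union>K. Z t w) -` C \<inter> space M"
      unfolding a(3) b(3) C_def by (auto simp: space_PiM Int_absorb1 Int_absorb2)
    then show "a \<inter> b \<in> \<A>" unfolding \<A>_def
      by (intro UN_I[of "J \<union> K"] CollectI exI[of _ C] conjI C) (use a b in auto)
  qed
  moreover have "Int_stable \<B>"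
  proof (rule Int_stableI)
    fix a b assume "a \<in> \<B>" "b \<in> \<B>"
    then obtain J A K B where a: "finite J" "J \<subseteq> {0..}" "a = (\<lambda>w. \<lambda>t\<in>J. Z (s+t) w - Z s w) -` A \<inter> space M" "A \<in> sets (PiM J (\<lambda>_. borel))"
      and b: "finite K" "K \<subseteq> {0..}" "b = (\<lambda>w. \<lambda>t\<in>K. Z (s+t) w - Z s w) -` B \<inter> space M" "B \<in> sets (PiM K (\<lambda>_. borel))"
      unfolding \<B>_def by blast
    define C where "C = ((\<lambda>f. restrict f J) -` A \<inter> space (PiM (J\<union>K) (\<lambda>_. borel))) \<inter> ((\<lambda>f. restrict f K) -` B \<inter> space (PiM (J\<union>K) (\<lambda>_. borel :: real measure)))"
    have C: "C \<in> sets (PiM (J\<union>K) (\<lambda>_. borel))" unfolding C_def using a b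
      by (intro sets.Int measurable_sets[OF measurable_restrict_subset]) auto
    have "a \<inter> b = (\<lambda>w. \<lambda>t\<in>J\<union>K. Z (s+t) w - Z s w) -` C \<inter> space M"
      unfolding a(3) b(3) C_def by (auto simp: space_PiM Int_absorb1 Int_absorb2)
    then show "a \<inter> b \<in> \<B>" unfolding \<B>_def
      by (intro UN_I[of "J \<union> K"] CollectI exI[of _ C] conjI C) (use a b in auto)
  qed
  ultimately have I: "indep_set (sigma_sets (space M) \<A>) (sigma_sets (space M) \<B>)"
    by (rule indep_set_sigma_sets)
  have FA: "sets (Fil s) \<subseteq> sigma_sets (space M) \<A>"
    unfolding sets_Fil
  proof (rule sigma_sets_mono, safe)
    fix t and A :: "real set" assume t: "t \<in> {0..s}" and A: "A \<in> sets borel"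
    have "Z t -` A \<inter> space M = (\<lambda>w. \<lambda>t\<in>{t}. Z t w) -` ((\<lambda>f. f t) -` A \<inter> space (PiM {t} (\<lambda>_. borel))) \<inter> space M"
      by (auto simp: space_PiM)
    moreover have "((\<lambda>f. f t) -` A \<inter> space (PiM {t} (\<lambda>_. borel))) \<in> sets (PiM {t} (\<lambda>_. borel))"
      using A by (intro measurable_sets[OF measurable_component_singleton]) auto
    ultimately have "Z t -` A \<inter> space M \<in> \<A>" unfolding \<A>_def
      by (intro UN_I[of "{t}"] CollectI exI conjI) (use t in auto)
    then show "Z t -` A \<inter> space M \<in> sigma_sets (space M) \<A>" by blast
  qed
  have pB: "path s \<in> sigma (space M) \<B> \<rightarrow>\<^sub>M PS"
    unfolding path_def
  proof (rule measurable_restrict)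
    fix u :: real assume u: "u \<in> {0..}"
    have BP: "\<B> \<subseteq> Pow (space M)" unfolding \<B>_def by auto
    show "(\<lambda>w. Z (s+u) w - Z s w) \<in> borel_measurable (sigma (space M) \<B>)"
    proof (rule measurableI)
      fix A :: "real set" assume A: "A \<in> sets borel"
      have "(\<lambda>w. Z (s+u) w - Z s w) -` A \<inter> space M = (\<lambda>w. \<lambda>t\<in>{u}. Z (s+t) w - Z s w) -` ((\<lambda>f. f u) -` A \<inter> space (PiM {u} (\<lambda>_. borel))) \<inter> space M"
        by (auto simp: space_PiM)
      moreover have "((\<lambda>f. f u) -` A \<inter> space (PiM {u} (\<lambda>_. borel))) \<in> sets (PiM {u} (\<lambda>_. borel))"
        using A by (intro measurable_sets[OF measurable_component_singleton]) auto
      ultimately have "(\<lambda>w. Z (s+u) w - Z s w) -` A \<inter> space M \<in> \<B>" unfolding \<B>_def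
        by (intro UN_I[of "{u}"] CollectI exI conjI) (use u in auto)
      then show "(\<lambda>w. Z (s+u) w - Z s w) -` A \<inter> space (sigma (space M) \<B>) \<in> sets (sigma (space M) \<B>)"
        using BP by auto
    qed simp
  qed
  have "{path s -` A \<inter> space M |A. A \<in> sets PS} \<subseteq> sigma_sets (space M) \<B>"
  proof safe
    fix A assume A: "A \<in> sets PS"
    have BP: "\<B> \<subseteq> Pow (space M)" unfolding \<B>_def by auto
    show "path s -` A \<inter> space M \<in> sigma_sets (space M) \<B>"
      using measurable_sets[OF pB A] BP by (simp add: space_measure_of sets_measure_of)
  qed
  then show ?thesis
    using I FA unfolding indep_sets2_eq by blast
qed

lemma path_joint_law:
  assumes s: "0 \<le> s"
  shows "distr M (Fil s \<Otimes>\<^sub>M PS) (\<lambda>w. (w, path s w)) = distr M (Fil s) (\<lambda>w. w) \<Otimes>\<^sub>M distr M PS (path 0)"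
proof -
  note [measurable] = id_Fil path_meas[OF s] path_meas[OF order_refl]
  interpret P1: prob_space "distr M (Fil s) (\<lambda>w. w)" by (rule prob_space_distr) measurable
  interpret P2: prob_space "distr M PS (path 0)" by (rule prob_space_distr) measurable
  show ?thesis
  proof (rule pair_measure_eqI[symmetric])
    show "sets (distr M (Fil s) (\<lambda>w. w) \<Otimes>\<^sub>M distr M PS (path 0)) = sets (distr M (Fil s \<Otimes>\<^sub>M PS) (\<lambda>w. (w, path s w)))"
      by (simp cong: sets_pair_measure_cong)
    fix A B assume "A \<in> sets (distr M (Fil s) (\<lambda>w. w))" "B \<in> sets (distr M PS (path 0))"
    then have A[measurable]: "A \<in> sets (Fil s)" and B[measurable]: "B \<in> sets PS" by auto
    have AM: "A \<in> events" using Fil_sub[of s] A by (auto simp: subalgebra_def)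
    have "(\<lambda>w. (w, path s w)) -` (A \<times> B) \<inter> space M = A \<inter> (path s -` B \<inter> space M)" by auto
    then have "emeasure (distr M (Fil s \<Otimes>\<^sub>M PS) (\<lambda>w. (w, path s w))) (A \<times> B) = emeasure M (A \<inter> (path s -` B \<inter> space M))"
      by (subst emeasure_distr) auto
    also have "\<dots> = ennreal (prob A * prob (path s -` B \<inter> space M))"
      unfolding emeasure_eq_measure
      by (intro arg_cong[where f=ennreal] indep_setD[OF path_indep[OF s] A]) (use B in blast)
    also have "\<dots> = emeasure M A * emeasure (distr M PS (path s)) B"
      by (subst emeasure_distr) (auto simp: emeasure_eq_measure ennreal_mult)
    also have "emeasure M A = emeasure (distr M (Fil s) (\<lambda>w. w)) A"
      using sets.sets_into_space[OF AM] by (subst emeasure_distr) (auto simp: Int_absorb2)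
    finally show "emeasure (distr M (Fil s) (\<lambda>w. w)) A * emeasure (distr M PS (path 0)) B =
        emeasure (distr M (Fil s \<Otimes>\<^sub>M PS) (\<lambda>w. (w, path s w))) (A \<times> B)"
      unfolding path_law[OF s] ..
  qed (rule P1.sigma_finite_measure_axioms, rule P2.sigma_finite_measure_axioms)
qed

text \<open>The Markov property in the form used throughout. The past enters through the outcome
  \<open>w\<close>, measured by \<open>Fil s\<close>, so \<open>\<Phi>\<close> may contain any
  weight and any random level known at time \<open>s\<close>; the path after \<open>s\<close> is
  replaced by an independent copy of \<open>path 0\<close>.\<close>

lemma markov_nn:
  assumes s: "0 \<le> s" and \<Phi>[measurable]: "\<Phi> \<in> borel_measurable (Fil s \<Otimes>\<^sub>M PS)"
  shows "(\<integral>\<^sup>+w. \<Phi> (w, path s w) \<partial>M) = (\<integral>\<^sup>+w. (\<integral>\<^sup>+w'. \<Phi> (w, path 0 w') \<partial>M) \<partial>M)"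
proof -
  note [measurable] = id_Fil path_meas[OF s] path_meas[OF order_refl]
  interpret PP: prob_space "distr M PS (path 0)" by (rule prob_space_distr) measurable
  have "(\<integral>\<^sup>+w. \<Phi> (w, path s w) \<partial>M) = (\<integral>\<^sup>+p. \<Phi> p \<partial>distr M (Fil s \<Otimes>\<^sub>M PS) (\<lambda>w. (w, path s w)))"
    by (subst nn_integral_distr) auto
  also have "distr M (Fil s \<Otimes>\<^sub>M PS) (\<lambda>w. (w, path s w)) = distr M (Fil s) (\<lambda>w. w) \<Otimes>\<^sub>M distr M PS (path 0)"
    by (rule path_joint_law[OF s])
  also have "(\<integral>\<^sup>+p. \<Phi> p \<partial>(distr M (Fil s) (\<lambda>w. w) \<Otimes>\<^sub>M distr M PS (path 0))) =
    (\<integral>\<^sup>+w. (\<integral>\<^sup>+p. \<Phi> (w, p) \<partial>distr M PS (path 0)) \<partial>distr M (Fil s) (\<lambda>w. w))"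
  proof (rule PP.nn_integral_fst[symmetric])
    have "sets (distr M (Fil s) (\<lambda>w. w) \<Otimes>\<^sub>M distr M PS (path 0)) = sets (Fil s \<Otimes>\<^sub>M PS)"
      by (intro sets_pair_measure_cong) auto
    then show "\<Phi> \<in> borel_measurable (distr M (Fil s) (\<lambda>w. w) \<Otimes>\<^sub>M distr M PS (path 0))"
      using \<Phi> by (simp cong: measurable_cong_sets)
  qed
  also have "\<dots> = (\<integral>\<^sup>+w. (\<integral>\<^sup>+p. \<Phi> (w, p) \<partial>distr M PS (path 0)) \<partial>M)"
  proof (rule nn_integral_distr[OF id_Fil])
    have "\<Phi> \<in> borel_measurable (Fil s \<Otimes>\<^sub>M distr M PS (path 0))" using \<Phi>
      by (simp cong: measurable_cong_sets sets_pair_measure_cong)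
    then show "(\<lambda>x. \<integral>\<^sup>+ p. \<Phi> (x, p) \<partial>distr M PS (path 0)) \<in> borel_measurable (distr M (Fil s) (\<lambda>w. w))"
      using PP.borel_measurable_nn_integral_fst[of \<Phi> "Fil s"] by simp
  qed
  also have "\<dots> = (\<integral>\<^sup>+w. (\<integral>\<^sup>+w'. \<Phi> (w, path 0 w') \<partial>M) \<partial>M)"
  proof (rule nn_integral_cong)
    fix w assume "w \<in> space M"
    then have [measurable]: "(\<lambda>p. \<Phi> (w, p)) \<in> borel_measurable PS"
      using measurable_Pair2[OF \<Phi>, of w] by simp
    show "(\<integral>\<^sup>+ p. \<Phi> (w, p) \<partial>distr M PS (path 0)) = (\<integral>\<^sup>+ x. \<Phi> (w, path 0 x) \<partial>M)"
      by (subst nn_integral_distr) auto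
  qed
  finally show ?thesis .
qed

end

section \<open>The resolvent density\<close>

lemma tendsto_right_seq:
  fixes f :: "real \<Rightarrow> real"
  assumes "(f \<longlongrightarrow> f r) (at_right r)" "\<And>n. r \<le> a n" "a \<longlonglongrightarrow> r"
  shows "(\<lambda>n. f (a n)) \<longlonglongrightarrow> f r"
proof -
  have "at r within {r..} = at_right r" unfolding at_within_def by (rule arg_cong[where f="\<lambda>A. inf (nhds r) (principal A)"]) auto
  then have "continuous (at r within {r..}) f" using assms(1) by (simp add: continuous_within)
  then show ?thesis using continuous_within_tendsto_compose'[of r "{r..}" f a sequentially] assms by auto
qed

text \<open>Grid points to the right of the time approximate it, and cutting them off at
  \<open>t\<close> keeps every evaluation inside \<open>{0..t}\<close>. So only variables known at
  \<open>t\<close> occur: this is progressive measurability, with \<open>F\<close> later taken as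
  \<open>Fil t\<close>.\<close>

lemma progressive_measurable:
  fixes Z :: "real \<Rightarrow> 'w \<Rightarrow> real"
  assumes Z: "\<And>s. 0 \<le> s \<Longrightarrow> s \<le> t \<Longrightarrow> Z s \<in> borel_measurable F"
    and rc: "\<And>w s. w \<in> space F \<Longrightarrow> 0 \<le> s \<Longrightarrow> ((\<lambda>s. Z s w) \<longlongrightarrow> Z s w) (at_right s)" and t: "0 \<le> t"
  shows "(\<lambda>(s,w). Z (max 0 (min t s)) w) \<in> borel_measurable (borel \<Otimes>\<^sub>M F)"
proof -
  define r where "r s = max 0 (min t s)" for s
  define a where "a n s = min t (max 0 (real_of_int \<lceil>r s * (real n + 1)\<rceil> / (real n + 1)))" for n s
  have r[measurable]: "r \<in> borel_measurable borel" unfolding r_def by measurable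
  have "(\<lambda>(s,w). Z (r s) w) \<in> borel_measurable (borel \<Otimes>\<^sub>M F)"
  proof (rule borel_measurable_LIMSEQ_real)
    fix n :: nat
    have "(\<lambda>p. Z (min t (max 0 (real_of_int \<lceil>r (fst p) * (real n + 1)\<rceil> / (real n + 1)))) (snd p)) \<in> borel_measurable (borel \<Otimes>\<^sub>M F)"
    proof (rule measurable_compose_countable[where f="\<lambda>i p. Z (min t (max 0 (real_of_int i / (real n + 1)))) (snd p)"])
      fix i :: int
      have [measurable]: "Z (min t (max 0 (real_of_int i / (real n + 1)))) \<in> borel_measurable F"
        by (rule Z) (use t in auto)
      show "(\<lambda>p. Z (min t (max 0 (real_of_int i / (real n + 1)))) (snd p)) \<in> borel_measurable (borel \<Otimes>\<^sub>M F)"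
        by measurable
    qed measurable
    then show "(\<lambda>(s,w). Z (a n s) w) \<in> borel_measurable (borel \<Otimes>\<^sub>M F)"
      unfolding a_def by (simp add: case_prod_beta)
  next
    fix p :: "real \<times> 'w" assume "p \<in> space (borel \<Otimes>\<^sub>M F)"
    then obtain s w where p: "p = (s,w)" "w \<in> space F" by (auto simp: space_pair_measure)
    have r0: "0 \<le> r s" "r s \<le> t" using t by (auto simp: r_def)
    have "(\<lambda>n. Z (a n s) w) \<longlonglongrightarrow> Z (r s) w"
    proof (rule tendsto_right_seq[where f="\<lambda>s. Z s w"])
      show "((\<lambda>s. Z s w) \<longlongrightarrow> Z (r s) w) (at_right (r s))" using p r0 by (intro rc) auto
      have u: "r s \<le> real_of_int \<lceil>r s * (real n + 1)\<rceil> / (real n + 1)" for n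
        by (subst pos_le_divide_eq) auto
      have v: "real_of_int \<lceil>r s * (real n + 1)\<rceil> / (real n + 1) \<le> r s + 1 / (real n + 1)" for n
      proof -
        have "real_of_int \<lceil>r s * (real n + 1)\<rceil> \<le> r s * (real n + 1) + 1" by linarith
        then have "real_of_int \<lceil>r s * (real n + 1)\<rceil> / (real n + 1) \<le> (r s * (real n + 1) + 1) / (real n + 1)"
          by (intro divide_right_mono) auto
        also have "\<dots> = r s + 1 / (real n + 1)" by (simp add: add_divide_distrib)
        finally show ?thesis .
      qed
      show ge: "r s \<le> a n s" for n unfolding a_def using r0 u[of n] by (intro min.boundedI max.coboundedI2)
      have le: "a n s \<le> r s + 1 / (real n + 1)" for n
      proof -
        have "0 \<le> r s + 1 / (real n + 1)" by (rule add_nonneg_nonneg[OF r0(1)]) simp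
        then have "max 0 (real_of_int \<lceil>r s * (real n + 1)\<rceil> / (real n + 1)) \<le> r s + 1 / (real n + 1)"
          using v[of n] by (rule max.boundedI)
        then show ?thesis unfolding a_def by (rule min.coboundedI2)
      qed
      have l: "(\<lambda>n. r s + 1 / (real n + 1)) \<longlonglongrightarrow> r s + 0"
        using LIMSEQ_inverse_real_of_nat by (intro tendsto_add tendsto_const) (simp only: inverse_eq_divide add.commute[of 1] of_nat_Suc)
      show "(\<lambda>n. a n s) \<longlonglongrightarrow> r s"
        by (rule tendsto_sandwich[OF _ _ tendsto_const l[simplified]]) (intro always_eventually allI ge, intro always_eventually allI le)
    qed
    then show "(\<lambda>n. case p of (s,w) \<Rightarrow> Z (a n s) w) \<longlonglongrightarrow> (case p of (s,w) \<Rightarrow> Z (r s) w)" by (simp add: p)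
  qed
  then show ?thesis by (simp add: r_def)
qed

lemma right_cont_measurable:
  fixes Z :: "real \<Rightarrow> 'w \<Rightarrow> real"
  assumes Z: "\<And>s. 0 \<le> s \<Longrightarrow> Z s \<in> borel_measurable F"
    and rc: "\<And>w s. w \<in> space F \<Longrightarrow> 0 \<le> s \<Longrightarrow> ((\<lambda>s. Z s w) \<longlongrightarrow> Z s w) (at_right s)"
  shows "(\<lambda>(s,w). Z (max 0 s) w) \<in> borel_measurable (borel \<Otimes>\<^sub>M F)"
proof (rule borel_measurable_LIMSEQ_real)
  fix n :: nat
  show "(\<lambda>(s,w). Z (max 0 (min (real n) s)) w) \<in> borel_measurable (borel \<Otimes>\<^sub>M F)"
    by (rule progressive_measurable) (use Z rc in auto)
next
  fix p :: "real \<times> 'w" assume "p \<in> space (borel \<Otimes>\<^sub>M F)"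
  obtain s w where p: "p = (s,w)" by (cases p)
  obtain N where "s \<le> real N" using real_arch_simple by blast
  then have "eventually (\<lambda>n. Z (max 0 (min (real n) s)) w = Z (max 0 s) w) sequentially"
  proof (intro eventually_sequentiallyI[of N])
    fix n assume "N \<le> n"
    then have "s \<le> real n" using \<open>s \<le> real N\<close> by simp
    then show "Z (max 0 (min (real n) s)) w = Z (max 0 s) w" by (simp only: min_absorb2)
  qed
  then show "(\<lambda>n. case p of (s,w) \<Rightarrow> Z (max 0 (min (real n) s)) w) \<longlonglongrightarrow> (case p of (s,w) \<Rightarrow> Z (max 0 s) w)"
    by (auto simp: p intro: tendsto_eventually)
qed

lemma integral_even:
  fixes f :: "real \<Rightarrow> real"
  assumes f: "integrable lborel f" and ev: "\<And>u. f (-u) = f u"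
  shows "(\<integral>u. f u \<partial>lborel) = 2 * (LBINT u:{0..}. f u)"
proof -
  have [measurable]: "f \<in> borel_measurable borel" using borel_measurable_integrable[OF f] by simp
  have i: "integrable lborel (\<lambda>u. indicator A u * f u)" if "A \<in> sets borel" for A
    using integrable_mult_indicator[of A lborel f] f that by simp
  have "(\<integral>u. f u \<partial>lborel) = (\<integral>u. indicator {0..} u * f u + indicator {..<0} u * f u \<partial>lborel)"
    by (intro Bochner_Integration.integral_cong refl) (auto simp: indicator_def)
  also have "\<dots> = (\<integral>u. indicator {0..} u * f u \<partial>lborel) + (\<integral>u. indicator {..<0} u * f u \<partial>lborel)"
    by (intro Bochner_Integration.integral_add i) auto
  also have "(\<integral>u. indicator {..<0} u * f u \<partial>lborel) = (\<integral>u. indicator {..<0} (-u) * f (-u) \<partial>lborel)"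
    using lborel_integral_real_affine[of "-1" "\<lambda>u. indicator {..<0} u * f u" 0] by simp
  also have "\<dots> = (\<integral>u. indicator {0..} u * f u \<partial>lborel)"
  proof (rule integral_cong_AE)
    have "AE u in lborel. u \<noteq> (0::real)" by (rule AE_lborel_singleton)
    then show "AE u in lborel. indicator {..<0} (-u) * f (-u) = indicator {0..} u * f u"
      by eventually_elim (auto simp: indicator_def ev)
  qed measurable
  finally show ?thesis by (simp add: set_lebesgue_integral_def)
qed

text \<open>Folds the inversion integral onto the half line, the form in which \<open>h_fun\<close>
  is defined.\<close>

lemma finv_hermitian:
  assumes "integrable lborel \<phi>" "\<And>u. \<phi> (-u) = cnj (\<phi> u)"
  shows "finv \<phi> z = (LBINT u:{0..}. Re (iexp (-(u*z)) * \<phi> u)) / pi"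
proof -
  have i: "integrable lborel (\<lambda>u::real. Re (iexp (-(u*z)) * \<phi> u))"
    using integrable_iexp_mult'[OF assms(1)] by (rule integrable_Re)
  have "Re (\<integral>u. iexp (-(u*z)) * \<phi> u \<partial>lborel) = (\<integral>u. Re (iexp (-(u*z)) * \<phi> u) \<partial>lborel)"
    using integrable_iexp_mult'[OF assms(1)] by (rule integral_Re[symmetric])
  also have "\<dots> = 2 * (LBINT u:{0..}. Re (iexp (-(u*z)) * \<phi> u))"
  proof (rule integral_even[OF i])
    fix u
    have "iexp (-(-u*z)) * \<phi> (-u) = cnj (iexp (-(u*z)) * \<phi> u)"
      by (simp add: assms exp_cnj)
    then show "Re (iexp (-(-u*z)) * \<phi> (-u)) = Re (iexp (-(u*z)) * \<phi> u)" by simp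
  qed
  finally show ?thesis by (simp add: finv_def)
qed

context levy0 begin

lemma joint_meas[measurable]: "(\<lambda>(s,w). Z (max 0 s) w) \<in> borel_measurable (borel \<Otimes>\<^sub>M M)"
  by (rule right_cont_measurable[OF Z_meas Z_right])

lemma joint_meas_Fil: "0 \<le> t \<Longrightarrow> (\<lambda>(s,w). Z (max 0 (min t s)) w) \<in> borel_measurable (borel \<Otimes>\<^sub>M Fil t)"
  by (rule progressive_measurable) (use Z_Fil Z_right in auto)

end

section \<open>Laws of the process at independent random times\<close>

locale levy_sym = levy0 +
  fixes \<eta> :: "real \<Rightarrow> complex"
  assumes chr: "\<And>t u. 0 \<le> t \<Longrightarrow> (\<integral>w. iexp (u * Z t w) \<partial>M) = exp (of_real t * \<eta> u)"
    and A: "\<And>q::real. q > 0 \<Longrightarrow> integrable lborel (\<lambda>u. 1 / (of_real q - \<eta> u))"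
begin

lemma Re_eta: "Re (\<eta> u) \<le> 0"
proof -
  have "norm (\<integral>w. iexp (u * Z 1 w) \<partial>M) \<le> (\<integral>w. norm (iexp (u * Z 1 w)) \<partial>M)" by (rule integral_norm_bound)
  also have "\<dots> = 1" by (simp add: prob_space)
  finally have "norm (exp (\<eta> u)) \<le> 1" using chr[of 1 u] by simp
  then show ?thesis by simp
qed

text \<open>By (A) at \<open>q = 1\<close> the function \<open>1 / (1 - \<eta> u)\<close> is
  measurable, and \<open>\<eta>\<close> is recovered from it algebraically.\<close>

lemma eta_meas[measurable]: "\<eta> \<in> borel_measurable borel"
proof -
  have [measurable]: "(\<lambda>u. 1 / (1 - \<eta> u)) \<in> borel_measurable borel"
    using borel_measurable_integrable[OF A[of 1]] by simp
  have "\<eta> = (\<lambda>u. 1 - 1 / (1 / (1 - \<eta> u)))" by (auto simp: fun_eq_iff)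
  also have "\<dots> \<in> borel_measurable borel" by measurable
  finally show ?thesis .
qed

lemma norm_q_eta: "0 < q \<Longrightarrow> q \<le> norm (complex_of_real q - \<eta> u)"
  using Re_eta[of u] complex_Re_le_cmod[of "of_real q - \<eta> u"] by simp

lemma norm_q_eta': assumes "0 \<le> q" shows "norm (\<eta> u) \<le> norm (complex_of_real q - \<eta> u)"
proof -
  have "(Re (\<eta> u))\<^sup>2 \<le> (q - Re (\<eta> u))\<^sup>2" using Re_eta[of u] assms by (intro abs_le_square_iff[THEN iffD1]) simp
  then show ?thesis unfolding cmod_def by (intro real_sqrt_le_mono) simp
qed

text \<open>\<open>N\<close> is the law of the process at an independent time with density
  \<open>g\<close>; its characteristic function averages \<open>exp (s * \<eta> u)\<close> over that
  time. Exponential times lead to the resolvent, uniform times to the mean occupation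
  measure.\<close>

lemma time_mix:
  fixes g :: "real \<Rightarrow> real"
  assumes g[measurable]: "g \<in> borel_measurable borel" and g0: "\<And>s. 0 \<le> g s" "\<And>s. s < 0 \<Longrightarrow> g s = 0"
    and gp: "prob_space (density lborel (\<lambda>s. ennreal (g s)))"
    and \<phi>: "\<And>u. (\<integral>s. g s *\<^sub>R exp (of_real s * \<eta> u) \<partial>lborel) = \<phi> u"
  shows "\<exists>N. real_distribution N \<and> char N = \<phi> \<and> (\<forall>f\<in>borel_measurable borel.
     (\<integral>\<^sup>+z. f z \<partial>N) = (\<integral>\<^sup>+s. g s * (\<integral>\<^sup>+w. f (Z (max 0 s) w) \<partial>M) \<partial>lborel))"
proof -
  let ?W = "density lborel (\<lambda>s. ennreal (g s))"
  interpret W: prob_space ?W by fact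
  interpret WM: pair_prob_space ?W M ..
  have jm[measurable]: "(\<lambda>(s,w). Z (max 0 s) w) \<in> borel_measurable (?W \<Otimes>\<^sub>M M)"
    using joint_meas by (simp cong: measurable_cong_sets sets_pair_measure_cong)
  define N where "N = distr (?W \<Otimes>\<^sub>M M) borel (\<lambda>(s,w). Z (max 0 s) w)"
  interpret N: real_distribution N unfolding N_def
    by (intro WM.real_distribution_distr jm)
  have "char N u = \<phi> u" for u
  proof -
    have i: "integrable (?W \<Otimes>\<^sub>M M) (\<lambda>(s,w). iexp (u * Z (max 0 s) w))"
    proof (rule WM.integrable_const_bound[where B=1])
      show "(\<lambda>(s,w). iexp (u * Z (max 0 s) w)) \<in> borel_measurable (?W \<Otimes>\<^sub>M M)"
        using jm unfolding case_prod_beta by measurable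
    qed auto
    have "char N u = (\<integral>(s,w). iexp (u * Z (max 0 s) w) \<partial>(?W \<Otimes>\<^sub>M M))"
      unfolding char_def N_def by (subst integral_distr[OF jm]) (simp_all add: split_beta')
    moreover have "(\<integral>(s,w). iexp (u * Z (max 0 s) w) \<partial>(?W \<Otimes>\<^sub>M M)) = (\<integral>s. (\<integral>w. iexp (u * Z (max 0 s) w) \<partial>M) \<partial>?W)"
      by (rule WM.integral_fst[OF i, symmetric])
    moreover have "(\<integral>s. (\<integral>w. iexp (u * Z (max 0 s) w) \<partial>M) \<partial>?W) = (\<integral>s. exp (of_real (max 0 s) * \<eta> u) \<partial>?W)" by (subst chr) auto
    moreover have "(\<integral>s. exp (of_real (max 0 s) * \<eta> u) \<partial>?W) = (\<integral>s. g s *\<^sub>R exp (of_real (max 0 s) * \<eta> u) \<partial>lborel)"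
      by (rule integral_density) (use g0 in auto)
    moreover have "(\<integral>s. g s *\<^sub>R exp (of_real (max 0 s) * \<eta> u) \<partial>lborel) = (\<integral>s. g s *\<^sub>R exp (of_real s * \<eta> u) \<partial>lborel)"
    proof (rule Bochner_Integration.integral_cong[OF refl])
      fix s show "g s *\<^sub>R exp (of_real (max 0 s) * \<eta> u) = g s *\<^sub>R exp (of_real s * \<eta> u)"
        using g0(2)[of s] by (cases "s < 0") simp_all
    qed
    ultimately show ?thesis using \<phi>[of u] by (simp only:)
  qed
  moreover have "(\<integral>\<^sup>+z. f z \<partial>N) = (\<integral>\<^sup>+s. g s * (\<integral>\<^sup>+w. f (Z (max 0 s) w) \<partial>M) \<partial>lborel)"
    if f[measurable]: "f \<in> borel_measurable borel" for f
  proof -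
    have "(\<integral>\<^sup>+z. f z \<partial>N) = (\<integral>\<^sup>+p. f (case p of (s,w) \<Rightarrow> Z (max 0 s) w) \<partial>(?W \<Otimes>\<^sub>M M))"
      unfolding N_def by (rule nn_integral_distr[OF jm]) simp
    also have "\<dots> = (\<integral>\<^sup>+s. (\<integral>\<^sup>+w. f (Z (max 0 s) w) \<partial>M) \<partial>?W)"
      using nn_integral_fst[of "\<lambda>p. f (case p of (s,w) \<Rightarrow> Z (max 0 s) w)" ?W] by simp
    also have "\<dots> = (\<integral>\<^sup>+s. g s * (\<integral>\<^sup>+w. f (Z (max 0 s) w) \<partial>M) \<partial>lborel)"
      using borel_measurable_nn_integral_fst[of "\<lambda>p. f (case p of (s,w) \<Rightarrow> Z (max 0 s) w)" borel]
      by (subst nn_integral_density) auto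
    finally show ?thesis .
  qed
  ultimately show ?thesis using N.real_distribution_axioms by (intro exI[of _ N]) (auto simp: fun_eq_iff)
qed

lemma integral_exp_interval:
  fixes k :: complex
  assumes "0 \<le> r" "k \<noteq> 0"
  shows "(\<integral>s. indicator {0..r} s *\<^sub>R exp (- (of_real s * k)) \<partial>lborel) = (1 - exp (- (of_real r * k))) / k"
proof -
  have "(\<integral>s. indicator {0..r} s *\<^sub>R exp (- (of_real s * k)) \<partial>lborel) =
    (- exp (- (of_real r * k)) / k) - (- exp (- (of_real 0 * k)) / k)"
  proof (rule integral_FTC_Icc[OF assms(1), where F="\<lambda>s. - exp (- (of_real s * k)) / k"])
    show "continuous_on {0..r} (\<lambda>s. exp (- (of_real s * k)))" by (intro continuous_intros)
    show "((\<lambda>s. - exp (- (of_real s * k)) / k) has_vector_derivative exp (- (of_real s * k))) (at s within {0..r})" for s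
    proof -
      have "((\<lambda>w. - exp (- (w * k)) / k) has_field_derivative exp (- (of_real s * k))) (at (of_real s))"
        using assms(2) by (auto intro!: derivative_eq_intros)
      from has_vector_derivative_real_field[OF this, of "{0..r}"] show ?thesis .
    qed
  qed
  then show ?thesis by (simp add: diff_divide_distrib)
qed

lemma integral_exp_eta_interval:
  assumes "0 \<le> r" "q - \<eta> u \<noteq> (0::complex)"
  shows "(\<integral>s. indicator {0..r} s *\<^sub>R exp (- (of_real s * (q - \<eta> u))) \<partial>lborel) = (1 - exp (- (of_real r * (q - \<eta> u)))) / (q - \<eta> u)"
  by (rule integral_exp_interval[OF assms])

lemma norm_exp_eta: "0 \<le> s \<Longrightarrow> norm (exp (of_real s * \<eta> u)) \<le> 1"
  using Re_eta[of u] by (simp add: mult_nonneg_nonpos)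

text \<open>The exponent is complex, so the integral is computed on bounded intervals by the
  fundamental theorem and extended by dominated convergence; \<open>Re (\<eta> u) \<le> 0\<close>
  makes the boundary term vanish.\<close>

lemma integral_exponential_eta:
  assumes q: "0 < q"
  shows "(\<integral>s. exponential_density q s *\<^sub>R exp (of_real s * \<eta> u) \<partial>lborel) = of_real q / (of_real q - \<eta> u)"
proof -
  let ?k = "of_real q - \<eta> u"
  have k0: "?k \<noteq> 0" using norm_q_eta[OF q, of u] q by auto
  have meas[measurable]: "(\<lambda>s. exponential_density q s *\<^sub>R exp (of_real s * \<eta> u)) \<in> borel_measurable borel"
    by measurable
  interpret E: prob_space "density lborel (\<lambda>s. ennreal (exponential_density q s))" using q by (rule prob_space_exponential_density)
  have ie: "integrable lborel (exponential_density q)"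
  proof (rule integrableI_nonneg)
    have "(\<integral>\<^sup>+s. ennreal (exponential_density q s) \<partial>lborel) = emeasure (density lborel (\<lambda>s. ennreal (exponential_density q s))) UNIV"
      by (subst emeasure_density) auto
    also have "\<dots> = 1" using E.emeasure_space_1 by simp
    finally show "(\<integral>\<^sup>+s. ennreal (exponential_density q s) \<partial>lborel) < \<infinity>" by simp
  qed (use q in \<open>auto simp: exponential_density_nonneg\<close>)
  have "(\<lambda>n. \<integral>s. indicator {0..real n} s *\<^sub>R (exponential_density q s *\<^sub>R exp (of_real s * \<eta> u)) \<partial>lborel)
    \<longlonglongrightarrow> (\<integral>s. exponential_density q s *\<^sub>R exp (of_real s * \<eta> u) \<partial>lborel)"
  proof (rule integral_dominated_convergence[where w="exponential_density q"])
    show "AE s in lborel. (\<lambda>n. indicator {0..real n} s *\<^sub>R (exponential_density q s *\<^sub>R exp (of_real s * \<eta> u))) \<longlonglongrightarrow> exponential_density q s *\<^sub>R exp (of_real s * \<eta> u)"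
    proof (rule AE_I2, rule tendsto_eventually)
      fix s :: real
      obtain N where N: "s \<le> real N" using real_arch_simple by blast
      show "\<forall>\<^sub>F n in sequentially. indicator {0..real n} s *\<^sub>R (exponential_density q s *\<^sub>R exp (of_real s * \<eta> u)) = exponential_density q s *\<^sub>R exp (of_real s * \<eta> u)"
        using N by (intro eventually_sequentiallyI[of N]) (auto simp: indicator_def exponential_density_def)
    qed
    show "AE s in lborel. norm (indicator {0..real n} s *\<^sub>R (exponential_density q s *\<^sub>R exp (of_real s * \<eta> u))) \<le> exponential_density q s" for n
    proof (rule AE_I2)
      fix s
      show "norm (indicator {0..real n} s *\<^sub>R (exponential_density q s *\<^sub>R exp (of_real s * \<eta> u))) \<le> exponential_density q s"
      proof (cases "s \<in> {0..real n}")
        case True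
        then have "exponential_density q s * norm (exp (of_real s * \<eta> u)) \<le> exponential_density q s * 1"
          using q by (intro mult_left_mono norm_exp_eta exponential_density_nonneg) auto
        then show ?thesis using True q exponential_density_nonneg[of q s] by simp
      qed (use q exponential_density_nonneg[of q s] in simp)
    qed
  qed (use ie in measurable)
  moreover have "(\<integral>s. indicator {0..real n} s *\<^sub>R (exponential_density q s *\<^sub>R exp (of_real s * \<eta> u)) \<partial>lborel)
     = of_real q * ((1 - exp (- (of_real n * ?k))) / ?k)" for n
  proof -
    have "(\<integral>s. indicator {0..real n} s *\<^sub>R (exponential_density q s *\<^sub>R exp (of_real s * \<eta> u)) \<partial>lborel)
      = (\<integral>s. of_real q * (indicator {0..real n} s *\<^sub>R exp (- (of_real s * ?k))) \<partial>lborel)"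
    proof (intro Bochner_Integration.integral_cong refl)
      fix s :: real
      have "exp (- (of_real s * ?k)) = exp (- (of_real (s * q))) * exp (of_real s * \<eta> u)"
        by (simp only: exp_add[symmetric]) (simp add: right_diff_distrib)
      also have "exp (- (of_real (s * q))) = of_real (exp (- s * q))"
        by (simp only: of_real_minus[symmetric] exp_of_real) simp
      finally show "indicator {0..real n} s *\<^sub>R (exponential_density q s *\<^sub>R exp (of_real s * \<eta> u))
         = of_real q * (indicator {0..real n} s *\<^sub>R exp (- (of_real s * ?k)))"
        by (simp add: indicator_def exponential_density_def scaleR_conv_of_real)
    qed
    also have "\<dots> = of_real q * ((1 - exp (- (of_real n * ?k))) / ?k)"
      unfolding integral_mult_right_zero using k0 by (subst integral_exp_eta_interval) auto
    finally show ?thesis .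
  qed
  moreover have "(\<lambda>n. of_real q * ((1 - exp (- (of_real (real n) * ?k))) / ?k)) \<longlonglongrightarrow> of_real q * ((1 - 0) / ?k)"
  proof (intro tendsto_intros k0)
    show "(\<lambda>n. exp (- (of_real (real n) * ?k))) \<longlonglongrightarrow> 0"
    proof (rule Lim_null_comparison)
      have "exp (- (real n * (q - Re (\<eta> u)))) \<le> exp (-q) ^ n" for n
      proof -
        have "real n * q \<le> real n * (q - Re (\<eta> u))" using Re_eta[of u] by (intro mult_left_mono) auto
        then have "exp (- (real n * (q - Re (\<eta> u)))) \<le> exp (real n * (-q))" by simp
        then show ?thesis by (simp only: exp_of_nat_mult)
      qed
      then show "\<forall>\<^sub>F n in sequentially. norm (exp (- (of_real (real n) * ?k))) \<le> exp (-q) ^ n" by simp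
      show "(\<lambda>n. exp (-q) ^ n) \<longlonglongrightarrow> 0" using q by (intro LIMSEQ_power_zero) simp
    qed
  qed
  ultimately show ?thesis using LIMSEQ_unique by fastforce
qed

text \<open>The candidate for \<open>resolvent_density\<close>. It is built from
  \<open>\<eta>\<close> alone and hence is the same for every starting point.\<close>

definition res :: "real \<Rightarrow> real \<Rightarrow> real" where
  "res q z = finv (\<lambda>u. 1 / (of_real q - \<eta> u)) z"

text \<open>The Fourier transform of the occupation measure of \<open>{0..r}\<close>, averaged over
  paths started at 0. The integral form is right also at zeros of \<open>\<eta>\<close>, where the
  quotient in \<open>occ_char_eq\<close> is not.\<close>

definition occ_char :: "real \<Rightarrow> real \<Rightarrow> complex" where
  "occ_char r u = (\<integral>s. indicator {0..r} s *\<^sub>R exp (of_real s * \<eta> u) \<partial>lborel)"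

definition occ :: "real \<Rightarrow> real \<Rightarrow> real" where
  "occ r z = finv (occ_char r) z"

lemma finv_cmult: "finv (\<lambda>u. of_real c * \<phi> u) z = c * finv \<phi> z"
proof -
  have "(\<integral>u. iexp (-(u*z)) * (of_real c * \<phi> u) \<partial>lborel) = (\<integral>u. of_real c * (iexp (-(u*z)) * \<phi> u) \<partial>lborel)"
    by (intro Bochner_Integration.integral_cong refl) (simp only: mult.left_commute)
  also have "\<dots> = of_real c * (\<integral>u. iexp (-(u*z)) * \<phi> u \<partial>lborel)" by (rule integral_mult_right_zero)
  finally show ?thesis unfolding finv_def by simp
qed

text \<open>Once the mixed characteristic function is integrable, the time-averaged law has the
  inverted transform as its density, which settles positivity as well.\<close>

lemma time_mix_density:
  fixes g :: "real \<Rightarrow> real"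
  assumes g: "g \<in> borel_measurable borel" and g0: "\<And>s. 0 \<le> g s" "\<And>s. s < 0 \<Longrightarrow> g s = 0"
    and gp: "prob_space (density lborel (\<lambda>s. ennreal (g s)))"
    and \<phi>: "\<And>u. (\<integral>s. g s *\<^sub>R exp (of_real s * \<eta> u) \<partial>lborel) = \<phi> u"
    and int: "integrable lborel \<phi>"
  shows "0 \<le> finv \<phi> z"
    "f \<in> borel_measurable borel \<Longrightarrow> (\<integral>\<^sup>+s. g s * (\<integral>\<^sup>+w. f (Z (max 0 s) w) \<partial>M) \<partial>lborel) = (\<integral>\<^sup>+z. ennreal (finv \<phi> z) * f z \<partial>lborel)"
proof -
  from time_mix[OF g g0 gp \<phi>] obtain N where N: "real_distribution N" "char N = \<phi>"
    "\<And>f. f \<in> borel_measurable borel \<Longrightarrow> (\<integral>\<^sup>+z. f z \<partial>N) = (\<integral>\<^sup>+s. g s * (\<integral>\<^sup>+w. f (Z (max 0 s) w) \<partial>M) \<partial>lborel)"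
    by blast
  interpret N: real_distribution N by fact
  have i: "integrable lborel (char N)" using int N(2) by simp
  show "0 \<le> finv \<phi> z" using N.density_char(1)[OF i] N(2) by simp
  assume f[measurable]: "f \<in> borel_measurable borel"
  have [measurable]: "finv \<phi> \<in> borel_measurable borel" by (rule measurable_finv[OF int])
  have "(\<integral>\<^sup>+z. f z \<partial>N) = (\<integral>\<^sup>+z. f z \<partial>density lborel (\<lambda>z. ennreal (finv \<phi> z)))"
    using N.density_char(2)[OF i] N(2) by (intro arg_cong[where f="\<lambda>N. \<integral>\<^sup>+z. f z \<partial>N"]) simp
  also have "\<dots> = (\<integral>\<^sup>+z. ennreal (finv \<phi> z) * f z \<partial>lborel)" by (rule nn_integral_density) auto
  finally show "(\<integral>\<^sup>+s. g s * (\<integral>\<^sup>+w. f (Z (max 0 s) w) \<partial>M) \<partial>lborel) = (\<integral>\<^sup>+z. ennreal (finv \<phi> z) * f z \<partial>lborel)"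
    using N(3)[OF f] by simp
qed

lemma integrable_q_div: "0 < q \<Longrightarrow> integrable lborel (\<lambda>u. of_real q / (of_real q - \<eta> u))"
  using integrable_mult_right[of "of_real q", OF A[of q]] by simp

lemma res_nonneg: assumes q: "0 < q" shows "0 \<le> res q z"
proof -
  have "0 \<le> finv (\<lambda>u. of_real q / (of_real q - \<eta> u)) z"
    by (rule time_mix_density(1)[of "exponential_density q"])
       (use q integrable_q_div[OF q] integral_exponential_eta[OF q] prob_space_exponential_density[OF q] in \<open>auto simp: exponential_density_nonneg exponential_density_def\<close>)
  also have "\<dots> = q * res q z" unfolding res_def finv_cmult[symmetric] by simp
  finally show ?thesis using q by (simp add: zero_le_mult_iff)
qed

lemma res_density:
  assumes q: "0 < q" and f: "f \<in> borel_measurable borel"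
  shows "(\<integral>\<^sup>+s. exponential_density q s * (\<integral>\<^sup>+w. f (Z (max 0 s) w) \<partial>M) \<partial>lborel) = (\<integral>\<^sup>+z. ennreal (q * res q z) * f z \<partial>lborel)"
proof -
  have "(\<integral>\<^sup>+s. exponential_density q s * (\<integral>\<^sup>+w. f (Z (max 0 s) w) \<partial>M) \<partial>lborel) =
    (\<integral>\<^sup>+z. ennreal (finv (\<lambda>u. of_real q / (of_real q - \<eta> u)) z) * f z \<partial>lborel)"
    by (rule time_mix_density(2)[OF _ _ _ _ _ _ f])
       (use q integrable_q_div[OF q] integral_exponential_eta[OF q] prob_space_exponential_density[OF q] in \<open>auto simp: exponential_density_nonneg exponential_density_def\<close>)
  also have "(\<lambda>z. finv (\<lambda>u. of_real q / (of_real q - \<eta> u)) z) = (\<lambda>z. q * res q z)"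
    unfolding res_def finv_cmult[symmetric] by simp
  finally show ?thesis .
qed

lemma occ_char_norm: "0 \<le> r \<Longrightarrow> norm (occ_char r u) \<le> r"
proof -
  assume t: "0 \<le> r"
  have "norm (occ_char r u) \<le> (\<integral>s. norm (indicator {0..r} s *\<^sub>R exp (of_real s * \<eta> u)) \<partial>lborel)"
    unfolding occ_char_def by (rule integral_norm_bound)
  also have "\<dots> \<le> (\<integral>s. indicator {0..r} s \<partial>lborel)"
  proof (rule integral_mono')
    show "norm (indicator {0..r} s *\<^sub>R exp (of_real s * \<eta> u)) \<le> indicator {0..r} s" for s
      using norm_exp_eta[of s u] by (cases "s \<in> {0..r}") (simp_all del: norm_exp_eq_Re)
  qed (simp_all add: emeasure_lborel_Icc_eq)
  also have "\<dots> = r" using t by simp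
  finally show ?thesis .
qed

lemma occ_char_eq: assumes "0 \<le> r" "\<eta> u \<noteq> 0" shows "occ_char r u = (exp (of_real r * \<eta> u) - 1) / \<eta> u"
  using integral_exp_eta_interval[of r 0 u] assms unfolding occ_char_def
  by (simp add: divide_simps)

lemma occ_char_norm2: assumes "0 \<le> r" "\<eta> u \<noteq> 0" shows "norm (occ_char r u) \<le> 2 / norm (\<eta> u)"
proof -
  have "norm (exp (of_real r * \<eta> u) - 1) \<le> norm (exp (of_real r * \<eta> u)) + norm (1::complex)" by (rule norm_triangle_ineq4)
  also have "\<dots> \<le> 2" using norm_exp_eta[OF assms(1), of u] by (simp del: norm_exp_eq_Re)
  finally show ?thesis unfolding occ_char_eq[OF assms] norm_divide by (rule divide_right_mono) simp
qed

lemma occ_char_meas[measurable]: "occ_char r \<in> borel_measurable borel"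
  unfolding occ_char_def by measurable

end

section \<open>Occupation density of the mean\<close>

text \<open>By the half-angle formula this is the square of
  \<open>|sin (n * y)| <= n * |sin y|\<close>, proved by induction. It compares a characteristic
  function at \<open>n * u\<close> with its value at \<open>u\<close>.\<close>

lemma one_minus_cos_multiple: "1 - cos (real n * x) \<le> (real n)\<^sup>2 * (1 - cos x)"
proof -
  have s: "\<bar>sin (real n * y)\<bar> \<le> real n * \<bar>sin y\<bar>" for y
  proof (induction n)
    case (Suc n)
    have "\<bar>sin (real (Suc n) * y)\<bar> = \<bar>sin (real n * y) * cos y + cos (real n * y) * sin y\<bar>"
    proof -
      have "real (Suc n) * y = real n * y + y" by (simp add: distrib_right)
      then show ?thesis by (simp only: sin_add)
    qed
    also have "\<dots> \<le> \<bar>sin (real n * y)\<bar> * \<bar>cos y\<bar> + \<bar>cos (real n * y)\<bar> * \<bar>sin y\<bar>"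
      by (rule order_trans[OF abs_triangle_ineq]) (simp add: abs_mult)
    also have "\<dots> \<le> \<bar>sin (real n * y)\<bar> * 1 + 1 * \<bar>sin y\<bar>"
      by (intro add_mono mult_left_mono mult_right_mono abs_cos_le_one) auto
    also have "\<dots> \<le> real n * \<bar>sin y\<bar> + \<bar>sin y\<bar>" using Suc by simp
    finally show ?case by (simp add: distrib_right)
  qed simp
  have c: "1 - cos z = 2 * (sin (z/2))\<^sup>2" for z :: real
    using cos_double_sin[of "z/2"] by simp
  have "(sin (real n * x / 2))\<^sup>2 \<le> (real n)\<^sup>2 * (sin (x/2))\<^sup>2"
    using power_mono[OF s[of "x/2"], of 2] by (simp add: power_mult_distrib)
  then show ?thesis unfolding c by simp
qed

section \<open>A lower bound for the symbol and the majorants built on it\<close>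

context levy_sym begin

text \<open>\<open>N\<close> is the law at an exponential time, with characteristic function
  \<open>1 / (1 - \<eta>)\<close>. By (A) it is integrable, hence tends to 0, so \<open>gap\<close>
  tends to 1; the inequality \<open>gap (n * u) <= n^2 * gap u\<close> carries this down to small
  \<open>u\<close> and gives the quadratic bound. Finally \<open>gap u <= |\<eta> u|\<close>, since
  \<open>|1 - \<eta> u| >= 1\<close>.\<close>

lemma eta_lower:
  obtains c where "0 < c" "\<And>u. \<bar>u\<bar> \<le> 1 \<Longrightarrow> c * u\<^sup>2 \<le> norm (\<eta> u)" "\<And>u. 1 \<le> \<bar>u\<bar> \<Longrightarrow> c \<le> norm (\<eta> u)"
    and "\<And>u. \<eta> (-u) = cnj (\<eta> u)"
proof -
  have ex1: "\<And>s::real. 0 \<le> exponential_density 1 s" "\<And>s::real. s < 0 \<Longrightarrow> exponential_density 1 s = 0"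
    by (auto simp: exponential_density_def)
  from time_mix[of "exponential_density 1" "\<lambda>u. of_real 1 / (of_real 1 - \<eta> u)"]
  obtain N where N: "real_distribution N" "char N = (\<lambda>u. 1 / (1 - \<eta> u))"
    using ex1 prob_space_exponential_density[of 1] integral_exponential_eta[of 1] by auto
  interpret N: real_distribution N by fact
  have i: "integrable lborel (char N)" using A[of 1] N(2) by simp
  define gap where "gap u = 1 - Re (char N u)" for u
  have ii: "integrable N (\<lambda>z. iexp (u * z))" for u by (rule N.integrable_iexp) auto
  have ic: "integrable N (\<lambda>z. cos (u * z))" for u
    using integrable_Re[OF ii[of u]] by (simp add: Re_exp)
  have gap_int: "gap u = (\<integral>z. 1 - cos (u * z) \<partial>N)" for u
  proof -
    have "Re (char N u) = (\<integral>z. Re (iexp (u * z)) \<partial>N)" unfolding char_def using integral_Re[OF ii[of u]] by simp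
    also have "\<dots> = (\<integral>z. cos (u * z) \<partial>N)" by (simp add: Re_exp)
    finally show ?thesis unfolding gap_def using ic[of u] N.prob_space by (simp del: N.space_eq_univ)
  qed
  have gap_mult: "gap (real n * u) \<le> (real n)\<^sup>2 * gap u" for n u
  proof -
    have "(\<integral>z. 1 - cos (real n * u * z) \<partial>N) \<le> (\<integral>z. (real n)\<^sup>2 * (1 - cos (u * z)) \<partial>N)"
    proof (rule integral_mono)
      show "1 - cos (real n * u * z) \<le> (real n)\<^sup>2 * (1 - cos (u * z))" for z
        using one_minus_cos_multiple[of n "u * z"] by (simp add: mult.assoc)
    qed (use ic in auto)
    then show ?thesis unfolding gap_int by simp
  qed
  have gap0: "0 \<le> gap u" for u unfolding gap_int by (intro integral_nonneg_AE) auto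
  have lim: "(gap \<longlongrightarrow> 1) at_top"
  proof -
    have "(gap \<longlongrightarrow> 1 - Re 0) at_top" unfolding gap_def
      by (intro tendsto_intros N.char_tendsto_0[OF i])
    then show ?thesis by simp
  qed
  \<comment> \<open>A zero of \<open>gap\<close> would repeat at all its integer multiples and
    contradict the limit 1.\<close>
  have gap_pos: "0 < gap u" if "0 < u" for u
  proof (rule ccontr)
    assume "\<not> 0 < gap u"
    then have "gap u = 0" using gap0[of u] by simp
    then have z: "gap (real n * u) = 0" for n using gap_mult[of n u] gap0[of "real n * u"] by simp
    have "filterlim (\<lambda>n. real n * u) at_top sequentially"
      using that by (intro filterlim_at_top_mult_tendsto_pos[OF tendsto_const _ filterlim_real_sequentially])
    from filterlim_compose[OF lim this] have "(\<lambda>n. gap (real n * u)) \<longlonglongrightarrow> 1" .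
    then show False unfolding z using LIMSEQ_unique tendsto_const by fastforce
  qed
  have gap_eta: "gap u \<le> norm (\<eta> u)" for u
  proof -
    have n1: "1 \<le> norm (1 - \<eta> u)" using norm_q_eta[of 1 u] by simp
    then have nz: "1 - \<eta> u \<noteq> 0" by auto
    have "gap u = Re (1 - char N u)" by (simp add: gap_def)
    also have "\<dots> \<le> norm (1 - char N u)" by (rule complex_Re_le_cmod)
    also have "1 - char N u = - \<eta> u / (1 - \<eta> u)" unfolding N(2) using nz by (simp add: divide_simps)
    also have "norm (- \<eta> u / (1 - \<eta> u)) = norm (\<eta> u) / norm (1 - \<eta> u)" by (simp only: norm_divide norm_minus_cancel)
    also have "\<dots> \<le> norm (\<eta> u) / 1" using n1 by (intro divide_left_mono) auto
    finally show ?thesis by simp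
  qed
  have "eventually (\<lambda>u. 1/2 < gap u) at_top" using lim by (intro order_tendstoD) auto
  then obtain K where K: "\<And>u. K \<le> u \<Longrightarrow> 1/2 < gap u" unfolding eventually_at_top_linorder by auto
  have "continuous_on {1..max 1 K} gap" unfolding gap_def
    by (intro continuous_intros continuous_at_imp_continuous_on ballI N.isCont_char)
  \<comment> \<open>The positive minimum on the compact range between 1 and the point where the
    limit takes over.\<close>
  then obtain u0 where u0: "u0 \<in> {1..max 1 K}" "\<And>u. u \<in> {1..max 1 K} \<Longrightarrow> gap u0 \<le> gap u"
    using continuous_attains_inf[of "{1..max 1 K}" gap] by auto
  define c where "c = min (gap u0) (1/2)"
  have c0: "0 < c" unfolding c_def using gap_pos[of u0] u0(1) by simp
  have c1: "c \<le> gap u" if "1 \<le> u" for u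
  proof (cases "u \<le> max 1 K")
    case True then show ?thesis using u0(2)[of u] that by (simp add: c_def min.coboundedI1)
  next
    case False then have "1/2 < gap u" using K[of u] by simp
    then show ?thesis by (simp add: c_def min.coboundedI2)
  qed
  have gap_abs: "gap u = gap \<bar>u\<bar>" for u unfolding gap_int by (cases "0 \<le> u") auto
  have c2: "c / 4 * u\<^sup>2 \<le> gap u" if "\<bar>u\<bar> \<le> 1" for u
  proof (cases "u = 0")
    case False
    \<comment> \<open>The least multiple that brings \<open>n * |u|\<close> up to 1; the product
      stays at most 2, whence the factor \<open>1 / 4\<close> in the constant.\<close>
    define n where "n = nat \<lceil>1 / \<bar>u\<bar>\<rceil>"
    have a: "0 < \<bar>u\<bar>" using False by simp
    have n1: "1 / \<bar>u\<bar> \<le> real n" unfolding n_def by linarith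
    have n2: "real n \<le> 1 / \<bar>u\<bar> + 1" unfolding n_def using a by (simp add: of_nat_nat)
    have "1 \<le> 1 / \<bar>u\<bar>" using a that by simp
    then have n3: "real n \<le> 2 / \<bar>u\<bar>" using n2 by linarith
    have n4: "1 \<le> real n * \<bar>u\<bar>" using n1 a by (simp add: pos_divide_le_eq)
    have n5: "real n * \<bar>u\<bar> \<le> 2" using n3 a by (simp add: pos_le_divide_eq)
    have "c \<le> gap (real n * \<bar>u\<bar>)" by (rule c1[OF n4])
    also have "\<dots> \<le> (real n)\<^sup>2 * gap \<bar>u\<bar>" by (rule gap_mult)
    finally have "c * u\<^sup>2 \<le> (real n)\<^sup>2 * gap \<bar>u\<bar> * u\<^sup>2" by (intro mult_right_mono) auto
    also have "\<dots> = (real n * \<bar>u\<bar>)\<^sup>2 * gap \<bar>u\<bar>" by (simp add: power_mult_distrib)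
    also have "\<dots> \<le> 2\<^sup>2 * gap \<bar>u\<bar>" using n5 by (intro mult_right_mono power_mono gap0) auto
    finally show ?thesis using gap_abs[of u] by simp
  qed (simp add: gap0)
  show ?thesis
  proof
    show "0 < c / 4" using c0 by simp
    show "c / 4 * u\<^sup>2 \<le> norm (\<eta> u)" if "\<bar>u\<bar> \<le> 1" for u using c2[OF that] gap_eta[of u] by linarith
    show "c / 4 \<le> norm (\<eta> u)" if "1 \<le> \<bar>u\<bar>" for u
      using c1[OF that] gap_eta[of u] gap_abs[of u] c0 by linarith
    show "\<eta> (-u) = cnj (\<eta> u)" for u
    proof -
      \<comment> \<open>Hermitian symmetry of \<open>\<eta>\<close> is read off the characteristic
        function \<open>1 / (1 - \<eta>)\<close>.\<close>
      have "char N (-u) = (\<integral>z. cnj (iexp (u * z)) \<partial>N)" unfolding char_def by (simp add: exp_cnj)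
      also have "\<dots> = cnj (char N u)" unfolding char_def by (rule Bochner_Integration.integral_cnj)
      finally have "1 / (1 - \<eta> (-u)) = cnj (1 / (1 - \<eta> u))" unfolding N(2) .
      then have "1 / (1 - \<eta> (-u)) = 1 / (1 - cnj (\<eta> u))" by simp
      then have "1 - \<eta> (-u) = 1 - cnj (\<eta> u)" by (metis div_by_1 divide_divide_eq_right mult_1)
      then show ?thesis by simp
    qed
  qed
qed

lemma eta_cnj: "\<eta> (-u) = cnj (\<eta> u)" using eta_lower by metis

lemma eta_nz: "u \<noteq> 0 \<Longrightarrow> \<eta> u \<noteq> 0"
proof -
  assume u: "u \<noteq> 0"
  obtain c where c: "0 < c" "\<And>u. \<bar>u\<bar> \<le> 1 \<Longrightarrow> c * u\<^sup>2 \<le> norm (\<eta> u)" "\<And>u. 1 \<le> \<bar>u\<bar> \<Longrightarrow> c \<le> norm (\<eta> u)"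
    using eta_lower by metis
  show "\<eta> u \<noteq> 0"
  proof (cases "\<bar>u\<bar> \<le> 1")
    case True
    have "0 < c * u\<^sup>2" using u c by simp
    then show ?thesis using c(2)[OF True] by auto
  next
    case False
    then show ?thesis using c(3)[of u] c(1) by auto
  qed
qed

text \<open>Near 0 the function \<open>1 / |\<eta>|\<close> can fail to be integrable, as for
  Brownian motion; beyond 1 it is integrable by (A). The cut keeps the good part.\<close>

definition inv_eta_tail :: "real \<Rightarrow> real" where
  "inv_eta_tail u = (if \<bar>u\<bar> \<le> 1 then 0 else 1 / norm (\<eta> u))"

lemma inv_eta_tail_meas[measurable]: "inv_eta_tail \<in> borel_measurable borel"
  unfolding inv_eta_tail_def by measurable

text \<open>Where \<open>|u| >= 1\<close>, the bound \<open>|\<eta> u| >= c\<close> makes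
  \<open>|1 - \<eta> u|\<close> at most a constant times \<open>|\<eta> u|\<close>, so (A) at
  \<open>q = 1\<close> supplies a majorant.\<close>

lemma inv_eta_tail_integrable: "integrable lborel inv_eta_tail"
proof -
  obtain c where c: "0 < c" "\<And>u. 1 \<le> \<bar>u\<bar> \<Longrightarrow> c \<le> norm (\<eta> u)"
    using eta_lower by metis
  show ?thesis
  proof (rule Bochner_Integration.integrable_bound)
    show "integrable lborel (\<lambda>u. (1 + 1/c) * norm (1 / (1 - \<eta> u)))"
      using A[of 1] by (intro integrable_mult_right integrable_norm) simp
    show "AE u in lborel. norm (inv_eta_tail u) \<le> norm ((1 + 1/c) * norm (1 / (1 - \<eta> u)))"
    proof (rule AE_I2)
      fix u
      show "norm (inv_eta_tail u) \<le> norm ((1 + 1/c) * norm (1 / (1 - \<eta> u)))"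
      proof (cases "\<bar>u\<bar> \<le> 1")
        case False
        then have e: "c \<le> norm (\<eta> u)" using c(2)[of u] by simp
        have "1 \<le> norm (1 - \<eta> u)" using norm_q_eta[of 1 u] by simp
        then have n1: "0 < norm (1 - \<eta> u)" by linarith
        have "norm (1 - \<eta> u) \<le> 1 + norm (\<eta> u)" using norm_triangle_ineq4[of 1 "\<eta> u"] by simp
        also have "1 \<le> norm (\<eta> u) / c" using e c(1) by simp
        finally have b: "norm (1 - \<eta> u) \<le> (1 + 1/c) * norm (\<eta> u)" by (simp add: distrib_right)
        have e0: "0 < norm (\<eta> u)" using e c(1) by linarith
        have "1 / norm (\<eta> u) \<le> (1 + 1/c) / norm (1 - \<eta> u)" using b e0 n1 by (simp add: field_simps)
        also have "\<dots> = (1 + 1/c) * norm (1 / (1 - \<eta> u))" by (simp add: norm_divide)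
        also have "\<dots> \<le> norm \<dots>" by simp
        finally show ?thesis using False e0 by (simp add: inv_eta_tail_def)
      qed (simp add: inv_eta_tail_def)
    qed
  qed measurable
qed

text \<open>Combines the bounds \<open>r\<close> and \<open>2 / |\<eta> u|\<close> for
  \<open>occ_char r u\<close>. The minimum is increasing in \<open>r\<close> and vanishes as
  \<open>r\<close> goes to 0, two features that pass on to \<open>occ_sup\<close>, the resulting
  bound for the density over all levels.\<close>

definition occ_dom :: "real \<Rightarrow> real \<Rightarrow> real" where
  "occ_dom r u = (if \<bar>u\<bar> \<le> 1 then r else min r (2 * inv_eta_tail u))"

lemma occ_dom_meas[measurable]: "occ_dom r \<in> borel_measurable borel"
  unfolding occ_dom_def by measurable

lemma inv_eta_tail_nonneg: "0 \<le> inv_eta_tail u" by (simp add: inv_eta_tail_def)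

lemma occ_dom_nonneg: "0 \<le> r \<Longrightarrow> 0 \<le> occ_dom r u"
  using inv_eta_tail_nonneg[of u] by (simp add: occ_dom_def)

lemma occ_dom_mono: "r \<le> t \<Longrightarrow> occ_dom r u \<le> occ_dom t u"
  by (simp add: occ_dom_def min.coboundedI1 min.coboundedI2)

lemma occ_dom_bound: "0 \<le> r \<Longrightarrow> norm (occ_char r u) \<le> occ_dom r u"
  using occ_char_norm[of r u] occ_char_norm2[of r u] eta_nz[of u]
  by (cases "\<bar>u\<bar> \<le> 1") (auto simp: occ_dom_def inv_eta_tail_def)

lemma occ_dom_le: "0 \<le> r \<Longrightarrow> occ_dom r u \<le> r * indicator {-1..1} u + 2 * inv_eta_tail u"
  by (cases "\<bar>u\<bar> \<le> 1") (auto simp: occ_dom_def inv_eta_tail_def indicator_def abs_le_iff)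

lemma occ_dom_integrable: "0 \<le> r \<Longrightarrow> integrable lborel (occ_dom r)"
proof (rule Bochner_Integration.integrable_bound)
  assume t: "0 \<le> r"
  show "integrable lborel (\<lambda>u. r * indicator {-1..1} u + 2 * inv_eta_tail u)"
    using inv_eta_tail_integrable by (intro Bochner_Integration.integrable_add integrable_mult_right) (simp_all add: emeasure_lborel_Icc_eq)
  show "AE u in lborel. norm (occ_dom r u) \<le> norm (r * indicator {-1..1} u + 2 * inv_eta_tail u)"
  proof (rule AE_I2)
    fix u show "norm (occ_dom r u) \<le> norm (r * indicator {-1..1} u + 2 * inv_eta_tail u)"
      using occ_dom_le[OF t, of u] occ_dom_nonneg[OF t, of u] by simp
  qed
qed measurable

lemma occ_char_integrable: "0 \<le> r \<Longrightarrow> integrable lborel (occ_char r)"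
proof (rule Bochner_Integration.integrable_bound[OF occ_dom_integrable])
  assume t: "0 \<le> r"
  show "AE u in lborel. norm (occ_char r u) \<le> norm (occ_dom r u)"
    using occ_dom_bound[OF t] occ_dom_nonneg[OF t] by simp
qed auto

definition occ_sup :: "real \<Rightarrow> real" where
  "occ_sup r = (\<integral>u. occ_dom r u \<partial>lborel) / (2*pi)"

lemma occ_le_sup: assumes "0 \<le> r" shows "\<bar>occ r z\<bar> \<le> occ_sup r"
proof -
  have "\<bar>occ r z\<bar> \<le> (\<integral>u. norm (occ_char r u) \<partial>lborel) / (2*pi)"
    unfolding occ_def by (rule finv_bound[OF occ_char_integrable[OF assms]])
  also have "\<dots> \<le> occ_sup r" unfolding occ_sup_def
    using occ_char_integrable[OF assms] occ_dom_integrable[OF assms] occ_dom_bound[OF assms]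
    by (intro divide_right_mono integral_mono) auto
  finally show ?thesis .
qed

lemma occ_sup_nonneg: "0 \<le> r \<Longrightarrow> 0 \<le> occ_sup r"
  using occ_le_sup[of r 0] by linarith

lemma occ_sup_mono: "0 \<le> r \<Longrightarrow> r \<le> t \<Longrightarrow> occ_sup r \<le> occ_sup t"
  unfolding occ_sup_def by (intro divide_right_mono integral_mono occ_dom_integrable occ_dom_mono) auto

lemma occ_sup_tendsto_0:
  assumes "X \<longlonglongrightarrow> 0" "\<And>n. 0 \<le> X n" "\<And>n. X n \<le> 1"
  shows "(\<lambda>n. occ_sup (X n)) \<longlonglongrightarrow> 0"
proof -
  have "(\<lambda>n. \<integral>u. occ_dom (X n) u \<partial>lborel) \<longlonglongrightarrow> (\<integral>u. 0 \<partial>(lborel :: real measure))"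
  proof (rule integral_dominated_convergence[where w="occ_dom 1"])
    show "AE u in lborel. (\<lambda>n. occ_dom (X n) u) \<longlonglongrightarrow> 0"
    proof (rule AE_I2, rule tendsto_sandwich[OF _ _ tendsto_const assms(1)])
      fix u show "\<forall>\<^sub>F n in sequentially. 0 \<le> occ_dom (X n) u" using occ_dom_nonneg[OF assms(2)] by simp
      show "\<forall>\<^sub>F n in sequentially. occ_dom (X n) u \<le> X n" by (simp add: occ_dom_def)
    qed
    show "AE u in lborel. norm (occ_dom (X n) u) \<le> occ_dom 1 u" for n
      using occ_dom_nonneg[OF assms(2)] occ_dom_mono[OF assms(3)] by simp
  qed (auto intro: occ_dom_integrable)
  then have "(\<lambda>n. (\<integral>u. occ_dom (X n) u \<partial>lborel) / (2*pi)) \<longlonglongrightarrow> 0 / (2*pi)" by (intro tendsto_intros) auto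
  then show ?thesis by (simp add: occ_sup_def)
qed

text \<open>The majorant \<open>occ_dom t\<close> serves for all \<open>r \<le> t\<close>, so the
  modulus of continuity is uniform in the duration as well as in the level.\<close>

lemma occ_equicont:
  assumes t: "0 \<le> t" and e: "0 < e"
  shows "\<exists>d>0. \<forall>r\<in>{0..t}. \<forall>z w. \<bar>z - w\<bar> < d \<longrightarrow> \<bar>occ r z - occ r w\<bar> < e"
proof -
  let ?I = "\<lambda>d::real. (\<integral>u. norm (iexp (u*d) - 1) * occ_dom t u \<partial>lborel)"
  have "(?I \<longlongrightarrow> 0) (at 0)"
    by (rule tendsto_integral_iexp_minus_1[OF occ_dom_integrable[OF t] occ_dom_nonneg[OF t]])
  moreover have "0 < e * (2*pi)" using e by simp
  ultimately have "\<forall>\<^sub>F d in at 0. ?I d < e * (2*pi)" by (rule order_tendstoD)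
  then obtain d where d: "d > 0" "\<And>x. x \<noteq> 0 \<Longrightarrow> \<bar>x\<bar> < d \<Longrightarrow> ?I x < e * (2*pi)"
    unfolding eventually_at dist_real_def by auto
  have "\<bar>occ r z - occ r w\<bar> < e" if "r \<in> {0..t}" "\<bar>z - w\<bar> < d" for r z w
  proof (cases "z = w")
    case False
    have r: "0 \<le> r" using that by simp
    have i: "integrable lborel (\<lambda>u. norm (iexp (u*(z-w)) - 1) * f u)" if f: "integrable lborel f" for f :: "real \<Rightarrow> real"
    proof (rule Bochner_Integration.integrable_bound)
      show "integrable lborel (\<lambda>u. 2 * f u)" using f by simp
      have [measurable]: "f \<in> borel_measurable borel" using borel_measurable_integrable[OF f] by simp
      show "(\<lambda>u. norm (iexp (u*(z-w)) - 1) * f u) \<in> borel_measurable lborel" by measurable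
      show "AE u in lborel. norm (norm (iexp (u*(z-w)) - 1) * f u) \<le> norm (2 * f u)"
      proof (rule AE_I2)
        fix u
        have "norm (iexp (u*(z-w)) - 1) \<le> 2" using norm_triangle_ineq4[of "iexp (u*(z-w))" 1] by simp
        then have "norm (iexp (u*(z-w)) - 1) * \<bar>f u\<bar> \<le> 2 * \<bar>f u\<bar>" by (rule mult_right_mono) simp
        then show "norm (norm (iexp (u*(z-w)) - 1) * f u) \<le> norm (2 * f u)" by (simp only: real_norm_def abs_mult abs_norm_cancel abs_numeral)
      qed
    qed
    have "\<bar>occ r z - occ r w\<bar> \<le> (\<integral>u. norm (iexp (u*(z-w)) - 1) * norm (occ_char r u) \<partial>lborel) / (2*pi)"
      unfolding occ_def by (rule finv_diff_bound[OF occ_char_integrable[OF r]])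
    also have "\<dots> \<le> ?I (z - w) / (2*pi)"
    proof (intro divide_right_mono integral_mono i integrable_norm occ_char_integrable[OF r] occ_dom_integrable[OF t] mult_left_mono)
      show "norm (occ_char r u) \<le> occ_dom t u" for u
        using occ_dom_bound[OF r, of u] occ_dom_mono[of r t u] that by simp
    qed auto
    also have "\<dots> < e" using d(2)[of "z - w"] False that by (simp add: pos_divide_less_eq)
    finally show ?thesis .
  qed (use e in simp)
  then show ?thesis using d(1) by blast
qed

lemma occ_cont: "0 \<le> r \<Longrightarrow> isCont (occ r) z"
  using continuous_finv[OF occ_char_integrable[of r]] unfolding occ_def by (simp add: continuous_on_eq_continuous_at)

lemma occ_meas: "0 \<le> r \<Longrightarrow> occ r \<in> borel_measurable borel"
  using measurable_finv[OF occ_char_integrable[of r]] unfolding occ_def by simp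

lemma occ_0: "occ 0 z = 0"
proof -
  have "occ_dom 0 u = 0" for u using inv_eta_tail_nonneg[of u] by (simp add: occ_dom_def)
  then show ?thesis using occ_le_sup[of 0 z] by (simp add: occ_sup_def)
qed

text \<open>\<open>occ_char r\<close> divided by \<open>r\<close> is the characteristic function at
  a uniform time in \<open>{0..r}\<close>; undoing the factor \<open>1 / r\<close> gives the density
  of the occupation measure.\<close>

lemma
  assumes r: "0 < r"
  shows occ_nonneg': "0 \<le> occ r z"
    and occ_density': "f \<in> borel_measurable borel \<Longrightarrow> (\<integral>\<^sup>+s. indicator {0..r} s * (\<integral>\<^sup>+w. f (Z (max 0 s) w) \<partial>M) \<partial>lborel) = (\<integral>\<^sup>+z. ennreal (occ r z) * f z \<partial>lborel)"
proof -
  define g :: "real \<Rightarrow> real" where "g s = 1 / r * indicator {0..r} s" for s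
  have g[measurable]: "g \<in> borel_measurable borel" unfolding g_def by measurable
  have g0: "0 \<le> g s" for s using r by (simp add: g_def)
  have g1: "s < 0 \<Longrightarrow> g s = 0" for s by (simp add: g_def)
  have eg: "ennreal (g s) = ennreal (1/r) * indicator {0..r} s" for s
    unfolding g_def by (simp add: indicator_def)
  have gp: "prob_space (density lborel (\<lambda>s. ennreal (g s)))"
  proof
    have "emeasure (density lborel (\<lambda>s. ennreal (g s))) UNIV = (\<integral>\<^sup>+s. ennreal (1/r) * indicator {0..r} s \<partial>lborel)"
      by (subst emeasure_density) (auto simp: eg)
    also have "\<dots> = ennreal (1/r) * ennreal r" using r by (subst nn_integral_cmult_indicator) auto
    also have "\<dots> = 1" using r by (simp add: ennreal_mult[symmetric])
    finally show "emeasure (density lborel (\<lambda>s. ennreal (g s))) (space (density lborel (\<lambda>s. ennreal (g s)))) = 1" by simp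
  qed
  have \<phi>: "(\<integral>s. g s *\<^sub>R exp (of_real s * \<eta> u) \<partial>lborel) = of_real (1/r) * occ_char r u" for u
  proof -
    have "(\<integral>s. g s *\<^sub>R exp (of_real s * \<eta> u) \<partial>lborel) = (\<integral>s. of_real (1/r) * (indicator {0..r} s *\<^sub>R exp (of_real s * \<eta> u)) \<partial>lborel)"
      by (intro Bochner_Integration.integral_cong refl) (simp add: g_def scaleR_conv_of_real)
    also have "\<dots> = of_real (1/r) * occ_char r u" unfolding occ_char_def by (rule integral_mult_right_zero)
    finally show ?thesis .
  qed
  have int: "integrable lborel (\<lambda>u. of_real (1/r) * occ_char r u)"
    using occ_char_integrable[of r] r by (intro integrable_mult_right) simp
  have fe: "finv (\<lambda>u. of_real (1/r) * occ_char r u) z = 1 / r * occ r z" for z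
    unfolding occ_def by (rule finv_cmult)
  have on: "0 \<le> occ r z" for z using time_mix_density(1)[OF g g0 g1 gp \<phi> int, of z] r unfolding fe by (simp add: zero_le_divide_iff)
  then show "0 \<le> occ r z" .
  assume f[measurable]: "f \<in> borel_measurable borel"
  have [measurable]: "occ r \<in> borel_measurable borel" using occ_meas r by simp
  have m[measurable]: "(\<lambda>s. \<integral>\<^sup>+w. f (Z (max 0 s) w) \<partial>M) \<in> borel_measurable borel"
    using borel_measurable_nn_integral_fst[of "\<lambda>p. f (case p of (s,w) \<Rightarrow> Z (max 0 s) w)" borel] by simp
  have "ennreal (1/r) * (\<integral>\<^sup>+s. indicator {0..r} s * (\<integral>\<^sup>+w. f (Z (max 0 s) w) \<partial>M) \<partial>lborel) =
     (\<integral>\<^sup>+s. g s * (\<integral>\<^sup>+w. f (Z (max 0 s) w) \<partial>M) \<partial>lborel)"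
    by (subst nn_integral_cmult[symmetric]) (simp_all add: eg mult.assoc)
  also have "\<dots> = (\<integral>\<^sup>+z. ennreal (1/r * occ r z) * f z \<partial>lborel)"
    using time_mix_density(2)[OF g g0 g1 gp \<phi> int f] unfolding fe .
  also have "\<dots> = (\<integral>\<^sup>+z. ennreal (1/r) * (ennreal (occ r z) * f z) \<partial>lborel)"
  proof (rule nn_integral_cong)
    fix z
    have "ennreal (1/r * occ r z) = ennreal (1/r) * ennreal (occ r z)" using r on by (intro ennreal_mult) auto
    then show "ennreal (1/r * occ r z) * f z = ennreal (1/r) * (ennreal (occ r z) * f z)" by (simp only: mult.assoc)
  qed
  also have "\<dots> = ennreal (1/r) * (\<integral>\<^sup>+z. ennreal (occ r z) * f z \<partial>lborel)"
    by (rule nn_integral_cmult) measurable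
  finally show "(\<integral>\<^sup>+s. indicator {0..r} s * (\<integral>\<^sup>+w. f (Z (max 0 s) w) \<partial>M) \<partial>lborel) = (\<integral>\<^sup>+z. ennreal (occ r z) * f z \<partial>lborel)"
    using r by (subst (asm) ennreal_mult_cancel_left) auto
qed

lemma occ_nonneg: "0 \<le> r \<Longrightarrow> 0 \<le> occ r z"
  using occ_nonneg'[of r z] occ_0 by (cases "r = 0") auto

end

section \<open>The maximum principle for the resolvent density\<close>

lemma one_minus_cos_le: "1 - cos x \<le> x\<^sup>2 / 2" for x :: real
proof -
  have "1 - cos x = 2 * (sin (x/2))\<^sup>2" using cos_double_sin[of "x/2"] by simp
  also have "(sin (x/2))\<^sup>2 \<le> (x/2)\<^sup>2" by (intro abs_le_square_iff[THEN iffD1] abs_sin_x_le_abs_x)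
  finally show ?thesis by (simp add: power_divide)
qed

lemma one_minus_cos_add_le: "1 - cos (x + y) \<le> 2 * (1 - cos x) + 2 * (1 - cos y)" for x y :: real
proof -
  have c: "1 - cos z = 2 * (sin (z/2))\<^sup>2" for z :: real using cos_double_sin[of "z/2"] by simp
  have "\<bar>sin ((x+y)/2)\<bar> = \<bar>sin (x/2) * cos (y/2) + cos (x/2) * sin (y/2)\<bar>"
    by (simp only: add_divide_distrib sin_add)
  also have "\<dots> \<le> \<bar>sin (x/2)\<bar> * \<bar>cos (y/2)\<bar> + \<bar>cos (x/2)\<bar> * \<bar>sin (y/2)\<bar>"
    by (rule order_trans[OF abs_triangle_ineq]) (simp add: abs_mult)
  also have "\<dots> \<le> \<bar>sin (x/2)\<bar> * 1 + 1 * \<bar>sin (y/2)\<bar>"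
    by (intro add_mono mult_left_mono mult_right_mono abs_cos_le_one) auto
  finally have a: "\<bar>sin ((x+y)/2)\<bar> \<le> \<bar>sin (x/2)\<bar> + \<bar>sin (y/2)\<bar>" by simp
  have "(sin ((x+y)/2))\<^sup>2 \<le> (\<bar>sin (x/2)\<bar> + \<bar>sin (y/2)\<bar>)\<^sup>2"
    using power_mono[OF a, of 2] by simp
  also have "\<dots> \<le> 2 * (sin (x/2))\<^sup>2 + 2 * (sin (y/2))\<^sup>2"
    using sum_squares_bound[of "\<bar>sin (x/2)\<bar>" "\<bar>sin (y/2)\<bar>"] by (simp add: power2_sum)
  finally show ?thesis unfolding c by simp
qed

context levy0 begin

lemma incr_nn:
  assumes s: "0 \<le> s" and u: "0 \<le> u" and g[measurable]: "g \<in> borel_measurable (Fil s \<Otimes>\<^sub>M borel)"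
  shows "(\<integral>\<^sup>+w. g (w, Z (s + u) w - Z s w) \<partial>M) = (\<integral>\<^sup>+w. (\<integral>\<^sup>+w'. g (w, Z u w') \<partial>M) \<partial>M)"
proof -
  have [measurable]: "(\<lambda>p. p u) \<in> borel_measurable PS" using u by (intro measurable_component_singleton) auto
  have pu: "path s w u = Z (s + u) w - Z s w" for s w using u by (simp add: path_def)
  have "(\<integral>\<^sup>+w. g (w, Z (s + u) w - Z s w) \<partial>M) = (\<integral>\<^sup>+w. (\<lambda>(w,p). g (w, p u)) (w, path s w) \<partial>M)"
    by (simp add: pu)
  also have "\<dots> = (\<integral>\<^sup>+w. (\<integral>\<^sup>+w'. (\<lambda>(w,p). g (w, p u)) (w, path 0 w') \<partial>M) \<partial>M)"
    by (rule markov_nn[OF s]) measurable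
  also have "\<dots> = (\<integral>\<^sup>+w. (\<integral>\<^sup>+w'. g (w, Z u w') \<partial>M) \<partial>M)"
  proof (rule nn_integral_cong)
    fix w
    have "AE w' in M. (\<lambda>(w,p). g (w, p u)) (w, path 0 w') = g (w, Z u w')"
      using Z_0 by eventually_elim (simp add: pu)
    then show "(\<integral>\<^sup>+w'. (\<lambda>(w,p). g (w, p u)) (w, path 0 w') \<partial>M) = (\<integral>\<^sup>+w'. g (w, Z u w') \<partial>M)"
      by (rule nn_integral_cong_AE)
  qed
  finally show ?thesis .
qed

lemma Z_Fil_self: "0 \<le> s \<Longrightarrow> Z s \<in> borel_measurable (Fil s)" by (rule Z_Fil) auto

lemma semigroup_nn:
  assumes s: "0 \<le> s" and u: "0 \<le> u" and f[measurable]: "f \<in> borel_measurable borel"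
  shows "(\<integral>\<^sup>+w. f (Z (s + u) w) \<partial>M) = (\<integral>\<^sup>+w. (\<integral>\<^sup>+w'. f (Z s w + Z u w') \<partial>M) \<partial>M)"
proof -
  note [measurable] = Z_Fil_self[OF s]
  have "(\<integral>\<^sup>+w. (\<lambda>(w,z). f (Z s w + z)) (w, Z (s + u) w - Z s w) \<partial>M) = (\<integral>\<^sup>+w. (\<integral>\<^sup>+w'. (\<lambda>(w,z). f (Z s w + z)) (w, Z u w') \<partial>M) \<partial>M)"
    by (rule incr_nn[OF s u]) measurable
  then show ?thesis by simp
qed

text \<open>Right-continuity at 0 gives convergence to the starting point in probability.\<close>

lemma prob_small_time:
  assumes "0 < \<epsilon>" "0 < e"
  obtains d where "0 < d" "\<And>s. 0 \<le> s \<Longrightarrow> s < d \<Longrightarrow> prob {v\<in>space M. \<epsilon> \<le> \<bar>Z s v\<bar>} \<le> e"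
proof -
  have "((\<lambda>s. prob {v\<in>space M. \<epsilon> \<le> \<bar>Z s v\<bar>}) \<longlongrightarrow> 0) (at_right 0)"
  proof (rule tendsto_at_right_sequentially[of 0 1])
    fix X :: "nat \<Rightarrow> real" assume X: "\<And>n. 0 < X n" "\<And>n. X n < 1" "decseq X" "X \<longlonglongrightarrow> 0"
    have "(\<lambda>n. \<integral>v. indicator {z. \<epsilon> \<le> \<bar>z\<bar>} (Z (X n) v) \<partial>M) \<longlonglongrightarrow> (\<integral>v. (0::real) \<partial>M)"
    proof (rule integral_dominated_convergence[where w="\<lambda>_. 1"])
      show "(\<lambda>v. indicator {z. \<epsilon> \<le> \<bar>z\<bar>} (Z (X n) v) :: real) \<in> borel_measurable M" for n
        using Z_meas[of "X n"] X(1)[of n] by simp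
      have "AE v in M. Z 0 v = 0 \<and> v \<in> space M" using Z_0 by simp
      then show "AE v in M. (\<lambda>n. indicator {z. \<epsilon> \<le> \<bar>z\<bar>} (Z (X n) v) :: real) \<longlonglongrightarrow> 0"
      proof eventually_elim
        case (elim v)
        have "(\<lambda>n. Z (X n) v) \<longlonglongrightarrow> Z 0 v"
          by (rule tendsto_right_seq[where f="\<lambda>s. Z s v"]) (use elim X Z_right[of v 0] less_imp_le in auto)
        then have "(\<lambda>n. \<bar>Z (X n) v\<bar>) \<longlonglongrightarrow> 0" using elim by (simp add: tendsto_rabs_zero)
        from order_tendstoD(2)[OF this assms(1)]
        have "eventually (\<lambda>n. indicator {z. \<epsilon> \<le> \<bar>z\<bar>} (Z (X n) v) = (0::real)) sequentially"
          by eventually_elim (simp add: indicator_def)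
        then show ?case by (rule tendsto_eventually)
      qed
    qed (auto simp: indicator_def)
    moreover have "(\<integral>v. indicator {z. \<epsilon> \<le> \<bar>z\<bar>} (Z (X n) v) \<partial>M) = prob {v\<in>space M. \<epsilon> \<le> \<bar>Z (X n) v\<bar>}" for n
    proof -
      have "(\<integral>v. indicator {z. \<epsilon> \<le> \<bar>z\<bar>} (Z (X n) v) \<partial>M) = (\<integral>v. indicator {v\<in>space M. \<epsilon> \<le> \<bar>Z (X n) v\<bar>} v \<partial>M)"
        by (intro Bochner_Integration.integral_cong refl) (auto simp: indicator_def)
      also have "\<dots> = prob {v\<in>space M. \<epsilon> \<le> \<bar>Z (X n) v\<bar>}"
        by (simp add: Int_def) (rule arg_cong[where f=prob], auto)
      finally show ?thesis .
    qed
    ultimately show "(\<lambda>n. prob {v\<in>space M. \<epsilon> \<le> \<bar>Z (X n) v\<bar>}) \<longlonglongrightarrow> 0" by simp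
  qed simp
  then have "\<forall>\<^sub>F s in at_right 0. prob {v\<in>space M. \<epsilon> \<le> \<bar>Z s v\<bar>} < e" using assms(2) by (rule order_tendstoD)
  then obtain d where d: "0 < d" "\<And>s. 0 < s \<Longrightarrow> s < d \<Longrightarrow> prob {v\<in>space M. \<epsilon> \<le> \<bar>Z s v\<bar>} < e"
    unfolding eventually_at_right_field by auto
  have "prob {v\<in>space M. \<epsilon> \<le> \<bar>Z 0 v\<bar>} = 0"
    using Z_0 assms(1) Z_meas[of 0] by (subst prob_eq_0) (auto elim: eventually_mono)
  then have "prob {v\<in>space M. \<epsilon> \<le> \<bar>Z s v\<bar>} \<le> e" if "0 \<le> s" "s < d" for s
    using d(2)[of s] that assms(2) by (cases "s = 0") auto
  with d(1) show ?thesis by (rule that)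
qed

end

context levy_sym begin

lemma res_cont: "0 < q \<Longrightarrow> isCont (res q) z"
  using continuous_finv[OF A[of q]] unfolding res_def by (simp add: continuous_on_eq_continuous_at)

lemma res_meas: "0 < q \<Longrightarrow> res q \<in> borel_measurable borel"
  using measurable_finv[OF A[of q]] unfolding res_def by simp

lemma res_total: assumes q: "0 < q" shows "(\<integral>\<^sup>+z. ennreal (q * res q z) \<partial>lborel) = 1"
proof -
  have "(\<integral>\<^sup>+z. ennreal (q * res q z) * 1 \<partial>lborel) = (\<integral>\<^sup>+s. exponential_density q s * (\<integral>\<^sup>+w. 1 \<partial>M) \<partial>lborel)"
    by (rule res_density[OF q, symmetric]) simp
  also have "\<dots> = (\<integral>\<^sup>+s. ennreal (exponential_density q s) \<partial>lborel)" by (simp add: emeasure_space_1)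
  also have "\<dots> = emeasure (density lborel (\<lambda>s. ennreal (exponential_density q s))) UNIV"
    by (subst emeasure_density) auto
  also have "\<dots> = 1" using prob_space.emeasure_space_1[OF prob_space_exponential_density[OF q]] by simp
  finally show ?thesis by simp
qed

text \<open>Splits the exponential time at \<open>t\<close>. Before \<open>t\<close> its density is
  at most \<open>q\<close> and the mean of \<open>f\<close> at most \<open>\<rho>\<close>; after
  \<open>t\<close> it is memoryless with weight \<open>exp (-q * t)\<close>, and by the semigroup
  property the rest is an average of potentials, each at most \<open>S\<close>.\<close>

lemma res_max_step:
  assumes q: "0 < q" and t: "0 \<le> t" and f[measurable]: "f \<in> borel_measurable borel" and S: "\<And>x. (\<integral>\<^sup>+z. ennreal (q * res q z) * f (x + z) \<partial>lborel) \<le> S"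
    and \<rho>: "\<And>s. 0 \<le> s \<Longrightarrow> s \<le> t \<Longrightarrow> (\<integral>\<^sup>+w. f (x + Z s w) \<partial>M) \<le> \<rho>"
  shows "(\<integral>\<^sup>+z. ennreal (q * res q z) * f (x + z) \<partial>lborel) \<le> ennreal (q * t) * \<rho> + ennreal (exp (-q*t)) * S"
proof -
  let ?e = "\<lambda>s. ennreal (exponential_density q s)"
  define Pf where "Pf s x = (\<integral>\<^sup>+w. f (x + Z (max 0 s) w) \<partial>M)" for s x
  have Pf_meas[measurable]: "(\<lambda>(x, s). Pf s x) \<in> borel_measurable (borel \<Otimes>\<^sub>M borel)"
  proof -
    have "(\<lambda>((x, s), w). f (x + Z (max 0 s) w)) \<in> borel_measurable ((borel \<Otimes>\<^sub>M borel) \<Otimes>\<^sub>M M)"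
    proof -
      have "(\<lambda>p. (\<lambda>(s,w). Z (max 0 s) w) (snd (fst p), snd p)) \<in> borel_measurable ((borel \<Otimes>\<^sub>M borel) \<Otimes>\<^sub>M M)"
        by (rule measurable_compose[OF _ joint_meas]) measurable
      then have [measurable]: "(\<lambda>p. Z (max 0 (snd (fst p))) (snd p)) \<in> borel_measurable ((borel \<Otimes>\<^sub>M borel) \<Otimes>\<^sub>M M)" by simp
      show ?thesis unfolding case_prod_beta by measurable
    qed
    from borel_measurable_nn_integral_fst[OF this] show ?thesis
      unfolding Pf_def by (simp add: case_prod_beta)
  qed
  have V: "(\<integral>\<^sup>+z. ennreal (q * res q z) * f (x + z) \<partial>lborel) = (\<integral>\<^sup>+s. ?e s * Pf s x \<partial>lborel)" for x
    unfolding Pf_def using res_density[OF q, of "\<lambda>z. f (x + z)"] by simp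
  have Pm[measurable]: "(\<lambda>s. Pf s x) \<in> borel_measurable borel" for x
    using measurable_compose[OF _ Pf_meas, of "\<lambda>s. (x, s)" borel] by simp
  have split: "?e s * Pf s x = ?e s * Pf s x * indicator {..<t} s + ?e s * Pf s x * indicator {t..} s" for s
    by (auto simp: indicator_def)
  have "(\<integral>\<^sup>+s. ?e s * Pf s x \<partial>lborel) = (\<integral>\<^sup>+s. ?e s * Pf s x * indicator {..<t} s \<partial>lborel) + (\<integral>\<^sup>+s. ?e s * Pf s x * indicator {t..} s \<partial>lborel)"
    by (subst split, rule nn_integral_add) measurable
  moreover have "(\<integral>\<^sup>+s. ?e s * Pf s x * indicator {..<t} s \<partial>lborel) \<le> ennreal (q * t) * \<rho>"
  proof -
    have "(\<integral>\<^sup>+s. ?e s * Pf s x * indicator {..<t} s \<partial>lborel) \<le> (\<integral>\<^sup>+s. ennreal q * \<rho> * indicator {0..t} s \<partial>lborel)"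
    proof (rule nn_integral_mono)
      fix s
      show "?e s * Pf s x * indicator {..<t} s \<le> ennreal q * \<rho> * indicator {0..t} s"
      proof (cases "0 \<le> s \<and> s < t")
        case True
        have "exponential_density q s \<le> q" using True q by (simp add: exponential_density_def)
        moreover have "Pf s x \<le> \<rho>" unfolding Pf_def using \<rho>[of s] True by (simp add: max_absorb2)
        ultimately have "?e s * Pf s x \<le> ennreal q * \<rho>" by (intro mult_mono ennreal_leI) auto
        then show ?thesis using True by simp
      next
        case False then show ?thesis by (auto simp: exponential_density_def indicator_def)
      qed
    qed
    also have "\<dots> = ennreal q * \<rho> * ennreal t" using t by (subst nn_integral_cmult_indicator) auto
    also have "\<dots> = ennreal (q * t) * \<rho>" using q t by (simp add: ennreal_mult mult.commute mult.left_commute)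
    finally show ?thesis .
  qed
  moreover have "(\<integral>\<^sup>+s. ?e s * Pf s x * indicator {t..} s \<partial>lborel) \<le> ennreal (exp (-q*t)) * S"
  proof -
    have "(\<integral>\<^sup>+s. ?e s * Pf s x * indicator {t..} s \<partial>lborel) = (\<integral>\<^sup>+s. ?e (t + 1 * s) * Pf (t + 1 * s) x * indicator {t..} (t + 1 * s) \<partial>lborel)"
      by (subst nn_integral_real_affine[where c=1 and t=t]) auto
    also have "\<dots> = (\<integral>\<^sup>+s. ennreal (exp (-q*t)) * (?e s * (\<integral>\<^sup>+w. Pf s (x + Z t w) \<partial>M)) \<partial>lborel)"
    proof (rule nn_integral_cong)
      fix s :: real
      show "?e (t + 1 * s) * Pf (t + 1 * s) x * indicator {t..} (t + 1 * s) = ennreal (exp (-q*t)) * (?e s * (\<integral>\<^sup>+w. Pf s (x + Z t w) \<partial>M))"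
      proof (cases "0 \<le> s")
        case True
        have "exponential_density q (t + s) = exp (-q*t) * exponential_density q s"
          using True t by (simp add: exponential_density_def exp_add[symmetric] algebra_simps)
        then have e: "?e (t + s) = ennreal (exp (-q*t)) * ?e s"
          using exponential_density_nonneg[OF q, of s] by (simp add: ennreal_mult)
        have "Pf (t + s) x = (\<integral>\<^sup>+w. Pf s (x + Z t w) \<partial>M)"
          unfolding Pf_def using semigroup_nn[OF t True, of "\<lambda>z. f (x + z)"] True t by (simp add: max_absorb2 add.assoc)
        then show ?thesis using True e by (simp add: mult.assoc)
      qed (simp add: exponential_density_def)
    qed
    also have "\<dots> = ennreal (exp (-q*t)) * (\<integral>\<^sup>+s. (\<integral>\<^sup>+w. ?e s * Pf s (x + Z t w) \<partial>M) \<partial>lborel)"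
    proof -
      have [measurable]: "Z t \<in> borel_measurable M" using t by simp
      have m1[measurable]: "(\<lambda>(s,w). Pf s (x + Z t w)) \<in> borel_measurable (borel \<Otimes>\<^sub>M M)"
        using measurable_compose[OF _ Pf_meas, of "\<lambda>p. (x + Z t (snd p), fst p)" "borel \<Otimes>\<^sub>M M"] by (simp add: case_prod_beta)
      have [measurable]: "(\<lambda>s. \<integral>\<^sup>+w. Pf s (x + Z t w) \<partial>M) \<in> borel_measurable borel"
        using borel_measurable_nn_integral_fst[OF m1] by simp
      have "(\<lambda>w. Pf s (x + Z t w)) \<in> borel_measurable M" for s
        using measurable_compose[OF _ m1, of "\<lambda>w. (s, w)" M] by simp
      then have "?e s * (\<integral>\<^sup>+w. Pf s (x + Z t w) \<partial>M) = (\<integral>\<^sup>+w. ?e s * Pf s (x + Z t w) \<partial>M)" for s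
        by (rule nn_integral_cmult[symmetric])
      then show ?thesis by (subst nn_integral_cmult) simp_all
    qed
    also have "(\<integral>\<^sup>+s. (\<integral>\<^sup>+w. ?e s * Pf s (x + Z t w) \<partial>M) \<partial>lborel) = (\<integral>\<^sup>+w. (\<integral>\<^sup>+s. ?e s * Pf s (x + Z t w) \<partial>lborel) \<partial>M)"
    proof -
      interpret LM: pair_sigma_finite lborel M ..
      have [measurable]: "Z t \<in> borel_measurable M" using t by simp
      have [measurable]: "(\<lambda>p. Pf (fst p) (x + Z t (snd p))) \<in> borel_measurable (borel \<Otimes>\<^sub>M M)"
        using measurable_compose[OF _ Pf_meas, of "\<lambda>p. (x + Z t (snd p), fst p)" "borel \<Otimes>\<^sub>M M"] by simp
      have "(\<lambda>(s,w). ?e s * Pf s (x + Z t w)) \<in> borel_measurable (borel \<Otimes>\<^sub>M M)"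
        unfolding case_prod_beta by measurable
      then have "(\<lambda>(s,w). ?e s * Pf s (x + Z t w)) \<in> borel_measurable (lborel \<Otimes>\<^sub>M M)"
        by (simp cong: measurable_cong_sets sets_pair_measure_cong)
      from LM.Fubini'[OF this] show ?thesis by simp
    qed
    also have "\<dots> \<le> (\<integral>\<^sup>+w. S \<partial>M)" unfolding V[symmetric] by (intro nn_integral_mono S)
    also have "\<dots> = S" by (simp add: emeasure_space_1)
    finally show ?thesis by (simp add: mult_left_mono)
  qed
  ultimately show ?thesis unfolding V by (simp add: add_mono)
qed

text \<open>If the density were larger near some \<open>w \<noteq> 0\<close> than at 0, the potential of a small window would be nearly
  maximal at a point away from that window; in a short time the process hardly reaches the window from there, which contradicts
  the previous lemma.\<close>

lemma res_le_0: assumes q: "0 < q" shows "res q w \<le> res q 0"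
proof (rule ccontr)
  assume "\<not> res q w \<le> res q 0"
  define g where "g = res q w - res q 0"
  have g: "0 < g" using \<open>\<not> res q w \<le> res q 0\<close> by (simp add: g_def)
  obtain d1 where d1: "0 < d1" "\<And>z. \<bar>z - w\<bar> < d1 \<Longrightarrow> \<bar>res q z - res q w\<bar> < g/3"
    using res_cont[OF q, of w] g unfolding continuous_at_eps_delta dist_real_def by (elim allE[of _ "g/3"]) auto
  obtain d2 where d2: "0 < d2" "\<And>z. \<bar>z\<bar> < d2 \<Longrightarrow> \<bar>res q z - res q 0\<bar> < g/3"
    using res_cont[OF q, of 0] g unfolding continuous_at_eps_delta dist_real_def by (elim allE[of _ "g/3"]) auto
  \<comment> \<open>Small enough that for \<open>|x| < 2 * \<epsilon>\<close> the shifted window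
    lies within \<open>3 * \<epsilon>\<close> of 0, where the density is below
    \<open>res q 0 + g / 3\<close>; for the other \<open>x\<close> the distance to the window is at
    least \<open>\<epsilon>\<close>.\<close>
  define \<epsilon> where "\<epsilon> = min d1 (d2/4)"
  have \<epsilon>: "0 < \<epsilon>" "\<epsilon> \<le> d1" "4 * \<epsilon> \<le> d2" using d1 d2 by (auto simp: \<epsilon>_def)
  define f :: "real \<Rightarrow> ennreal" where "f = indicator {-\<epsilon><..<\<epsilon>}"
  have f[measurable]: "f \<in> borel_measurable borel" by (simp add: f_def)
  note [measurable] = res_meas[OF q]
  define V where "V x = (\<integral>\<^sup>+z. ennreal (q * res q z) * f (x + z) \<partial>lborel)" for x
  define b where "b = q * (res q 0 + g/3) * (2*\<epsilon>)"
  have r0: "0 \<le> res q z" for z by (rule res_nonneg[OF q])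
  have b0: "0 < b" unfolding b_def using q \<epsilon> g r0[of 0] by (intro mult_pos_pos add_nonneg_pos) auto
  have Vle: "V x \<le> ennreal b" if "\<bar>x\<bar> < 2*\<epsilon>" for x
  proof -
    have "V x \<le> (\<integral>\<^sup>+z. ennreal (q * (res q 0 + g/3)) * indicator {-\<epsilon>-x<..<\<epsilon>-x} z \<partial>lborel)"
      unfolding V_def
    proof (rule nn_integral_mono)
      fix z
      show "ennreal (q * res q z) * f (x + z) \<le> ennreal (q * (res q 0 + g/3)) * indicator {-\<epsilon>-x<..<\<epsilon>-x} z"
      proof (cases "z \<in> {-\<epsilon>-x<..<\<epsilon>-x}")
        case True
        then have "\<bar>z\<bar> < d2" using that \<epsilon> by (simp add: abs_less_iff)
        then have "res q z \<le> res q 0 + g/3" using d2(2)[of z] unfolding abs_less_iff by linarith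
        then have "q * res q z \<le> q * (res q 0 + g/3)" using q by (intro mult_left_mono) auto
        then have "ennreal (q * res q z) \<le> ennreal (q * (res q 0 + g/3))" by (rule ennreal_leI)
        then show ?thesis using True by (simp add: f_def)
      next
        case False then show ?thesis by (auto simp: f_def indicator_def)
      qed
    qed
    also have "\<dots> = ennreal (q * (res q 0 + g/3)) * ennreal (2*\<epsilon>)" using \<epsilon> by (subst nn_integral_cmult_indicator) auto
    also have "\<dots> = ennreal b" unfolding b_def using q g r0[of 0] \<epsilon> by (subst ennreal_mult) auto
    finally show ?thesis .
  qed
  \<comment> \<open>Seen from \<open>-w\<close>, the window corresponds to displacements near
    \<open>w\<close>, where the density is at least \<open>res q 0 + 2 * g / 3\<close>; so the
    supremum \<open>S\<close> of the potential is above \<open>b\<close>.\<close>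
  have Vw: "ennreal (q * (res q 0 + 2*g/3) * (2*\<epsilon>)) \<le> V (-w)"
  proof -
    have "ennreal (q * (res q 0 + 2*g/3) * (2*\<epsilon>)) = ennreal (q * (res q 0 + 2*g/3)) * ennreal (2*\<epsilon>)"
      using q g r0[of 0] \<epsilon> by (subst ennreal_mult) auto
    also have "\<dots> = (\<integral>\<^sup>+z. ennreal (q * (res q 0 + 2*g/3)) * indicator {w-\<epsilon><..<w+\<epsilon>} z \<partial>lborel)"
      using \<epsilon> by (subst nn_integral_cmult_indicator) auto
    also have "\<dots> \<le> V (-w)"
      unfolding V_def
    proof (rule nn_integral_mono)
      fix z
      show "ennreal (q * (res q 0 + 2*g/3)) * indicator {w-\<epsilon><..<w+\<epsilon>} z \<le> ennreal (q * res q z) * f (-w + z)"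
      proof (cases "z \<in> {w-\<epsilon><..<w+\<epsilon>}")
        case True
        then have "\<bar>z - w\<bar> < d1" using \<epsilon> by (simp add: abs_less_iff)
        from d1(2)[OF this] have "res q w - g/3 \<le> res q z" unfolding abs_less_iff by linarith
        moreover have "res q w = res q 0 + g" by (simp add: g_def)
        ultimately have "res q 0 + 2*g/3 \<le> res q z" by linarith
        then have "q * (res q 0 + 2*g/3) \<le> q * res q z" using q by (intro mult_left_mono) auto
        then have "ennreal (q * (res q 0 + 2*g/3)) \<le> ennreal (q * res q z)" by (rule ennreal_leI)
        then show ?thesis using True by (simp add: f_def)
      qed simp
    qed
    finally show ?thesis .
  qed
  define S where "S = (SUP x. V x)"
  have VS: "V x \<le> S" for x unfolding S_def by (rule SUP_upper) simp
  have V1: "V x \<le> 1" for x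
  proof -
    have "V x \<le> (\<integral>\<^sup>+z. ennreal (q * res q z) \<partial>lborel)" unfolding V_def f_def by (intro nn_integral_mono) (auto simp: indicator_def)
    then show ?thesis using res_total[OF q] by simp
  qed
  have S1: "S \<le> 1" unfolding S_def by (rule SUP_least) (rule V1)
  define s where "s = enn2real S"
  have Ss: "S = ennreal s" and s0: "0 \<le> s" unfolding s_def using S1 by (auto simp: top_unique less_top intro!: ennreal_enn2real[symmetric] le_less_trans[OF S1])
  have bs: "b < s"
  proof -
    have "b < q * (res q 0 + 2*g/3) * (2*\<epsilon>)" unfolding b_def using q g \<epsilon> by (intro mult_strict_right_mono mult_strict_left_mono) auto
    moreover have "ennreal (q * (res q 0 + 2*g/3) * (2*\<epsilon>)) \<le> ennreal s" using Vw VS[of "-w"] Ss by (metis order_trans)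
    ultimately show ?thesis using s0 by (auto simp: ennreal_le_iff)
  qed
  have sp: "0 < s" using bs b0 by simp
  \<comment> \<open>With probability at most \<open>s / 4\<close> of a displacement by
    \<open>\<epsilon>\<close> before \<open>t\<close>, the first term costs at most
    \<open>q * t * s / 4\<close>, while the factor \<open>exp (-q * t)\<close> gains at least
    \<open>q * t * s / 2\<close>. The cap \<open>1 / q\<close> on \<open>t\<close> below is what
    makes \<open>exp (-q * t) \<le> 1 - q * t / 2\<close> available.\<close>
  obtain d where d: "0 < d" "\<And>r. 0 \<le> r \<Longrightarrow> r < d \<Longrightarrow> prob {v\<in>space M. \<epsilon> \<le> \<bar>Z r v\<bar>} \<le> s/4"
    using prob_small_time[OF \<epsilon>(1), of "s/4"] sp by auto
  define t where "t = min (d/2) (1/q)"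
  have t: "0 < t" "t < d" "q * t \<le> 1" unfolding t_def using d q by (auto simp: min_def field_simps)
  have step: "V x \<le> ennreal (q * t * (s/4) + exp (-q*t) * s)" if x: "2*\<epsilon> \<le> \<bar>x\<bar>" for x
  proof -
    have "V x \<le> ennreal (q * t) * ennreal (s/4) + ennreal (exp (-q*t)) * S"
      unfolding V_def
    proof (rule res_max_step[OF q less_imp_le[OF t(1)] f])
      show "(\<integral>\<^sup>+z. ennreal (q * res q z) * f (x + z) \<partial>lborel) \<le> S" for x using VS[of x] by (simp add: V_def)
      fix r assume r: "0 \<le> r" "r \<le> t"
      have [measurable]: "Z r \<in> borel_measurable M" using r by simp
      have "(\<integral>\<^sup>+v. f (x + Z r v) \<partial>M) \<le> (\<integral>\<^sup>+v. indicator {v\<in>space M. \<epsilon> \<le> \<bar>Z r v\<bar>} v \<partial>M)"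
      proof (rule nn_integral_mono)
        fix v assume "v \<in> space M"
        then show "f (x + Z r v) \<le> indicator {v\<in>space M. \<epsilon> \<le> \<bar>Z r v\<bar>} v"
          unfolding f_def using x by (auto simp: indicator_def abs_if split: if_splits)
      qed
      also have "\<dots> = ennreal (prob {v\<in>space M. \<epsilon> \<le> \<bar>Z r v\<bar>})" by (subst nn_integral_indicator) (auto simp: emeasure_eq_measure)
      also have "\<dots> \<le> ennreal (s/4)" using d(2)[of r] r t by (intro ennreal_leI) auto
      finally show "(\<integral>\<^sup>+v. f (x + Z r v) \<partial>M) \<le> ennreal (s/4)" .
    qed
    also have "\<dots> = ennreal (q * t * (s/4) + exp (-q*t) * s)"
      unfolding Ss using q t sp by (simp only: ennreal_mult[symmetric] ennreal_plus[symmetric] mult_nonneg_nonneg less_imp_le exp_ge_zero divide_nonneg_nonneg zero_le_numeral)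
    finally show ?thesis .
  qed
  have et: "exp (-q*t) \<le> 1 - q*t/2"
  proof -
    have "exp (-(q*t)) \<le> 1 / (1 + q*t)"
      using le_imp_inverse_le[OF exp_ge_add_one_self[of "q*t"]] q t by (simp add: exp_minus inverse_eq_divide add_pos_pos)
    also have "\<dots> \<le> 1 - q*t/2"
    proof -
      have p: "0 < q*t" using q t by simp
      have "1 \<le> (1 - q*t/2) * (1 + q*t)" using p t(3) mult_left_mono[OF t(3), of "q*t"] by (simp add: algebra_simps)
      then show ?thesis using p by (subst pos_divide_le_eq) auto
    qed
    finally show ?thesis by simp
  qed
  have "q * t * (s/4) + exp (-q*t) * s \<le> q * t * (s/4) + (1 - q*t/2) * s"
    using et sp by (intro add_left_mono mult_right_mono) auto
  also have "\<dots> = s - q * t * s / 4" by (simp add: algebra_simps)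
  finally have lt: "q * t * (s/4) + exp (-q*t) * s < s" using q t sp by (smt (verit) divide_pos_pos mult_pos_pos)
  define m where "m = max b (q * t * (s/4) + exp (-q*t) * s)"
  have "S \<le> ennreal m" unfolding S_def
  proof (rule SUP_least)
    fix x
    show "V x \<le> ennreal m"
    proof (cases "\<bar>x\<bar> < 2*\<epsilon>")
      case True from Vle[OF this] show ?thesis by (rule order_trans) (auto intro!: ennreal_leI simp: m_def)
    next
      case False then show ?thesis using step[of x] by (intro order_trans[OF step]) (auto intro!: ennreal_leI simp: m_def)
    qed
  qed
  moreover have "0 \<le> m" unfolding m_def using b0 by simp
  ultimately have "s \<le> m" unfolding Ss by (simp add: ennreal_le_iff)
  then show False using bs lt unfolding m_def by simp
qed

end

section \<open>The function h as a limit of resolvent differences\<close>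

lemma two_one_minus_cos_le: "2 * (1 - cos x) \<le> x\<^sup>2" for x :: real
  using mult_left_mono[OF one_minus_cos_le[of x], of 2] by simp

lemma finv_tendsto:
  assumes w: "integrable lborel w" and m: "\<And>n. \<phi> n \<in> borel_measurable borel" "\<psi> \<in> borel_measurable borel"
    and lim: "AE u in lborel. (\<lambda>n. \<phi> n u) \<longlonglongrightarrow> \<psi> u"
    and b: "\<And>n. AE u in lborel. norm (\<phi> n u) \<le> w u"
  shows "(\<lambda>n. finv (\<phi> n) z) \<longlonglongrightarrow> finv \<psi> z"
proof -
  note [measurable] = m
  have "(\<lambda>n. \<integral>u. iexp (-(u*z)) * \<phi> n u \<partial>lborel) \<longlonglongrightarrow> (\<integral>u. iexp (-(u*z)) * \<psi> u \<partial>lborel)"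
  proof (rule integral_dominated_convergence[OF _ _ w])
    show "AE u in lborel. (\<lambda>n. iexp (-(u*z)) * \<phi> n u) \<longlonglongrightarrow> iexp (-(u*z)) * \<psi> u"
      using lim by eventually_elim (intro tendsto_intros)
    show "AE u in lborel. norm (iexp (-(u*z)) * \<phi> n u) \<le> w u" for n
      using b[of n] by eventually_elim (simp add: norm_mult)
  qed measurable
  then show ?thesis unfolding finv_def by (intro tendsto_intros) auto
qed

context levy_sym begin

definition hq :: "real \<Rightarrow> real \<Rightarrow> real" where "hq q y = res q 0 - res q (-y)"

lemma hq_nonneg: "0 < q \<Longrightarrow> 0 \<le> hq q y"
  using res_le_0[of q "-y"] by (simp add: hq_def)

lemma hq_meas: "0 < q \<Longrightarrow> hq q \<in> borel_measurable borel"
  using res_meas[of q] unfolding hq_def[abs_def] by measurable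

lemma hq_half:
  assumes q: "0 < q"
  shows "hq q y = (LBINT u:{0..}. Re ((1 - iexp (u*y)) / (of_real q - \<eta> u))) / pi"
proof -
  have r: "res q z = (LBINT u:{0..}. Re (iexp (-(u*z)) * (1 / (of_real q - \<eta> u)))) / pi" for z
    unfolding res_def by (rule finv_hermitian[OF A[OF q]]) (simp add: eta_cnj)
  have i: "set_integrable lborel {0..} (\<lambda>u. Re (iexp (-(u*z)) * (1 / (of_real q - \<eta> u))))" for z
    unfolding set_integrable_def
    by (intro integrable_mult_indicator integrable_Re integrable_iexp_mult' A[OF q]) auto
  have "hq q y = ((LBINT u:{0..}. Re (iexp (-(u*0)) * (1 / (of_real q - \<eta> u)))) - (LBINT u:{0..}. Re (iexp (-(u*(-y))) * (1 / (of_real q - \<eta> u))))) / pi"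
    unfolding hq_def r by (simp add: diff_divide_distrib)
  also have "(LBINT u:{0..}. Re (iexp (-(u*0)) * (1 / (of_real q - \<eta> u)))) - (LBINT u:{0..}. Re (iexp (-(u*(-y))) * (1 / (of_real q - \<eta> u)))) =
    (LBINT u:{0..}. Re (iexp (-(u*0)) * (1 / (of_real q - \<eta> u))) - Re (iexp (-(u*(-y))) * (1 / (of_real q - \<eta> u))))"
    by (rule set_integral_diff(2)[OF i i, symmetric])
  also have "(\<lambda>u. Re (iexp (-(u*0)) * (1 / (of_real q - \<eta> u))) - Re (iexp (-(u*(-y))) * (1 / (of_real q - \<eta> u)))) =
    (\<lambda>u. Re ((1 - iexp (u*y)) / (of_real q - \<eta> u)))"
    by (rule ext) (simp only: mult_zero_right of_real_0 minus_zero exp_zero mult_1 mult_minus_right minus_minus minus_complex.sel(1)[symmetric] times_divide_eq_right mult_1_right diff_divide_distrib)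
  finally show ?thesis .
qed

text \<open>In the real part of the product the cosine term tolerates the modulus of
  \<open>1 / (q - \<eta>)\<close>, but the sine term must keep the imaginary part to be reached by
  (B). Passing to \<open>q = 0\<close> is possible because \<open>q\<close> leaves
  \<open>Im (\<eta> u)\<close> unchanged and only enlarges the modulus of the denominator.\<close>

lemma half_bound:
  assumes q: "0 \<le> q" and u: "\<eta> u \<noteq> 0"
  shows "\<bar>Re ((1 - iexp (u*y)) / (of_real q - \<eta> u))\<bar> \<le> (1 - cos (u*y)) / norm (\<eta> u) + \<bar>sin (u*y)\<bar> * \<bar>Im (1 / \<eta> u)\<bar>"
proof -
  let ?k = "of_real q - \<eta> u"
  have ek: "norm (\<eta> u) \<le> norm ?k" by (rule norm_q_eta'[OF q])
  have e0: "0 < norm (\<eta> u)" using u by simp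
  have k0: "0 < norm ?k" using ek e0 by linarith
  have "Re ((1 - iexp (u*y)) / ?k) = (1 - cos (u*y)) * Re (1 / ?k) + sin (u*y) * Im (1 / ?k)"
  proof -
    have "(1 - iexp (u*y)) / ?k = (1 - iexp (u*y)) * (1 / ?k)" by simp
    then show ?thesis by (simp only: times_complex.sel minus_complex.sel Re_exp Im_exp) simp
  qed
  also have "\<bar>\<dots>\<bar> \<le> \<bar>1 - cos (u*y)\<bar> * \<bar>Re (1 / ?k)\<bar> + \<bar>sin (u*y)\<bar> * \<bar>Im (1 / ?k)\<bar>"
    by (rule order_trans[OF abs_triangle_ineq]) (simp only: abs_mult)
  also have "\<dots> \<le> (1 - cos (u*y)) * (1 / norm (\<eta> u)) + \<bar>sin (u*y)\<bar> * \<bar>Im (1 / \<eta> u)\<bar>"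
  proof (intro add_mono mult_mono)
    have "\<bar>Re (1 / ?k)\<bar> \<le> norm (1 / ?k)" by (rule abs_Re_le_cmod)
    also have "\<dots> = 1 / norm ?k" by (simp add: norm_divide)
    also have "\<dots> \<le> 1 / norm (\<eta> u)" using ek e0 k0 by (intro divide_left_mono) auto
    finally show "\<bar>Re (1 / ?k)\<bar> \<le> 1 / norm (\<eta> u)" .
    have "\<bar>Im (1 / ?k)\<bar> = \<bar>Im (\<eta> u)\<bar> / (norm ?k)\<^sup>2" by (simp add: Im_divide cmod_power2)
    also have "\<dots> \<le> \<bar>Im (\<eta> u)\<bar> / (norm (\<eta> u))\<^sup>2" using ek e0 by (intro divide_left_mono power_mono mult_pos_pos) auto
    also have "\<dots> = \<bar>Im (1 / \<eta> u)\<bar>" by (simp add: Im_divide cmod_power2)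
    finally show "\<bar>Im (1 / ?k)\<bar> \<le> \<bar>Im (1 / \<eta> u)\<bar>" .
  qed auto
  finally show ?thesis by simp
qed

text \<open>A majorant of all \<open>hq q\<close> up to the factor \<open>1 / pi\<close>. With
  values in \<open>ennreal\<close>, its finiteness is asked in the mean only.\<close>

definition Hn :: "real \<Rightarrow> ennreal" where
  "Hn y = (\<integral>\<^sup>+u. ennreal ((1 - cos (u*y)) / norm (\<eta> u)) \<partial>lborel)"

lemma Hn_meas[measurable]: "Hn \<in> borel_measurable borel"
proof -
  have "(\<lambda>(y,u). ennreal ((1 - cos (u*y)) / norm (\<eta> u))) \<in> borel_measurable (borel \<Otimes>\<^sub>M lborel)" by measurable
  from lborel.borel_measurable_nn_integral_fst[OF this] show ?thesis unfolding Hn_def[abs_def] by simp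
qed

text \<open>Here the maximum principle pays: \<open>hq q y\<close> is at most
  \<open>hq q y + hq q (-y)\<close>, in which the sine parts cancel. The direct estimate
  \<open>half_bound\<close> would lead to a term growing like \<open>|y|\<close>, whose mean under
  the process may be infinite.\<close>

lemma hq_le_Hn:
  assumes q: "0 < q"
  shows "ennreal (hq q y) \<le> ennreal (1/pi) * Hn y"
proof -
  let ?\<phi> = "\<lambda>u. 1 / (of_real q - \<eta> u)"
  have i: "integrable lborel (\<lambda>u. iexp (-(u*z)) * ?\<phi> u)" for z by (rule integrable_iexp_mult'[OF A[OF q]])
  have "hq q y + hq q (-y) = (2 * Re (\<integral>u. iexp (-(u*0)) * ?\<phi> u \<partial>lborel) - Re (\<integral>u. iexp (-(u*y)) * ?\<phi> u \<partial>lborel) - Re (\<integral>u. iexp (-(u*(-y))) * ?\<phi> u \<partial>lborel)) / (2*pi)"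
    unfolding hq_def res_def finv_def by (simp add: diff_divide_distrib)
  moreover have "2 * Re (\<integral>u. iexp (-(u*0)) * ?\<phi> u \<partial>lborel) - Re (\<integral>u. iexp (-(u*y)) * ?\<phi> u \<partial>lborel) - Re (\<integral>u. iexp (-(u*(-y))) * ?\<phi> u \<partial>lborel)
     = (\<integral>u. 2 * Re (iexp (-(u*0)) * ?\<phi> u) - Re (iexp (-(u*y)) * ?\<phi> u) - Re (iexp (-(u*(-y))) * ?\<phi> u) \<partial>lborel)"
    using i[of 0] i[of y] i[of "-y"] by (subst Bochner_Integration.integral_diff | simp)+
  moreover have "(\<lambda>u. 2 * Re (iexp (-(u*0)) * ?\<phi> u) - Re (iexp (-(u*y)) * ?\<phi> u) - Re (iexp (-(u*(-y))) * ?\<phi> u)) = (\<lambda>u. 2 * ((1 - cos (u*y)) * Re (?\<phi> u)))"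
  proof
    fix u
    have "iexp (-(u*y)) = Complex (cos (u*y)) (- sin (u*y))" "iexp (-(u*(-y))) = Complex (cos (u*y)) (sin (u*y))"
      by (simp_all add: complex_eq_iff Re_exp Im_exp)
    moreover have "iexp (-(u*0)) = 1" by simp
    ultimately show "2 * Re (iexp (-(u*0)) * ?\<phi> u) - Re (iexp (-(u*y)) * ?\<phi> u) - Re (iexp (-(u*(-y))) * ?\<phi> u) = 2 * ((1 - cos (u*y)) * Re (?\<phi> u))"
      by (simp only: times_complex.sel complex.sel one_complex.sel) (simp add: algebra_simps)
  qed
  ultimately have eq: "hq q y + hq q (-y) = (\<integral>u. 2 * ((1 - cos (u*y)) * Re (?\<phi> u)) \<partial>lborel) / (2*pi)" by (simp only:)
  have le: "(1 - cos (u*y)) * Re (?\<phi> u) \<le> (1 - cos (u*y)) / norm (\<eta> u)" if "u \<noteq> 0" for u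
  proof -
    have e0: "0 < norm (\<eta> u)" using eta_nz[OF that] by simp
    have ek: "norm (\<eta> u) \<le> norm (complex_of_real q - \<eta> u)" by (rule norm_q_eta') (use q in simp)
    have "Re (?\<phi> u) \<le> norm (?\<phi> u)" by (rule complex_Re_le_cmod)
    also have "\<dots> = 1 / norm (complex_of_real q - \<eta> u)" by (simp add: norm_divide)
    also have "\<dots> \<le> 1 / norm (\<eta> u)" using ek e0 by (intro divide_left_mono mult_pos_pos) linarith+
    finally have "(1 - cos (u*y)) * Re (?\<phi> u) \<le> (1 - cos (u*y)) * (1 / norm (\<eta> u))" by (intro mult_left_mono) auto
    then show ?thesis by simp
  qed
  have Re0: "0 \<le> Re (?\<phi> u)" for u using Re_eta[of u] q by (simp add: Re_divide)
  have ic: "integrable lborel (\<lambda>u. (1 - cos (u*y)) * Re (?\<phi> u))"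
  proof (rule Bochner_Integration.integrable_bound)
    show "integrable lborel (\<lambda>u. 2 * norm (?\<phi> u))" using A[OF q] by simp
    show "AE u in lborel. norm ((1 - cos (u*y)) * Re (?\<phi> u)) \<le> norm (2 * norm (?\<phi> u))"
    proof (rule AE_I2)
      fix u
      have "\<bar>1 - cos (u*y)\<bar> \<le> 2" using cos_ge_minus_one[of "u*y"] cos_le_one[of "u*y"] by linarith
      then have "\<bar>1 - cos (u*y)\<bar> * \<bar>Re (?\<phi> u)\<bar> \<le> 2 * norm (?\<phi> u)" by (intro mult_mono abs_Re_le_cmod) auto
      then show "norm ((1 - cos (u*y)) * Re (?\<phi> u)) \<le> norm (2 * norm (?\<phi> u))" by (simp only: real_norm_def abs_mult abs_numeral abs_norm_cancel)
    qed
  qed measurable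
  have "hq q y \<le> hq q y + hq q (-y)" using hq_nonneg[OF q] by simp
  then have "ennreal (hq q y) \<le> ennreal (1/pi * (\<integral>u. (1 - cos (u*y)) * Re (?\<phi> u) \<partial>lborel))"
    unfolding eq by (intro ennreal_leI) simp
  also have "\<dots> = ennreal (1/pi) * ennreal (\<integral>u. (1 - cos (u*y)) * Re (?\<phi> u) \<partial>lborel)"
    using Re0 by (intro ennreal_mult integral_nonneg_AE AE_I2 mult_nonneg_nonneg) auto
  also have "ennreal (\<integral>u. (1 - cos (u*y)) * Re (?\<phi> u) \<partial>lborel) = (\<integral>\<^sup>+u. ennreal ((1 - cos (u*y)) * Re (?\<phi> u)) \<partial>lborel)"
    using Re0 by (intro nn_integral_eq_integral[symmetric] ic AE_I2 mult_nonneg_nonneg) auto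
  also have "\<dots> \<le> Hn y" unfolding Hn_def
  proof (rule nn_integral_mono_AE)
    have "AE u in lborel. u \<noteq> (0::real)" by (rule AE_lborel_singleton)
    then show "AE u in lborel. ennreal ((1 - cos (u*y)) * Re (?\<phi> u)) \<le> ennreal ((1 - cos (u*y)) / norm (\<eta> u))"
      by eventually_elim (intro ennreal_leI le)
  qed
  finally show ?thesis by (simp add: mult_left_mono)
qed

lemma exp_eta_diff: assumes "0 \<le> r" shows "norm (1 - exp (of_real r * \<eta> u)) \<le> r * norm (\<eta> u)"
proof (cases "\<eta> u = 0")
  case False
  have "norm (1 - exp (of_real r * \<eta> u)) = norm (occ_char r u) * norm (\<eta> u)"
    unfolding occ_char_eq[OF assms False] using False by (simp add: norm_divide norm_minus_commute)
  also have "\<dots> \<le> r * norm (\<eta> u)" by (intro mult_right_mono occ_char_norm assms) auto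
  finally show ?thesis .
qed simp

text \<open>After Fubini, for \<open>|u| <= 1\<close> the mean of \<open>1 - cos\<close> is at most
  \<open>(u * v)^2 + 2 * r * |\<eta> u|\<close>, and dividing by
  \<open>|\<eta> u| >= c * u^2\<close> leaves the constant \<open>K\<close>; for larger
  \<open>u\<close> the tail of \<open>1 / |\<eta>|\<close> is integrable. Moments of the process
  never enter.\<close>

lemma Hn_finite:
  assumes r: "0 \<le> r"
  shows "(\<integral>\<^sup>+w. Hn (v + Z r w) \<partial>M) < \<infinity>"
proof -
  note [measurable] = Z_meas[OF r]
  interpret MLb: pair_sigma_finite M lborel ..
  obtain c where c: "0 < c" "\<And>u. \<bar>u\<bar> \<le> 1 \<Longrightarrow> c * u\<^sup>2 \<le> norm (\<eta> u)"
    using eta_lower by metis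
  define K where "K = v\<^sup>2 / c + 2 * r"
  have K0: "0 \<le> K" unfolding K_def using c r by simp
  have m: "(\<lambda>(w,u). ennreal ((1 - cos (u*(v + Z r w))) / norm (\<eta> u))) \<in> borel_measurable (M \<Otimes>\<^sub>M lborel)"
    by measurable
  have "(\<integral>\<^sup>+w. Hn (v + Z r w) \<partial>M) = (\<integral>\<^sup>+u. (\<integral>\<^sup>+w. ennreal ((1 - cos (u*(v + Z r w))) / norm (\<eta> u)) \<partial>M) \<partial>lborel)"
    unfolding Hn_def using MLb.Fubini'[OF m] by simp
  also have "\<dots> \<le> (\<integral>\<^sup>+u. ennreal (K * indicator {-1..1} u + 2 * inv_eta_tail u) \<partial>lborel)"
  proof (rule nn_integral_mono_AE)
    have "AE u in lborel. u \<noteq> (0::real)" by (rule AE_lborel_singleton)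
    then show "AE u in lborel. (\<integral>\<^sup>+w. ennreal ((1 - cos (u*(v + Z r w))) / norm (\<eta> u)) \<partial>M) \<le> ennreal (K * indicator {-1..1} u + 2 * inv_eta_tail u)"
    proof eventually_elim
      case (elim u)
      have e0: "0 < norm (\<eta> u)" using eta_nz[OF elim] by simp
      have ii: "integrable M (\<lambda>w. iexp (u * Z r w))" by (rule integrable_iexp) auto
      have ic: "integrable M (\<lambda>w. cos (u * Z r w))" using integrable_Re[OF ii] by (simp add: Re_exp)
      have icv: "integrable M (\<lambda>w. (1 - cos (u*(v + Z r w))) / norm (\<eta> u))"
      proof (rule integrable_const_bound[where B="2 / norm (\<eta> u)"])
        show "AE w in M. norm ((1 - cos (u*(v + Z r w))) / norm (\<eta> u)) \<le> 2 / norm (\<eta> u)"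
        proof (rule AE_I2)
          fix w
          have "\<bar>1 - cos (u*(v + Z r w))\<bar> \<le> 2"
            using cos_ge_minus_one[of "u*(v + Z r w)"] cos_le_one[of "u*(v + Z r w)"] by linarith
          then have "\<bar>1 - cos (u*(v + Z r w))\<bar> / norm (\<eta> u) \<le> 2 / norm (\<eta> u)" by (rule divide_right_mono) simp
          then show "norm ((1 - cos (u*(v + Z r w))) / norm (\<eta> u)) \<le> 2 / norm (\<eta> u)"
            by (simp only: real_norm_def abs_divide abs_norm_cancel)
        qed
      qed measurable
      have "(\<integral>\<^sup>+w. ennreal ((1 - cos (u*(v + Z r w))) / norm (\<eta> u)) \<partial>M) = ennreal (\<integral>w. (1 - cos (u*(v + Z r w))) / norm (\<eta> u) \<partial>M)"
        by (rule nn_integral_eq_integral[OF icv]) auto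
      also have "\<dots> \<le> ennreal (K * indicator {-1..1} u + 2 * inv_eta_tail u)"
      proof (rule ennreal_leI)
        show "(\<integral>w. (1 - cos (u*(v + Z r w))) / norm (\<eta> u) \<partial>M) \<le> K * indicator {-1..1} u + 2 * inv_eta_tail u"
        proof (cases "\<bar>u\<bar> \<le> 1")
          case True
          have "(\<integral>w. (1 - cos (u*(v + Z r w))) / norm (\<eta> u) \<partial>M) \<le> (\<integral>w. (2 * (1 - cos (u * v)) + 2 * (1 - cos (u * Z r w))) / norm (\<eta> u) \<partial>M)"
          proof (rule integral_mono[OF icv])
            fix w
            have "1 - cos (u * v + u * Z r w) \<le> 2 * (1 - cos (u * v)) + 2 * (1 - cos (u * Z r w))" by (rule one_minus_cos_add_le)
            then show "(1 - cos (u*(v + Z r w))) / norm (\<eta> u) \<le> (2 * (1 - cos (u * v)) + 2 * (1 - cos (u * Z r w))) / norm (\<eta> u)"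
              by (intro divide_right_mono) (simp_all add: distrib_left)
          qed (use ic in simp)
          also have "\<dots> = (2 * (1 - cos (u * v)) + 2 * (1 - (\<integral>w. cos (u * Z r w) \<partial>M))) / norm (\<eta> u)"
            using ic by (simp add: prob_space)
          also have "(\<integral>w. cos (u * Z r w) \<partial>M) = Re (exp (of_real r * \<eta> u))"
            unfolding chr[OF r, symmetric] using integral_Re[OF ii] by (simp add: Re_exp)
          also have "2 * (1 - cos (u * v)) + 2 * (1 - Re (exp (of_real r * \<eta> u))) \<le> (u * v)\<^sup>2 + 2 * (r * norm (\<eta> u))"
          proof -
            have "1 - Re (exp (of_real r * \<eta> u)) = Re (1 - exp (of_real r * \<eta> u))" by simp
            also have "\<dots> \<le> norm (1 - exp (of_real r * \<eta> u))" by (rule complex_Re_le_cmod)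
            also have "\<dots> \<le> r * norm (\<eta> u)" by (rule exp_eta_diff[OF r])
            finally have "2 * (1 - Re (exp (of_real r * \<eta> u))) \<le> 2 * (r * norm (\<eta> u))"
              by (rule mult_left_mono) simp
            then show ?thesis by (rule add_mono[OF two_one_minus_cos_le])
          qed
          then have "(2 * (1 - cos (u * v)) + 2 * (1 - Re (exp (of_real r * \<eta> u)))) / norm (\<eta> u) \<le> ((u * v)\<^sup>2 + 2 * (r * norm (\<eta> u))) / norm (\<eta> u)"
            by (rule divide_right_mono) simp
          also have "\<dots> = u\<^sup>2 / norm (\<eta> u) * v\<^sup>2 + 2 * r" using e0 by (simp add: add_divide_distrib power_mult_distrib)
          also have "\<dots> \<le> 1 / c * v\<^sup>2 + 2 * r"
          proof (intro add_right_mono mult_right_mono)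
            show "u\<^sup>2 / norm (\<eta> u) \<le> 1 / c" using c(2)[OF True] e0 c(1) by (simp add: field_simps)
          qed simp
          also have "\<dots> = K * indicator {-1..1} u + 2 * inv_eta_tail u" using True by (simp add: K_def inv_eta_tail_def abs_le_iff)
          finally show ?thesis .
        next
          case False
          have "(\<integral>w. (1 - cos (u*(v + Z r w))) / norm (\<eta> u) \<partial>M) \<le> (\<integral>w. 2 / norm (\<eta> u) \<partial>M)"
          proof (rule integral_mono[OF icv])
            fix w
            have "1 - cos (u*(v + Z r w)) \<le> 2" using cos_ge_minus_one[of "u*(v + Z r w)"] by linarith
            then show "(1 - cos (u*(v + Z r w))) / norm (\<eta> u) \<le> 2 / norm (\<eta> u)" by (intro divide_right_mono) auto
          qed simp
          also have "\<dots> = 2 * inv_eta_tail u" using False by (simp add: inv_eta_tail_def prob_space)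
          finally show ?thesis using K0 by (auto simp: indicator_def)
        qed
      qed
      finally show ?case .
    qed
  qed
  also have "\<dots> < \<infinity>"
  proof -
    have "integrable lborel (\<lambda>u. K * indicator {-1..1} u + 2 * inv_eta_tail u)"
      using inv_eta_tail_integrable by (intro Bochner_Integration.integrable_add integrable_mult_right) (simp_all add: emeasure_lborel_Icc_eq)
    then have "(\<integral>\<^sup>+u. ennreal (norm (K * indicator {-1..1} u + 2 * inv_eta_tail u)) \<partial>lborel) < \<infinity>" by (simp add: integrable_iff_bounded)
    moreover have "norm (K * indicator {-1..1} u + 2 * inv_eta_tail u) = K * indicator {-1..1} u + 2 * inv_eta_tail u" for u :: real
      using K0 inv_eta_tail_nonneg[of u] by simp
    ultimately show ?thesis by simp
  qed
  finally show ?thesis .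
qed

text \<open>On the Fourier side, averaging over \<open>Z s\<close> multiplies the transform by
  \<open>exp (s * \<eta> u)\<close>; the constant \<open>res q 0\<close> cancels in the
  difference.\<close>

lemma hq_mean:
  assumes q: "0 < q" and s: "0 \<le> s"
  shows "(\<integral>w. hq q (v + Z s w) \<partial>M) - hq q v = finv (\<lambda>u. (1 - exp (of_real s * \<eta> u)) / (of_real q - \<eta> u)) (-v)"
proof -
  note [measurable] = Z_meas[OF s] res_meas[OF q]
  let ?\<phi> = "\<lambda>u. 1 / (of_real q - \<eta> u)"
  interpret MLb: pair_sigma_finite M lborel ..
  have i: "integrable lborel (\<lambda>u. iexp (-(u*z)) * ?\<phi> u)" for z by (rule integrable_iexp_mult'[OF A[OF q]])
  have i2: "integrable lborel (\<lambda>u. exp (of_real s * \<eta> u) * ?\<phi> u)"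
  proof (rule Bochner_Integration.integrable_bound[OF A[OF q]])
    show "AE u in lborel. norm (exp (of_real s * \<eta> u) * ?\<phi> u) \<le> norm (?\<phi> u)"
    proof (rule AE_I2)
      fix u
      have "norm (exp (of_real s * \<eta> u)) * norm (?\<phi> u) \<le> 1 * norm (?\<phi> u)" by (intro mult_right_mono norm_exp_eta s) auto
      then show "norm (exp (of_real s * \<eta> u) * ?\<phi> u) \<le> norm (?\<phi> u)" by (simp only: norm_mult mult_1)
    qed
  qed measurable
  have pint: "integrable (M \<Otimes>\<^sub>M lborel) (\<lambda>(w,u). iexp (-(u*(-(v + Z s w)))) * ?\<phi> u)"
  proof (rule MLb.Fubini_integrable)
    have "(\<lambda>w. \<integral>u. norm (case (w,u) of (w,u) \<Rightarrow> iexp (-(u*(-(v + Z s w)))) * ?\<phi> u) \<partial>lborel) = (\<lambda>w. \<integral>u. norm (?\<phi> u) \<partial>lborel)"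
      by (simp only: prod.case norm_mult norm_exp_i_times mult_1)
    then show "integrable M (\<lambda>w. \<integral>u. norm (case (w,u) of (w,u) \<Rightarrow> iexp (-(u*(-(v + Z s w)))) * ?\<phi> u) \<partial>lborel)" by simp
    show "AE w in M. integrable lborel (\<lambda>u. case (w,u) of (w,u) \<Rightarrow> iexp (-(u*(-(v + Z s w)))) * ?\<phi> u)"
      unfolding prod.case using i by (intro AE_I2)
  qed measurable
  have "(\<integral>w. (\<integral>u. iexp (-(u*(-(v + Z s w)))) * ?\<phi> u \<partial>lborel) \<partial>M) = (\<integral>u. (\<integral>w. iexp (-(u*(-(v + Z s w)))) * ?\<phi> u \<partial>M) \<partial>lborel)"
    by (rule MLb.Fubini_integral[OF pint, symmetric])
  moreover have "(\<integral>w. iexp (-(u*(-(v + Z s w)))) * ?\<phi> u \<partial>M) = iexp (-(u*(-v))) * (exp (of_real s * \<eta> u) * ?\<phi> u)" for u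
  proof -
    have "iexp (-(u*(-(v + Z s w)))) * ?\<phi> u = iexp (-(u*(-v))) * ?\<phi> u * iexp (u * Z s w)" for w
    proof -
      have r: "-(u*(-(v + Z s w))) = -(u*(-v)) + u * Z s w" by (simp add: algebra_simps)
      have "iexp (-(u*(-(v + Z s w)))) = iexp (-(u*(-v))) * iexp (u * Z s w)"
        unfolding r by (simp only: of_real_add distrib_left exp_add)
      then show ?thesis by (simp only: mult_ac)
    qed
    then have "(\<integral>w. iexp (-(u*(-(v + Z s w)))) * ?\<phi> u \<partial>M) = (\<integral>w. iexp (-(u*(-v))) * ?\<phi> u * iexp (u * Z s w) \<partial>M)" by (simp only:)
    also have "\<dots> = iexp (-(u*(-v))) * ?\<phi> u * (\<integral>w. iexp (u * Z s w) \<partial>M)" by (rule integral_mult_right_zero)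
    finally show ?thesis unfolding chr[OF s] by (simp only: mult.assoc mult.commute[of "exp (of_real s * \<eta> u)"])
  qed
  ultimately have F: "(\<integral>w. (\<integral>u. iexp (-(u*(-(v + Z s w)))) * ?\<phi> u \<partial>lborel) \<partial>M) = (\<integral>u. iexp (-(u*(-v))) * (exp (of_real s * \<eta> u) * ?\<phi> u) \<partial>lborel)"
    by (simp only:)
  have io: "integrable M (\<lambda>w. (\<integral>u. iexp (-(u*(-(v + Z s w)))) * ?\<phi> u \<partial>lborel))"
    using MLb.integrable_fst'[OF pint] by (simp only: prod.case)
  have "(\<integral>w. res q (-(v + Z s w)) \<partial>M) = (\<integral>w. Re (\<integral>u. iexp (-(u*(-(v + Z s w)))) * ?\<phi> u \<partial>lborel) \<partial>M) / (2*pi)"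
    unfolding res_def finv_def by (rule integral_divide_zero)
  also have "(\<integral>w. Re (\<integral>u. iexp (-(u*(-(v + Z s w)))) * ?\<phi> u \<partial>lborel) \<partial>M) = Re (\<integral>u. iexp (-(u*(-v))) * (exp (of_real s * \<eta> u) * ?\<phi> u) \<partial>lborel)"
    unfolding F[symmetric] by (rule integral_Re[OF io])
  finally have r1: "(\<integral>w. res q (-(v + Z s w)) \<partial>M) = finv (\<lambda>u. exp (of_real s * \<eta> u) * ?\<phi> u) (-v)"
    unfolding finv_def .
  have ir: "integrable M (\<lambda>w. res q (-(v + Z s w)))"
    unfolding res_def finv_def using integrable_Re[OF io] by (rule integrable_divide_zero[rotated])
  have "(\<integral>w. hq q (v + Z s w) \<partial>M) - hq q v = res q (-v) - (\<integral>w. res q (-(v + Z s w)) \<partial>M)"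
    unfolding hq_def using ir by (simp add: prob_space)
  also have "\<dots> = finv ?\<phi> (-v) - finv (\<lambda>u. exp (of_real s * \<eta> u) * ?\<phi> u) (-v)"
    unfolding r1 by (simp add: res_def)
  also have "\<dots> = Re ((\<integral>u. iexp (-(u*(-v))) * ?\<phi> u \<partial>lborel) - (\<integral>u. iexp (-(u*(-v))) * (exp (of_real s * \<eta> u) * ?\<phi> u) \<partial>lborel)) / (2*pi)"
    unfolding finv_def by (simp only: minus_complex.sel diff_divide_distrib)
  also have "(\<integral>u. iexp (-(u*(-v))) * ?\<phi> u \<partial>lborel) - (\<integral>u. iexp (-(u*(-v))) * (exp (of_real s * \<eta> u) * ?\<phi> u) \<partial>lborel)
     = (\<integral>u. iexp (-(u*(-v))) * ?\<phi> u - iexp (-(u*(-v))) * (exp (of_real s * \<eta> u) * ?\<phi> u) \<partial>lborel)"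
    by (rule Bochner_Integration.integral_diff[OF i integrable_iexp_mult'[OF i2], symmetric])
  also have "(\<lambda>u. iexp (-(u*(-v))) * ?\<phi> u - iexp (-(u*(-v))) * (exp (of_real s * \<eta> u) * ?\<phi> u)) =
     (\<lambda>u. iexp (-(u*(-v))) * ((1 - exp (of_real s * \<eta> u)) / (of_real q - \<eta> u)))"
    by (rule ext) (simp only: right_diff_distrib times_divide_eq_right mult_1_right diff_divide_distrib)
  finally show ?thesis unfolding finv_def .
qed

text \<open>Dominated convergence; off \<open>u = 0\<close> the integrand vanishes in the limit,
  since \<open>\<eta> u\<close> is not 0 there.\<close>

lemma q_res_sup_tendsto_0:
  "((\<lambda>q. (\<integral>u. norm (complex_of_real q / (of_real q - \<eta> u)) \<partial>lborel)) \<longlongrightarrow> 0) (at_right 0)"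
proof (rule tendsto_at_right_sequentially[of 0 1])
  fix X :: "nat \<Rightarrow> real" assume X: "\<And>n. 0 < X n" "\<And>n. X n < 1" "decseq X" "X \<longlonglongrightarrow> 0"
  have "(\<lambda>n. \<integral>u. norm (complex_of_real (X n) / (of_real (X n) - \<eta> u)) \<partial>lborel) \<longlonglongrightarrow> (\<integral>u. 0 \<partial>(lborel::real measure))"
  proof (rule integral_dominated_convergence[where w="\<lambda>u. norm (1 / (1 - \<eta> u))"])
    show "integrable lborel (\<lambda>u. norm (1 / (1 - \<eta> u)))" using A[of 1] by (intro integrable_norm) simp
    have "AE u in lborel. u \<noteq> (0::real)" by (rule AE_lborel_singleton)
    then show "AE u in lborel. (\<lambda>n. norm (complex_of_real (X n) / (of_real (X n) - \<eta> u))) \<longlonglongrightarrow> 0"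
    proof eventually_elim
      case (elim u)
      have "(\<lambda>n. norm (complex_of_real (X n) / (of_real (X n) - \<eta> u))) \<longlonglongrightarrow> norm (complex_of_real 0 / (of_real 0 - \<eta> u))"
        using eta_nz[OF elim] by (intro tendsto_intros X) simp
      then show ?case by simp
    qed
    show "AE u in lborel. norm (norm (complex_of_real (X n) / (of_real (X n) - \<eta> u))) \<le> norm (1 / (1 - \<eta> u))" for n
    proof (rule AE_I2)
      fix u
      let ?q = "X n" let ?k = "of_real ?q - \<eta> u"
      have k: "?q \<le> norm ?k" by (rule norm_q_eta[OF X(1)])
      have n1: "1 \<le> norm (1 - \<eta> u)" using norm_q_eta[of 1 u] by simp
      \<comment> \<open>The majorant for \<open>q < 1\<close> comes from
        \<open>q * |1 - \<eta>| <= q * |q - \<eta>| + q * (1 - q)\<close>, where the factor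
        \<open>q\<close> of the last term is at most \<open>|q - \<eta>|\<close>.\<close>
      have "1 - \<eta> u = ?k + of_real (1 - ?q)" by simp
      then have "norm (1 - \<eta> u) \<le> norm ?k + norm (complex_of_real (1 - ?q))" by (simp only: norm_triangle_ineq)
      also have "norm (complex_of_real (1 - ?q)) = 1 - ?q" using X(2)[of n] by (simp only: norm_of_real)
      finally have "?q * norm (1 - \<eta> u) \<le> ?q * (norm ?k + (1 - ?q))" using X(1)[of n] by (intro mult_left_mono) auto
      also have "\<dots> \<le> ?q * norm ?k + norm ?k * (1 - ?q)" using k X(2)[of n] by (simp add: distrib_left mult_right_mono)
      also have "\<dots> = norm ?k" by (simp add: algebra_simps)
      finally have fin: "?q * norm (1 - \<eta> u) \<le> norm ?k" .
      have "?q / norm ?k \<le> 1 / norm (1 - \<eta> u)"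
      proof -
        have kp: "0 < norm ?k" and np: "0 < norm (1 - \<eta> u)" using n1 k X(1)[of n] by linarith+
        show ?thesis using fin by (simp add: pos_divide_le_eq[OF kp] pos_le_divide_eq[OF np])
      qed
      then show "norm (norm (complex_of_real (X n) / (of_real (X n) - \<eta> u))) \<le> norm (1 / (1 - \<eta> u))"
        using X(1)[of n] by (simp add: norm_divide)
    qed
  qed measurable
  then show "(\<lambda>n. \<integral>u. norm (complex_of_real (X n) / (of_real (X n) - \<eta> u)) \<partial>lborel) \<longlonglongrightarrow> 0" by simp
qed simp

lemma q_res_bound: assumes "0 < q" shows "\<bar>q * res q z\<bar> \<le> (\<integral>u. norm (complex_of_real q / (of_real q - \<eta> u)) \<partial>lborel)"
proof -
  have "q * res q z = finv (\<lambda>u. of_real q / (of_real q - \<eta> u)) z"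
    unfolding res_def finv_cmult[symmetric] by simp
  also have "\<bar>\<dots>\<bar> \<le> (\<integral>u. norm (complex_of_real q / (of_real q - \<eta> u)) \<partial>lborel) / (2*pi)"
    by (rule finv_bound[OF integrable_q_div[OF assms]])
  also have "\<dots> \<le> (\<integral>u. norm (complex_of_real q / (of_real q - \<eta> u)) \<partial>lborel) / 1"
    using pi_ge_two by (intro divide_left_mono integral_nonneg_AE) auto
  finally show ?thesis by simp
qed

end

locale levy_tan = levy_sym +
  assumes B: "set_integrable lborel {0..1} (\<lambda>u. \<bar>Im (of_real u / \<eta> u)\<bar>)"
begin

text \<open>Dominated convergence on the half line. For \<open>u <= 1\<close> the cosine part is
  bounded through \<open>c * u^2 <= |\<eta> u|\<close> and the sine part through (B), using
  \<open>|sin (u * y)| <= u * |y|\<close>; for \<open>u > 1\<close> the crude bound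
  \<open>2 / |\<eta> u|\<close> is enough.\<close>

lemma hq_tendsto: "((\<lambda>q. hq q y) \<longlongrightarrow> h_fun \<eta> y) (at_right 0)"
proof (rule tendsto_at_right_sequentially[of 0 1])
  fix X :: "nat \<Rightarrow> real" assume X: "\<And>n. 0 < X n" "\<And>n. X n < 1" "decseq X" "X \<longlonglongrightarrow> 0"
  obtain c where c: "0 < c" "\<And>u. \<bar>u\<bar> \<le> 1 \<Longrightarrow> c * u\<^sup>2 \<le> norm (\<eta> u)"
    using eta_lower by metis
  define W where "W u = y\<^sup>2/(2*c) * indicator {0..1} u + \<bar>y\<bar> * (indicator {0..1} u * \<bar>Im (of_real u / \<eta> u)\<bar>) + (2 * inv_eta_tail u + indicator {0..1} u * 0)" for u
  have "(\<lambda>n. (\<integral>u. indicator {0..} u *\<^sub>R Re ((1 - iexp (u*y)) / (of_real (X n) - \<eta> u)) \<partial>lborel)) \<longlonglongrightarrow>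
     (\<integral>u. indicator {0..} u *\<^sub>R Re ((iexp (u*y) - 1) / \<eta> u) \<partial>lborel)"
  proof (rule integral_dominated_convergence[where w="\<lambda>u. y\<^sup>2/(2*c) * indicator {0..1} u + \<bar>y\<bar> * (indicator {0..1} u *\<^sub>R \<bar>Im (of_real u / \<eta> u)\<bar>) + 2 * inv_eta_tail u"])
    show "integrable lborel (\<lambda>u. y\<^sup>2/(2*c) * indicator {0..1} u + \<bar>y\<bar> * (indicator {0..1} u *\<^sub>R \<bar>Im (of_real u / \<eta> u)\<bar>) + 2 * inv_eta_tail u)"
      using inv_eta_tail_integrable B unfolding set_integrable_def
      by (intro Bochner_Integration.integrable_add integrable_mult_right) (simp_all add: emeasure_lborel_Icc_eq)
    have "AE u in lborel. u \<noteq> (0::real)" by (rule AE_lborel_singleton)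
    then show "AE u in lborel. (\<lambda>n. indicator {0..} u *\<^sub>R Re ((1 - iexp (u*y)) / (of_real (X n) - \<eta> u))) \<longlonglongrightarrow> indicator {0..} u *\<^sub>R Re ((iexp (u*y) - 1) / \<eta> u)"
    proof eventually_elim
      case (elim u)
      have "(\<lambda>n. indicator {0..} u *\<^sub>R Re ((1 - iexp (u*y)) / (of_real (X n) - \<eta> u))) \<longlonglongrightarrow> indicator {0..} u *\<^sub>R Re ((1 - iexp (u*y)) / (of_real 0 - \<eta> u))"
        using eta_nz[OF elim] by (intro tendsto_intros X) simp
      also have "(1 - iexp (u*y)) / (of_real 0 - \<eta> u) = (iexp (u*y) - 1) / \<eta> u"
        by (simp only: of_real_0 diff_0 minus_divide_right[symmetric] minus_divide_left minus_diff_eq)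
      finally show ?case .
    qed
    show "AE u in lborel. norm (indicator {0..} u *\<^sub>R Re ((1 - iexp (u*y)) / (of_real (X n) - \<eta> u))) \<le>
       y\<^sup>2/(2*c) * indicator {0..1} u + \<bar>y\<bar> * (indicator {0..1} u *\<^sub>R \<bar>Im (of_real u / \<eta> u)\<bar>) + 2 * inv_eta_tail u" for n
      using \<open>AE u in lborel. u \<noteq> (0::real)\<close>
    proof eventually_elim
      case (elim u)
      show ?case
      proof (cases "0 \<le> u")
        case True
        have e0: "0 < norm (\<eta> u)" using eta_nz[OF elim] by simp
        have nb: "\<bar>Re ((1 - iexp (u*y)) / (of_real (X n) - \<eta> u))\<bar> \<le> (1 - cos (u*y)) / norm (\<eta> u) + \<bar>sin (u*y)\<bar> * \<bar>Im (1 / \<eta> u)\<bar>"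
          by (rule half_bound) (use X(1)[of n] e0 in auto)
        show ?thesis
        proof (cases "u \<le> 1")
          case u1: True
          have "(1 - cos (u*y)) / norm (\<eta> u) \<le> (u*y)\<^sup>2 / 2 / norm (\<eta> u)" by (intro divide_right_mono one_minus_cos_le) auto
          also have "\<dots> = u\<^sup>2 / norm (\<eta> u) * (y\<^sup>2 / 2)" by (simp add: power_mult_distrib)
          also have "\<dots> \<le> 1 / c * (y\<^sup>2 / 2)"
          proof (intro mult_right_mono)
            show "u\<^sup>2 / norm (\<eta> u) \<le> 1 / c" using c(2)[of u] True u1 e0 c(1) by (simp add: field_simps)
          qed simp
          also have "\<dots> = y\<^sup>2/(2*c)" by simp
          finally have b1: "(1 - cos (u*y)) / norm (\<eta> u) \<le> y\<^sup>2/(2*c)" .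
          have "Im (of_real u / \<eta> u) = u * Im (1 / \<eta> u)" by (simp add: Im_divide)
          then have iu: "\<bar>Im (of_real u / \<eta> u)\<bar> = u * \<bar>Im (1 / \<eta> u)\<bar>" using True by (simp only: abs_mult)
          have "\<bar>sin (u*y)\<bar> * \<bar>Im (1 / \<eta> u)\<bar> \<le> \<bar>u * y\<bar> * \<bar>Im (1 / \<eta> u)\<bar>" by (intro mult_right_mono abs_sin_x_le_abs_x) auto
          also have "\<dots> = \<bar>y\<bar> * \<bar>Im (of_real u / \<eta> u)\<bar>" unfolding iu using True by (simp only: abs_mult) simp
          finally have b2: "\<bar>sin (u*y)\<bar> * \<bar>Im (1 / \<eta> u)\<bar> \<le> \<bar>y\<bar> * \<bar>Im (of_real u / \<eta> u)\<bar>" .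
          have "u \<in> {0..1}" "u \<in> {0..}" using True u1 by auto
          moreover have "0 \<le> inv_eta_tail u" by (rule inv_eta_tail_nonneg)
          ultimately show ?thesis using nb b1 b2 by (simp only: indicator_simps scaleR_one real_norm_def mult_1_right)
        next
          case u1: False
          have "\<bar>Re ((1 - iexp (u*y)) / (of_real (X n) - \<eta> u))\<bar> \<le> norm ((1 - iexp (u*y)) / (of_real (X n) - \<eta> u))" by (rule abs_Re_le_cmod)
          also have "\<dots> = norm (1 - iexp (u*y)) / norm (complex_of_real (X n) - \<eta> u)" by (rule norm_divide)
          also have "\<dots> \<le> 2 / norm (\<eta> u)"
          proof (rule frac_le)
            show "norm (1 - iexp (u*y)) \<le> 2" using norm_triangle_ineq4[of 1 "iexp (u*y)"] by simp
            show "norm (\<eta> u) \<le> norm (complex_of_real (X n) - \<eta> u)" by (rule norm_q_eta') (use X(1)[of n] in simp)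
          qed (use e0 in auto)
          also have "\<dots> = 2 * inv_eta_tail u" using u1 by (simp add: inv_eta_tail_def)
          finally have "\<bar>Re ((1 - iexp (u*y)) / (of_real (X n) - \<eta> u))\<bar> \<le> 2 * inv_eta_tail u" .
          moreover have "u \<notin> {0..1}" "u \<in> {0..}" using True u1 by auto
          ultimately show ?thesis by (simp only: indicator_simps not_False_eq_True scaleR_one scaleR_zero_left real_norm_def mult_zero_right add_0)
        qed
      next
        case False
        then have "u \<notin> {0..1}" "u \<notin> {0..}" by auto
        then show ?thesis using inv_eta_tail_nonneg[of u] by (simp only: indicator_simps scaleR_zero_left real_norm_def mult_zero_right add_0 abs_zero) simp
      qed
    qed
  qed measurable
  then have "(\<lambda>n. (\<integral>u. indicator {0..} u *\<^sub>R Re ((1 - iexp (u*y)) / (of_real (X n) - \<eta> u)) \<partial>lborel) / pi) \<longlonglongrightarrow>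
     (\<integral>u. indicator {0..} u *\<^sub>R Re ((iexp (u*y) - 1) / \<eta> u) \<partial>lborel) / pi" by (intro tendsto_intros) auto
  then show "(\<lambda>n. hq (X n) y) \<longlonglongrightarrow> h_fun \<eta> y"
    unfolding hq_half[OF X(1)] h_fun_def set_lebesgue_integral_def by simp
qed simp

abbreviation "h \<equiv> h_fun \<eta>"

lemma hq_seq: "(\<lambda>n. hq (1 / (real n + 1)) y) \<longlonglongrightarrow> h y"
proof (rule filterlim_compose[OF hq_tendsto])
  have "(\<lambda>n. 1 / (real n + 1)) \<longlonglongrightarrow> 0"
    using LIMSEQ_inverse_real_of_nat by (simp only: inverse_eq_divide of_nat_Suc add.commute[of 1])
  then show "filterlim (\<lambda>n. 1 / (real n + 1)) (at_right 0) sequentially"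
    by (auto simp: filterlim_at intro!: always_eventually)
qed

lemma h_meas[measurable]: "h \<in> borel_measurable borel"
proof (rule borel_measurable_LIMSEQ_real[OF hq_seq])
  show "hq (1 / (real n + 1)) \<in> borel_measurable borel" for n by (rule hq_meas) simp
qed

lemma h_nonneg: "0 \<le> h y"
  by (rule LIMSEQ_le_const[OF hq_seq]) (intro exI[of _ 0] allI impI hq_nonneg, simp)

text \<open>\<open>hq_mean\<close> is used along \<open>q = 1 / (n + 1)\<close>. On the left the
  majorant from \<open>Hn\<close> allows dominated convergence; on the right the transform tends to
  that of \<open>occ r\<close>, with majorant \<open>occ_dom r\<close>.\<close>

lemma
  assumes r: "0 \<le> r"
  shows h_integrable: "integrable M (\<lambda>w. h (v + Z r w))"
    and h_mean: "(\<integral>w. h (v + Z r w) \<partial>M) = h v + occ r (-v)"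
proof -
  note [measurable] = Z_meas[OF r]
  define q where "q n = 1 / (real n + 1)" for n
  have q: "0 < q n" for n by (simp add: q_def)
  have qs: "q \<longlonglongrightarrow> 0" unfolding q_def using LIMSEQ_inverse_real_of_nat by (simp only: inverse_eq_divide of_nat_Suc add.commute[of 1])
  note [measurable] = hq_meas[OF q]
  define W where "W w = enn2real (ennreal (1/pi) * Hn (v + Z r w))" for w
  have fin: "(\<integral>\<^sup>+w. ennreal (1/pi) * Hn (v + Z r w) \<partial>M) < \<infinity>"
    using Hn_finite[OF r, of v] by (subst nn_integral_cmult) (auto simp: ennreal_mult_less_top)
  have ae: "AE w in M. ennreal (1/pi) * Hn (v + Z r w) \<noteq> \<infinity>"
    by (rule nn_integral_PInf_AE) (use fin in auto)
  have Wi: "integrable M W"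
  proof (rule integrableI_nonneg)
    have "(\<integral>\<^sup>+w. ennreal (W w) \<partial>M) \<le> (\<integral>\<^sup>+w. ennreal (1/pi) * Hn (v + Z r w) \<partial>M)"
      unfolding W_def
    proof (rule nn_integral_mono)
      show "ennreal (enn2real x) \<le> x" for x by (cases x) auto
    qed
    then show "(\<integral>\<^sup>+w. ennreal (W w) \<partial>M) < \<infinity>" using fin by (rule le_less_trans)
  qed (simp_all add: W_def[abs_def])
  have dom: "AE w in M. norm (hq (q n) (v + Z r w)) \<le> W w" for n
    using ae
  proof eventually_elim
    case (elim w)
    have "ennreal (hq (q n) (v + Z r w)) \<le> ennreal (W w)"
      unfolding W_def using hq_le_Hn[OF q] elim by (simp add: less_top)
    then show ?case using hq_nonneg[OF q] by (simp add: ennreal_le_iff W_def)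
  qed
  have lim: "AE w in M. (\<lambda>n. hq (q n) (v + Z r w)) \<longlonglongrightarrow> h (v + Z r w)"
    unfolding q_def using hq_seq by (intro AE_I2)
  show "integrable M (\<lambda>w. h (v + Z r w))"
    by (rule integrable_dominated_convergence[OF _ _ Wi lim dom]) measurable
  have "(\<lambda>n. \<integral>w. hq (q n) (v + Z r w) \<partial>M) \<longlonglongrightarrow> (\<integral>w. h (v + Z r w) \<partial>M)"
    by (rule integral_dominated_convergence[OF _ _ Wi lim dom]) measurable
  then have "(\<lambda>n. (\<integral>w. hq (q n) (v + Z r w) \<partial>M) - hq (q n) v) \<longlonglongrightarrow> (\<integral>w. h (v + Z r w) \<partial>M) - h v"
    unfolding q_def using hq_seq by (intro tendsto_diff)
  moreover have "(\<lambda>n. (\<integral>w. hq (q n) (v + Z r w) \<partial>M) - hq (q n) v) \<longlonglongrightarrow> occ r (-v)"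
    unfolding hq_mean[OF q r] occ_def
  proof (rule finv_tendsto[OF occ_dom_integrable[OF r]])
    have ae0: "AE u in lborel. u \<noteq> (0::real)" by (rule AE_lborel_singleton)
    show "AE u in lborel. (\<lambda>n. (1 - exp (of_real r * \<eta> u)) / (of_real (q n) - \<eta> u)) \<longlonglongrightarrow> occ_char r u"
      using ae0
    proof eventually_elim
      case (elim u)
      have "(\<lambda>n. (1 - exp (of_real r * \<eta> u)) / (of_real (q n) - \<eta> u)) \<longlonglongrightarrow> (1 - exp (of_real r * \<eta> u)) / (of_real 0 - \<eta> u)"
        using eta_nz[OF elim] by (intro tendsto_intros qs) simp
      also have "(1 - exp (of_real r * \<eta> u)) / (of_real 0 - \<eta> u) = occ_char r u"
        unfolding occ_char_eq[OF r eta_nz[OF elim]]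
        by (simp only: of_real_0 diff_0 minus_divide_right[symmetric] minus_divide_left minus_diff_eq)
      finally show ?case .
    qed
    show "AE u in lborel. norm ((1 - exp (of_real r * \<eta> u)) / (of_real (q n) - \<eta> u)) \<le> occ_dom r u" for n
      using ae0
    proof eventually_elim
      case (elim u)
      have e0: "0 < norm (\<eta> u)" using eta_nz[OF elim] by simp
      have ek: "norm (\<eta> u) \<le> norm (complex_of_real (q n) - \<eta> u)" by (rule norm_q_eta') (use q[of n] in simp)
      have "norm ((1 - exp (of_real r * \<eta> u)) / (of_real (q n) - \<eta> u)) = norm (1 - exp (of_real r * \<eta> u)) / norm (complex_of_real (q n) - \<eta> u)" by (rule norm_divide)
      also have "\<dots> \<le> norm (1 - exp (of_real r * \<eta> u)) / norm (\<eta> u)" using ek e0 by (intro divide_left_mono mult_pos_pos) auto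
      also have "\<dots> = norm (occ_char r u)" unfolding occ_char_eq[OF r eta_nz[OF elim]] by (simp add: norm_divide norm_minus_commute)
      also have "\<dots> \<le> occ_dom r u" by (rule occ_dom_bound[OF r])
      finally show ?case .
    qed
  qed auto
  ultimately have "(\<integral>w. h (v + Z r w) \<partial>M) - h v = occ r (-v)" by (rule LIMSEQ_unique)
  then show "(\<integral>w. h (v + Z r w) \<partial>M) = h v + occ r (-v)" by simp
qed

end

section \<open>Occupation averages\<close>

abbreviation "PS \<equiv> Pi\<^sub>M {0::real..} (\<lambda>_. borel :: real measure)"

text \<open>Evaluating a path along a grid from the right recovers right-continuous paths and, unlike evaluation itself,
  is jointly measurable on the whole product space, which contains very irregular functions.\<close>

definition rgrid :: "nat \<Rightarrow> real \<Rightarrow> real" where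
  "rgrid n r = max 0 (real_of_int \<lceil>max 0 r * (real n + 1)\<rceil> / (real n + 1))"

definition rg :: "(real \<Rightarrow> real) \<Rightarrow> real \<Rightarrow> real" where
  "rg p r = lim (\<lambda>n. p (rgrid n r))"

definition rcont :: "(real \<Rightarrow> real) \<Rightarrow> bool" where
  "rcont p \<longleftrightarrow> (\<forall>r\<ge>0. (p \<longlongrightarrow> p r) (at_right r))"

lemma rgrid_ge: "max 0 r \<le> rgrid n r"
proof -
  have "max 0 r \<le> real_of_int \<lceil>max 0 r * (real n + 1)\<rceil> / (real n + 1)"
    by (subst pos_le_divide_eq) auto
  then show ?thesis unfolding rgrid_def by (rule max.coboundedI2)
qed

lemma rgrid_le: "rgrid n r \<le> max 0 r + 1 / (real n + 1)"
proof -
  let ?r = "max 0 r"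
  have "real_of_int \<lceil>?r * (real n + 1)\<rceil> \<le> ?r * (real n + 1) + 1" by linarith
  then have "real_of_int \<lceil>?r * (real n + 1)\<rceil> / (real n + 1) \<le> (?r * (real n + 1) + 1) / (real n + 1)"
    by (intro divide_right_mono) auto
  also have "\<dots> = ?r + 1 / (real n + 1)" by (simp add: add_divide_distrib)
  finally have a: "real_of_int \<lceil>?r * (real n + 1)\<rceil> / (real n + 1) \<le> ?r + 1 / (real n + 1)" .
  have "0 \<le> ?r + 1 / (real n + 1)" by (rule add_nonneg_nonneg) auto
  then show ?thesis unfolding rgrid_def using a by (rule max.boundedI)
qed

lemma rgrid_tendsto: "(\<lambda>n. rgrid n r) \<longlonglongrightarrow> max 0 r"
proof (rule tendsto_sandwich)
  show "\<forall>\<^sub>F n in sequentially. max 0 r \<le> rgrid n r" using rgrid_ge by (intro always_eventually allI)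
  show "\<forall>\<^sub>F n in sequentially. rgrid n r \<le> max 0 r + 1 / (real n + 1)" using rgrid_le by (intro always_eventually allI)
  have "(\<lambda>n. max 0 r + 1 / (real n + 1)) \<longlonglongrightarrow> max 0 r + 0"
    using LIMSEQ_inverse_real_of_nat by (intro tendsto_add tendsto_const) (simp only: inverse_eq_divide add.commute[of 1] of_nat_Suc)
  then show "(\<lambda>n. max 0 r + 1 / (real n + 1)) \<longlonglongrightarrow> max 0 r" by simp
qed simp

lemma rg_eq: assumes "rcont p" shows "rg p r = p (max 0 r)"
  unfolding rg_def
proof (rule limI, rule tendsto_right_seq[where f=p and a="\<lambda>n. rgrid n r"])
  show "(p \<longlongrightarrow> p (max 0 r)) (at_right (max 0 r))" using assms by (simp add: rcont_def)
qed (use rgrid_ge rgrid_tendsto in auto)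

lemma rg_meas[measurable]: "(\<lambda>(p, r). rg p r) \<in> borel_measurable (PS \<Otimes>\<^sub>M borel)"
proof -
  have "(\<lambda>x. lim (\<lambda>n. fst x (rgrid n (snd x)))) \<in> borel_measurable (PS \<Otimes>\<^sub>M (borel :: real measure))"
  proof (rule borel_measurable_lim_metric)
    fix n :: nat
    show "(\<lambda>x. fst x (rgrid n (snd x))) \<in> borel_measurable (PS \<Otimes>\<^sub>M (borel :: real measure))"
      unfolding rgrid_def
    proof (rule measurable_compose_countable[where f="\<lambda>i x. fst x (max 0 (real_of_int i / (real n + 1)))"])
      fix i :: int
      have [measurable]: "(\<lambda>p. p (max 0 (real_of_int i / (real n + 1)))) \<in> borel_measurable PS"
        by (intro measurable_component_singleton) auto
      show "(\<lambda>x. fst x (max 0 (real_of_int i / (real n + 1)))) \<in> borel_measurable (PS \<Otimes>\<^sub>M (borel :: real measure))"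
        by measurable
    qed measurable
  qed
  then show ?thesis by (simp add: rg_def case_prod_beta)
qed

definition AF :: "(real \<Rightarrow> ennreal) \<Rightarrow> real \<Rightarrow> (real \<Rightarrow> real) \<Rightarrow> ennreal" where
  "AF f t p = (\<integral>\<^sup>+r. f (rg p r) * indicator {0..t} r \<partial>lborel)"

text \<open>The integrand carries a parameter because the Markov property is later applied with a
  level that depends on the past.\<close>

lemma AF_meas_gen:
  assumes [measurable]: "(\<lambda>(v, y). g v y) \<in> borel_measurable (N \<Otimes>\<^sub>M borel)"
  shows "(\<lambda>(v, p). AF (g v) t p) \<in> borel_measurable (N \<Otimes>\<^sub>M PS)"
proof -
  have r: "(\<lambda>x. rg (snd (fst x)) (snd x)) \<in> borel_measurable ((N \<Otimes>\<^sub>M PS) \<Otimes>\<^sub>M borel)"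
    using measurable_compose[OF _ rg_meas, of "\<lambda>x. (snd (fst x), snd x)" "(N \<Otimes>\<^sub>M PS) \<Otimes>\<^sub>M borel"] by simp
  have "(\<lambda>x. g (fst (fst x)) (rg (snd (fst x)) (snd x))) \<in> borel_measurable ((N \<Otimes>\<^sub>M PS) \<Otimes>\<^sub>M borel)"
    using measurable_compose[OF _ assms, of "\<lambda>x. (fst (fst x), rg (snd (fst x)) (snd x))" "(N \<Otimes>\<^sub>M PS) \<Otimes>\<^sub>M borel"] r by simp
  then have "(\<lambda>(x, r). g (fst x) (rg (snd x) r) * indicator {0..t} r) \<in> borel_measurable ((N \<Otimes>\<^sub>M PS) \<Otimes>\<^sub>M lborel)"
    unfolding case_prod_beta by (simp cong: measurable_cong_sets sets_pair_measure_cong)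
  from lborel.borel_measurable_nn_integral_fst[OF this] show ?thesis
    unfolding AF_def by (simp add: case_prod_beta)
qed

lemma AF_meas: "f \<in> borel_measurable borel \<Longrightarrow> AF f t \<in> borel_measurable PS"
proof -
  assume [measurable]: "f \<in> borel_measurable borel"
  have "(\<lambda>(v::unit, y). f y) \<in> borel_measurable (count_space UNIV \<Otimes>\<^sub>M borel)" by measurable
  from measurable_compose[OF _ AF_meas_gen[OF this, of t], of "\<lambda>p. ((), p)" PS] show ?thesis by simp
qed

text \<open>The open window of \<open>local_time\<close>, normalised so that for
  \<open>e > 0\<close> its integral is 1 in the position as well as in the level.\<close>

definition fe :: "real \<Rightarrow> real \<Rightarrow> real \<Rightarrow> ennreal" where
  "fe e x y = ennreal (1/(2*e)) * indicator {x-e<..<x+e} y"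

lemma fe_meas[measurable]: "fe e x \<in> borel_measurable borel"
  unfolding fe_def[abs_def] by measurable

lemma fe_meas2[measurable]: "(\<lambda>(x, y). fe e x y) \<in> borel_measurable (borel \<Otimes>\<^sub>M borel)"
proof -
  have "(\<lambda>(x, y). fe e x y) = (\<lambda>z. ennreal (1/(2*e)) * indicator {z. fst z - e < snd z \<and> snd z < fst z + e} z)"
    by (auto simp: fun_eq_iff fe_def indicator_def)
  also have "\<dots> \<in> borel_measurable (borel \<Otimes>\<^sub>M borel)" by measurable
  finally show ?thesis .
qed

lemma fe_shift: "fe e x (v + y) = fe e (x - v) y"
  by (auto simp: fe_def indicator_def)

definition avg :: "real \<Rightarrow> real \<Rightarrow> real \<Rightarrow> (real \<Rightarrow> real) \<Rightarrow> ennreal" where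
  "avg e x t p = AF (fe e x) t p"

lemma avg_meas2[measurable]: "(\<lambda>(x, p). avg e x t p) \<in> borel_measurable (borel \<Otimes>\<^sub>M PS)"
  unfolding avg_def by (rule AF_meas_gen[OF fe_meas2])

lemma avg_meas[measurable]: "avg e x t \<in> borel_measurable PS"
  unfolding avg_def by (rule AF_meas[OF fe_meas])

lemma avg_le: assumes "0 < e" "0 \<le> t" shows "avg e x t p \<le> ennreal (t / (2*e))"
proof -
  have "avg e x t p \<le> (\<integral>\<^sup>+r. ennreal (1/(2*e)) * indicator {0..t} r \<partial>lborel)"
    unfolding avg_def AF_def fe_def by (intro nn_integral_mono) (auto simp: indicator_def)
  also have "\<dots> = ennreal (1/(2*e)) * ennreal t" using assms by (subst nn_integral_cmult_indicator) auto
  also have "\<dots> = ennreal (t / (2*e))" using assms by (subst ennreal_mult[symmetric]) auto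
  finally show ?thesis .
qed

lemma avg_finite: assumes "0 < e" "0 \<le> t" shows "avg e x t p < \<infinity>"
  using avg_le[OF assms, of x p] by (rule le_less_trans) simp

definition ar :: "real \<Rightarrow> real \<Rightarrow> real \<Rightarrow> (real \<Rightarrow> real) \<Rightarrow> real" where
  "ar e x t p = enn2real (avg e x t p)"

lemma ar_avg: "0 < e \<Longrightarrow> 0 \<le> t \<Longrightarrow> ennreal (ar e x t p) = avg e x t p"
  using avg_finite[of e t x p] by (simp add: ar_def)

lemma ar_nonneg: "0 \<le> ar e x t p" by (simp add: ar_def)

lemma ar_le: assumes "0 < e" "0 \<le> t" shows "ar e x t p \<le> t / (2*e)"
  using avg_le[OF assms, of x p] assms ar_avg[OF assms, of x p] by (metis ennreal_le_iff divide_nonneg_nonneg mult_nonneg_nonneg less_imp_le zero_le_numeral)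

lemma ar_meas2[measurable]: "(\<lambda>(x, p). ar e x t p) \<in> borel_measurable (borel \<Otimes>\<^sub>M PS)"
  using measurable_compose[OF avg_meas2 borel_measurable_enn2real] unfolding ar_def by (simp add: case_prod_beta)

lemma ar_meas[measurable]: "ar e x t \<in> borel_measurable PS"
  unfolding ar_def[abs_def] by measurable

context levy0 begin

lemma path_rcont: assumes "w \<in> space M" "0 \<le> s" shows "rcont (path s w)"
  unfolding rcont_def
proof (intro allI impI)
  fix r :: real assume r: "0 \<le> r"
  have "((\<lambda>u. Z u w) \<longlongrightarrow> Z (s + r) w) (at_right (s + r))" using assms r by (intro Z_right) auto
  then have "((\<lambda>u. Z (s + u) w) \<longlongrightarrow> Z (s + r) w) (at_right r)"
    unfolding filterlim_at_right_to_0[of _ _ "s + r"] filterlim_at_right_to_0[of _ _ "r"] by (simp add: add_ac)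
  then have "((\<lambda>u. Z (s + u) w - Z s w) \<longlongrightarrow> path s w r) (at_right r)"
    using r unfolding path_def by (auto intro!: tendsto_intros)
  then show "(path s w \<longlongrightarrow> path s w r) (at_right r)"
  proof (rule Lim_transform_eventually)
    show "\<forall>\<^sub>F u in at_right r. Z (s + u) w - Z s w = path s w u"
      unfolding eventually_at_filter using r by (intro always_eventually) (auto simp: path_def)
  qed
qed

lemma rg_path: "w \<in> space M \<Longrightarrow> 0 \<le> s \<Longrightarrow> rg (path s w) r = Z (s + max 0 r) w - Z s w"
  unfolding rg_eq[OF path_rcont] by (simp add: path_def)

text \<open>\<open>Z\<close> shifted to start at 0 at every outcome, so that it agrees with
  \<open>path 0\<close> at all nonnegative times; it stays adapted, since \<open>Z 0\<close> is
  known from the beginning.\<close>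

definition Y :: "real \<Rightarrow> 'w \<Rightarrow> real" where "Y s w = Z s w - Z 0 w"

lemma Y_Fil: "0 \<le> s \<Longrightarrow> Y s \<in> borel_measurable (Fil s)"
  unfolding Y_def[abs_def] by (intro borel_measurable_diff Z_Fil) auto

lemma Y_meas[measurable]: "0 \<le> s \<Longrightarrow> Y s \<in> borel_measurable M"
  unfolding Y_def[abs_def] by (intro borel_measurable_diff Z_meas) auto

lemma Y_ae: "0 \<le> s \<Longrightarrow> AE w in M. Y s w = Z s w"
  using Z_0 by eventually_elim (simp add: Y_def)

lemma Y_joint[measurable]: "(\<lambda>(s,w). Y (max 0 s) w) \<in> borel_measurable (borel \<Otimes>\<^sub>M M)"
proof -
  have [measurable]: "Z 0 \<in> borel_measurable M" by simp
  have [measurable]: "(\<lambda>x. Z (max 0 (fst x)) (snd x)) \<in> borel_measurable (borel \<Otimes>\<^sub>M M)"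
    using joint_meas by (simp add: case_prod_beta)
  show ?thesis unfolding Y_def case_prod_beta by measurable
qed

lemma rg_path0: "w \<in> space M \<Longrightarrow> rg (path 0 w) r = Y (max 0 r) w"
  using rg_path[of w 0 r] by (simp add: Y_def)

lemma AF_path0: "w \<in> space M \<Longrightarrow> AF f t (path 0 w) = (\<integral>\<^sup>+r. f (Y r w) * indicator {0..t} r \<partial>lborel)"
  unfolding AF_def by (intro nn_integral_cong) (simp add: rg_path0 indicator_def)

lemma AF_path_shift:
  assumes w: "w \<in> space M" and s: "0 \<le> s" and f[measurable]: "f \<in> borel_measurable borel"
  shows "AF (\<lambda>y. f (Y s w + y)) u (path s w) = (\<integral>\<^sup>+r. f (Y r w) * indicator {s..s+u} r \<partial>lborel)"
proof -
  have [measurable]: "(\<lambda>r. Y (max 0 r) w) \<in> borel_measurable borel"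
    using measurable_compose[OF _ Y_joint, of "\<lambda>r. (r, w)" borel] w by simp
  have "(\<integral>\<^sup>+r. f (Y r w) * indicator {s..s+u} r \<partial>lborel) = (\<integral>\<^sup>+r. f (Y (max 0 r) w) * indicator {s..s+u} r \<partial>lborel)"
    using s by (intro nn_integral_cong) (auto simp: indicator_def)
  also have "\<dots> = (\<integral>\<^sup>+r. f (Y (max 0 (s + 1 * r)) w) * indicator {s..s+u} (s + 1 * r) \<partial>lborel)"
    by (subst nn_integral_real_affine[where c=1 and t=s]) auto
  also have "\<dots> = AF (\<lambda>y. f (Y s w + y)) u (path s w)"
    unfolding AF_def using s w by (intro nn_integral_cong) (auto simp: indicator_def rg_path Y_def)
  finally show ?thesis ..
qed

text \<open>The second period is seen from the position at time \<open>s\<close>, so the level is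
  lowered by \<open>Y s w\<close>; counting the common time \<open>s\<close> twice costs nothing, as
  it is a null set.\<close>

lemma avg_split:
  assumes w: "w \<in> space M" and s: "0 \<le> s" and t: "0 \<le> t"
  shows "avg e x (s + t) (path 0 w) = avg e x s (path 0 w) + avg e (x - Y s w) t (path s w)"
proof -
  have [measurable]: "(\<lambda>r. Y (max 0 r) w) \<in> borel_measurable borel"
    using measurable_compose[OF _ Y_joint, of "\<lambda>r. (r, w)" borel] w by simp
  have "avg e (x - Y s w) t (path s w) = (\<integral>\<^sup>+r. fe e x (Y r w) * indicator {s..s+t} r \<partial>lborel)"
    unfolding avg_def using AF_path_shift[OF w s fe_meas[of e x], of t] by (simp add: fe_shift)
  also have "\<dots> = (\<integral>\<^sup>+r. fe e x (Y (max 0 r) w) * indicator {s..s+t} r \<partial>lborel)"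
    using s by (intro nn_integral_cong) (auto simp: indicator_def)
  finally have a: "avg e (x - Y s w) t (path s w) = (\<integral>\<^sup>+r. fe e x (Y (max 0 r) w) * indicator {s..s+t} r \<partial>lborel)" .
  have b: "avg e x t (path 0 w) = (\<integral>\<^sup>+r. fe e x (Y (max 0 r) w) * indicator {0..t} r \<partial>lborel)" for t
    unfolding avg_def AF_def using w by (intro nn_integral_cong) (simp add: rg_path0)
  show ?thesis unfolding a b
  proof (subst nn_integral_add[symmetric])
    have "AE r in lborel. r \<noteq> s" by (rule AE_lborel_singleton)
    then show "(\<integral>\<^sup>+r. fe e x (Y (max 0 r) w) * indicator {0..s+t} r \<partial>lborel) =
      (\<integral>\<^sup>+r. fe e x (Y (max 0 r) w) * indicator {0..s} r + fe e x (Y (max 0 r) w) * indicator {s..s+t} r \<partial>lborel)"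
      by (intro nn_integral_cong_AE, elim eventually_mono) (use s t in \<open>auto simp: indicator_def\<close>)
  qed measurable
qed

end

context levy_sym begin

text \<open>The mean of the additive functional of \<open>g\<close> up to time \<open>r\<close> for
  the process started at \<open>v\<close>, written with the occupation density; see
  \<open>AF_mean\<close>.\<close>

definition GF :: "real \<Rightarrow> (real \<Rightarrow> ennreal) \<Rightarrow> real \<Rightarrow> ennreal" where
  "GF r g v = (\<integral>\<^sup>+z. ennreal (occ r z) * g (v + z) \<partial>lborel)"

lemma AF_mean:
  assumes s: "0 \<le> s" and g[measurable]: "g \<in> borel_measurable borel"
  shows "(\<integral>\<^sup>+w. AF (\<lambda>y. g (v + y)) s (path 0 w) \<partial>M) = GF s g v"
proof (cases "s = 0")
  case True
  have "AF (\<lambda>y. g (v + y)) 0 p = 0" for p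
  proof -
    have "AE r in lborel. r \<noteq> (0::real)" by (rule AE_lborel_singleton)
    then have "AE r in lborel. g (v + rg p r) * indicator {0..0} r = 0" by eventually_elim simp
    then have "AF (\<lambda>y. g (v + y)) 0 p = (\<integral>\<^sup>+r. 0 \<partial>(lborel::real measure))" unfolding AF_def by (rule nn_integral_cong_AE)
    then show ?thesis by simp
  qed
  then show ?thesis using True by (simp add: GF_def occ_0)
next
  case False
  then have t0: "0 < s" using s by simp
  interpret MLb: pair_sigma_finite M lborel ..
  have m: "(\<lambda>(w,r). g (v + Z (max 0 r) w) * indicator {0..s} r) \<in> borel_measurable (M \<Otimes>\<^sub>M lborel)"
  proof -
    have [measurable]: "(\<lambda>x. Z (max 0 (snd x)) (fst x)) \<in> borel_measurable (M \<Otimes>\<^sub>M lborel)"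
      using measurable_compose[OF _ joint_meas, of "\<lambda>x. (snd x, fst x)" "M \<Otimes>\<^sub>M lborel"] by simp
    show ?thesis unfolding case_prod_beta by measurable
  qed
  have "(\<integral>\<^sup>+w. AF (\<lambda>y. g (v + y)) s (path 0 w) \<partial>M) = (\<integral>\<^sup>+w. (\<integral>\<^sup>+r. g (v + Z (max 0 r) w) * indicator {0..s} r \<partial>lborel) \<partial>M)"
  proof (rule nn_integral_cong_AE)
    have "AE w in M. Z 0 w = 0 \<and> w \<in> space M" using Z_0 by simp
    then show "AE w in M. AF (\<lambda>y. g (v + y)) s (path 0 w) = (\<integral>\<^sup>+r. g (v + Z (max 0 r) w) * indicator {0..s} r \<partial>lborel)"
      by eventually_elim (simp add: AF_def rg_path)
  qed
  also have "\<dots> = (\<integral>\<^sup>+r. (\<integral>\<^sup>+w. g (v + Z (max 0 r) w) * indicator {0..s} r \<partial>M) \<partial>lborel)"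
    using MLb.Fubini'[OF m] by simp
  also have "\<dots> = (\<integral>\<^sup>+r. indicator {0..s} r * (\<integral>\<^sup>+w. g (v + Z (max 0 r) w) \<partial>M) \<partial>lborel)"
    by (intro nn_integral_cong) (auto simp: indicator_def)
  also have "\<dots> = GF s g v" unfolding GF_def using occ_density'[OF t0, of "\<lambda>z. g (v + z)"] by simp
  finally show ?thesis .
qed

lemma AF_markov:
  assumes s: "0 \<le> s" and u: "0 \<le> u" and g[measurable]: "g \<in> borel_measurable borel"
    and U[measurable]: "U \<in> borel_measurable (Fil s)"
  shows "(\<integral>\<^sup>+w. U w * (\<integral>\<^sup>+r. g (Y r w) * indicator {s..s+u} r \<partial>lborel) \<partial>M) = (\<integral>\<^sup>+w. U w * GF u g (Y s w) \<partial>M)"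
proof -
  note [measurable] = Y_Fil[OF s]
  have am: "(\<lambda>(v, p). AF (\<lambda>y. g (v + y)) u p) \<in> borel_measurable (borel \<Otimes>\<^sub>M PS)"
    by (rule AF_meas_gen) measurable
  have [measurable]: "(\<lambda>x. AF (\<lambda>y. g (Y s (fst x) + y)) u (snd x)) \<in> borel_measurable (Fil s \<Otimes>\<^sub>M PS)"
    using measurable_compose[OF _ am, of "\<lambda>x. (Y s (fst x), snd x)" "Fil s \<Otimes>\<^sub>M PS"] by simp
  have "(\<integral>\<^sup>+w. U w * (\<integral>\<^sup>+r. g (Y r w) * indicator {s..s+u} r \<partial>lborel) \<partial>M) =
    (\<integral>\<^sup>+w. (\<lambda>(w, p). U w * AF (\<lambda>y. g (Y s w + y)) u p) (w, path s w) \<partial>M)"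
    by (intro nn_integral_cong) (simp add: AF_path_shift[OF _ s])
  also have "\<dots> = (\<integral>\<^sup>+w. (\<integral>\<^sup>+w'. (\<lambda>(w, p). U w * AF (\<lambda>y. g (Y s w + y)) u p) (w, path 0 w') \<partial>M) \<partial>M)"
    by (rule markov_nn[OF s]) measurable
  also have "\<dots> = (\<integral>\<^sup>+w. U w * GF u g (Y s w) \<partial>M)"
  proof (rule nn_integral_cong)
    fix w
    have "(\<lambda>w'. AF (\<lambda>y. g (Y s w + y)) u (path 0 w')) \<in> borel_measurable M"
      by (rule measurable_compose[OF path_meas[OF order_refl] AF_meas]) measurable
    then show "(\<integral>\<^sup>+w'. (\<lambda>(w, p). U w * AF (\<lambda>y. g (Y s w + y)) u p) (w, path 0 w') \<partial>M) = U w * GF u g (Y s w)"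
      using AF_mean[OF u g, of "Y s w"] by (simp add: nn_integral_cmult)
  qed
  finally show ?thesis .
qed

lemma GF_fe_le: assumes e: "0 < e" and r: "0 \<le> r" and c: "\<And>z. \<bar>v + z - x\<bar> < e \<Longrightarrow> occ r z \<le> c" and c0: "0 \<le> c"
  shows "GF r (fe e x) v \<le> ennreal c"
proof -
  have "GF r (fe e x) v \<le> (\<integral>\<^sup>+z. ennreal (c / (2*e)) * indicator {x-v-e<..<x-v+e} z \<partial>lborel)"
    unfolding GF_def
  proof (rule nn_integral_mono)
    fix z
    show "ennreal (occ r z) * fe e x (v + z) \<le> ennreal (c / (2*e)) * indicator {x-v-e<..<x-v+e} z"
    proof (cases "z \<in> {x-v-e<..<x-v+e}")
      case True
      then have "\<bar>v + z - x\<bar> < e" by (simp add: abs_less_iff)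
      from c[OF this] have "occ r z * (1/(2*e)) \<le> c * (1/(2*e))" using e by (intro mult_right_mono) auto
      then have "ennreal (occ r z * (1/(2*e))) \<le> ennreal (c / (2*e))" by (intro ennreal_leI) simp
      moreover have "ennreal (occ r z * (1/(2*e))) = ennreal (occ r z) * ennreal (1/(2*e))"
        using occ_nonneg[OF r, of z] e by (intro ennreal_mult) auto
      ultimately show ?thesis using True by (simp add: fe_def)
    next
      case False then show ?thesis by (auto simp: fe_def indicator_def)
    qed
  qed
  also have "\<dots> = ennreal (c / (2*e)) * ennreal (2*e)" using e by (subst nn_integral_cmult_indicator) auto
  also have "\<dots> = ennreal c" using e c0 by (subst ennreal_mult[symmetric]) auto
  finally show ?thesis .
qed

lemma GF_fe_ge: assumes e: "0 < e" and r: "0 \<le> r" and c: "\<And>z. \<bar>v + z - x\<bar> < e \<Longrightarrow> c \<le> occ r z" and c0: "0 \<le> c"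
  shows "ennreal c \<le> GF r (fe e x) v"
proof -
  have "ennreal c = ennreal (c / (2*e)) * ennreal (2*e)" using e c0 by (subst ennreal_mult[symmetric]) auto
  also have "\<dots> = (\<integral>\<^sup>+z. ennreal (c / (2*e)) * indicator {x-v-e<..<x-v+e} z \<partial>lborel)"
    using e by (subst nn_integral_cmult_indicator) auto
  also have "\<dots> \<le> GF r (fe e x) v" unfolding GF_def
  proof (rule nn_integral_mono)
    fix z
    show "ennreal (c / (2*e)) * indicator {x-v-e<..<x-v+e} z \<le> ennreal (occ r z) * fe e x (v + z)"
    proof (cases "z \<in> {x-v-e<..<x-v+e}")
      case True
      then have "\<bar>v + z - x\<bar> < e" by (simp add: abs_less_iff)
      from c[OF this] have "c * (1/(2*e)) \<le> occ r z * (1/(2*e))" using e by (intro mult_right_mono) auto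
      then have "ennreal (c / (2*e)) \<le> ennreal (occ r z * (1/(2*e)))" by (intro ennreal_leI) simp
      moreover have "ennreal (occ r z * (1/(2*e))) = ennreal (occ r z) * ennreal (1/(2*e))"
        using occ_nonneg[OF r, of z] e by (intro ennreal_mult) auto
      moreover have "v + z \<in> {x-e<..<x+e}" using True by auto
      ultimately show ?thesis using True by (simp add: fe_def)
    qed simp
  qed
  finally show ?thesis .
qed

lemma GF_fe_sup: "0 < e \<Longrightarrow> 0 \<le> r \<Longrightarrow> GF r (fe e x) v \<le> ennreal (occ_sup r)"
  using occ_le_sup[of r] occ_sup_nonneg[of r] by (intro GF_fe_le) (auto intro: order_trans[OF abs_ge_self])

lemma avg_mean: "0 \<le> t \<Longrightarrow> (\<integral>\<^sup>+w. avg e x t (path 0 w) \<partial>M) = GF t (fe e x) 0"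
  using AF_mean[of t "fe e x" 0] by (simp add: avg_def)

text \<open>Ordered pairs of visits: \<open>f\<close> at time \<open>s\<close> and \<open>g\<close>
  later, up to time \<open>T\<close>. By the Markov property the later visit may be averaged first,
  see \<open>PF_eq\<close>.\<close>

definition PF :: "(real \<Rightarrow> ennreal) \<Rightarrow> (real \<Rightarrow> ennreal) \<Rightarrow> real \<Rightarrow> real \<Rightarrow> real \<Rightarrow> ennreal" where
  "PF f g r T s = (\<integral>\<^sup>+w. f (Y s w) * (\<integral>\<^sup>+u. g (Y u w) * indicator {s..T} u \<partial>lborel) \<partial>M)"

lemma PF_eq:
  assumes s: "0 \<le> s" "s \<le> T" and [measurable]: "f \<in> borel_measurable borel" "g \<in> borel_measurable borel"
  shows "PF f g r T s = (\<integral>\<^sup>+w. f (Y s w) * GF (T - s) g (Y s w) \<partial>M)"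
proof -
  note [measurable] = Y_Fil[OF s(1)]
  show ?thesis unfolding PF_def using AF_markov[OF s(1), of "T - s" g "\<lambda>w. f (Y s w)"] s by simp
qed

text \<open>A product of two time integrals splits according to which time comes first. If
  \<open>g\<close> comes first, its time is automatically at most \<open>r\<close>, so that term
  runs over \<open>{0..r}\<close> only; the diagonal has measure 0.\<close>

lemma pair_formula:
  assumes r: "0 \<le> r" "r \<le> T" and f[measurable]: "f \<in> borel_measurable borel" and g[measurable]: "g \<in> borel_measurable borel"
  shows "(\<integral>\<^sup>+w. AF f r (path 0 w) * AF g T (path 0 w) \<partial>M) =
     (\<integral>\<^sup>+s. indicator {0..r} s * PF f g r T s \<partial>lborel) + (\<integral>\<^sup>+s. indicator {0..r} s * PF g f r r s \<partial>lborel)"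
proof -
  interpret MLb: pair_sigma_finite M lborel ..
  have Ym[measurable]: "(\<lambda>r. Y (max 0 r) w) \<in> borel_measurable borel" if "w \<in> space M" for w
    using measurable_compose[OF _ Y_joint, of "\<lambda>r. (r, w)" borel] that by simp
  have Y2[measurable]: "(\<lambda>x. Y (max 0 (snd x)) (fst x)) \<in> borel_measurable (M \<Otimes>\<^sub>M lborel)"
    using measurable_compose[OF _ Y_joint, of "\<lambda>x. (snd x, fst x)" "M \<Otimes>\<^sub>M lborel"] by simp
  have Y3[measurable]: "(\<lambda>x. Y (max 0 (snd x)) (fst (fst x))) \<in> borel_measurable ((M \<Otimes>\<^sub>M lborel) \<Otimes>\<^sub>M lborel)"
    using measurable_compose[OF _ Y_joint, of "\<lambda>x. (snd x, fst (fst x))" "(M \<Otimes>\<^sub>M lborel) \<Otimes>\<^sub>M lborel"] by simp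
  have ind2: "(\<lambda>x. indicator {snd (fst x)..t} (snd x) :: ennreal) \<in> borel_measurable ((M \<Otimes>\<^sub>M lborel) \<Otimes>\<^sub>M lborel)" for t :: real
  proof -
    have eq: "(\<lambda>x :: ('w \<times> real) \<times> real. indicator {snd (fst x)..t} (snd x) :: ennreal) = (\<lambda>x. if snd (fst x) \<le> snd x \<and> snd x \<le> t then 1 else 0)"
      by (auto simp: fun_eq_iff indicator_def)
    show ?thesis unfolding eq by measurable
  qed
  define J where "J f g r t w = (\<integral>\<^sup>+s. indicator {0..r} s * (f (Y (max 0 s) w) * (\<integral>\<^sup>+u. g (Y (max 0 u) w) * indicator {s..t} u \<partial>lborel)) \<partial>lborel)"
    for f g :: "real \<Rightarrow> ennreal" and r t :: real and w
  have inner: "(\<lambda>x. \<integral>\<^sup>+u. g (Y (max 0 u) (fst x)) * indicator {snd x..t} u \<partial>lborel) \<in> borel_measurable (M \<Otimes>\<^sub>M lborel)"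
    if [measurable]: "g \<in> borel_measurable borel" for g :: "real \<Rightarrow> ennreal" and t
  proof -
    note [measurable] = ind2
    have "(\<lambda>(x,u). g (Y (max 0 u) (fst x)) * indicator {snd x..t} u) \<in> borel_measurable ((M \<Otimes>\<^sub>M lborel) \<Otimes>\<^sub>M lborel)"
      unfolding case_prod_beta by measurable
    from lborel.borel_measurable_nn_integral_fst[OF this] show ?thesis by simp
  qed
  have EJ: "(\<integral>\<^sup>+w. J f g r t w \<partial>M) = (\<integral>\<^sup>+s. indicator {0..r} s * PF f g r' t s \<partial>lborel)"
    and Jm: "J f g r t \<in> borel_measurable M"
    if [measurable]: "f \<in> borel_measurable borel" "g \<in> borel_measurable borel" for f g :: "real \<Rightarrow> ennreal" and r r' t
  proof -
    note [measurable] = inner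
    have m: "(\<lambda>(w,s). indicator {0..r} s * (f (Y (max 0 s) w) * (\<integral>\<^sup>+u. g (Y (max 0 u) w) * indicator {s..t} u \<partial>lborel))) \<in> borel_measurable (M \<Otimes>\<^sub>M lborel)"
      unfolding case_prod_beta by measurable
    show "J f g r t \<in> borel_measurable M" unfolding J_def[abs_def] using lborel.borel_measurable_nn_integral_fst[OF m] by simp
    have "(\<integral>\<^sup>+w. J f g r t w \<partial>M) = (\<integral>\<^sup>+s. (\<integral>\<^sup>+w. indicator {0..r} s * (f (Y (max 0 s) w) * (\<integral>\<^sup>+u. g (Y (max 0 u) w) * indicator {s..t} u \<partial>lborel)) \<partial>M) \<partial>lborel)"
      unfolding J_def using MLb.Fubini'[OF m] by simp
    also have "\<dots> = (\<integral>\<^sup>+s. indicator {0..r} s * PF f g r' t s \<partial>lborel)"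
    proof (rule nn_integral_cong)
      fix s :: real
      show "(\<integral>\<^sup>+w. indicator {0..r} s * (f (Y (max 0 s) w) * (\<integral>\<^sup>+u. g (Y (max 0 u) w) * indicator {s..t} u \<partial>lborel)) \<partial>M) = indicator {0..r} s * PF f g r' t s"
      proof (cases "s \<in> {0..r}")
        case True
        have "g (Y (max 0 u) w) * indicator {s..t} u = g (Y u w) * indicator {s..t} u" for u w
          using True by (auto simp: indicator_def)
        then show ?thesis using True by (simp add: PF_def)
      qed simp
    qed
    finally show "(\<integral>\<^sup>+w. J f g r t w \<partial>M) = (\<integral>\<^sup>+s. indicator {0..r} s * PF f g r' t s \<partial>lborel)" .
  qed
  have "AF f r (path 0 w) * AF g T (path 0 w) = J f g r T w + J g f r r w" if w: "w \<in> space M" for w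
  proof -
    let ?F = "\<lambda>s. f (Y (max 0 s) w)" and ?G = "\<lambda>s. g (Y (max 0 s) w)"
    have [measurable]: "?F \<in> borel_measurable borel" "?G \<in> borel_measurable borel" using Ym[OF w] by measurable
    have [measurable]: "(\<lambda>x :: real \<times> real. indicator {fst x..t} (snd x) :: ennreal) \<in> borel_measurable (lborel \<Otimes>\<^sub>M lborel)" for t
    proof -
      have eq: "(\<lambda>x :: real \<times> real. indicator {fst x..t} (snd x) :: ennreal) = (\<lambda>x. if fst x \<le> snd x \<and> snd x \<le> t then 1 else 0)"
        by (auto simp: fun_eq_iff indicator_def)
      show ?thesis unfolding eq by measurable
    qed
    have [measurable]: "(\<lambda>x :: real \<times> real. indicator {..<fst x} (snd x) :: ennreal) \<in> borel_measurable (lborel \<Otimes>\<^sub>M lborel)"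
    proof -
      have eq: "(\<lambda>x :: real \<times> real. indicator {..<fst x} (snd x) :: ennreal) = (\<lambda>x. if snd x < fst x then 1 else 0)"
        by (auto simp: fun_eq_iff indicator_def)
      show ?thesis unfolding eq by measurable
    qed
    have "AF f r (path 0 w) * AF g T (path 0 w) = (\<integral>\<^sup>+s. ?F s * indicator {0..r} s * (\<integral>\<^sup>+u. ?G u * indicator {0..T} u \<partial>lborel) \<partial>lborel)"
      unfolding AF_def rg_path0[OF w] by (rule nn_integral_multc[symmetric]) measurable
    also have "\<dots> = (\<integral>\<^sup>+s. indicator {0..r} s * (?F s * (\<integral>\<^sup>+u. ?G u * indicator {s..T} u \<partial>lborel)) +
          (\<integral>\<^sup>+u. indicator {0..r} s * ?F s * (indicator {0..r} u * ?G u * indicator {..<s} u) \<partial>lborel) \<partial>lborel)"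
    proof (rule nn_integral_cong)
      fix s :: real
      show "?F s * indicator {0..r} s * (\<integral>\<^sup>+u. ?G u * indicator {0..T} u \<partial>lborel) =
        indicator {0..r} s * (?F s * (\<integral>\<^sup>+u. ?G u * indicator {s..T} u \<partial>lborel)) +
          (\<integral>\<^sup>+u. indicator {0..r} s * ?F s * (indicator {0..r} u * ?G u * indicator {..<s} u) \<partial>lborel)"
      proof (cases "s \<in> {0..r}")
        case True
        have "(\<integral>\<^sup>+u. ?G u * indicator {0..T} u \<partial>lborel) = (\<integral>\<^sup>+u. ?G u * indicator {s..T} u + indicator {0..r} u * ?G u * indicator {..<s} u \<partial>lborel)"
          using True r by (intro nn_integral_cong) (auto simp: indicator_def)
        also have "\<dots> = (\<integral>\<^sup>+u. ?G u * indicator {s..T} u \<partial>lborel) + (\<integral>\<^sup>+u. indicator {0..r} u * ?G u * indicator {..<s} u \<partial>lborel)"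
          by (rule nn_integral_add) measurable
        finally show ?thesis using True by (simp add: distrib_left nn_integral_cmult)
      qed simp
    qed
    also have "\<dots> = (\<integral>\<^sup>+s. indicator {0..r} s * (?F s * (\<integral>\<^sup>+u. ?G u * indicator {s..T} u \<partial>lborel)) \<partial>lborel) +
          (\<integral>\<^sup>+s. (\<integral>\<^sup>+u. indicator {0..r} s * ?F s * (indicator {0..r} u * ?G u * indicator {..<s} u) \<partial>lborel) \<partial>lborel)"
    proof (rule nn_integral_add)
      have "(\<lambda>(s,u). ?G u * indicator {s..T} u) \<in> borel_measurable (lborel \<Otimes>\<^sub>M lborel)" unfolding case_prod_beta by measurable
      from lborel.borel_measurable_nn_integral_fst[OF this]
      have [measurable]: "(\<lambda>s. \<integral>\<^sup>+u. ?G u * indicator {s..T} u \<partial>lborel) \<in> borel_measurable lborel" by simp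
      show "(\<lambda>s. indicator {0..r} s * (?F s * (\<integral>\<^sup>+u. ?G u * indicator {s..T} u \<partial>lborel))) \<in> borel_measurable lborel" by measurable
      have "(\<lambda>(s,u). indicator {0..r} s * ?F s * (indicator {0..r} u * ?G u * indicator {..<s} u)) \<in> borel_measurable (lborel \<Otimes>\<^sub>M lborel)" unfolding case_prod_beta by measurable
      from lborel.borel_measurable_nn_integral_fst[OF this]
      show "(\<lambda>s. \<integral>\<^sup>+u. indicator {0..r} s * ?F s * (indicator {0..r} u * ?G u * indicator {..<s} u) \<partial>lborel) \<in> borel_measurable lborel" by simp
    qed
    also have "(\<integral>\<^sup>+s. (\<integral>\<^sup>+u. indicator {0..r} s * ?F s * (indicator {0..r} u * ?G u * indicator {..<s} u) \<partial>lborel) \<partial>lborel)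
      = (\<integral>\<^sup>+u. (\<integral>\<^sup>+s. indicator {0..r} s * ?F s * (indicator {0..r} u * ?G u * indicator {..<s} u) \<partial>lborel) \<partial>lborel)"
    proof -
      have "(\<lambda>(s,u). indicator {0..r} s * ?F s * (indicator {0..r} u * ?G u * indicator {..<s} u)) \<in> borel_measurable (lborel \<Otimes>\<^sub>M lborel)" unfolding case_prod_beta by measurable
      from lborel_pair.Fubini'[OF this] show ?thesis by simp
    qed
    also have "\<dots> = (\<integral>\<^sup>+u. indicator {0..r} u * (?G u * (\<integral>\<^sup>+s. ?F s * indicator {u..r} s \<partial>lborel)) \<partial>lborel)"
    proof (rule nn_integral_cong)
      fix u :: real
      have "AE s in lborel. s \<noteq> u" by (rule AE_lborel_singleton)
      then have "(\<integral>\<^sup>+s. indicator {0..r} s * ?F s * (indicator {0..r} u * ?G u * indicator {..<s} u) \<partial>lborel) =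
        (\<integral>\<^sup>+s. indicator {0..r} u * ?G u * (?F s * indicator {u..r} s) \<partial>lborel)"
        by (intro nn_integral_cong_AE, elim eventually_mono) (auto simp: indicator_def mult.commute)
      also have "\<dots> = indicator {0..r} u * ?G u * (\<integral>\<^sup>+s. ?F s * indicator {u..r} s \<partial>lborel)"
        by (rule nn_integral_cmult) measurable
      finally show "(\<integral>\<^sup>+s. indicator {0..r} s * ?F s * (indicator {0..r} u * ?G u * indicator {..<s} u) \<partial>lborel) =
        indicator {0..r} u * (?G u * (\<integral>\<^sup>+s. ?F s * indicator {u..r} s \<partial>lborel))" by (simp only: mult.assoc)
    qed
    finally show ?thesis unfolding J_def .
  qed
  then have "(\<integral>\<^sup>+w. AF f r (path 0 w) * AF g T (path 0 w) \<partial>M) = (\<integral>\<^sup>+w. J f g r T w + J g f r r w \<partial>M)"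
    by (intro nn_integral_cong) simp
  also have "\<dots> = (\<integral>\<^sup>+w. J f g r T w \<partial>M) + (\<integral>\<^sup>+w. J g f r r w \<partial>M)"
    by (rule nn_integral_add[OF Jm Jm]) auto
  finally show ?thesis unfolding EJ[OF f g, of r T r] EJ[OF g f, of r r r] .
qed

end

section \<open>Convergence of the occupation averages\<close>

context levy_sym begin

lemma avg_path_meas[measurable]: "(\<lambda>w. avg e x t (path 0 w)) \<in> borel_measurable M"
  by (rule measurable_compose[OF path_meas[OF order_refl] avg_meas])

lemma ar_path_meas[measurable]: "(\<lambda>w. ar e x t (path 0 w)) \<in> borel_measurable M"
  by (rule measurable_compose[OF path_meas[OF order_refl] ar_meas])

lemma avg_mean_le: "0 < e \<Longrightarrow> 0 \<le> t \<Longrightarrow> (\<integral>\<^sup>+w. avg e x t (path 0 w) \<partial>M) \<le> ennreal (occ_sup t)"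
  using GF_fe_sup[of e t x 0] by (simp add: avg_mean)

lemma AF_mean_time:
  assumes f[measurable]: "f \<in> borel_measurable borel"
  shows "(\<integral>\<^sup>+s. indicator {0..t} s * (\<integral>\<^sup>+w. f (Y (max 0 s) w) \<partial>M) \<partial>lborel) = (\<integral>\<^sup>+w. AF f t (path 0 w) \<partial>M)"
    and "(\<lambda>s. \<integral>\<^sup>+w. f (Y (max 0 s) w) \<partial>M) \<in> borel_measurable borel"
proof -
  interpret MLb: pair_sigma_finite M lborel ..
  have m: "(\<lambda>(w,r). f (Y (max 0 r) w) * indicator {0..t} r) \<in> borel_measurable (M \<Otimes>\<^sub>M lborel)"
  proof -
    have [measurable]: "(\<lambda>x. Y (max 0 (snd x)) (fst x)) \<in> borel_measurable (M \<Otimes>\<^sub>M lborel)"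
      using measurable_compose[OF _ Y_joint, of "\<lambda>x. (snd x, fst x)" "M \<Otimes>\<^sub>M lborel"] by simp
    show ?thesis unfolding case_prod_beta by measurable
  qed
  have "(\<integral>\<^sup>+w. AF f t (path 0 w) \<partial>M) = (\<integral>\<^sup>+w. (\<integral>\<^sup>+r. f (Y (max 0 r) w) * indicator {0..t} r \<partial>lborel) \<partial>M)"
    by (intro nn_integral_cong) (simp add: AF_def rg_path0)
  also have "\<dots> = (\<integral>\<^sup>+r. (\<integral>\<^sup>+w. f (Y (max 0 r) w) * indicator {0..t} r \<partial>M) \<partial>lborel)"
    using MLb.Fubini'[OF m] by simp
  also have "\<dots> = (\<integral>\<^sup>+s. indicator {0..t} s * (\<integral>\<^sup>+w. f (Y (max 0 s) w) \<partial>M) \<partial>lborel)"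
    by (intro nn_integral_cong) (auto simp: indicator_def)
  finally show "(\<integral>\<^sup>+s. indicator {0..t} s * (\<integral>\<^sup>+w. f (Y (max 0 s) w) \<partial>M) \<partial>lborel) = (\<integral>\<^sup>+w. AF f t (path 0 w) \<partial>M)" by simp
  have "(\<lambda>(s,w). f (Y (max 0 s) w)) \<in> borel_measurable (borel \<Otimes>\<^sub>M M)"
    using measurable_compose[OF Y_joint f] by (simp add: case_prod_beta)
  from borel_measurable_nn_integral_fst[OF this]
  show "(\<lambda>s. \<integral>\<^sup>+w. f (Y (max 0 s) w) \<partial>M) \<in> borel_measurable borel" by simp
qed

lemma PF_sum_le:
  assumes r: "0 \<le> r" "r \<le> T" and f[measurable]: "f \<in> borel_measurable borel" "g \<in> borel_measurable borel"
    and c: "\<And>s v. 0 \<le> s \<Longrightarrow> s \<le> r \<Longrightarrow> f v * GF (T - s) g v \<le> f v * c"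
  shows "(\<integral>\<^sup>+s. indicator {0..r} s * PF f g r' T s \<partial>lborel) \<le> c * (\<integral>\<^sup>+w. AF f r (path 0 w) \<partial>M)"
proof -
  note [measurable] = AF_mean_time(2)[OF f(1)]
  have "(\<integral>\<^sup>+s. indicator {0..r} s * PF f g r' T s \<partial>lborel) \<le> (\<integral>\<^sup>+s. c * (indicator {0..r} s * (\<integral>\<^sup>+w. f (Y (max 0 s) w) \<partial>M)) \<partial>lborel)"
  proof (rule nn_integral_mono)
    fix s :: real
    show "indicator {0..r} s * PF f g r' T s \<le> c * (indicator {0..r} s * (\<integral>\<^sup>+w. f (Y (max 0 s) w) \<partial>M))"
    proof (cases "s \<in> {0..r}")
      case True
      then have s: "0 \<le> s" "s \<le> T" "s \<le> r" using r by auto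
      have [measurable]: "Y s \<in> borel_measurable M" using s by simp
      have "PF f g r' T s = (\<integral>\<^sup>+w. f (Y s w) * GF (T - s) g (Y s w) \<partial>M)" using s by (intro PF_eq) auto
      also have "\<dots> \<le> (\<integral>\<^sup>+w. f (Y s w) * c \<partial>M)" by (intro nn_integral_mono c s)
      also have "\<dots> = c * (\<integral>\<^sup>+w. f (Y s w) \<partial>M)" by (subst nn_integral_multc) (auto simp: mult.commute)
      finally show ?thesis using True by simp
    qed simp
  qed
  also have "\<dots> = c * (\<integral>\<^sup>+w. AF f r (path 0 w) \<partial>M)"
    unfolding AF_mean_time(1)[OF f(1), symmetric] by (rule nn_integral_cmult) measurable
  finally show ?thesis .
qed

text \<open>Each of the two orders of visits contributes at most \<open>occ_sup T\<close> times the
  mean of the earlier visit, because \<open>GF\<close> of a normalised window is bounded by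
  \<open>occ_sup\<close>.\<close>

lemma avg_second_moment:
  assumes e: "0 < e" and r: "0 \<le> r" "r \<le> T"
  shows "(\<integral>\<^sup>+w. avg e x r (path 0 w) * avg e x T (path 0 w) \<partial>M) \<le> 2 * ennreal (occ_sup T) * (\<integral>\<^sup>+w. avg e x r (path 0 w) \<partial>M)"
proof -
  have b: "fe e x v * GF (T' - s) (fe e x) v \<le> fe e x v * ennreal (occ_sup T)" if "0 \<le> s" "s \<le> T'" "T' \<le> T" for s v T'
  proof (rule mult_left_mono)
    have "GF (T' - s) (fe e x) v \<le> ennreal (occ_sup (T' - s))" using e that by (intro GF_fe_sup) auto
    also have "\<dots> \<le> ennreal (occ_sup T)" using that by (intro ennreal_leI occ_sup_mono) auto
    finally show "GF (T' - s) (fe e x) v \<le> ennreal (occ_sup T)" .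
  qed simp
  have "(\<integral>\<^sup>+w. avg e x r (path 0 w) * avg e x T (path 0 w) \<partial>M) =
     (\<integral>\<^sup>+s. indicator {0..r} s * PF (fe e x) (fe e x) r T s \<partial>lborel) + (\<integral>\<^sup>+s. indicator {0..r} s * PF (fe e x) (fe e x) r r s \<partial>lborel)"
    unfolding avg_def by (rule pair_formula[OF r fe_meas fe_meas])
  also have "\<dots> \<le> ennreal (occ_sup T) * (\<integral>\<^sup>+w. AF (fe e x) r (path 0 w) \<partial>M) + ennreal (occ_sup T) * (\<integral>\<^sup>+w. AF (fe e x) r (path 0 w) \<partial>M)"
    using r by (intro add_mono PF_sum_le fe_meas b) auto
  also have "\<dots> = 2 * ennreal (occ_sup T) * (\<integral>\<^sup>+w. avg e x r (path 0 w) \<partial>M)"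
    unfolding avg_def by (simp add: mult_2 distrib_right)
  finally show ?thesis .
qed

text \<open>Expanding the square leaves mixed moments, each a sum over two orders of visits. In
  every order only the window of the later visit has to be exchanged, and this changes the inner
  mean by at most \<open>2 * \<rho>\<close>. Four such exchanges give
  \<open>8 * \<rho> * occ_sup T\<close>.\<close>

lemma avg_L2:
  assumes t: "0 \<le> t" "t \<le> T" and \<rho>: "0 \<le> \<rho>" and d: "\<And>r w. 0 \<le> r \<Longrightarrow> r \<le> T \<Longrightarrow> \<bar>w\<bar> < d \<Longrightarrow> \<bar>occ r w - occ r 0\<bar> \<le> \<rho>"
    and e: "0 < e" "e \<le> d/2" "0 < e'" "e' \<le> d/2"
  shows "(\<integral>k. (ar e x t (path 0 k) - ar e' x t (path 0 k))\<^sup>2 \<partial>M) \<le> 8 * \<rho> * occ_sup T"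
proof -
  let ?f = "fe e x" and ?g = "fe e' x"
  let ?P = "\<lambda>f g. (\<integral>\<^sup>+s. indicator {0..t} s * PF f g t t s \<partial>lborel)"
  let ?m = "\<lambda>f. (\<integral>\<^sup>+k. AF f t (path 0 k) \<partial>M)"
  \<comment> \<open>From a first visit within \<open>d / 2\<close> of \<open>x\<close>, a visit to
    either window is a displacement below \<open>d\<close>, where \<open>occ\<close> is within
    \<open>\<rho>\<close> of its value at 0.\<close>
  have key: "?P (fe a x) (fe a x) \<le> ?P (fe a x) (fe b x) + ennreal (2*\<rho>) * ?m (fe a x)" if ab: "0 < a" "a \<le> d/2" "0 < b" "b \<le> d/2" for a b
  proof -
    let ?f = "fe a x" and ?g = "fe b x"
    note [measurable] = AF_mean_time(2)[OF fe_meas[of a x]]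
    have pm: "(\<lambda>s. indicator {0..t} s * PF ?f ?g t t s) \<in> borel_measurable lborel"
    proof -
      have Y2[measurable]: "(\<lambda>x. Y (max 0 (fst x)) (snd x)) \<in> borel_measurable (lborel \<Otimes>\<^sub>M M)"
        using measurable_compose[OF _ Y_joint, of "\<lambda>x. (fst x, snd x)" "lborel \<Otimes>\<^sub>M M"] by simp
      have Y3[measurable]: "(\<lambda>x. Y (max 0 (snd x)) (snd (fst x))) \<in> borel_measurable ((lborel \<Otimes>\<^sub>M M) \<Otimes>\<^sub>M lborel)"
        using measurable_compose[OF _ Y_joint, of "\<lambda>x. (snd x, snd (fst x))" "(lborel \<Otimes>\<^sub>M M) \<Otimes>\<^sub>M lborel"] by simp
      have [measurable]: "(\<lambda>x. indicator {fst (fst x)..t} (snd x) :: ennreal) \<in> borel_measurable ((lborel \<Otimes>\<^sub>M M) \<Otimes>\<^sub>M lborel)"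
      proof -
        have eq: "(\<lambda>x :: (real \<times> 'a) \<times> real. indicator {fst (fst x)..t} (snd x) :: ennreal) = (\<lambda>x. if fst (fst x) \<le> snd x \<and> snd x \<le> t then 1 else 0)"
          by (auto simp: fun_eq_iff indicator_def)
        show ?thesis unfolding eq by measurable
      qed
      have "(\<lambda>(x,u). ?g (Y (max 0 u) (snd x)) * indicator {fst x..t} u) \<in> borel_measurable ((lborel \<Otimes>\<^sub>M M) \<Otimes>\<^sub>M lborel)"
        unfolding case_prod_beta by measurable
      from lborel.borel_measurable_nn_integral_fst[OF this]
      have [measurable]: "(\<lambda>x. \<integral>\<^sup>+u. ?g (Y (max 0 u) (snd x)) * indicator {fst x..t} u \<partial>lborel) \<in> borel_measurable (lborel \<Otimes>\<^sub>M M)" by simp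
      have "(\<lambda>(s,k). ?f (Y (max 0 s) k) * (\<integral>\<^sup>+u. ?g (Y (max 0 u) k) * indicator {s..t} u \<partial>lborel)) \<in> borel_measurable (lborel \<Otimes>\<^sub>M M)"
        unfolding case_prod_beta by measurable
      from borel_measurable_nn_integral_fst[OF this]
      have [measurable]: "(\<lambda>s. \<integral>\<^sup>+k. ?f (Y (max 0 s) k) * (\<integral>\<^sup>+u. ?g (Y (max 0 u) k) * indicator {s..t} u \<partial>lborel) \<partial>M) \<in> borel_measurable lborel" by simp
      have eq: "(\<lambda>s. indicator {0..t} s * PF ?f ?g t t s) = (\<lambda>s. indicator {0..t} s * (\<integral>\<^sup>+k. ?f (Y (max 0 s) k) * (\<integral>\<^sup>+u. ?g (Y (max 0 u) k) * indicator {s..t} u \<partial>lborel) \<partial>M))"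
      proof
        fix s
        show "indicator {0..t} s * PF ?f ?g t t s = indicator {0..t} s * (\<integral>\<^sup>+k. ?f (Y (max 0 s) k) * (\<integral>\<^sup>+u. ?g (Y (max 0 u) k) * indicator {s..t} u \<partial>lborel) \<partial>M)"
        proof (cases "s \<in> {0..t}")
          case True
          then have "?g (Y (max 0 u) k) * indicator {s..t} u = ?g (Y u k) * indicator {s..t} u" for u k
            by (auto simp: indicator_def)
          then show ?thesis using True by (simp add: PF_def)
        qed simp
      qed
      show ?thesis unfolding eq by measurable
    qed
    have "?P ?f ?f \<le> (\<integral>\<^sup>+s. indicator {0..t} s * PF ?f ?g t t s + ennreal (2*\<rho>) * (indicator {0..t} s * (\<integral>\<^sup>+k. ?f (Y (max 0 s) k) \<partial>M)) \<partial>lborel)"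
    proof (rule nn_integral_mono)
      fix s :: real
      show "indicator {0..t} s * PF ?f ?f t t s \<le> indicator {0..t} s * PF ?f ?g t t s + ennreal (2*\<rho>) * (indicator {0..t} s * (\<integral>\<^sup>+k. ?f (Y (max 0 s) k) \<partial>M))"
      proof (cases "s \<in> {0..t}")
        case True
        then have s: "0 \<le> s" "s \<le> t" by auto
        let ?r = "t - s"
        have r: "0 \<le> ?r" "?r \<le> T" using s t by auto
        have [measurable]: "Y s \<in> borel_measurable M" using s by simp
        have "?f v * GF ?r ?f v \<le> ?f v * GF ?r ?g v + ennreal (2*\<rho>) * ?f v" for v
        proof (cases "\<bar>v - x\<bar> < a")
          case True
          have o: "\<bar>occ ?r z - occ ?r 0\<bar> \<le> \<rho>" if "\<bar>v + z - x\<bar> < c" "c \<le> d/2" for z c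
          proof (rule d[OF r])
            have "\<bar>z\<bar> \<le> \<bar>v + z - x\<bar> + \<bar>v - x\<bar>" by linarith
            then show "\<bar>z\<bar> < d" using that True ab by linarith
          qed
          have o0: "0 \<le> occ ?r 0" by (rule occ_nonneg[OF r(1)])
          have "GF ?r ?f v \<le> ennreal (occ ?r 0 + \<rho>)"
          proof (rule GF_fe_le[OF ab(1) r(1)])
            fix z assume "\<bar>v + z - x\<bar> < a"
            from o[OF this ab(2)] show "occ ?r z \<le> occ ?r 0 + \<rho>" by linarith
          qed (use o0 \<rho> in simp)
          \<comment> \<open>The maximum with 0 keeps the lower bound for the other window
            nonnegative, as \<open>ennreal_plus\<close> and \<open>GF_fe_ge\<close> require.\<close>
          also have "\<dots> \<le> ennreal (max 0 (occ ?r 0 - \<rho>) + 2*\<rho>)" by (intro ennreal_leI) simp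
          also have "\<dots> = ennreal (max 0 (occ ?r 0 - \<rho>)) + ennreal (2*\<rho>)" using \<rho> by (intro ennreal_plus) auto
          also have "ennreal (max 0 (occ ?r 0 - \<rho>)) \<le> GF ?r ?g v"
          proof (rule GF_fe_ge[OF ab(3) r(1)])
            fix z assume "\<bar>v + z - x\<bar> < b"
            from o[OF this ab(4)] show "max 0 (occ ?r 0 - \<rho>) \<le> occ ?r z" using occ_nonneg[OF r(1), of z] by (auto simp: abs_le_iff)
          qed simp
          finally have "GF ?r ?f v \<le> GF ?r ?g v + ennreal (2*\<rho>)" by (simp add: add_right_mono)
          then have "?f v * GF ?r ?f v \<le> ?f v * (GF ?r ?g v + ennreal (2*\<rho>))" by (rule mult_left_mono) simp
          then show ?thesis by (simp add: distrib_left mult.commute)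
        next
          case False
          then have "?f v = 0" by (auto simp: fe_def indicator_def abs_less_iff)
          then show ?thesis by simp
        qed
        then have "(\<integral>\<^sup>+k. ?f (Y s k) * GF ?r ?f (Y s k) \<partial>M) \<le> (\<integral>\<^sup>+k. ?f (Y s k) * GF ?r ?g (Y s k) + ennreal (2*\<rho>) * ?f (Y s k) \<partial>M)"
          by (intro nn_integral_mono)
        also have "\<dots> = (\<integral>\<^sup>+k. ?f (Y s k) * GF ?r ?g (Y s k) \<partial>M) + ennreal (2*\<rho>) * (\<integral>\<^sup>+k. ?f (Y s k) \<partial>M)"
        proof -
          have [measurable]: "GF ?r ?g \<in> borel_measurable borel"
          proof -
            have [measurable]: "occ ?r \<in> borel_measurable borel" by (rule occ_meas[OF r(1)])
            have "(\<lambda>(v,z). ennreal (occ ?r z) * ?g (v + z)) \<in> borel_measurable (borel \<Otimes>\<^sub>M lborel)" by measurable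
            from lborel.borel_measurable_nn_integral_fst[OF this] show ?thesis unfolding GF_def[abs_def] by simp
          qed
          show ?thesis by (simp add: nn_integral_add nn_integral_cmult)
        qed
        finally show ?thesis using True s by (simp add: PF_eq)
      qed simp
    qed
    also have "\<dots> = ?P ?f ?g + ennreal (2*\<rho>) * ?m ?f"
    proof -
      have "(\<integral>\<^sup>+s. indicator {0..t} s * PF ?f ?g t t s + ennreal (2*\<rho>) * (indicator {0..t} s * (\<integral>\<^sup>+k. ?f (Y (max 0 s) k) \<partial>M)) \<partial>lborel) =
         ?P ?f ?g + (\<integral>\<^sup>+s. ennreal (2*\<rho>) * (indicator {0..t} s * (\<integral>\<^sup>+k. ?f (Y (max 0 s) k) \<partial>M)) \<partial>lborel)"
        by (rule nn_integral_add[OF pm]) measurable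
      also have "(\<integral>\<^sup>+s. ennreal (2*\<rho>) * (indicator {0..t} s * (\<integral>\<^sup>+k. ?f (Y (max 0 s) k) \<partial>M)) \<partial>lborel) = ennreal (2*\<rho>) * ?m ?f"
        unfolding AF_mean_time(1)[OF fe_meas[of a x], symmetric] by (rule nn_integral_cmult) measurable
      finally show ?thesis .
    qed
    finally show ?thesis .
  qed
  have T0: "0 \<le> T" using t by simp
  have mean: "?m (fe a x) \<le> ennreal (occ_sup T)" if "0 < a" for a
    using avg_mean_le[OF that t(1), of x] occ_sup_mono[OF t] unfolding avg_def by (auto intro: order_trans ennreal_leI)
  have pf: "(\<integral>\<^sup>+k. AF f t (path 0 k) * AF g t (path 0 k) \<partial>M) = ?P f g + ?P g f" if "f \<in> borel_measurable borel" "g \<in> borel_measurable borel" for f g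
    using pair_formula[OF t(1) order_refl that] .
  have bb: "norm (ar a x t (path 0 k) * ar b x t (path 0 k)) \<le> t / (2*a) * (t / (2*b))" if "0 < a" "0 < b" for a b k
  proof -
    have "ar a x t (path 0 k) * ar b x t (path 0 k) \<le> t / (2*a) * (t / (2*b))"
      by (intro mult_mono ar_le that t ar_nonneg divide_nonneg_nonneg) (use that in auto)
    then show ?thesis by (simp only: real_norm_def abs_mult abs_of_nonneg[OF ar_nonneg])
  qed
  have int: "integrable M (\<lambda>k. ar a x t (path 0 k) * ar b x t (path 0 k))" if "0 < a" "0 < b" for a b
    using bb[OF that] by (intro integrable_const_bound[where B="t / (2*a) * (t / (2*b))"]) auto
  have toR: "(\<integral>\<^sup>+k. AF (fe a x) t (path 0 k) * AF (fe b x) t (path 0 k) \<partial>M) = ennreal (\<integral>k. ar a x t (path 0 k) * ar b x t (path 0 k) \<partial>M)" if "0 < a" "0 < b" for a b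
  proof -
    have "(\<integral>\<^sup>+k. AF (fe a x) t (path 0 k) * AF (fe b x) t (path 0 k) \<partial>M) = (\<integral>\<^sup>+k. ennreal (ar a x t (path 0 k) * ar b x t (path 0 k)) \<partial>M)"
      using that t by (intro nn_integral_cong) (simp add: ennreal_mult ar_nonneg ar_avg avg_def)
    also have "\<dots> = ennreal (\<integral>k. ar a x t (path 0 k) * ar b x t (path 0 k) \<partial>M)"
      by (intro nn_integral_eq_integral int that AE_I2 mult_nonneg_nonneg ar_nonneg)
    finally show ?thesis .
  qed
  let ?E = "\<lambda>a b. (\<integral>k. ar a x t (path 0 k) * ar b x t (path 0 k) \<partial>M)"
  have E0: "0 \<le> ?E a b" for a b by (intro integral_nonneg_AE AE_I2 mult_nonneg_nonneg ar_nonneg)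
  have "ennreal (?E e e) + ennreal (?E e' e') = (?P ?f ?f + ?P ?f ?f) + (?P ?g ?g + ?P ?g ?g)"
    using toR[OF e(1) e(1)] toR[OF e(3) e(3)] pf[OF fe_meas[of e x] fe_meas[of e x]] pf[OF fe_meas[of e' x] fe_meas[of e' x]] by simp
  also have "\<dots> \<le> ((?P ?f ?g + ennreal (2*\<rho>) * ?m ?f) + (?P ?f ?g + ennreal (2*\<rho>) * ?m ?f)) + ((?P ?g ?f + ennreal (2*\<rho>) * ?m ?g) + (?P ?g ?f + ennreal (2*\<rho>) * ?m ?g))"
    using key[OF e(1,2) e(3,4)] key[OF e(3,4) e(1,2)] by (intro add_mono)
  also have "\<dots> \<le> ((?P ?f ?g + ennreal (2*\<rho>) * ennreal (occ_sup T)) + (?P ?f ?g + ennreal (2*\<rho>) * ennreal (occ_sup T))) + ((?P ?g ?f + ennreal (2*\<rho>) * ennreal (occ_sup T)) + (?P ?g ?f + ennreal (2*\<rho>) * ennreal (occ_sup T)))"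
    using mean[OF e(1)] mean[OF e(3)] by (intro add_mono mult_left_mono order_refl) auto
  also have "\<dots> = (?P ?f ?g + ?P ?g ?f) + (?P ?f ?g + ?P ?g ?f) + 4 * (ennreal (2*\<rho>) * ennreal (occ_sup T))"
  proof -
    have "((a + c) + (a + c)) + ((b + c) + (b + c)) = (a + b) + (a + b) + 4 * c" for a b c :: ennreal
    proof -
      have "4 * c = (c + c) + (c + c)" using distrib_right[of 2 2 c] by (simp add: mult_2)
      then show ?thesis by (simp only: add_ac)
    qed
    then show ?thesis .
  qed
  also have "\<dots> = ennreal (?E e e') + ennreal (?E e e') + 4 * (ennreal (2*\<rho>) * ennreal (occ_sup T))"
    using toR[OF e(1) e(3)] pf[OF fe_meas[of e x] fe_meas[of e' x]] by simp
  also have "\<dots> = ennreal (?E e e' + ?E e e' + 4 * (2*\<rho> * occ_sup T))"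
  proof -
    have "4 * (ennreal (2*\<rho>) * ennreal (occ_sup T)) = ennreal (4 * (2*\<rho> * occ_sup T))"
      using \<rho> occ_sup_nonneg[OF T0] by (simp only: ennreal_mult[symmetric] mult_nonneg_nonneg zero_le_numeral ennreal_numeral[symmetric])
    moreover have "0 \<le> 4 * (2*\<rho> * occ_sup T)" using \<rho> occ_sup_nonneg[OF T0] by simp
    ultimately show ?thesis using E0[of e e'] by (simp only: ennreal_plus[symmetric] add_nonneg_nonneg)
  qed
  finally have "ennreal (?E e e + ?E e' e') \<le> ennreal (?E e e' + ?E e e' + 4 * (2*\<rho> * occ_sup T))"
    using E0 by (simp add: ennreal_plus)
  moreover have "0 \<le> ?E e e' + ?E e e' + 4 * (2*\<rho> * occ_sup T)" using E0 \<rho> occ_sup_nonneg[OF T0] by (intro add_nonneg_nonneg mult_nonneg_nonneg) auto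
  ultimately have le: "?E e e + ?E e' e' \<le> ?E e e' + ?E e e' + 4 * (2*\<rho> * occ_sup T)" by (simp only: ennreal_le_iff)
  have "(\<integral>k. (ar e x t (path 0 k) - ar e' x t (path 0 k))\<^sup>2 \<partial>M) = (\<integral>k. ar e x t (path 0 k) * ar e x t (path 0 k) - 2 * (ar e x t (path 0 k) * ar e' x t (path 0 k)) + ar e' x t (path 0 k) * ar e' x t (path 0 k) \<partial>M)"
    by (intro Bochner_Integration.integral_cong refl) (simp add: power2_eq_square algebra_simps)
  also have "\<dots> = ?E e e - 2 * ?E e e' + ?E e' e'"
    using int[OF e(1) e(1)] int[OF e(1) e(3)] int[OF e(3) e(3)] by simp
  also have "\<dots> \<le> 8 * \<rho> * occ_sup T" using le by simp
  finally show ?thesis .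
qed

lemma ar_integrable: assumes "0 < e" "0 \<le> t" shows "integrable M (\<lambda>w. ar e x t (path 0 w))"
  using ar_le[OF assms, of x] ar_nonneg[of e x t] by (intro integrable_const_bound[where B="t/(2*e)"]) auto

text \<open>From \<open>L2\<close> to \<open>L1\<close> by \<open>2 * k * |y| <= k^2 + y^2\<close>.
  The radius \<open>d\<close> depends neither on the level nor on the time up to
  \<open>T\<close>.\<close>

lemma L1_cauchy:
  assumes T: "0 \<le> T" and k: "0 < k"
  shows "\<exists>d>0. \<forall>t x e e'. 0 \<le> t \<longrightarrow> t \<le> T \<longrightarrow> 0 < e \<longrightarrow> e \<le> d \<longrightarrow> 0 < e' \<longrightarrow> e' \<le> d \<longrightarrow>
     (\<integral>v. \<bar>ar e x t (path 0 v) - ar e' x t (path 0 v)\<bar> \<partial>M) \<le> k"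
proof -
  define C where "C = occ_sup T + 1"
  have C: "0 < C" "occ_sup T \<le> C" using occ_sup_nonneg[OF T] by (auto simp: C_def)
  \<comment> \<open>Solves \<open>8 * \<rho> * C = k^2\<close>; the summand 1 in \<open>C\<close>
    keeps the denominator positive.\<close>
  define \<rho> where "\<rho> = k\<^sup>2 / (8 * C)"
  have \<rho>: "0 < \<rho>" using k C by (simp add: \<rho>_def)
  obtain d where d: "0 < d" "\<And>r z w. r \<in> {0..T} \<Longrightarrow> \<bar>z - w\<bar> < d \<Longrightarrow> \<bar>occ r z - occ r w\<bar> < \<rho>"
    using occ_equicont[OF T \<rho>] by blast
  have "(\<integral>v. \<bar>ar e x t (path 0 v) - ar e' x t (path 0 v)\<bar> \<partial>M) \<le> k"
    if h: "0 \<le> t" "t \<le> T" "0 < e" "e \<le> d/2" "0 < e'" "e' \<le> d/2" for t x e e'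
  proof -
    let ?X = "\<lambda>v. ar e x t (path 0 v) - ar e' x t (path 0 v)"
    have "(\<integral>v. (?X v)\<^sup>2 \<partial>M) \<le> 8 * \<rho> * occ_sup T"
    proof (rule avg_L2[OF h(1,2) less_imp_le[OF \<rho>] _ h(3-6)])
      fix r w assume "0 \<le> r" "r \<le> T" "\<bar>w\<bar> < d"
      then show "\<bar>occ r w - occ r 0\<bar> \<le> \<rho>" using d(2)[of r w 0] by simp
    qed
    also have "\<dots> \<le> 8 * \<rho> * C" using \<rho> C by (intro mult_left_mono) auto
    also have "\<dots> = k\<^sup>2" using C by (simp add: \<rho>_def)
    finally have X2: "(\<integral>v. (?X v)\<^sup>2 \<partial>M) \<le> k\<^sup>2" .
    have Xb: "\<bar>?X v\<bar> \<le> t/(2*e) + t/(2*e')" for v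
      using ar_le[OF h(3,1), of x "path 0 v"] ar_le[OF h(5,1), of x "path 0 v"] ar_nonneg[of e x t "path 0 v"] ar_nonneg[of e' x t "path 0 v"]
      by linarith
    have i2: "integrable M (\<lambda>v. (?X v)\<^sup>2)"
    proof (rule integrable_const_bound[where B="(t/(2*e) + t/(2*e'))\<^sup>2"])
      show "AE v in M. norm ((?X v)\<^sup>2) \<le> (t/(2*e) + t/(2*e'))\<^sup>2"
      proof (rule AE_I2)
        fix v
        have "\<bar>?X v\<bar>\<^sup>2 \<le> (t/(2*e) + t/(2*e'))\<^sup>2" by (rule power_mono[OF Xb]) simp
        then show "norm ((?X v)\<^sup>2) \<le> (t/(2*e) + t/(2*e'))\<^sup>2" by simp
      qed
    qed measurable
    have i1: "integrable M (\<lambda>v. \<bar>?X v\<bar>)" using ar_integrable[OF h(3,1), of x] ar_integrable[OF h(5,1), of x] by simp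
    have "(\<integral>v. \<bar>?X v\<bar> \<partial>M) \<le> (\<integral>v. k/2 + (?X v)\<^sup>2 / (2*k) \<partial>M)"
    proof (rule integral_mono[OF i1])
      fix v
      have "2 * k * \<bar>y\<bar> \<le> k\<^sup>2 + y\<^sup>2" for y :: real using sum_squares_bound[of k "\<bar>y\<bar>"] by simp
      then have "2 * k * \<bar>?X v\<bar> \<le> k\<^sup>2 + (?X v)\<^sup>2" .
      then have "\<bar>?X v\<bar> \<le> (k\<^sup>2 + (?X v)\<^sup>2) / (2*k)" using k by (simp add: pos_le_divide_eq mult.commute)
      also have "\<dots> = k/2 + (?X v)\<^sup>2 / (2*k)" using k by (simp add: add_divide_distrib power2_eq_square)
      finally show "\<bar>?X v\<bar> \<le> k/2 + (?X v)\<^sup>2 / (2*k)" .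
    qed (use i2 in simp)
    also have "\<dots> = k/2 + (\<integral>v. (?X v)\<^sup>2 \<partial>M) / (2*k)" using i2 by (simp add: prob_space)
    also have "\<dots> \<le> k/2 + k\<^sup>2 / (2*k)" using X2 k by (intro add_left_mono divide_right_mono) auto
    also have "\<dots> = k" using k by (simp add: power2_eq_square)
    finally show ?thesis .
  qed
  then show ?thesis using d(1) by (intro exI[of _ "d/2"]) auto
qed

text \<open>A single sequence of radii serves all levels and all times up to \<open>T\<close>; this
  uniformity is what later allows levels that depend on the path.\<close>

lemma ex_seq:
  assumes T: "0 \<le> T"
  obtains es where "\<And>n. 0 < es n" "decseq es" "es \<longlonglongrightarrow> 0"
    "\<And>k t x e. 0 \<le> t \<Longrightarrow> t \<le> T \<Longrightarrow> 0 < e \<Longrightarrow> e \<le> es k \<Longrightarrow> (\<integral>w. \<bar>ar e x t (path 0 w) - ar (es k) x t (path 0 w)\<bar> \<partial>M) \<le> (1/2)^k"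
proof -
  have "\<forall>k::nat. \<exists>d>0. \<forall>t x e e'. 0 \<le> t \<longrightarrow> t \<le> T \<longrightarrow> 0 < e \<longrightarrow> e \<le> d \<longrightarrow> 0 < e' \<longrightarrow> e' \<le> d \<longrightarrow>
     (\<integral>w. \<bar>ar e x t (path 0 w) - ar e' x t (path 0 w)\<bar> \<partial>M) \<le> (1/2)^k"
    by (intro allI L1_cauchy[OF T]) simp
  from choice[OF this] obtain d where dd: "\<forall>k::nat. d k > 0 \<and> (\<forall>t x e e'. 0 \<le> t \<longrightarrow> t \<le> T \<longrightarrow> 0 < e \<longrightarrow> e \<le> d k \<longrightarrow> 0 < e' \<longrightarrow> e' \<le> d k \<longrightarrow>
     (\<integral>w. \<bar>ar e x t (path 0 w) - ar e' x t (path 0 w)\<bar> \<partial>M) \<le> (1/2)^k)" by (rule exE)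
  have d: "0 < d k" "0 \<le> t \<Longrightarrow> t \<le> T \<Longrightarrow> 0 < e \<Longrightarrow> e \<le> d k \<Longrightarrow> 0 < e' \<Longrightarrow> e' \<le> d k \<Longrightarrow>
     (\<integral>w. \<bar>ar e x t (path 0 w) - ar e' x t (path 0 w)\<bar> \<partial>M) \<le> (1/2)^k" for k t x e e'
    using dd by simp_all
  \<comment> \<open>The running minimum of the moduli makes the radii decreasing, and the cap
    \<open>1 / (n + 1)\<close> below sends them to 0.\<close>
  define m where "m n = Min (d ` {..n})" for n
  have m0: "0 < m n" for n unfolding m_def using d(1) by (subst Min_gr_iff) auto
  have md: "m n \<le> d n" for n unfolding m_def by (intro Min_le) auto
  have mdec: "m (Suc n) \<le> m n" for n unfolding m_def by (intro Min_antimono) auto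
  define es where "es n = min (m n) (1 / (real n + 1))" for n
  show ?thesis
  proof
    show es0: "0 < es n" for n using m0 by (simp add: es_def)
    show "decseq es"
    proof (rule decseq_SucI)
      fix n
      have "1 / (real (Suc n) + 1) \<le> 1 / (real n + 1)" by (intro divide_left_mono) auto
      then show "es (Suc n) \<le> es n" unfolding es_def using mdec[of n] by (intro min.mono)
    qed
    have l: "(\<lambda>n. 1 / (real n + 1)) \<longlonglongrightarrow> 0"
      using LIMSEQ_inverse_real_of_nat by (simp only: inverse_eq_divide of_nat_Suc add.commute[of 1])
    show "es \<longlonglongrightarrow> 0"
    proof (rule tendsto_sandwich[OF _ _ tendsto_const l])
      show "\<forall>\<^sub>F n in sequentially. 0 \<le> es n" using es0 by (intro always_eventually allI less_imp_le)
      show "\<forall>\<^sub>F n in sequentially. es n \<le> 1 / (real n + 1)" by (simp add: es_def)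
    qed
    show "(\<integral>w. \<bar>ar e x t (path 0 w) - ar (es k) x t (path 0 w)\<bar> \<partial>M) \<le> (1/2)^k" if "0 \<le> t" "t \<le> T" "0 < e" "e \<le> es k" for k t x e
    proof (rule d(2)[OF that(1-3)])
      have "es k \<le> d k" unfolding es_def using md[of k] by (rule min.coboundedI1)
      then show "e \<le> d k" "es k \<le> d k" using that by auto
      show "0 < es k" by (rule es0)
    qed
  qed
qed

end

section \<open>The limsup over all radii\<close>

text \<open>The differentiation theorem is applied on \<open>{x..x+h}\<close> and, after reflecting
  \<open>f\<close>, on \<open>{x-h..x}\<close>; together these cover centred intervals. Only an
  upper bound is recorded, as the reverse comparison of limsup and limit is
  \<open>LamE_le_LS\<close>.\<close>

lemma lebesgue_point_upper:
  fixes f :: "real \<Rightarrow> real"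
  assumes f[measurable]: "f \<in> borel_measurable borel" and f0: "\<And>x. 0 \<le> f x"
    and fin: "\<And>n::nat. (\<integral>\<^sup>+x. ennreal (f x) * indicator {-real n..real n} x \<partial>lborel) < \<infinity>"
  shows "AE x in lborel. \<forall>k>0. \<exists>d>0. \<forall>h. 0 < h \<longrightarrow> h < d \<longrightarrow>
     (\<integral>\<^sup>+y. ennreal (f y) * indicator {x-h..x+h} y \<partial>lborel) \<le> ennreal (2*h*(f x + k))"
proof -
  have si: "set_integrable lborel {a..b} f" for a b
  proof -
    obtain n where n: "max \<bar>a\<bar> \<bar>b\<bar> \<le> real n" using real_arch_simple by blast
    have "integrable lborel (\<lambda>x. indicator {-real n..real n} x *\<^sub>R f x)"
    proof (rule integrableI_nonneg)
      have "(\<integral>\<^sup>+x. ennreal (indicator {-real n..real n} x *\<^sub>R f x) \<partial>lborel) = (\<integral>\<^sup>+x. ennreal (f x) * indicator {-real n..real n} x \<partial>lborel)"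
        by (intro nn_integral_cong) (auto simp: indicator_def)
      then show "(\<integral>\<^sup>+x. ennreal (indicator {-real n..real n} x *\<^sub>R f x) \<partial>lborel) < \<infinity>" using fin by simp
    qed (use f0 in auto)
    then have "set_integrable lborel {-real n..real n} f" by (simp add: set_integrable_def)
    then show ?thesis by (rule set_integrable_subset) (use n in auto)
  qed
  have si': "set_integrable lborel {a..b} (\<lambda>x. f (-x))" for a b
  proof -
    have "integrable lborel (\<lambda>x. indicator {-b..-a} (0 + (-1) * x) *\<^sub>R f (0 + (-1) * x))"
      using si[of "-b" "-a"] unfolding set_integrable_def by (intro lborel_integrable_real_affine) auto
    moreover have "(\<lambda>x. indicator {-b..-a} (0 + (-1) * x) *\<^sub>R f (0 + (-1) * x)) = (\<lambda>x. indicator {a..b} x *\<^sub>R f (-x))"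
      by (auto simp: fun_eq_iff indicator_def)
    ultimately show ?thesis by (simp add: set_integrable_def)
  qed
  have "f integrable_on cbox a b" for a b using set_borel_integral_eq_integral(1)[OF si] by simp
  from integrable_ccontinuous_explicit[OF this] obtain N1 where N1: "negligible N1"
    "\<And>x e. x \<notin> N1 \<Longrightarrow> 0 < e \<Longrightarrow> \<exists>d>0. \<forall>h. 0 < h \<and> h < d \<longrightarrow> norm (integral (cbox x (x + h *\<^sub>R One)) f /\<^sub>R h ^ DIM(real) - f x) < e"
    by blast
  have "(\<lambda>x. f (-x)) integrable_on cbox a b" for a b using set_borel_integral_eq_integral(1)[OF si'] by simp
  from integrable_ccontinuous_explicit[OF this] obtain N2 where N2: "negligible N2"
    "\<And>x e. x \<notin> N2 \<Longrightarrow> 0 < e \<Longrightarrow> \<exists>d>0. \<forall>h. 0 < h \<and> h < d \<longrightarrow> norm (integral (cbox x (x + h *\<^sub>R One)) (\<lambda>x. f (-x)) /\<^sub>R h ^ DIM(real) - f (-x)) < e"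
    by blast
  have ae: "AE x in lborel. x \<notin> N" if "negligible N" for N :: "real set"
  proof -
    have "N \<in> null_sets lebesgue" using that by (simp add: negligible_iff_null_sets)
    then have "AE x in lebesgue. x \<notin> N" by (rule AE_not_in)
    then show ?thesis by (simp add: AE_completion_iff)
  qed
  have ae2: "AE x in lborel. -x \<notin> N2"
  proof -
    from ae[OF N2(1)] obtain N where N: "N \<in> null_sets lborel" "N2 \<subseteq> N"
      unfolding eventually_ae_filter by auto
    then have [measurable]: "N \<in> sets borel" by auto
    have "AE x in lborel. x \<notin> N" using N(1) by (rule AE_not_in)
    then have "AE x in lborel. 0 + (-1) * x \<notin> N" by (intro AE_borel_affine[where P="\<lambda>x. x \<notin> N"]) auto
    then show ?thesis by eventually_elim (use N(2) in auto)
  qed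
  have eq1: "integral {x..x+h} f = (\<integral>y. indicator {x..x+h} y *\<^sub>R f y \<partial>lborel)" for x h
    using set_borel_integral_eq_integral(2)[OF si, of x "x+h"] by (simp add: set_lebesgue_integral_def)
  have eq2: "integral {-x..-x+h} (\<lambda>x. f (-x)) = (\<integral>y. indicator {x-h..x} y *\<^sub>R f y \<partial>lborel)" for x h
  proof -
    have "integral {-x..-x+h} (\<lambda>x. f (-x)) = (\<integral>y. indicator {-x..-x+h} y *\<^sub>R f (-y) \<partial>lborel)"
      using set_borel_integral_eq_integral(2)[OF si', of "-x" "-x+h"] by (simp add: set_lebesgue_integral_def)
    also have "(\<lambda>y. indicator {-x..-x+h} y *\<^sub>R f (-y)) = (\<lambda>y. indicator {x-h..x} (0 + (-1) * y) *\<^sub>R f (0 + (-1) * y))"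
      by (auto simp: fun_eq_iff indicator_def)
    also have "(\<integral>y. indicator {x-h..x} (0 + (-1) * y) *\<^sub>R f (0 + (-1) * y) \<partial>lborel) = (\<integral>y. indicator {x-h..x} y *\<^sub>R f y \<partial>lborel)"
      using lborel_integral_real_affine[of "-1" "\<lambda>y. indicator {x-h..x} y *\<^sub>R f y" 0] by simp
    finally show ?thesis .
  qed
  show ?thesis using ae[OF N1(1)] ae2
  proof eventually_elim
    case (elim x)
    show ?case
    proof (intro allI impI)
      fix k :: real assume k: "0 < k"
      obtain d1 where d1: "d1 > 0" "\<And>h. 0 < h \<Longrightarrow> h < d1 \<Longrightarrow> \<bar>integral {x..x+h} f / h - f x\<bar> < k"
        using N1(2)[OF elim(1) k] by (auto simp: divide_inverse mult.commute)
      obtain d2 where d2: "d2 > 0" "\<And>h. 0 < h \<Longrightarrow> h < d2 \<Longrightarrow> \<bar>integral {-x..-x+h} (\<lambda>x. f (-x)) / h - f x\<bar> < k"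
        using N2(2)[OF elim(2) k] by (auto simp: divide_inverse mult.commute)
      have "(\<integral>\<^sup>+y. ennreal (f y) * indicator {x-h..x+h} y \<partial>lborel) \<le> ennreal (2*h*(f x + k))" if h: "0 < h" "h < min d1 d2" for h
      proof -
        let ?I = "\<lambda>S. (\<integral>y. indicator S y *\<^sub>R f y \<partial>lborel)"
        have I0: "0 \<le> ?I S" for S using f0 by (intro integral_nonneg_AE AE_I2) (auto simp: indicator_def)
        have nn: "(\<integral>\<^sup>+y. ennreal (f y) * indicator {a..b} y \<partial>lborel) = ennreal (?I {a..b})" for a b
        proof -
          have "(\<integral>\<^sup>+y. ennreal (f y) * indicator {a..b} y \<partial>lborel) = (\<integral>\<^sup>+y. ennreal (indicator {a..b} y *\<^sub>R f y) \<partial>lborel)"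
            by (intro nn_integral_cong) (auto simp: indicator_def)
          also have "\<dots> = ennreal (?I {a..b})" using si[of a b] f0 unfolding set_integrable_def
            by (intro nn_integral_eq_integral) auto
          finally show ?thesis .
        qed
        have a: "?I {x..x+h} \<le> h * (f x + k)"
        proof -
          have "integral {x..x+h} f / h \<le> f x + k" using d1(2)[of h] h by linarith
          then show ?thesis using h unfolding eq1 by (simp add: pos_divide_le_eq mult.commute)
        qed
        have b: "?I {x-h..x} \<le> h * (f x + k)"
        proof -
          have "integral {-x..-x+h} (\<lambda>x. f (-x)) / h \<le> f x + k" using d2(2)[of h] h by linarith
          then show ?thesis using h unfolding eq2 by (simp add: pos_divide_le_eq mult.commute)
        qed
        have "(\<integral>\<^sup>+y. ennreal (f y) * indicator {x-h..x+h} y \<partial>lborel) \<le> (\<integral>\<^sup>+y. ennreal (f y) * indicator {x-h..x} y + ennreal (f y) * indicator {x..x+h} y \<partial>lborel)"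
          by (intro nn_integral_mono) (auto simp: indicator_def)
        also have "\<dots> = ennreal (?I {x-h..x}) + ennreal (?I {x..x+h})"
          unfolding nn[symmetric] by (rule nn_integral_add) measurable
        also have "\<dots> = ennreal (?I {x-h..x} + ?I {x..x+h})" using I0 by (intro ennreal_plus[symmetric]) auto
        also have "\<dots> \<le> ennreal (2*h*(f x + k))" using a b by (intro ennreal_leI) (simp add: mult.assoc)
        finally show ?thesis .
      qed
      then show "\<exists>d>0. \<forall>h. 0 < h \<longrightarrow> h < d \<longrightarrow> (\<integral>\<^sup>+y. ennreal (f y) * indicator {x-h..x+h} y \<partial>lborel) \<le> ennreal (2*h*(f x + k))"
        using d1(1) d2(1) by (intro exI[of _ "min d1 d2"]) auto
    qed
  qed
qed

text \<open>Rational radii keep the supremum measurable with respect to the raw filtration; by \<open>avg_le_SS\<close> they lose nothing.\<close>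

definition SS :: "real \<Rightarrow> real \<Rightarrow> real \<Rightarrow> (real \<Rightarrow> real) \<Rightarrow> ennreal" where
  "SS \<kappa> x t p = (SUP e\<in>\<rat> \<inter> {0<..<\<kappa>}. avg e x t p)"

definition LS :: "real \<Rightarrow> real \<Rightarrow> (real \<Rightarrow> real) \<Rightarrow> ennreal" where
  "LS x t p = (INF n. SS (1 / (real n + 1)) x t p)"

lemma SS_meas2[measurable]: "(\<lambda>(x, p). SS \<kappa> x t p) \<in> borel_measurable (borel \<Otimes>\<^sub>M PS)"
proof -
  have "(\<lambda>z. SUP e\<in>\<rat> \<inter> {0<..<\<kappa>}. avg e (fst z) t (snd z)) \<in> borel_measurable (borel \<Otimes>\<^sub>M PS)"
  proof (rule borel_measurable_SUP)
    show "countable (\<rat> \<inter> {0<..<\<kappa>})" using countable_rat by (rule countable_subset[rotated]) auto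
    show "(\<lambda>z. avg e (fst z) t (snd z)) \<in> borel_measurable (borel \<Otimes>\<^sub>M PS)" for e
      using avg_meas2 by (simp add: case_prod_beta)
  qed
  then show ?thesis by (simp add: SS_def case_prod_beta)
qed

lemma LS_meas2[measurable]: "(\<lambda>(x, p). LS x t p) \<in> borel_measurable (borel \<Otimes>\<^sub>M PS)"
proof -
  have "(\<lambda>z. INF n. SS (1 / (real n + 1)) (fst z) t (snd z)) \<in> borel_measurable (borel \<Otimes>\<^sub>M PS)"
    using SS_meas2 by (intro borel_measurable_INF) (auto simp: case_prod_beta)
  then show ?thesis by (simp add: LS_def case_prod_beta)
qed

lemma SS_meas[measurable]: "SS \<kappa> x t \<in> borel_measurable PS"
  using measurable_compose[OF _ SS_meas2, of "\<lambda>p. (x, p)" PS] by simp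

lemma LS_meas[measurable]: "LS x t \<in> borel_measurable PS"
  using measurable_compose[OF _ LS_meas2, of "\<lambda>p. (x, p)" PS] by simp

lemma rg_meas1: "p \<in> space PS \<Longrightarrow> rg p \<in> borel_measurable borel"
  using measurable_compose[OF _ rg_meas, of "\<lambda>r. (p, r)" borel] by simp

lemma avg_nu: "avg e x t p = ennreal (1/(2*e)) * AF (indicator {x-e<..<x+e}) t p" if "p \<in> space PS"
proof -
  note [measurable] = rg_meas1[OF that]
  have "avg e x t p = (\<integral>\<^sup>+r. ennreal (1/(2*e)) * (indicator {x-e<..<x+e} (rg p r) * indicator {0..t} r) \<partial>lborel)"
    unfolding avg_def AF_def fe_def by (simp add: mult.assoc)
  also have "\<dots> = ennreal (1/(2*e)) * AF (indicator {x-e<..<x+e}) t p"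
    unfolding AF_def by (rule nn_integral_cmult) measurable
  finally show ?thesis .
qed

lemma nu_avg: "AF (indicator {x-e<..<x+e}) t p = ennreal (2*e) * avg e x t p" if "p \<in> space PS" "0 < e"
proof -
  have "ennreal (2*e) * ennreal (1/(2*e)) = 1" using that(2) by (subst ennreal_mult[symmetric]) auto
  then show ?thesis unfolding avg_nu[OF that(1)] by (simp only: mult.assoc[symmetric] mult_1)
qed

text \<open>An open window is the increasing union of open windows with smaller rational radii.\<close>

lemma avg_le_SS: assumes p: "p \<in> space PS" and e: "0 < e" "e < \<kappa>" shows "avg e x t p \<le> SS \<kappa> x t p"
proof -
  note [measurable] = rg_meas1[OF p]
  have "\<exists>q\<in>\<rat>. e - e / (real n + 2) < q \<and> q < e" for n
    using Rats_dense_in_real[of "e - e / (real n + 2)" e] e by auto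
  then obtain q0 where q0: "\<And>n. q0 n \<in> \<rat> \<and> e - e / (real n + 2) < q0 n \<and> q0 n < e" by metis
  have q0p: "0 < q0 n" for n
  proof -
    have "e / (real n + 2) \<le> e / 1" using e by (intro divide_left_mono) auto
    then show ?thesis using q0[of n] by linarith
  qed
  define b where "b = SS \<kappa> x t p"
  have le: "AF (indicator {x - q0 n<..<x + q0 n}) t p \<le> ennreal (2*e) * b" for n
  proof -
    have "avg (q0 n) x t p \<le> b" unfolding b_def SS_def using q0[of n] q0p[of n] e by (intro SUP_upper) auto
    then have "ennreal (2 * q0 n) * avg (q0 n) x t p \<le> ennreal (2*e) * b"
      using q0[of n] q0p[of n] by (intro mult_mono ennreal_leI) auto
    then show ?thesis unfolding nu_avg[OF p q0p] .
  qed
  have lim: "(\<lambda>n. indicator {x - q0 n<..<x + q0 n} y :: ennreal) \<longlonglongrightarrow> indicator {x-e<..<x+e} y" for y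
  proof (cases "y \<in> {x-e<..<x+e}")
    case True
    then have a: "0 < e - \<bar>y - x\<bar>" by (auto simp: abs_less_iff)
    have "(\<lambda>n. e / (real n + 2)) \<longlonglongrightarrow> 0"
      by (intro tendsto_divide_0[OF tendsto_const] filterlim_at_top_imp_at_infinity filterlim_tendsto_add_at_top[OF tendsto_const, of _ _ "2::real", unfolded add.commute[of 2]] filterlim_real_sequentially)
    from order_tendstoD(2)[OF this a] have "\<forall>\<^sub>F n in sequentially. indicator {x - q0 n<..<x + q0 n} y = (1::ennreal)"
    proof eventually_elim
      case (elim n)
      then have "\<bar>y - x\<bar> < q0 n" using q0[of n] by linarith
      then show ?case by (simp add: abs_less_iff)
    qed
    then show ?thesis using True by (simp add: tendsto_eventually)
  next
    case False
    then have "y \<notin> {x - q0 n<..<x + q0 n}" for n using q0[of n] by auto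
    then show ?thesis using False by simp
  qed
  \<comment> \<open>Fatou's lemma, since the chosen rational radii need not be increasing.\<close>
  have "AF (indicator {x-e<..<x+e}) t p = (\<integral>\<^sup>+r. liminf (\<lambda>n. indicator {x - q0 n<..<x + q0 n} (rg p r) * indicator {0..t} r) \<partial>lborel)"
    unfolding AF_def
  proof (rule nn_integral_cong)
    fix r :: real
    have "(\<lambda>n. indicator {x - q0 n<..<x + q0 n} (rg p r) * indicator {0..t} r :: ennreal) \<longlonglongrightarrow> indicator {x-e<..<x+e} (rg p r) * indicator {0..t} r"
      by (cases "r \<in> {0..t}") (simp_all add: lim)
    from lim_imp_Liminf[OF sequentially_bot this]
    show "indicator {x-e<..<x+e} (rg p r) * indicator {0..t} r = liminf (\<lambda>n. indicator {x - q0 n<..<x + q0 n} (rg p r) * indicator {0..t} r :: ennreal)" by simp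
  qed
  also have "\<dots> \<le> liminf (\<lambda>n. AF (indicator {x - q0 n<..<x + q0 n}) t p)"
    unfolding AF_def by (rule nn_integral_liminf) measurable
  also have "\<dots> \<le> ennreal (2*e) * b"
    by (rule Liminf_le) (use le in \<open>auto intro: always_eventually\<close>)
  finally have "ennreal (1/(2*e)) * AF (indicator {x-e<..<x+e}) t p \<le> ennreal (1/(2*e)) * (ennreal (2*e) * b)" by (rule mult_left_mono) simp
  also have "\<dots> = b"
  proof -
    have "ennreal (1/(2*e)) * ennreal (2*e) = 1" using e by (subst ennreal_mult[symmetric]) auto
    then show ?thesis by (simp only: mult.assoc[symmetric] mult_1)
  qed
  finally show ?thesis unfolding avg_nu[OF p] b_def .
qed

text \<open>The liminf is defined and measurable on all of path space; along the radii of
  \<open>levy_occ\<close> it is almost surely a finite limit, by \<open>Lam_conv\<close>.\<close>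

definition LamE :: "(nat \<Rightarrow> real) \<Rightarrow> real \<Rightarrow> real \<Rightarrow> (real \<Rightarrow> real) \<Rightarrow> ennreal" where
  "LamE es x t p = liminf (\<lambda>n. avg (es n) x t p)"

definition Lam :: "(nat \<Rightarrow> real) \<Rightarrow> real \<Rightarrow> real \<Rightarrow> (real \<Rightarrow> real) \<Rightarrow> real" where
  "Lam es x t p = enn2real (LamE es x t p)"

lemma LamE_meas2[measurable]: "(\<lambda>(x, p). LamE es x t p) \<in> borel_measurable (borel \<Otimes>\<^sub>M PS)"
proof -
  have "(\<lambda>z. liminf (\<lambda>n. avg (es n) (fst z) t (snd z))) \<in> borel_measurable (borel \<Otimes>\<^sub>M PS)"
    using avg_meas2 by (intro borel_measurable_liminf) (simp add: case_prod_beta)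
  then show ?thesis by (simp add: LamE_def case_prod_beta)
qed

lemma Lam_meas2[measurable]: "(\<lambda>(x, p). Lam es x t p) \<in> borel_measurable (borel \<Otimes>\<^sub>M PS)"
  using measurable_compose[OF LamE_meas2 borel_measurable_enn2real] unfolding Lam_def by (simp add: case_prod_beta)

lemma LamE_meas[measurable]: "LamE es x t \<in> borel_measurable PS"
  using measurable_compose[OF _ LamE_meas2, of "\<lambda>p. (x, p)" PS] by simp

lemma Lam_meas[measurable]: "Lam es x t \<in> borel_measurable PS"
  using measurable_compose[OF _ Lam_meas2, of "\<lambda>p. (x, p)" PS] by simp

lemma Lam_nonneg: "0 \<le> Lam es x t p" by (simp add: Lam_def)

text \<open>Radii along which the averages converge fast enough to converge almost surely, up to time \<open>T\<close>.\<close>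

locale levy_occ = levy_sym +
  fixes T :: real and es :: "nat \<Rightarrow> real"
  assumes T0: "0 \<le> T" and es0: "\<And>n. 0 < es n" and es_dec: "decseq es" and es_lim: "es \<longlonglongrightarrow> 0"
    and es_L1: "\<And>k t x e. 0 \<le> t \<Longrightarrow> t \<le> T \<Longrightarrow> 0 < e \<Longrightarrow> e \<le> es k \<Longrightarrow> (\<integral>w. \<bar>ar e x t (path 0 w) - ar (es k) x t (path 0 w)\<bar> \<partial>M) \<le> (1/2)^k"
begin

lemma LamP_meas[measurable]: "(\<lambda>w. Lam es x t (path 0 w)) \<in> borel_measurable M"
  by (rule measurable_compose[OF path_meas[OF order_refl] Lam_meas])

lemma LamEP_meas[measurable]: "(\<lambda>w. LamE es x t (path 0 w)) \<in> borel_measurable M"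
  by (rule measurable_compose[OF path_meas[OF order_refl] LamE_meas])

lemma LSP_meas[measurable]: "(\<lambda>w. LS x t (path 0 w)) \<in> borel_measurable M"
  by (rule measurable_compose[OF path_meas[OF order_refl] LS_meas])

lemma SSP_meas[measurable]: "(\<lambda>w. SS \<kappa> x t (path 0 w)) \<in> borel_measurable M"
  by (rule measurable_compose[OF path_meas[OF order_refl] SS_meas])

lemma es_mono: "k \<le> n \<Longrightarrow> es n \<le> es k" using es_dec by (rule decseqD)

lemma nn_ar_diff:
  assumes "0 \<le> t" "0 < e" "0 < e'"
  shows "(\<integral>\<^sup>+w. ennreal \<bar>ar e x t (path 0 w) - ar e' x t (path 0 w)\<bar> \<partial>M) = ennreal (\<integral>w. \<bar>ar e x t (path 0 w) - ar e' x t (path 0 w)\<bar> \<partial>M)"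
  using ar_integrable[of e t x] ar_integrable[of e' t x] assms by (intro nn_integral_eq_integral) auto

text \<open>The \<open>L1\<close> distances of consecutive averages are summable, so the differences
  are almost surely absolutely summable.\<close>

lemma Lam_conv:
  assumes t: "0 \<le> t" "t \<le> T"
  shows "AE w in M. (\<lambda>n. ar (es n) x t (path 0 w)) \<longlonglongrightarrow> Lam es x t (path 0 w) \<and> LamE es x t (path 0 w) = ennreal (Lam es x t (path 0 w))"
proof -
  let ?a = "\<lambda>n w. ar (es n) x t (path 0 w)"
  have "(\<integral>\<^sup>+w. (\<Sum>n. ennreal \<bar>?a (Suc n) w - ?a n w\<bar>) \<partial>M) = (\<Sum>n. (\<integral>\<^sup>+w. ennreal \<bar>?a (Suc n) w - ?a n w\<bar> \<partial>M))"
    by (rule nn_integral_suminf) measurable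
  also have "\<dots> \<le> (\<Sum>n. ennreal ((1/2)^n))"
  proof (rule suminf_le)
    fix n
    show "(\<integral>\<^sup>+w. ennreal \<bar>?a (Suc n) w - ?a n w\<bar> \<partial>M) \<le> ennreal ((1/2)^n)"
      unfolding nn_ar_diff[OF t(1) es0 es0] by (intro ennreal_leI es_L1 t es0 es_mono) simp
  qed auto
  also have "\<dots> = ennreal (\<Sum>n. (1/2)^n)" by (rule suminf_ennreal2) (auto intro: summable_geometric)
  also have "\<dots> < \<infinity>" by simp
  finally have "(\<integral>\<^sup>+w. (\<Sum>n. ennreal \<bar>?a (Suc n) w - ?a n w\<bar>) \<partial>M) \<noteq> \<infinity>" by simp
  moreover have "(\<lambda>w. \<Sum>n. ennreal \<bar>?a (Suc n) w - ?a n w\<bar>) \<in> borel_measurable M" by measurable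
  ultimately have "AE w in M. (\<Sum>n. ennreal \<bar>?a (Suc n) w - ?a n w\<bar>) \<noteq> \<infinity>" by (intro nn_integral_PInf_AE)
  then show ?thesis
  proof eventually_elim
    case (elim w)
    have "summable (\<lambda>n. \<bar>?a (Suc n) w - ?a n w\<bar>)"
      by (rule summable_suminf_not_top) (use elim in \<open>auto simp: infinity_ennreal_def\<close>)
    then have "summable (\<lambda>n. ?a (Suc n) w - ?a n w)" by (rule summable_rabs_cancel)
    then have "convergent (\<lambda>n. \<Sum>k<n. ?a (Suc k) w - ?a k w)" by (simp add: summable_iff_convergent)
    then obtain l where "(\<lambda>n. \<Sum>k<n. ?a (Suc k) w - ?a k w) \<longlonglongrightarrow> l" by (auto simp: convergent_def)
    then have "(\<lambda>n. ?a n w - ?a 0 w) \<longlonglongrightarrow> l" unfolding sum_lessThan_telescope[of "\<lambda>n. ?a n w"] .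
    then have "(\<lambda>n. (?a n w - ?a 0 w) + ?a 0 w) \<longlonglongrightarrow> l + ?a 0 w" by (intro tendsto_add tendsto_const)
    then have c: "(\<lambda>n. ?a n w) \<longlonglongrightarrow> l + ?a 0 w" by simp
    have l0: "0 \<le> l + ?a 0 w" by (rule LIMSEQ_le_const[OF c]) (auto simp: ar_nonneg)
    have "(\<lambda>n. avg (es n) x t (path 0 w)) \<longlonglongrightarrow> ennreal (l + ?a 0 w)"
      using tendsto_ennrealI[OF c] by (simp add: ar_avg es0 t)
    then have E: "LamE es x t (path 0 w) = ennreal (l + ?a 0 w)" unfolding LamE_def by (intro lim_imp_Liminf) auto
    then have "Lam es x t (path 0 w) = l + ?a 0 w" using l0 by (simp add: Lam_def)
    then show ?case using c E by simp
  qed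
qed

text \<open>Fatou's lemma along \<open>es\<close>; the factor 2 comes from passing through the
  radius \<open>es k\<close>.\<close>

lemma Lam_L1_nn:
  assumes t: "0 \<le> t" "t \<le> T" and e: "0 < e" "e \<le> es k"
  shows "(\<integral>\<^sup>+w. ennreal \<bar>ar e x t (path 0 w) - Lam es x t (path 0 w)\<bar> \<partial>M) \<le> ennreal (2 * (1/2)^k)"
proof -
  let ?a = "\<lambda>n w. ar (es n) x t (path 0 w)"
  have "(\<integral>\<^sup>+w. ennreal \<bar>ar e x t (path 0 w) - Lam es x t (path 0 w)\<bar> \<partial>M) = (\<integral>\<^sup>+w. liminf (\<lambda>n. ennreal \<bar>ar e x t (path 0 w) - ?a n w\<bar>) \<partial>M)"
  proof (rule nn_integral_cong_AE)
    show "AE w in M. ennreal \<bar>ar e x t (path 0 w) - Lam es x t (path 0 w)\<bar> = liminf (\<lambda>n. ennreal \<bar>ar e x t (path 0 w) - ?a n w\<bar>)"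
      using Lam_conv[OF t, of x]
    proof eventually_elim
      case (elim w)
      then have "(\<lambda>n. ennreal \<bar>ar e x t (path 0 w) - ?a n w\<bar>) \<longlonglongrightarrow> ennreal \<bar>ar e x t (path 0 w) - Lam es x t (path 0 w)\<bar>"
        by (intro tendsto_ennrealI tendsto_rabs tendsto_diff tendsto_const) auto
      from lim_imp_Liminf[OF sequentially_bot this] show ?case by simp
    qed
  qed
  also have "\<dots> \<le> liminf (\<lambda>n. \<integral>\<^sup>+w. ennreal \<bar>ar e x t (path 0 w) - ?a n w\<bar> \<partial>M)"
    by (rule nn_integral_liminf) measurable
  also have "\<dots> \<le> ennreal (2 * (1/2)^k)"
  proof (rule Liminf_le[OF sequentially_bot], rule eventually_sequentiallyI[of k])
    fix n assume n: "k \<le> n"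
    have "(\<integral>\<^sup>+w. ennreal \<bar>ar e x t (path 0 w) - ?a n w\<bar> \<partial>M) \<le> (\<integral>\<^sup>+w. ennreal \<bar>ar e x t (path 0 w) - ?a k w\<bar> + ennreal \<bar>?a n w - ?a k w\<bar> \<partial>M)"
    proof (rule nn_integral_mono)
      fix w
      have "\<bar>ar e x t (path 0 w) - ?a n w\<bar> \<le> \<bar>ar e x t (path 0 w) - ?a k w\<bar> + \<bar>?a n w - ?a k w\<bar>" by linarith
      then have "ennreal \<bar>ar e x t (path 0 w) - ?a n w\<bar> \<le> ennreal (\<bar>ar e x t (path 0 w) - ?a k w\<bar> + \<bar>?a n w - ?a k w\<bar>)"
        by (rule ennreal_leI)
      also have "\<dots> = ennreal \<bar>ar e x t (path 0 w) - ?a k w\<bar> + ennreal \<bar>?a n w - ?a k w\<bar>"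
        by (intro ennreal_plus) auto
      finally show "ennreal \<bar>ar e x t (path 0 w) - ?a n w\<bar> \<le> ennreal \<bar>ar e x t (path 0 w) - ?a k w\<bar> + ennreal \<bar>?a n w - ?a k w\<bar>" .
    qed
    also have "\<dots> = (\<integral>\<^sup>+w. ennreal \<bar>ar e x t (path 0 w) - ?a k w\<bar> \<partial>M) + (\<integral>\<^sup>+w. ennreal \<bar>?a n w - ?a k w\<bar> \<partial>M)"
      by (rule nn_integral_add) measurable
    also have "\<dots> \<le> ennreal ((1/2)^k) + ennreal ((1/2)^k)"
      unfolding nn_ar_diff[OF t(1) e(1) es0] nn_ar_diff[OF t(1) es0 es0]
      by (intro add_mono ennreal_leI es_L1 t e es0 es_mono n)
    also have "\<dots> = ennreal (2 * (1/2)^k)" by (subst ennreal_plus[symmetric]) auto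
    finally show "(\<integral>\<^sup>+w. ennreal \<bar>ar e x t (path 0 w) - ?a n w\<bar> \<partial>M) \<le> ennreal (2 * (1/2)^k)" .
  qed
  finally show ?thesis .
qed

lemma Lam_integrable: assumes t: "0 \<le> t" "t \<le> T" shows "integrable M (\<lambda>w. Lam es x t (path 0 w))"
proof -
  have "integrable M (\<lambda>w. ar (es 0) x t (path 0 w) - Lam es x t (path 0 w))"
    using Lam_L1_nn[OF t es0 order_refl, of 0 x] by (subst integrable_iff_bounded) (auto intro: le_less_trans)
  from Bochner_Integration.integrable_diff[OF ar_integrable[OF es0 t(1), of 0 x] this] show ?thesis by simp
qed

lemma GF_tendsto:
  assumes s: "0 \<le> s"
  shows "(\<lambda>n. GF s (fe (es n) x) v) \<longlonglongrightarrow> ennreal (occ s (x - v))"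
proof -
  let ?o = "occ s (x - v)"
  have o0: "0 \<le> ?o" by (rule occ_nonneg[OF s])
  have ex: "\<forall>\<^sub>F n in sequentially. ennreal (?o - k) \<le> GF s (fe (es n) x) v \<and> GF s (fe (es n) x) v \<le> ennreal (?o + k)" if k: "0 < k" for k
  proof -
    obtain d where d: "0 < d" "\<And>z. \<bar>z - (x - v)\<bar> < d \<Longrightarrow> \<bar>occ s z - ?o\<bar> < k"
      using occ_cont[OF s, of "x - v"] k unfolding continuous_at_eps_delta dist_real_def by (elim allE[of _ k]) auto
    have "\<forall>\<^sub>F n in sequentially. es n < d" using order_tendstoD(2)[OF es_lim d(1)] .
    then show ?thesis
    proof eventually_elim
      case (elim n)
      have c: "\<bar>occ s z - ?o\<bar> < k" if "\<bar>v + z - x\<bar> < es n" for z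
        by (rule d(2)) (use that elim in linarith)
      have "GF s (fe (es n) x) v \<le> ennreal (?o + k)"
      proof (rule GF_fe_le[OF es0 s])
        show "occ s z \<le> ?o + k" if "\<bar>v + z - x\<bar> < es n" for z using c[OF that] by linarith
      qed (use o0 k in simp)
      moreover have "ennreal (max 0 (?o - k)) \<le> GF s (fe (es n) x) v"
      proof (rule GF_fe_ge[OF es0 s])
        show "max 0 (?o - k) \<le> occ s z" if "\<bar>v + z - x\<bar> < es n" for z
        proof (rule max.boundedI[OF occ_nonneg[OF s]])
          show "?o - k \<le> occ s z" using c[OF that] by linarith
        qed
      qed simp
      ultimately show ?case by (auto intro: order_trans[OF ennreal_leI])
    qed
  qed
  define G where "G n = enn2real (GF s (fe (es n) x) v)" for n
  have fin: "GF s (fe (es n) x) v = ennreal (G n)" and G0: "0 \<le> G n" for n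
  proof -
    have "GF s (fe (es n) x) v < top" by (rule le_less_trans[OF GF_fe_sup[OF es0 s]]) simp
    then show "GF s (fe (es n) x) v = ennreal (G n)" by (simp add: G_def)
  qed (simp add: G_def)
  have "G \<longlonglongrightarrow> ?o"
  proof (rule LIMSEQ_I)
    fix r :: real assume r: "0 < r"
    from ex[of "r/2"] r have "\<forall>\<^sub>F n in sequentially. norm (G n - ?o) < r"
    proof (simp, elim eventually_mono)
      fix n assume h: "ennreal (?o - r/2) \<le> GF s (fe (es n) x) v \<and> GF s (fe (es n) x) v \<le> ennreal (?o + r/2)"
      have "?o - r/2 \<le> G n" using h G0[of n] unfolding fin by (simp add: ennreal_le_iff)
      moreover have "G n \<le> ?o + r/2"
      proof -
        have "0 \<le> ?o + r/2" using o0 r by simp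
        moreover have "ennreal (G n) \<le> ennreal (?o + r/2)" using h unfolding fin by (rule conjunct2)
        ultimately show ?thesis by (simp only: ennreal_le_iff)
      qed
      ultimately show "\<bar>G n - ?o\<bar> < r" using r by linarith
    qed
    then show "\<exists>no. \<forall>n\<ge>no. norm (G n - ?o) < r" by (simp add: eventually_sequentially)
  qed
  then show ?thesis unfolding fin by (rule tendsto_ennrealI)
qed

text \<open>The means of the averages converge in two ways: to the left side by \<open>L1\<close>
  convergence, and to the right side by continuity of \<open>occ\<close> at the level.\<close>

lemma Lam_mean:
  assumes t: "0 \<le> t" "t \<le> T"
  shows "(\<integral>w. Lam es x t (path 0 w) \<partial>M) = occ t x"
proof -
  have "(\<lambda>n. \<integral>w. ar (es n) x t (path 0 w) \<partial>M) \<longlonglongrightarrow> (\<integral>w. Lam es x t (path 0 w) \<partial>M)"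
  proof (rule tendsto_L1_int)
    show "(\<lambda>n. \<integral>\<^sup>+w. norm (ar (es n) x t (path 0 w) - Lam es x t (path 0 w)) \<partial>M) \<longlonglongrightarrow> 0"
    proof (rule tendsto_sandwich[OF _ _ tendsto_const])
      show "\<forall>\<^sub>F n in sequentially. (\<integral>\<^sup>+w. norm (ar (es n) x t (path 0 w) - Lam es x t (path 0 w)) \<partial>M) \<le> ennreal (2 * (1/2)^n)"
        using Lam_L1_nn[OF t es0 order_refl] by (intro always_eventually allI) simp
      have "(\<lambda>n. 2 * (1/2)^n :: real) \<longlonglongrightarrow> 2 * 0" by (intro tendsto_mult tendsto_const LIMSEQ_power_zero) simp
      then show "(\<lambda>n. ennreal (2 * (1/2)^n)) \<longlonglongrightarrow> 0" using tendsto_ennrealI by fastforce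
    qed simp
  qed (use ar_integrable[OF es0 t(1)] Lam_integrable[OF t] in auto)
  moreover have "(\<lambda>n. \<integral>w. ar (es n) x t (path 0 w) \<partial>M) \<longlonglongrightarrow> occ t x"
  proof -
    have "ennreal (\<integral>w. ar (es n) x t (path 0 w) \<partial>M) = GF t (fe (es n) x) 0" for n
    proof -
      have "ennreal (\<integral>w. ar (es n) x t (path 0 w) \<partial>M) = (\<integral>\<^sup>+w. ennreal (ar (es n) x t (path 0 w)) \<partial>M)"
        by (rule nn_integral_eq_integral[OF ar_integrable[OF es0 t(1)], symmetric]) (simp add: ar_nonneg)
      also have "\<dots> = (\<integral>\<^sup>+w. avg (es n) x t (path 0 w) \<partial>M)" by (simp add: ar_avg es0 t)
      also have "\<dots> = GF t (fe (es n) x) 0" by (rule avg_mean[OF t(1)])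
      finally show ?thesis .
    qed
    then have "(\<lambda>n. ennreal (\<integral>w. ar (es n) x t (path 0 w) \<partial>M)) \<longlonglongrightarrow> ennreal (occ t x)"
      using GF_tendsto[OF t(1), of x 0] by simp
    then show ?thesis
      by (subst (asm) tendsto_ennreal_iff) (auto intro!: always_eventually integral_nonneg_AE AE_I2 ar_nonneg occ_nonneg t)
  qed
  ultimately show ?thesis by (rule LIMSEQ_unique)
qed

text \<open>Fatou's lemma applied to \<open>avg_second_moment\<close>. The right side keeps the
  factor \<open>occ r x\<close>, which cancels in \<open>LS0_small\<close>.\<close>

lemma Lam_second_moment:
  assumes r: "0 \<le> r" "r \<le> t" "t \<le> T"
  shows "(\<integral>\<^sup>+w. LamE es x r (path 0 w) * LamE es x t (path 0 w) \<partial>M) \<le> 2 * ennreal (occ_sup t) * ennreal (occ r x)"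
proof -
  have t: "0 \<le> t" "t \<le> T" "r \<le> T" using r by auto
  have "(\<integral>\<^sup>+w. LamE es x r (path 0 w) * LamE es x t (path 0 w) \<partial>M) = (\<integral>\<^sup>+w. liminf (\<lambda>n. avg (es n) x r (path 0 w) * avg (es n) x t (path 0 w)) \<partial>M)"
  proof (rule nn_integral_cong_AE)
    show "AE w in M. LamE es x r (path 0 w) * LamE es x t (path 0 w) = liminf (\<lambda>n. avg (es n) x r (path 0 w) * avg (es n) x t (path 0 w))"
      using Lam_conv[OF r(1) t(3), of x] Lam_conv[OF t(1,2), of x]
    proof eventually_elim
      case (elim w)
      have "(\<lambda>n. ennreal (ar (es n) x r (path 0 w) * ar (es n) x t (path 0 w))) \<longlonglongrightarrow> ennreal (Lam es x r (path 0 w) * Lam es x t (path 0 w))"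
        using elim by (intro tendsto_ennrealI tendsto_mult) auto
      then have "(\<lambda>n. avg (es n) x r (path 0 w) * avg (es n) x t (path 0 w)) \<longlonglongrightarrow> LamE es x r (path 0 w) * LamE es x t (path 0 w)"
        using elim by (simp add: ennreal_mult ar_nonneg Lam_nonneg ar_avg es0 r t)
      from lim_imp_Liminf[OF sequentially_bot this] show ?case by simp
    qed
  qed
  also have "\<dots> \<le> liminf (\<lambda>n. \<integral>\<^sup>+w. avg (es n) x r (path 0 w) * avg (es n) x t (path 0 w) \<partial>M)"
    by (rule nn_integral_liminf) measurable
  also have "\<dots> \<le> liminf (\<lambda>n. 2 * ennreal (occ_sup t) * GF r (fe (es n) x) 0)"
    using avg_second_moment[OF es0 r(1,2)] avg_mean[OF r(1)] by (intro Liminf_mono always_eventually allI) simp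
  also have "\<dots> = 2 * ennreal (occ_sup t) * ennreal (occ r x)"
  proof (rule lim_imp_Liminf[OF sequentially_bot])
    have "(\<lambda>n. GF r (fe (es n) x) 0) \<longlonglongrightarrow> ennreal (occ r x)" using GF_tendsto[OF r(1), of x 0] by simp
    then show "(\<lambda>n. 2 * ennreal (occ_sup t) * GF r (fe (es n) x) 0) \<longlonglongrightarrow> 2 * ennreal (occ_sup t) * ennreal (occ r x)"
      by (intro ennreal_tendsto_cmult) (auto simp: ennreal_mult_less_top)
  qed
  finally show ?thesis .
qed

end

section \<open>Comparison of the limsup with the limit along a sequence\<close>

lemma ennreal_suminf_tendsto_0:
  fixes f :: "nat \<Rightarrow> ennreal"
  assumes "(\<Sum>n. f n) \<noteq> \<infinity>"
  shows "f \<longlonglongrightarrow> 0"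
proof -
  have fin: "f n = ennreal (enn2real (f n))" for n
  proof -
    have "f n \<le> (\<Sum>n. f n)" using sum_le_suminf[of f "{n}"] by simp
    also have "\<dots> < top" using assms by (simp add: less_top)
    finally show ?thesis by simp
  qed
  have "summable (\<lambda>n. enn2real (f n))"
  proof (rule summable_suminf_not_top)
    show "(\<Sum>n. ennreal (enn2real (f n))) \<noteq> top" using assms unfolding fin[symmetric] by simp
  qed simp
  then have "(\<lambda>n. enn2real (f n)) \<longlonglongrightarrow> 0" by (rule summable_LIMSEQ_zero)
  then have "(\<lambda>n. ennreal (enn2real (f n))) \<longlonglongrightarrow> ennreal 0" by (rule tendsto_ennrealI)
  then show ?thesis unfolding fin[symmetric] by simp
qed

lemma ennreal_min_1_add_le: "min 1 (a + b) \<le> min 1 a + min 1 (b :: ennreal)"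
proof (cases "1 \<le> a \<or> 1 \<le> b")
  case True
  have "min 1 (a + b) \<le> 1" by simp
  also have "1 \<le> min 1 a + min 1 b" using True by (auto simp: min_absorb1 intro: add_increasing add_increasing2)
  finally show ?thesis .
next
  case False
  then show ?thesis by (simp add: min_absorb2 not_le less_imp_le)
qed

context levy_occ begin

lemma path_space: "w \<in> space M \<Longrightarrow> path s w \<in> space PS"
  by (auto simp: path_def space_PiM)

lemma path0_pair: "(\<lambda>z. (fst z, path 0 (snd z))) \<in> (borel \<Otimes>\<^sub>M M) \<rightarrow>\<^sub>M (borel \<Otimes>\<^sub>M PS)"
proof -
  note [measurable] = path_meas[OF order_refl]
  show ?thesis by measurable
qed

lemma Lam_x_meas: "w \<in> space M \<Longrightarrow> (\<lambda>x. Lam es x t (path 0 w)) \<in> borel_measurable borel"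
  using measurable_compose[OF _ Lam_meas2, of "\<lambda>x. (x, path 0 w)" borel] path_space by simp

lemma ar_x_meas: "w \<in> space M \<Longrightarrow> (\<lambda>x. ar e x t (path 0 w)) \<in> borel_measurable borel"
  using measurable_compose[OF _ ar_meas2, of "\<lambda>x. (x, path 0 w)" borel] path_space by simp

lemma avg_x_meas: "w \<in> space M \<Longrightarrow> (\<lambda>x. avg e x t (path 0 w)) \<in> borel_measurable borel"
  using measurable_compose[OF _ avg_meas2, of "\<lambda>x. (x, path 0 w)" borel] path_space by simp

text \<open>For a position inside the small window, all levels within \<open>a\<close> of it lie in
  \<open>{z-e'..z+e'}\<close>, so integrating \<open>fe a\<close> over the levels gives exactly
  1.\<close>

lemma occupation_le_avg_integral:
  assumes v: "v \<in> space M" and e: "0 < e" "0 < a" "e + a \<le> e'"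
  shows "ennreal (2*e) * avg e z t (path 0 v) \<le> (\<integral>\<^sup>+x. avg a x t (path 0 v) * indicator {z-e'..z+e'} x \<partial>lborel)"
proof -
  let ?p = "path 0 v"
  note [measurable] = rg_meas1[OF path_space[OF v, of 0]]
  have m: "(\<lambda>(x,r). fe a x (rg ?p r) * indicator {0..t} r * indicator {z-e'..z+e'} x) \<in> borel_measurable (lborel \<Otimes>\<^sub>M lborel)"
  proof -
    have "(\<lambda>w. fe a (fst w) (rg ?p (snd w))) \<in> borel_measurable (lborel \<Otimes>\<^sub>M lborel)"
      using measurable_compose[OF _ fe_meas2, of "\<lambda>w. (fst w, rg ?p (snd w))" "lborel \<Otimes>\<^sub>M lborel"] by simp
    then show ?thesis unfolding case_prod_beta by measurable
  qed
  have one: "(\<integral>\<^sup>+x. fe a x y * indicator {z-e'..z+e'} x \<partial>lborel) = 1" if y: "y \<in> {z-e<..<z+e}" for y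
  proof -
    have "(\<integral>\<^sup>+x. fe a x y * indicator {z-e'..z+e'} x \<partial>lborel) = (\<integral>\<^sup>+x. ennreal (1/(2*a)) * indicator {y-a<..<y+a} x \<partial>lborel)"
      using y e by (intro nn_integral_cong) (auto simp: fe_def indicator_def)
    also have "\<dots> = ennreal (1/(2*a)) * ennreal (2*a)" using e by (subst nn_integral_cmult_indicator) auto
    also have "\<dots> = 1" using e by (subst ennreal_mult[symmetric]) auto
    finally show ?thesis .
  qed
  have "ennreal (2*e) * avg e z t ?p = AF (indicator {z-e<..<z+e}) t ?p"
    by (rule nu_avg[OF path_space[OF v] e(1), symmetric])
  also have "\<dots> \<le> (\<integral>\<^sup>+r. (\<integral>\<^sup>+x. fe a x (rg ?p r) * indicator {0..t} r * indicator {z-e'..z+e'} x \<partial>lborel) \<partial>lborel)"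
    unfolding AF_def
  proof (rule nn_integral_mono)
    fix r :: real
    show "indicator {z-e<..<z+e} (rg ?p r) * indicator {0..t} r \<le> (\<integral>\<^sup>+x. fe a x (rg ?p r) * indicator {0..t} r * indicator {z-e'..z+e'} x \<partial>lborel)"
      using one[of "rg ?p r"] by (cases "rg ?p r \<in> {z-e<..<z+e} \<and> r \<in> {0..t}") auto
  qed
  also have "\<dots> = (\<integral>\<^sup>+x. (\<integral>\<^sup>+r. fe a x (rg ?p r) * indicator {0..t} r * indicator {z-e'..z+e'} x \<partial>lborel) \<partial>lborel)"
    using lborel_pair.Fubini'[OF m] by simp
  also have "\<dots> = (\<integral>\<^sup>+x. avg a x t ?p * indicator {z-e'..z+e'} x \<partial>lborel)"
    unfolding avg_def AF_def by (intro nn_integral_cong nn_integral_multc) measurable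
  finally show ?thesis .
qed

text \<open>At a fixed outcome \<open>Lam\<close> is, as a function of the level, a density that
  dominates the occupation measure of intervals. The null set must not depend on the interval; hence
  the almost sure convergence is that of the local \<open>L1\<close> norms \<open>D n N\<close> over
  the level, which have summable means by Fubini.\<close>

lemma avg_le_Lam_integral:
  assumes t: "0 \<le> t" "t \<le> T"
  shows "AE w in M. (\<forall>n::nat. (\<integral>\<^sup>+x. ennreal (Lam es x t (path 0 w)) * indicator {-real n..real n} x \<partial>lborel) < \<infinity>) \<and>
    (\<forall>z e e'. 0 < e \<longrightarrow> e < e' \<longrightarrow> ennreal (2*e) * avg e z t (path 0 w) \<le> (\<integral>\<^sup>+x. ennreal (Lam es x t (path 0 w)) * indicator {z-e'..z+e'} x \<partial>lborel))"
proof -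
  interpret MLb: pair_sigma_finite lborel M ..
  define D where "D n N w = (\<integral>\<^sup>+x. ennreal \<bar>ar (es n) x t (path 0 w) - Lam es x t (path 0 w)\<bar> * indicator {-real N..real N} x \<partial>lborel)" for n N :: nat and w
  have m: "(\<lambda>(x,w). ennreal \<bar>ar (es n) x t (path 0 w) - Lam es x t (path 0 w)\<bar> * indicator {-real N..real N} x) \<in> borel_measurable (lborel \<Otimes>\<^sub>M M)" for n N
  proof -
    have [measurable]: "(\<lambda>z. ar (es n) (fst z) t (path 0 (snd z))) \<in> borel_measurable (borel \<Otimes>\<^sub>M M)"
      using measurable_compose[OF path0_pair ar_meas2] by simp
    have [measurable]: "(\<lambda>z. Lam es (fst z) t (path 0 (snd z))) \<in> borel_measurable (borel \<Otimes>\<^sub>M M)"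
      using measurable_compose[OF path0_pair Lam_meas2] by simp
    have "(\<lambda>(x,w). ennreal \<bar>ar (es n) x t (path 0 w) - Lam es x t (path 0 w)\<bar> * indicator {-real N..real N} x) \<in> borel_measurable (borel \<Otimes>\<^sub>M M)"
      unfolding case_prod_beta by measurable
    then show ?thesis by (simp cong: measurable_cong_sets sets_pair_measure_cong)
  qed
  have Dm[measurable]: "D n N \<in> borel_measurable M" for n N
    unfolding D_def[abs_def] using lborel.borel_measurable_nn_integral_fst[OF measurable_pair_swap[OF m[of n N]]] by simp
  have ED: "(\<integral>\<^sup>+w. D n N w \<partial>M) \<le> ennreal (4 * real N * (1/2)^n)" for n N
  proof -
    have "(\<integral>\<^sup>+w. D n N w \<partial>M) = (\<integral>\<^sup>+x. (\<integral>\<^sup>+w. ennreal \<bar>ar (es n) x t (path 0 w) - Lam es x t (path 0 w)\<bar> * indicator {-real N..real N} x \<partial>M) \<partial>lborel)"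
      unfolding D_def using MLb.Fubini'[OF m[of n N]] by simp
    also have "\<dots> \<le> (\<integral>\<^sup>+x. ennreal (2 * (1/2)^n) * indicator {-real N..real N} x \<partial>lborel)"
      using Lam_L1_nn[OF t es0 order_refl] by (intro nn_integral_mono) (auto simp: indicator_def)
    also have "\<dots> = ennreal (2 * (1/2)^n) * ennreal (2 * real N)" by (subst nn_integral_cmult_indicator) auto
    also have "\<dots> = ennreal (4 * real N * (1/2)^n)" by (subst ennreal_mult[symmetric]) (auto simp: mult_ac)
    finally show ?thesis .
  qed
  have "AE w in M. (\<lambda>n. D n N w) \<longlonglongrightarrow> 0" for N
  proof -
    have "(\<integral>\<^sup>+w. (\<Sum>n. D n N w) \<partial>M) = (\<Sum>n. (\<integral>\<^sup>+w. D n N w \<partial>M))" by (rule nn_integral_suminf) measurable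
    also have "\<dots> \<le> (\<Sum>n. ennreal (4 * real N * (1/2)^n))" by (intro suminf_le ED) auto
    also have "\<dots> = ennreal (\<Sum>n. 4 * real N * (1/2)^n)" by (rule suminf_ennreal2) (auto intro: summable_geometric summable_mult)
    also have "\<dots> < \<infinity>" by simp
    finally have "(\<integral>\<^sup>+w. (\<Sum>n. D n N w) \<partial>M) \<noteq> \<infinity>" by simp
    moreover have "(\<lambda>w. \<Sum>n. D n N w) \<in> borel_measurable M" by measurable
    ultimately have "AE w in M. (\<Sum>n. D n N w) \<noteq> \<infinity>" by (intro nn_integral_PInf_AE)
    then show ?thesis by eventually_elim (rule ennreal_suminf_tendsto_0)
  qed
  then have "AE w in M. \<forall>N. (\<lambda>n. D n N w) \<longlonglongrightarrow> 0" by (simp add: AE_all_countable)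
  moreover have "AE w in M. w \<in> space M" by simp
  ultimately show ?thesis
  proof eventually_elim
    case (elim w)
    let ?p = "path 0 w"
    note w = elim(2)
    note [measurable] = Lam_x_meas[OF w] ar_x_meas[OF w] avg_x_meas[OF w]
    show ?case
    proof (intro conjI allI impI)
      fix N :: nat
      have "\<forall>\<^sub>F n in sequentially. D n N w < 1" using elim(1) by (intro order_tendstoD(2)[of _ 0]) auto
      then obtain n where n: "D n N w < 1" by (auto simp: eventually_sequentially)
      have "(\<integral>\<^sup>+x. ennreal (Lam es x t ?p) * indicator {-real N..real N} x \<partial>lborel) \<le>
        (\<integral>\<^sup>+x. ennreal (t/(2*es n)) * indicator {-real N..real N} x + ennreal \<bar>ar (es n) x t ?p - Lam es x t ?p\<bar> * indicator {-real N..real N} x \<partial>lborel)"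
      proof (rule nn_integral_mono)
        fix x :: real
        have "Lam es x t ?p \<le> t/(2*es n) + \<bar>ar (es n) x t ?p - Lam es x t ?p\<bar>"
          using ar_le[OF es0 t(1), of n x ?p] by linarith
        then have "ennreal (Lam es x t ?p) \<le> ennreal (t/(2*es n) + \<bar>ar (es n) x t ?p - Lam es x t ?p\<bar>)" by (rule ennreal_leI)
        also have "\<dots> = ennreal (t/(2*es n)) + ennreal \<bar>ar (es n) x t ?p - Lam es x t ?p\<bar>"
          using t es0[of n] by (intro ennreal_plus) auto
        finally show "ennreal (Lam es x t ?p) * indicator {-real N..real N} x \<le> ennreal (t/(2*es n)) * indicator {-real N..real N} x + ennreal \<bar>ar (es n) x t ?p - Lam es x t ?p\<bar> * indicator {-real N..real N} x"
          by (auto simp: indicator_def)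
      qed
      also have "\<dots> = (\<integral>\<^sup>+x. ennreal (t/(2*es n)) * indicator {-real N..real N} x \<partial>lborel) + D n N w"
        unfolding D_def by (rule nn_integral_add) measurable
      also have "\<dots> < \<infinity>" using n by (subst nn_integral_cmult_indicator) (auto simp: ennreal_mult_less_top emeasure_lborel_Icc_eq order_less_trans)
      finally show "(\<integral>\<^sup>+x. ennreal (Lam es x t ?p) * indicator {-real N..real N} x \<partial>lborel) < \<infinity>" .
    next
      fix z e e' :: real assume e: "0 < e" "e < e'"
      obtain N where N: "\<bar>z\<bar> + e' \<le> real N" using real_arch_simple by blast
      have "\<forall>\<^sub>F n in sequentially. es n < e' - e" using e by (intro order_tendstoD(2)[OF es_lim]) simp
      then have "\<forall>\<^sub>F n in sequentially. ennreal (2*e) * avg e z t ?p \<le> (\<integral>\<^sup>+x. ennreal (Lam es x t ?p) * indicator {z-e'..z+e'} x \<partial>lborel) + D n N w"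
      proof eventually_elim
        case (elim n)
        have "ennreal (2*e) * avg e z t ?p \<le> (\<integral>\<^sup>+x. avg (es n) x t ?p * indicator {z-e'..z+e'} x \<partial>lborel)"
          by (rule occupation_le_avg_integral[OF w e(1) es0]) (use elim in simp)
        also have "\<dots> \<le> (\<integral>\<^sup>+x. ennreal (Lam es x t ?p) * indicator {z-e'..z+e'} x + ennreal \<bar>ar (es n) x t ?p - Lam es x t ?p\<bar> * indicator {-real N..real N} x \<partial>lborel)"
        proof (rule nn_integral_mono)
          fix x :: real
          have "ar (es n) x t ?p \<le> Lam es x t ?p + \<bar>ar (es n) x t ?p - Lam es x t ?p\<bar>" by linarith
          then have "ennreal (ar (es n) x t ?p) \<le> ennreal (Lam es x t ?p + \<bar>ar (es n) x t ?p - Lam es x t ?p\<bar>)" by (rule ennreal_leI)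
          also have "\<dots> = ennreal (Lam es x t ?p) + ennreal \<bar>ar (es n) x t ?p - Lam es x t ?p\<bar>"
            by (intro ennreal_plus Lam_nonneg) auto
          finally have a: "avg (es n) x t ?p \<le> ennreal (Lam es x t ?p) + ennreal \<bar>ar (es n) x t ?p - Lam es x t ?p\<bar>"
            unfolding ar_avg[OF es0 t(1)] .
          show "avg (es n) x t ?p * indicator {z-e'..z+e'} x \<le> ennreal (Lam es x t ?p) * indicator {z-e'..z+e'} x + ennreal \<bar>ar (es n) x t ?p - Lam es x t ?p\<bar> * indicator {-real N..real N} x"
          proof (cases "x \<in> {z-e'..z+e'}")
            case True
            then have "x \<in> {-real N..real N}" using N by auto
            then show ?thesis using True a by simp
          qed simp
        qed
        also have "\<dots> = (\<integral>\<^sup>+x. ennreal (Lam es x t ?p) * indicator {z-e'..z+e'} x \<partial>lborel) + D n N w"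
          unfolding D_def by (rule nn_integral_add) measurable
        finally show ?case .
      qed
      moreover have "(\<lambda>n. (\<integral>\<^sup>+x. ennreal (Lam es x t ?p) * indicator {z-e'..z+e'} x \<partial>lborel) + D n N w) \<longlonglongrightarrow> (\<integral>\<^sup>+x. ennreal (Lam es x t ?p) * indicator {z-e'..z+e'} x \<partial>lborel) + 0"
        using elim(1) by (intro tendsto_add tendsto_const) auto
      ultimately show "ennreal (2*e) * avg e z t ?p \<le> (\<integral>\<^sup>+x. ennreal (Lam es x t ?p) * indicator {z-e'..z+e'} x \<partial>lborel)"
        using tendsto_lowerbound[OF _ _ sequentially_bot] by fastforce
    qed
  qed
qed

text \<open>Lebesgue differentiation of \<open>Lam\<close> in the level at a fixed outcome, then
  Fubini to exchange level and outcome. Joint measurability of \<open>LS\<close> and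
  \<open>LamE\<close> in both variables is what makes the exchange possible.\<close>

lemma LS_le_Lam_AE:
  assumes t: "0 \<le> t" "t \<le> T"
  shows "AE x in lborel. AE w in M. LS x t (path 0 w) \<le> LamE es x t (path 0 w)"
proof -
  interpret MLb: pair_sigma_finite lborel M ..
  have "AE w in M. AE x in lborel. LS x t (path 0 w) \<le> LamE es x t (path 0 w)"
    using avg_le_Lam_integral[OF t] AE_space[of M]
  proof eventually_elim
    case (elim w)
    let ?p = "path 0 w"
    have "AE x in lborel. \<forall>k>0. \<exists>d>0. \<forall>h. 0 < h \<longrightarrow> h < d \<longrightarrow>
     (\<integral>\<^sup>+y. ennreal (Lam es y t ?p) * indicator {x-h..x+h} y \<partial>lborel) \<le> ennreal (2*h*(Lam es x t ?p + k))"
      using elim by (intro lebesgue_point_upper Lam_x_meas Lam_nonneg) auto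
    then show ?case
    proof eventually_elim
      case e2: (elim x)
      let ?f = "Lam es x t ?p"
      have f0: "0 \<le> ?f" by (rule Lam_nonneg)
      have k: "LS x t ?p \<le> ennreal ((1 + k) * (?f + k))" if k: "0 < k" for k
      proof -
        obtain d where d: "0 < d" "\<And>h. 0 < h \<Longrightarrow> h < d \<Longrightarrow> (\<integral>\<^sup>+y. ennreal (Lam es y t ?p) * indicator {x-h..x+h} y \<partial>lborel) \<le> ennreal (2*h*(?f + k))"
          using e2 k by blast
        have "\<exists>n. 1 / (real n + 1) < d / (1 + k)"
        proof -
          obtain n where "inverse (real (Suc n)) < d / (1 + k)" using reals_Archimedean[of "d / (1 + k)"] d(1) k by auto
          then show ?thesis by (intro exI[of _ n]) (simp add: inverse_eq_divide add.commute)
        qed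
        then obtain n where n: "1 / (real n + 1) < d / (1 + k)" by blast
        have "LS x t ?p \<le> SS (1 / (real n + 1)) x t ?p" unfolding LS_def by (rule INF_lower) simp
        also have "\<dots> \<le> ennreal ((1 + k) * (?f + k))" unfolding SS_def
        proof (rule SUP_least)
          fix e assume "e \<in> \<rat> \<inter> {0<..<1 / (real n + 1)}"
          then have e: "0 < e" "e < d / (1 + k)" using n by auto
          \<comment> \<open>\<open>avg_le_Lam_integral\<close> needs a strictly larger interval;
            enlarging by the factor \<open>1 + k\<close> costs just that factor, which tends to 1 at
            the end.\<close>
          let ?e' = "(1 + k) * e"
          have e': "e < ?e'" "?e' < d" "0 < ?e'" using e k by (auto simp: pos_less_divide_eq mult.commute)
          have "ennreal (2*e) * avg e x t ?p \<le> (\<integral>\<^sup>+y. ennreal (Lam es y t ?p) * indicator {x-?e'..x+?e'} y \<partial>lborel)"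
            using elim e e' by blast
          also have "\<dots> \<le> ennreal (2*?e'*(?f + k))" by (rule d(2)[OF e'(3,2)])
          finally have "ennreal (1/(2*e)) * (ennreal (2*e) * avg e x t ?p) \<le> ennreal (1/(2*e)) * ennreal (2*?e'*(?f + k))" by (rule mult_left_mono) simp
          also have "ennreal (1/(2*e)) * ennreal (2*?e'*(?f + k)) = ennreal ((1 + k) * (?f + k))"
          proof -
            have "1/(2*e) * (2*?e'*(?f + k)) = (1 + k) * (?f + k)" using e by simp
            moreover have "ennreal (1/(2*e)) * ennreal (2*?e'*(?f + k)) = ennreal (1/(2*e) * (2*?e'*(?f + k)))"
              using e k f0 by (intro ennreal_mult[symmetric]) auto
            ultimately show ?thesis by simp
          qed
          also have "ennreal (1/(2*e)) * (ennreal (2*e) * avg e x t ?p) = avg e x t ?p"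
          proof -
            have "ennreal (1/(2*e)) * ennreal (2*e) = 1" using e by (subst ennreal_mult[symmetric]) auto
            then show ?thesis by (simp only: mult.assoc[symmetric] mult_1)
          qed
          finally show "avg e x t ?p \<le> ennreal ((1 + k) * (?f + k))" .
        qed
        finally show ?thesis .
      qed
      have "(\<lambda>n. 1 / (real n + 1)) \<longlonglongrightarrow> 0"
        using LIMSEQ_inverse_real_of_nat by (simp only: inverse_eq_divide of_nat_Suc add.commute[of 1])
      then have "(\<lambda>n. (1 + 1 / (real n + 1)) * (?f + 1 / (real n + 1))) \<longlonglongrightarrow> (1 + 0) * (?f + 0)" by (intro tendsto_intros)
      then have lim: "(\<lambda>n. ennreal ((1 + 1 / (real n + 1)) * (?f + 1 / (real n + 1)))) \<longlonglongrightarrow> ennreal ?f" using tendsto_ennrealI by fastforce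
      have "LS x t ?p \<le> ennreal ?f"
        by (rule LIMSEQ_le_const[OF lim]) (intro exI[of _ 0] allI impI k, simp)
      also have "\<dots> \<le> LamE es x t ?p" unfolding Lam_def by (cases "LamE es x t ?p") auto
      finally show ?case .
    qed
  qed
  moreover have "{z \<in> space (lborel \<Otimes>\<^sub>M M). LS (fst z) t (path 0 (snd z)) \<le> LamE es (fst z) t (path 0 (snd z))} \<in> sets (lborel \<Otimes>\<^sub>M M)"
  proof -
    have [measurable]: "(\<lambda>z. LS (fst z) t (path 0 (snd z))) \<in> borel_measurable (borel \<Otimes>\<^sub>M M)"
      using measurable_compose[OF path0_pair LS_meas2] by simp
    have [measurable]: "(\<lambda>z. LamE es (fst z) t (path 0 (snd z))) \<in> borel_measurable (borel \<Otimes>\<^sub>M M)"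
      using measurable_compose[OF path0_pair LamE_meas2] by simp
    have "{z \<in> space (borel \<Otimes>\<^sub>M M). LS (fst z) t (path 0 (snd z)) \<le> LamE es (fst z) t (path 0 (snd z))} \<in> sets (borel \<Otimes>\<^sub>M M)"
      by measurable
    then show ?thesis by (simp add: space_pair_measure cong: sets_pair_measure_cong)
  qed
  ultimately show ?thesis using MLb.AE_commute[of "\<lambda>x w. LS x t (path 0 w) \<le> LamE es x t (path 0 w)"] by blast
qed

text \<open>Shrunk windows with the normalisation of the full radius: a path that starts within
  \<open>k\<close> of a level \<open>w\<close> and is within \<open>e - k\<close> of its start is
  within \<open>e\<close> of \<open>w\<close>. For \<open>e <= k\<close> the window is
  empty.\<close>

definition Sk :: "real \<Rightarrow> real \<Rightarrow> real \<Rightarrow> (real \<Rightarrow> real) \<Rightarrow> ennreal" where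
  "Sk \<kappa> k r p = (SUP e\<in>\<rat> \<inter> {0<..<\<kappa>}. ennreal (1/(2*e)) * AF (indicator {-(e-k)<..<e-k}) r p)"

lemma Sk_meas[measurable]: "Sk \<kappa> k r \<in> borel_measurable PS"
  unfolding Sk_def[abs_def]
proof (rule borel_measurable_SUP)
  show "countable (\<rat> \<inter> {0<..<\<kappa>})" using countable_rat by (rule countable_subset[rotated]) auto
  have [measurable]: "AF (indicator {-(e-k)<..<e-k}) r \<in> borel_measurable PS" for e by (rule AF_meas) measurable
  show "(\<lambda>p. ennreal (1/(2*e)) * AF (indicator {-(e-k)<..<e-k}) r p) \<in> borel_measurable PS" for e by measurable
qed

lemma Sk_mono: "k' \<le> k \<Longrightarrow> Sk \<kappa> k r p \<le> Sk \<kappa> k' r p"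
  unfolding Sk_def AF_def by (intro SUP_mono' mult_left_mono nn_integral_mono) (auto simp: indicator_def)

text \<open>As \<open>n\<close> grows, the shrunk windows increase to the open window of radius
  \<open>e\<close>, so monotone convergence applies for each radius.\<close>

lemma SS_le_SUP_Sk:
  assumes p: "p \<in> space PS"
  shows "SS \<kappa> 0 r p \<le> (SUP n. Sk \<kappa> (es n) r p)"
  unfolding SS_def
proof (rule SUP_least)
  fix e assume e: "e \<in> \<rat> \<inter> {0<..<\<kappa>}"
  note [measurable] = rg_meas1[OF p]
  have "AF (indicator {0-e<..<0+e}) r p = (\<integral>\<^sup>+s. (SUP n. indicator {-(e-es n)<..<e-es n} (rg p s) * indicator {0..r} s) \<partial>lborel)"
    unfolding AF_def
  proof (rule nn_integral_cong)
    fix s :: real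
    show "indicator {0-e<..<0+e} (rg p s) * indicator {0..r} s = (SUP n. indicator {-(e-es n)<..<e-es n} (rg p s) * indicator {0..r} s :: ennreal)"
    proof (rule antisym)
      show "(SUP n. indicator {-(e-es n)<..<e-es n} (rg p s) * indicator {0..r} s :: ennreal) \<le> indicator {0-e<..<0+e} (rg p s) * indicator {0..r} s"
      proof (rule SUP_least)
        fix n show "indicator {-(e-es n)<..<e-es n} (rg p s) * indicator {0..r} s \<le> (indicator {0-e<..<0+e} (rg p s) * indicator {0..r} s :: ennreal)"
          using es0[of n] by (auto simp: indicator_def)
      qed
      show "indicator {0-e<..<0+e} (rg p s) * indicator {0..r} s \<le> (SUP n. indicator {-(e-es n)<..<e-es n} (rg p s) * indicator {0..r} s :: ennreal)"
      proof (cases "rg p s \<in> {0-e<..<0+e}")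
        case True
        then have "0 < e - \<bar>rg p s\<bar>" by auto
        from order_tendstoD(2)[OF es_lim this] obtain n where "es n < e - \<bar>rg p s\<bar>" by (auto simp: eventually_sequentially)
        then have "rg p s \<in> {-(e-es n)<..<e-es n}" by auto
        then have "indicator {0-e<..<0+e} (rg p s) * indicator {0..r} s \<le> (indicator {-(e-es n)<..<e-es n} (rg p s) * indicator {0..r} s :: ennreal)" using True by simp
        also have "\<dots> \<le> (SUP n. indicator {-(e-es n)<..<e-es n} (rg p s) * indicator {0..r} s)" by (rule SUP_upper) simp
        finally show ?thesis .
      qed simp
    qed
  qed
  also have "\<dots> = (SUP n. AF (indicator {-(e-es n)<..<e-es n}) r p)"
    unfolding AF_def
  proof (rule nn_integral_monotone_convergence_SUP)
    show "incseq (\<lambda>n s. indicator {-(e-es n)<..<e-es n} (rg p s) * indicator {0..r} s :: ennreal)"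
    proof (rule incseq_SucI, rule le_funI)
      fix n s
      show "indicator {-(e-es n)<..<e-es n} (rg p s) * indicator {0..r} s \<le> (indicator {-(e-es (Suc n))<..<e-es (Suc n)} (rg p s) * indicator {0..r} s :: ennreal)"
        using es_mono[of n "Suc n"] by (auto simp: indicator_def)
    qed
  qed measurable
  finally have "avg e 0 r p = ennreal (1/(2*e)) * (SUP n. AF (indicator {-(e-es n)<..<e-es n}) r p)"
    unfolding avg_nu[OF p] by simp
  also have "\<dots> = (SUP n. ennreal (1/(2*e)) * AF (indicator {-(e-es n)<..<e-es n}) r p)" by (rule SUP_mult_left_ennreal)
  also have "\<dots> \<le> (SUP n. Sk \<kappa> (es n) r p)"
  proof (rule SUP_mono')
    show "ennreal (1/(2*e)) * AF (indicator {-(e-es n)<..<e-es n}) r p \<le> Sk \<kappa> (es n) r p" for n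
      unfolding Sk_def using e by (intro SUP_upper) auto
  qed
  finally show "avg e 0 r p \<le> (SUP n. Sk \<kappa> (es n) r p)" .
qed

text \<open>By the triangle inequality a shrunk window around the restart point lies in the full
  window around \<open>w\<close>. The time horizon doubles because the restart happens at some
  \<open>s \<le> r\<close> and the path is followed for another \<open>r\<close>.\<close>

lemma SS_ge_Sk:
  assumes v: "v \<in> space M" and s: "0 \<le> s" "s \<le> r" and k: "\<bar>Y s v - w\<bar> < k"
  shows "Sk \<kappa> k r (path s v) \<le> SS \<kappa> w (2*r) (path 0 v)"
  unfolding Sk_def SS_def
proof (rule SUP_mono)
  fix e assume e: "e \<in> \<rat> \<inter> {0<..<\<kappa>}"
  have "AF (indicator {-(e-k)<..<e-k}) r (path s v) \<le> AF (\<lambda>y. indicator {w-e<..<w+e} (Y s v + y)) r (path s v)"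
    unfolding AF_def
  proof (rule nn_integral_mono, rule mult_right_mono)
    fix u
    show "indicator {-(e-k)<..<e-k} (rg (path s v) u) \<le> (indicator {w-e<..<w+e} (Y s v + rg (path s v) u) :: ennreal)"
    proof (cases "rg (path s v) u \<in> {-(e-k)<..<e-k}")
      case True
      then have "\<bar>rg (path s v) u\<bar> < e - k" by auto
      then have "\<bar>Y s v + rg (path s v) u - w\<bar> < e" using k by linarith
      then have "Y s v + rg (path s v) u \<in> {w-e<..<w+e}" by (auto simp: abs_less_iff)
      then show ?thesis using True by simp
    qed simp
  qed simp
  also have "\<dots> = (\<integral>\<^sup>+u. indicator {w-e<..<w+e} (Y u v) * indicator {s..s+r} u \<partial>lborel)"
    by (rule AF_path_shift[OF v s(1)]) measurable
  also have "\<dots> \<le> (\<integral>\<^sup>+u. indicator {w-e<..<w+e} (Y u v) * indicator {0..2*r} u \<partial>lborel)"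
    using s by (intro nn_integral_mono) (auto simp: indicator_def)
  also have "\<dots> = AF (indicator {w-e<..<w+e}) (2*r) (path 0 v)" by (rule AF_path0[OF v, symmetric])
  finally have "ennreal (1/(2*e)) * AF (indicator {-(e-k)<..<e-k}) r (path s v) \<le> avg e w (2*r) (path 0 v)"
    unfolding avg_nu[OF path_space[OF v]] by (intro mult_left_mono) auto
  then show "\<exists>e'\<in>\<rat> \<inter> {0<..<\<kappa>}. ennreal (1/(2*e)) * AF (indicator {-(e-k)<..<e-k}) r (path s v) \<le> avg e' w (2*r) (path 0 v)"
    using e by blast
qed

text \<open>Each restart time \<open>s \<le> r\<close> is weighted by the normalised indicator that
  the path is within \<open>k\<close> of \<open>w\<close>. The path after \<open>s\<close> is
  independent of that event and distributed as \<open>path 0\<close>, so the mean factorises, and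
  \<open>SS_ge_Sk\<close> bounds the occupation near the restart point by the occupation near
  \<open>w\<close>.\<close>

lemma transfer:
  assumes r: "0 \<le> r" and k: "0 < k"
  shows "(\<integral>\<^sup>+v. avg k w r (path 0 v) \<partial>M) * (\<integral>\<^sup>+v. min 1 (Sk \<kappa> k r (path 0 v)) \<partial>M) \<le>
    (\<integral>\<^sup>+v. avg k w r (path 0 v) * min 1 (SS \<kappa> w (2*r) (path 0 v)) \<partial>M)"
proof -
  interpret MLb: pair_sigma_finite M lborel ..
  let ?C = "\<integral>\<^sup>+v. min 1 (Sk \<kappa> k r (path 0 v)) \<partial>M"
  have [measurable]: "(\<lambda>v. Sk \<kappa> k r (path s v)) \<in> borel_measurable M" if "0 \<le> s" for s
    by (rule measurable_compose[OF path_meas[OF that] Sk_meas])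
  note [measurable] = AF_mean_time(2)[OF fe_meas[of k w]]
  have Ym[measurable]: "(\<lambda>x. Y (max 0 (snd x)) (fst x)) \<in> borel_measurable (M \<Otimes>\<^sub>M lborel)"
    using measurable_compose[OF _ Y_joint, of "\<lambda>x. (snd x, fst x)" "M \<Otimes>\<^sub>M lborel"] by simp
  have m: "(\<lambda>(v,s). fe k w (Y (max 0 s) v) * indicator {0..r} s * min 1 (SS \<kappa> w (2*r) (path 0 v))) \<in> borel_measurable (M \<Otimes>\<^sub>M lborel)"
    unfolding case_prod_beta by measurable
  have "(\<integral>\<^sup>+v. avg k w r (path 0 v) \<partial>M) * ?C = (\<integral>\<^sup>+s. indicator {0..r} s * (\<integral>\<^sup>+v. fe k w (Y (max 0 s) v) \<partial>M) \<partial>lborel) * ?C"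
    unfolding avg_def AF_mean_time(1)[OF fe_meas] ..
  also have "\<dots> = (\<integral>\<^sup>+s. indicator {0..r} s * (\<integral>\<^sup>+v. fe k w (Y (max 0 s) v) \<partial>M) * ?C \<partial>lborel)"
    by (rule nn_integral_multc[symmetric]) measurable
  also have "\<dots> \<le> (\<integral>\<^sup>+s. (\<integral>\<^sup>+v. fe k w (Y (max 0 s) v) * indicator {0..r} s * min 1 (SS \<kappa> w (2*r) (path 0 v)) \<partial>M) \<partial>lborel)"
  proof (rule nn_integral_mono)
    fix s :: real
    show "indicator {0..r} s * (\<integral>\<^sup>+v. fe k w (Y (max 0 s) v) \<partial>M) * ?C \<le> (\<integral>\<^sup>+v. fe k w (Y (max 0 s) v) * indicator {0..r} s * min 1 (SS \<kappa> w (2*r) (path 0 v)) \<partial>M)"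
    proof (cases "s \<in> {0..r}")
      case True
      then have s: "0 \<le> s" "s \<le> r" by auto
      have Ys[measurable]: "Y s \<in> borel_measurable M" using s by simp
      note [measurable] = Y_Fil[OF s(1)]
      have "(\<integral>\<^sup>+v. fe k w (Y s v) \<partial>M) * ?C = (\<integral>\<^sup>+v. (\<integral>\<^sup>+v'. (\<lambda>(v,p). fe k w (Y s v) * min 1 (Sk \<kappa> k r p)) (v, path 0 v') \<partial>M) \<partial>M)"
        by (simp add: nn_integral_cmult nn_integral_multc)
      also have "\<dots> = (\<integral>\<^sup>+v. (\<lambda>(v,p). fe k w (Y s v) * min 1 (Sk \<kappa> k r p)) (v, path s v) \<partial>M)"
        by (rule markov_nn[OF s(1), symmetric]) measurable
      also have "\<dots> \<le> (\<integral>\<^sup>+v. fe k w (Y s v) * min 1 (SS \<kappa> w (2*r) (path 0 v)) \<partial>M)"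
      proof (rule nn_integral_mono)
        fix v assume v: "v \<in> space M"
        show "(\<lambda>(v,p). fe k w (Y s v) * min 1 (Sk \<kappa> k r p)) (v, path s v) \<le> fe k w (Y s v) * min 1 (SS \<kappa> w (2*r) (path 0 v))"
        proof (cases "\<bar>Y s v - w\<bar> < k")
          case True
          have "min 1 (Sk \<kappa> k r (path s v)) \<le> min 1 (SS \<kappa> w (2*r) (path 0 v))"
            by (intro min.mono order_refl SS_ge_Sk[OF v s True])
          then show ?thesis by (simp add: mult_left_mono)
        next
          case False
          then have "fe k w (Y s v) = 0" by (auto simp: fe_def indicator_def abs_less_iff)
          then show ?thesis by simp
        qed
      qed
      finally show ?thesis using True by (simp add: mult.assoc)
    qed simp
  qed
  also have "\<dots> = (\<integral>\<^sup>+v. (\<integral>\<^sup>+s. fe k w (Y (max 0 s) v) * indicator {0..r} s * min 1 (SS \<kappa> w (2*r) (path 0 v)) \<partial>lborel) \<partial>M)"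
    using MLb.Fubini'[OF m] by simp
  also have "\<dots> = (\<integral>\<^sup>+v. avg k w r (path 0 v) * min 1 (SS \<kappa> w (2*r) (path 0 v)) \<partial>M)"
  proof (rule nn_integral_cong)
    fix v assume v: "v \<in> space M"
    have [measurable]: "(\<lambda>r. Y (max 0 r) v) \<in> borel_measurable borel"
      using measurable_compose[OF _ Y_joint, of "\<lambda>r. (r, v)" borel] v by simp
    show "(\<integral>\<^sup>+s. fe k w (Y (max 0 s) v) * indicator {0..r} s * min 1 (SS \<kappa> w (2*r) (path 0 v)) \<partial>lborel) = avg k w r (path 0 v) * min 1 (SS \<kappa> w (2*r) (path 0 v))"
      unfolding avg_def AF_def rg_path0[OF v] by (rule nn_integral_multc) measurable
  qed
  finally show ?thesis .
qed

end

context levy_occ begin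

lemma occ_total: assumes r: "0 < r" shows "(\<integral>\<^sup>+z. ennreal (occ r z) \<partial>lborel) = ennreal r"
proof -
  have "(\<integral>\<^sup>+z. ennreal (occ r z) * 1 \<partial>lborel) = (\<integral>\<^sup>+s. indicator {0..r} s * (\<integral>\<^sup>+w. 1 \<partial>M) \<partial>lborel)"
    by (rule occ_density'[OF r, symmetric]) simp
  then show ?thesis using r by (simp add: emeasure_space_1)
qed

text \<open>\<open>occ r\<close> has total mass \<open>r > 0\<close>, so it is positive on a set of
  positive measure, which cannot consist of exceptional levels alone.\<close>

lemma good_level:
  assumes r: "0 < r" "2 * r \<le> T"
  obtains w where "0 < occ r w" "AE v in M. LS w (2*r) (path 0 v) \<le> LamE es w (2*r) (path 0 v)"
proof (cases "\<exists>w. 0 < occ r w \<and> (AE v in M. LS w (2*r) (path 0 v) \<le> LamE es w (2*r) (path 0 v))")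
  case True then show ?thesis using that by blast
next
  case False
  have "AE w in lborel. AE v in M. LS w (2*r) (path 0 v) \<le> LamE es w (2*r) (path 0 v)"
    by (rule LS_le_Lam_AE) (use r in auto)
  then have "AE w in lborel. ennreal (occ r w) = 0"
    by eventually_elim (use False in \<open>auto simp: ennreal_eq_0_iff not_less\<close>)
  then have "(\<integral>\<^sup>+z. ennreal (occ r z) \<partial>lborel) = (\<integral>\<^sup>+z. 0 \<partial>(lborel::real measure))" by (rule nn_integral_cong_AE)
  then show ?thesis using occ_total[OF r(1)] r by simp
qed

lemma LamE_finite_mean: "0 \<le> t \<Longrightarrow> t \<le> T \<Longrightarrow> (\<integral>\<^sup>+w. LamE es x t (path 0 w) \<partial>M) = ennreal (occ t x)"
proof -
  assume t: "0 \<le> t" "t \<le> T"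
  have "(\<integral>\<^sup>+w. LamE es x t (path 0 w) \<partial>M) = (\<integral>\<^sup>+w. ennreal (Lam es x t (path 0 w)) \<partial>M)"
    using Lam_conv[OF t, of x] by (intro nn_integral_cong_AE) (auto elim: eventually_mono)
  also have "\<dots> = ennreal (\<integral>w. Lam es x t (path 0 w) \<partial>M)"
    by (intro nn_integral_eq_integral Lam_integrable t) (simp add: Lam_nonneg)
  finally show ?thesis using Lam_mean[OF t] by simp
qed

text \<open>\<open>transfer\<close> is used with \<open>k = es n\<close>: the weight converges to
  the local time at \<open>w\<close> with an \<open>L1\<close> error of at most
  \<open>2 * (1/2)^n\<close>, and its mean converges to \<open>occ r w\<close>.\<close>

lemma transfer_limit:
  assumes r: "0 \<le> r" "r \<le> T" and \<kappa>: "0 < \<kappa>"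
  shows "ennreal (occ r w) * (\<integral>\<^sup>+v. min 1 (SS \<kappa> 0 r (path 0 v)) \<partial>M) \<le> (\<integral>\<^sup>+v. LamE es w r (path 0 v) * min 1 (SS \<kappa> w (2*r) (path 0 v)) \<partial>M)"
    (is "?o * _ \<le> ?R")
proof -
  have [measurable]: "(\<lambda>v. Sk \<kappa> k r (path 0 v)) \<in> borel_measurable M" for k
    by (rule measurable_compose[OF path_meas[OF order_refl] Sk_meas])
  define c where "c n = (\<integral>\<^sup>+v. min 1 (Sk \<kappa> (es n) r (path 0 v)) \<partial>M)" for n
  have c1: "c n \<le> 1" for n
  proof -
    have "c n \<le> (\<integral>\<^sup>+v. 1 \<partial>M)" unfolding c_def by (intro nn_integral_mono) simp
    then show ?thesis by (simp add: emeasure_space_1)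
  qed
  have cm: "c m \<le> c n" if "m \<le> n" for m n
    unfolding c_def by (intro nn_integral_mono min.mono order_refl Sk_mono es_mono that)
  have le: "GF r (fe (es n) w) 0 * c n \<le> ?R + ennreal (2 * (1/2)^n)" for n
  proof -
    have "GF r (fe (es n) w) 0 * c n \<le> (\<integral>\<^sup>+v. avg (es n) w r (path 0 v) * min 1 (SS \<kappa> w (2*r) (path 0 v)) \<partial>M)"
      using transfer[OF r(1) es0, of n w \<kappa>] unfolding avg_mean[OF r(1)] c_def .
    also have "\<dots> \<le> (\<integral>\<^sup>+v. LamE es w r (path 0 v) * min 1 (SS \<kappa> w (2*r) (path 0 v)) + ennreal \<bar>ar (es n) w r (path 0 v) - Lam es w r (path 0 v)\<bar> \<partial>M)"
    proof (rule nn_integral_mono)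
      fix v
      let ?p = "path 0 v"
      let ?m = "min 1 (SS \<kappa> w (2*r) ?p)"
      have "ar (es n) w r ?p \<le> Lam es w r ?p + \<bar>ar (es n) w r ?p - Lam es w r ?p\<bar>" by linarith
      then have "ennreal (ar (es n) w r ?p) \<le> ennreal (Lam es w r ?p + \<bar>ar (es n) w r ?p - Lam es w r ?p\<bar>)" by (rule ennreal_leI)
      also have "\<dots> = ennreal (Lam es w r ?p) + ennreal \<bar>ar (es n) w r ?p - Lam es w r ?p\<bar>"
        by (intro ennreal_plus Lam_nonneg) auto
      also have "\<dots> \<le> LamE es w r ?p + ennreal \<bar>ar (es n) w r ?p - Lam es w r ?p\<bar>"
      proof (rule add_right_mono)
        show "ennreal (Lam es w r ?p) \<le> LamE es w r ?p" unfolding Lam_def by (cases "LamE es w r ?p") auto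
      qed
      finally have "avg (es n) w r ?p * ?m \<le> (LamE es w r ?p + ennreal \<bar>ar (es n) w r ?p - Lam es w r ?p\<bar>) * ?m"
        unfolding ar_avg[OF es0 r(1)] by (rule mult_right_mono) simp
      also have "\<dots> = LamE es w r ?p * ?m + ennreal \<bar>ar (es n) w r ?p - Lam es w r ?p\<bar> * ?m" by (rule distrib_right)
      also have "\<dots> \<le> LamE es w r ?p * ?m + ennreal \<bar>ar (es n) w r ?p - Lam es w r ?p\<bar> * 1"
        by (intro add_left_mono mult_left_mono) auto
      finally show "avg (es n) w r ?p * ?m \<le> LamE es w r ?p * ?m + ennreal \<bar>ar (es n) w r ?p - Lam es w r ?p\<bar>" by simp
    qed
    also have "\<dots> = ?R + (\<integral>\<^sup>+v. ennreal \<bar>ar (es n) w r (path 0 v) - Lam es w r (path 0 v)\<bar> \<partial>M)"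
      by (rule nn_integral_add) measurable
    also have "\<dots> \<le> ?R + ennreal (2 * (1/2)^n)" by (intro add_left_mono Lam_L1_nn r es0 order_refl)
    finally show ?thesis .
  qed
  \<comment> \<open>The shrinkage is frozen at index \<open>m\<close> while the radius of the weight
    goes to 0; this is allowed since \<open>c m <= c n\<close> for \<open>n >= m\<close>. Only
    afterwards is the supremum over \<open>m\<close> taken.\<close>
  have oc: "?o * c m \<le> ?R" for m
  proof (rule LIMSEQ_le)
    have "(\<lambda>n. GF r (fe (es n) w) 0) \<longlonglongrightarrow> ?o" using GF_tendsto[OF r(1), of w 0] by simp
    then have "(\<lambda>n. c m * GF r (fe (es n) w) 0) \<longlonglongrightarrow> c m * ?o"
      by (intro ennreal_tendsto_cmult) (use c1[of m] in \<open>auto intro: le_less_trans\<close>)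
    then show "(\<lambda>n. GF r (fe (es n) w) 0 * c m) \<longlonglongrightarrow> ?o * c m" by (simp add: mult.commute)
    have "(\<lambda>n. 2 * (1/2)^n :: real) \<longlonglongrightarrow> 2 * 0" by (intro tendsto_mult tendsto_const LIMSEQ_power_zero) simp
    then have "(\<lambda>n. ennreal (2 * (1/2)^n)) \<longlonglongrightarrow> 0" using tendsto_ennrealI by fastforce
    then have "(\<lambda>n. ?R + ennreal (2 * (1/2)^n)) \<longlonglongrightarrow> ?R + 0" by (intro tendsto_add tendsto_const)
    then show "(\<lambda>n. ?R + ennreal (2 * (1/2)^n)) \<longlonglongrightarrow> ?R" by simp
    show "\<exists>N. \<forall>n\<ge>N. GF r (fe (es n) w) 0 * c m \<le> ?R + ennreal (2 * (1/2)^n)"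
      by (intro exI[of _ m] allI impI order_trans[OF mult_left_mono[OF cm] le]) auto
  qed
  have "(\<integral>\<^sup>+v. min 1 (SS \<kappa> 0 r (path 0 v)) \<partial>M) \<le> (\<integral>\<^sup>+v. (SUP n. min 1 (Sk \<kappa> (es n) r (path 0 v))) \<partial>M)"
  proof (rule nn_integral_mono)
    fix v assume "v \<in> space M"
    then have "min 1 (SS \<kappa> 0 r (path 0 v)) \<le> min 1 (SUP n. Sk \<kappa> (es n) r (path 0 v))"
      by (intro min.mono order_refl SS_le_SUP_Sk path_space)
    also have "\<dots> = (SUP n. min 1 (Sk \<kappa> (es n) r (path 0 v)))" unfolding inf_min[symmetric] by (rule inf_SUP)
    finally show "min 1 (SS \<kappa> 0 r (path 0 v)) \<le> (SUP n. min 1 (Sk \<kappa> (es n) r (path 0 v)))" .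
  qed
  also have "\<dots> = (SUP n. c n)" unfolding c_def
  proof (rule nn_integral_monotone_convergence_SUP)
    show "incseq (\<lambda>n v. min 1 (Sk \<kappa> (es n) r (path 0 v)))"
    proof (rule incseq_SucI, rule le_funI)
      fix n v
      show "min 1 (Sk \<kappa> (es n) r (path 0 v)) \<le> min 1 (Sk \<kappa> (es (Suc n)) r (path 0 v))"
        by (intro min.mono order_refl Sk_mono es_mono) simp
    qed
  qed measurable
  finally have "?o * (\<integral>\<^sup>+v. min 1 (SS \<kappa> 0 r (path 0 v)) \<partial>M) \<le> ?o * (SUP n. c n)" by (rule mult_left_mono) simp
  also have "\<dots> = (SUP n. ?o * c n)" by (rule SUP_mult_left_ennreal)
  also have "\<dots> \<le> ?R" by (intro SUP_least oc)
  finally show ?thesis .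
qed

lemma SS_tendsto_LS: "(\<lambda>n. SS (1 / (real n + 1)) x t p) \<longlonglongrightarrow> LS x t p"
  unfolding LS_def
proof (rule LIMSEQ_INF, rule decseq_SucI)
  fix n
  have "1 / (real (Suc n) + 1) \<le> 1 / (real n + 1)" by (intro divide_left_mono) auto
  then show "SS (1 / (real (Suc n) + 1)) x t p \<le> SS (1 / (real n + 1)) x t p"
    unfolding SS_def by (intro SUP_subset_mono) auto
qed

lemma LS_le_SS: "LS x t p \<le> SS (1 / (real n + 1)) x t p"
  unfolding LS_def by (rule INF_lower) simp

text \<open>When the radii go to 0 at a good level \<open>w\<close>, the right side of
  \<open>transfer_limit\<close> is at most the mean of a product of two local times at
  \<open>w\<close>. The second moment bound contains \<open>occ r w > 0\<close>, which cancels, so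
  nothing about \<open>w\<close> is left and the bound vanishes with \<open>r\<close>.\<close>

lemma LS0_small:
  assumes r: "0 < r" "2 * r \<le> T"
  shows "(\<integral>\<^sup>+v. min 1 (LS 0 r (path 0 v)) \<partial>M) \<le> 2 * ennreal (occ_sup (2*r))"
proof -
  obtain w where w: "0 < occ r w" "AE v in M. LS w (2*r) (path 0 v) \<le> LamE es w (2*r) (path 0 v)"
    using good_level[OF r] by blast
  let ?o = "ennreal (occ r w)"
  have rT: "0 \<le> r" "r \<le> T" using r by auto
  let ?R = "\<lambda>n. \<integral>\<^sup>+v. LamE es w r (path 0 v) * min 1 (SS (1 / (real n + 1)) w (2*r) (path 0 v)) \<partial>M"
  have fin: "(\<integral>\<^sup>+v. LamE es w r (path 0 v) \<partial>M) < \<infinity>" using LamE_finite_mean[OF rT, of w] by simp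
  have "?o * (\<integral>\<^sup>+v. min 1 (LS 0 r (path 0 v)) \<partial>M) \<le> ?R n" for n
  proof -
    have "?o * (\<integral>\<^sup>+v. min 1 (LS 0 r (path 0 v)) \<partial>M) \<le> ?o * (\<integral>\<^sup>+v. min 1 (SS (1 / (real n + 1)) 0 r (path 0 v)) \<partial>M)"
      by (intro mult_left_mono nn_integral_mono min.mono order_refl LS_le_SS) simp
    also have "\<dots> \<le> ?R n" by (rule transfer_limit[OF rT]) simp
    finally show ?thesis .
  qed
  moreover have "?R \<longlonglongrightarrow> (\<integral>\<^sup>+v. LamE es w r (path 0 v) * min 1 (LS w (2*r) (path 0 v)) \<partial>M)"
  proof (rule nn_integral_dominated_convergence[where w="\<lambda>v. LamE es w r (path 0 v)"])
    show "AE v in M. LamE es w r (path 0 v) * min 1 (SS (1 / (real n + 1)) w (2*r) (path 0 v)) \<le> LamE es w r (path 0 v)" for n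
    proof (rule AE_I2)
      fix v
      have "LamE es w r (path 0 v) * min 1 (SS (1 / (real n + 1)) w (2*r) (path 0 v)) \<le> LamE es w r (path 0 v) * 1" by (intro mult_left_mono) auto
      then show "LamE es w r (path 0 v) * min 1 (SS (1 / (real n + 1)) w (2*r) (path 0 v)) \<le> LamE es w r (path 0 v)" by simp
    qed
    show "AE v in M. (\<lambda>n. LamE es w r (path 0 v) * min 1 (SS (1 / (real n + 1)) w (2*r) (path 0 v))) \<longlonglongrightarrow> LamE es w r (path 0 v) * min 1 (LS w (2*r) (path 0 v))"
      using Lam_conv[OF rT, of w]
    proof eventually_elim
      case (elim v)
      show ?case by (intro ennreal_tendsto_cmult tendsto_min tendsto_const SS_tendsto_LS) (use elim in simp)
    qed
  qed (use fin in measurable)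
  ultimately have "?o * (\<integral>\<^sup>+v. min 1 (LS 0 r (path 0 v)) \<partial>M) \<le> (\<integral>\<^sup>+v. LamE es w r (path 0 v) * min 1 (LS w (2*r) (path 0 v)) \<partial>M)"
    by (intro LIMSEQ_le_const) auto
  also have "\<dots> \<le> (\<integral>\<^sup>+v. LamE es w r (path 0 v) * LamE es w (2*r) (path 0 v) \<partial>M)"
    by (rule nn_integral_mono_AE, use w(2) in eventually_elim) (auto intro!: mult_left_mono intro: min.coboundedI2)
  also have "\<dots> \<le> 2 * ennreal (occ_sup (2*r)) * ?o" by (rule Lam_second_moment) (use r in auto)
  finally have "?o * (\<integral>\<^sup>+v. min 1 (LS 0 r (path 0 v)) \<partial>M) \<le> ?o * (2 * ennreal (occ_sup (2*r)))" by (simp only: mult.commute)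
  then show ?thesis using w(1) by (subst (asm) ennreal_mult_le_mult_iff) auto
qed

text \<open>For \<open>x \<noteq> 0\<close> right-continuity keeps the path away from
  \<open>x\<close> for a short time, so at each outcome the limsup is eventually 0. The level 0 is
  the real case, settled by \<open>LS0_small\<close>.\<close>

lemma LS_small:
  assumes X: "X \<longlonglongrightarrow> 0" "\<And>n. 0 < X n" "\<And>n. 2 * X n \<le> T" "\<And>n. 2 * X n \<le> 1"
  shows "(\<lambda>n. \<integral>\<^sup>+v. min 1 (LS x (X n) (path 0 v)) \<partial>M) \<longlonglongrightarrow> 0"
proof (cases "x = 0")
  case True
  have "(\<lambda>n. 2 * X n) \<longlonglongrightarrow> 2 * 0" by (intro tendsto_intros X)
  then have "(\<lambda>n. occ_sup (2 * X n)) \<longlonglongrightarrow> 0" using X(2,4) by (intro occ_sup_tendsto_0) (auto simp: less_imp_le)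
  then have "(\<lambda>n. ennreal (occ_sup (2 * X n))) \<longlonglongrightarrow> ennreal 0" by (rule tendsto_ennrealI)
  then have l: "(\<lambda>n. 2 * ennreal (occ_sup (2 * X n))) \<longlonglongrightarrow> 2 * ennreal 0" by (intro ennreal_tendsto_cmult) auto
  show ?thesis unfolding True
  proof (rule tendsto_sandwich[OF _ _ tendsto_const])
    show "\<forall>\<^sub>F n in sequentially. (\<integral>\<^sup>+v. min 1 (LS 0 (X n) (path 0 v)) \<partial>M) \<le> 2 * ennreal (occ_sup (2 * X n))"
      by (intro always_eventually allI LS0_small X)
    show "(\<lambda>n. 2 * ennreal (occ_sup (2 * X n))) \<longlonglongrightarrow> 0" using l by simp
  qed simp
next
  case False
  have "(\<lambda>n. \<integral>\<^sup>+v. min 1 (LS x (X n) (path 0 v)) \<partial>M) \<longlonglongrightarrow> (\<integral>\<^sup>+v. 0 \<partial>M)"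
  proof (rule nn_integral_dominated_convergence[where w="\<lambda>_. 1"])
    show "AE v in M. (\<lambda>n. min 1 (LS x (X n) (path 0 v))) \<longlonglongrightarrow> 0"
    proof (rule AE_I2)
      fix v assume v: "v \<in> space M"
      have "((\<lambda>s. Y s v) \<longlongrightarrow> Z 0 v - Z 0 v) (at_right 0)" unfolding Y_def using Z_right[OF v, of 0] by (intro tendsto_intros) auto
      then have "((\<lambda>s. \<bar>Y s v\<bar>) \<longlongrightarrow> 0) (at_right 0)" by (simp add: tendsto_rabs_zero)
      from order_tendstoD(2)[OF this, of "\<bar>x\<bar>/2"] False have "\<forall>\<^sub>F s in at_right 0. \<bar>Y s v\<bar> < \<bar>x\<bar>/2" by simp
      then obtain b where b: "0 < b" "\<And>s. 0 < s \<Longrightarrow> s < b \<Longrightarrow> \<bar>Y s v\<bar> < \<bar>x\<bar>/2" unfolding eventually_at_right_field by auto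
      have b': "\<bar>Y s v\<bar> < \<bar>x\<bar>/2" if "0 \<le> s" "s < b" for s
        using b(2)[of s] that False by (cases "s = 0") (auto simp: Y_def)
      obtain j where "inverse (real (Suc j)) < \<bar>x\<bar>/2" using reals_Archimedean[of "\<bar>x\<bar>/2"] False by auto
      then have j: "1 / (real j + 1) < \<bar>x\<bar>/2" by (simp add: inverse_eq_divide add.commute)
      have "LS x r (path 0 v) = 0" if r: "r < b" for r
      proof -
        have "avg e x r (path 0 v) = 0" if e: "e < \<bar>x\<bar>/2" for e
        proof -
          have "fe e x (Y u v) * indicator {0..r} u = 0" for u
          proof (cases "u \<in> {0..r}")
            case True
            then have "\<bar>Y u v\<bar> < \<bar>x\<bar>/2" using b'[of u] r by auto
            then have "\<not> \<bar>Y u v - x\<bar> < e" using e by linarith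
            then show ?thesis by (auto simp: fe_def indicator_def abs_less_iff)
          qed simp
          then show ?thesis unfolding avg_def AF_path0[OF v] by (simp only: mult_zero_left nn_integral_const)
        qed
        then have "SS (1 / (real j + 1)) x r (path 0 v) \<le> 0" unfolding SS_def using j by (intro SUP_least) auto
        then show ?thesis using LS_le_SS[of x r "path 0 v" j] by (simp add: order_antisym)
      qed
      moreover have "\<forall>\<^sub>F n in sequentially. X n < b" using X(1) b(1) by (rule order_tendstoD(2))
      ultimately have "\<forall>\<^sub>F n in sequentially. min 1 (LS x (X n) (path 0 v)) = 0" by (auto elim: eventually_mono)
      then show "(\<lambda>n. min 1 (LS x (X n) (path 0 v))) \<longlonglongrightarrow> 0" by (rule tendsto_eventually)
    qed
  qed (auto simp: emeasure_space_1)
  then show ?thesis by simp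
qed

text \<open>By the Markov property the mean occupation gained in a period of length \<open>d\<close>
  is at most \<open>occ_sup d\<close>, wherever the process is when the period starts.\<close>

lemma occ_add_le:
  assumes t: "0 \<le> t" and d: "0 \<le> d"
  shows "occ (t + d) x \<le> occ t x + occ_sup d"
proof -
  have le: "GF (t + d) (fe (es n) x) 0 \<le> GF t (fe (es n) x) 0 + ennreal (occ_sup d)" for n
  proof -
    have "GF (t + d) (fe (es n) x) 0 = (\<integral>\<^sup>+w. avg (es n) x (t + d) (path 0 w) \<partial>M)" by (rule avg_mean[symmetric]) (use t d in simp)
    also have "\<dots> = (\<integral>\<^sup>+w. avg (es n) x t (path 0 w) + avg (es n) (x - Y t w) d (path t w) \<partial>M)"
      by (intro nn_integral_cong avg_split t d)
    also have "\<dots> = (\<integral>\<^sup>+w. avg (es n) x t (path 0 w) \<partial>M) + (\<integral>\<^sup>+w. avg (es n) (x - Y t w) d (path t w) \<partial>M)"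
    proof (rule nn_integral_add)
      have [measurable]: "Y t \<in> borel_measurable M" using t by simp
      have "(\<lambda>w. (x - Y t w, path t w)) \<in> M \<rightarrow>\<^sub>M (borel \<Otimes>\<^sub>M PS)" using path_meas[OF t] by measurable
      from measurable_compose[OF this avg_meas2] show "(\<lambda>w. avg (es n) (x - Y t w) d (path t w)) \<in> borel_measurable M" by simp
    qed measurable
    also have "(\<integral>\<^sup>+w. avg (es n) (x - Y t w) d (path t w) \<partial>M) = (\<integral>\<^sup>+w. 1 * (\<integral>\<^sup>+r. fe (es n) x (Y r w) * indicator {t..t+d} r \<partial>lborel) \<partial>M)"
    proof (rule nn_integral_cong)
      fix w assume "w \<in> space M"
      from AF_path_shift[OF this t fe_meas[of "es n" x], of d]
      show "avg (es n) (x - Y t w) d (path t w) = 1 * (\<integral>\<^sup>+r. fe (es n) x (Y r w) * indicator {t..t+d} r \<partial>lborel)"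
        by (simp add: avg_def fe_shift)
    qed
    also have "\<dots> = (\<integral>\<^sup>+w. 1 * GF d (fe (es n) x) (Y t w) \<partial>M)" by (rule AF_markov[OF t d fe_meas]) simp
    also have "\<dots> \<le> (\<integral>\<^sup>+w. ennreal (occ_sup d) \<partial>M)" using GF_fe_sup[OF es0 d] by (intro nn_integral_mono) simp
    also have "\<dots> = ennreal (occ_sup d)" by (simp add: emeasure_space_1)
    finally show ?thesis unfolding avg_mean[OF t] by (simp add: add_left_mono)
  qed
  have "ennreal (occ (t + d) x) \<le> ennreal (occ t x) + ennreal (occ_sup d)"
  proof (rule LIMSEQ_le)
    show "(\<lambda>n. GF (t + d) (fe (es n) x) 0) \<longlonglongrightarrow> ennreal (occ (t + d) x)" using GF_tendsto[of "t + d" x 0] t d by simp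
    show "(\<lambda>n. GF t (fe (es n) x) 0 + ennreal (occ_sup d)) \<longlonglongrightarrow> ennreal (occ t x) + ennreal (occ_sup d)"
      using GF_tendsto[OF t, of x 0] by (intro tendsto_add tendsto_const) simp
  qed (use le in auto)
  also have "\<dots> = ennreal (occ t x + occ_sup d)" using occ_nonneg[OF t] occ_sup_nonneg[OF d] by (intro ennreal_plus[symmetric])
  finally show ?thesis using occ_nonneg[OF t, of x] occ_sup_nonneg[OF d] by (simp only: ennreal_le_iff add_nonneg_nonneg)
qed

text \<open>The law of \<open>Z d\<close> for a single \<open>d\<close> is not known to have a
  density, but integrated over \<open>d\<close> it has the density \<open>occ T\<close>; so a null
  set of levels is almost surely avoided by \<open>x - Y d\<close> for almost every
  \<open>d\<close>. The Markov property then moves the comparison to the path after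
  \<open>d\<close>.\<close>

lemma good_delta:
  assumes t: "0 \<le> t" "t < T"
  shows "AE d in lborel. 0 < d \<longrightarrow> d \<le> T \<longrightarrow> (AE b in M. LS (x - Y d b) t (path d b) \<le> LamE es (x - Y d b) t (path d b))"
proof -
  have T: "0 < T" using t by simp
  have "AE v in lborel. AE b in M. LS v t (path 0 b) \<le> LamE es v t (path 0 b)" by (rule LS_le_Lam_AE) (use t in auto)
  then obtain N where N: "N \<in> null_sets lborel" "\<And>v. v \<notin> N \<Longrightarrow> AE b in M. LS v t (path 0 b) \<le> LamE es v t (path 0 b)"
    by (rule AE_E3) auto
  then have [measurable]: "N \<in> sets borel" by auto
  have [measurable]: "occ T \<in> borel_measurable borel" using occ_meas T by simp
  have "(\<integral>\<^sup>+s. indicator {0..T} s * (\<integral>\<^sup>+b. indicator N (x - Z (max 0 s) b) \<partial>M) \<partial>lborel) = (\<integral>\<^sup>+z. ennreal (occ T z) * indicator N (x - z) \<partial>lborel)"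
    by (rule occ_density'[OF T]) measurable
  also have "\<dots> = (\<integral>\<^sup>+z. 0 \<partial>(lborel::real measure))"
  proof (rule nn_integral_cong_AE)
    have "AE z in lborel. z \<notin> N" using N(1) by (rule AE_not_in)
    then have "AE z in lborel. x + (-1) * z \<notin> N" by (intro AE_borel_affine[where P="\<lambda>x. x \<notin> N"]) auto
    then show "AE z in lborel. ennreal (occ T z) * indicator N (x - z) = 0" by eventually_elim simp
  qed
  finally have z: "(\<integral>\<^sup>+s. indicator {0..T} s * (\<integral>\<^sup>+b. indicator N (x - Z (max 0 s) b) \<partial>M) \<partial>lborel) = 0" by simp
  have m[measurable]: "(\<lambda>s. \<integral>\<^sup>+b. indicator N (x - Z (max 0 s) b) \<partial>M) \<in> borel_measurable borel"
  proof -
    have [measurable]: "(\<lambda>w. Z (max 0 (fst w)) (snd w)) \<in> borel_measurable (borel \<Otimes>\<^sub>M M)" using joint_meas by (simp add: case_prod_beta)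
    have "(\<lambda>(s,b). indicator N (x - Z (max 0 s) b) :: ennreal) \<in> borel_measurable (borel \<Otimes>\<^sub>M M)" unfolding case_prod_beta by measurable
    from borel_measurable_nn_integral_fst[OF this] show ?thesis by simp
  qed
  have "AE s in lborel. indicator {0..T} s * (\<integral>\<^sup>+b. indicator N (x - Z (max 0 s) b) \<partial>M) = 0"
    using z by (subst (asm) nn_integral_0_iff_AE) auto
  then show ?thesis
  proof eventually_elim
    case (elim d)
    show ?case
    proof (intro impI)
      assume d: "0 < d" "d \<le> T"
      then have d0: "0 \<le> d" by simp
      note [measurable] = Z_meas[OF d0] Y_Fil[OF d0] Y_meas[OF d0] path_meas[OF d0]
      have "(\<integral>\<^sup>+b. indicator N (x - Z d b) \<partial>M) = 0" using elim d by (simp add: max_absorb2)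
      then have "AE b in M. indicator N (x - Z d b) = (0::ennreal)" by (subst (asm) nn_integral_0_iff_AE) auto
      then have nN: "AE b in M. x - Y d b \<notin> N" using Y_ae[OF d0] by eventually_elim (simp add: indicator_eq_0_iff)
      define \<Phi> where "\<Phi> = (\<lambda>(b,p). if LS (x - Y d b) t p \<le> LamE es (x - Y d b) t p then 0 else 1 :: ennreal)"
      have \<Phi>m: "\<Phi> \<in> borel_measurable (Fil d \<Otimes>\<^sub>M PS)"
      proof -
        have a: "(\<lambda>w. (x - Y d (fst w), snd w)) \<in> (Fil d \<Otimes>\<^sub>M PS) \<rightarrow>\<^sub>M (borel \<Otimes>\<^sub>M PS)" by measurable
        have [measurable]: "(\<lambda>w. LS (x - Y d (fst w)) t (snd w)) \<in> borel_measurable (Fil d \<Otimes>\<^sub>M PS)" using measurable_compose[OF a LS_meas2] by simp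
        have [measurable]: "(\<lambda>w. LamE es (x - Y d (fst w)) t (snd w)) \<in> borel_measurable (Fil d \<Otimes>\<^sub>M PS)" using measurable_compose[OF a LamE_meas2] by simp
        show ?thesis unfolding \<Phi>_def case_prod_beta by measurable
      qed
      have "(\<integral>\<^sup>+b. \<Phi> (b, path d b) \<partial>M) = (\<integral>\<^sup>+b. (\<integral>\<^sup>+b'. \<Phi> (b, path 0 b') \<partial>M) \<partial>M)" by (rule markov_nn[OF d0 \<Phi>m])
      also have "\<dots> = (\<integral>\<^sup>+b. 0 \<partial>M)"
      proof (rule nn_integral_cong_AE, use nN in eventually_elim)
        case (elim b)
        have "(\<integral>\<^sup>+b'. \<Phi> (b, path 0 b') \<partial>M) = (\<integral>\<^sup>+b'. 0 \<partial>M)"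
          by (rule nn_integral_cong_AE, use N(2)[OF elim] in eventually_elim) (simp add: \<Phi>_def)
        then show ?case by simp
      qed
      finally have z0: "(\<integral>\<^sup>+b. \<Phi> (b, path d b) \<partial>M) = 0" by simp
      have "(\<lambda>b. (b, path d b)) \<in> M \<rightarrow>\<^sub>M (Fil d \<Otimes>\<^sub>M PS)" using id_Fil by measurable
      from measurable_compose[OF this \<Phi>m] have "AE b in M. \<Phi> (b, path d b) = 0" using z0 by (subst (asm) nn_integral_0_iff_AE) auto
      then show "AE b in M. LS (x - Y d b) t (path d b) \<le> LamE es (x - Y d b) t (path d b)"
        by eventually_elim (auto simp: \<Phi>_def split: if_splits)
    qed
  qed
qed

text \<open>The first part uses \<open>t \<le> d + t\<close> and additivity of the averages; a
  supremum of sums is at most the sum of the suprema, and the limit in the radii preserves this. The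
  second part holds term by term.\<close>

lemma LS_split_le:
  assumes w: "w \<in> space M" and d: "0 \<le> d" and t: "0 \<le> t"
  shows "LS x t (path 0 w) \<le> LS x d (path 0 w) + LS (x - Y d w) t (path d w)"
    and "LamE es (x - Y d w) t (path d w) \<le> LamE es x (t + d) (path 0 w)"
proof -
  have m: "avg e x t (path 0 w) \<le> avg e x (d + t) (path 0 w)" for e
    unfolding avg_def AF_path0[OF w] using d by (intro nn_integral_mono) (auto simp: indicator_def)
  have "SS \<kappa> x t (path 0 w) \<le> SS \<kappa> x d (path 0 w) + SS \<kappa> (x - Y d w) t (path d w)" for \<kappa>
    unfolding SS_def[of \<kappa> x t]
  proof (rule SUP_least)
    fix e assume e: "e \<in> \<rat> \<inter> {0<..<\<kappa>}"
    have "avg e x t (path 0 w) \<le> avg e x d (path 0 w) + avg e (x - Y d w) t (path d w)"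
      using m[of e] unfolding avg_split[OF w d t] .
    also have "\<dots> \<le> SS \<kappa> x d (path 0 w) + SS \<kappa> (x - Y d w) t (path d w)"
      unfolding SS_def using e by (intro add_mono SUP_upper)
    finally show "avg e x t (path 0 w) \<le> SS \<kappa> x d (path 0 w) + SS \<kappa> (x - Y d w) t (path d w)" .
  qed
  then show "LS x t (path 0 w) \<le> LS x d (path 0 w) + LS (x - Y d w) t (path d w)"
    by (intro LIMSEQ_le[OF SS_tendsto_LS tendsto_add[OF SS_tendsto_LS SS_tendsto_LS]]) auto
  show "LamE es (x - Y d w) t (path d w) \<le> LamE es x (t + d) (path 0 w)"
    unfolding LamE_def
  proof (intro Liminf_mono always_eventually allI)
    fix n
    show "avg (es n) (x - Y d w) t (path d w) \<le> avg (es n) x (t + d) (path 0 w)"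
      using avg_split[OF w d t, of "es n" x] by (simp add: add.commute)
  qed
qed

lemma Lam_mono_AE:
  assumes t: "0 \<le> s" "s \<le> t" "t \<le> T"
  shows "AE w in M. Lam es x s (path 0 w) \<le> Lam es x t (path 0 w)"
proof -
  have h: "0 \<le> t" "s \<le> T" using t by auto
  show ?thesis using Lam_conv[OF t(1) h(2), of x] Lam_conv[OF h(1) t(3), of x] AE_space[of M]
  proof eventually_elim
    case (elim w)
    show ?case
    proof (rule LIMSEQ_le)
      show "(\<lambda>n. ar (es n) x s (path 0 w)) \<longlonglongrightarrow> Lam es x s (path 0 w)" "(\<lambda>n. ar (es n) x t (path 0 w)) \<longlonglongrightarrow> Lam es x t (path 0 w)" using elim by auto
      have "avg (es n) x s (path 0 w) \<le> avg (es n) x t (path 0 w)" for n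
        unfolding avg_def AF_path0[OF elim(3)] using t by (intro nn_integral_mono) (auto simp: indicator_def)
      then have "ar (es n) x s (path 0 w) \<le> ar (es n) x t (path 0 w)" for n
        unfolding ar_def by (intro enn2real_mono) (use avg_finite[OF es0 h(1)] in auto)
      then show "\<exists>N. \<forall>n\<ge>N. ar (es n) x s (path 0 w) \<le> ar (es n) x t (path 0 w)" by blast
    qed
  qed
qed

text \<open>The radii \<open>es k\<close> may be irrational, while \<open>SS\<close> ranges over
  rational ones; \<open>avg_le_SS\<close> bridges the gap.\<close>

lemma LamE_le_LS: "p \<in> space PS \<Longrightarrow> LamE es x t p \<le> LS x t p"
  unfolding LS_def
proof (rule INF_greatest)
  fix n :: nat assume p: "p \<in> space PS"
  have "\<forall>\<^sub>F k in sequentially. es k < 1 / (real n + 1)" by (intro order_tendstoD(2)[OF es_lim]) simp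
  then have "\<forall>\<^sub>F k in sequentially. avg (es k) x t p \<le> SS (1 / (real n + 1)) x t p"
    by eventually_elim (rule avg_le_SS[OF p es0])
  then show "LamE es x t p \<le> SS (1 / (real n + 1)) x t p" unfolding LamE_def by (intro Liminf_le) auto
qed

text \<open>The exceptional levels of \<open>LS_le_Lam_AE\<close> are avoided by restarting at small times \<open>d n\<close>.\<close>

lemma LS_eq_Lam:
  assumes t: "0 \<le> t" "t < T"
  shows "AE w in M. LS x t (path 0 w) = ennreal (Lam es x t (path 0 w))"
proof -
  \<comment> \<open>The three bounds ensure \<open>t + d n \<le> T\<close>,
    \<open>2 * d n \<le> 1\<close> and \<open>2 * d n \<le> T\<close>, as \<open>Lam_conv\<close>
    and \<open>LS_small\<close> need.\<close>
  define a where "a n = min (min (T - t) (1/2)) (T/2) / (real n + 1)" for n :: nat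
  have a0: "0 < a n" for n unfolding a_def using t by (intro divide_pos_pos) auto
  have aT: "a n \<le> min (min (T - t) (1/2)) (T/2)" for n
  proof -
    have "a n \<le> min (min (T - t) (1/2)) (T/2) / 1" unfolding a_def using t by (intro divide_left_mono) auto
    then show ?thesis by simp
  qed
  \<comment> \<open>Almost every time is good, so each interval \<open>{0<..<a n}\<close> contains a
    good one.\<close>
  have "\<exists>d. 0 < d \<and> d < a n \<and> (AE w in M. LS (x - Y d w) t (path d w) \<le> LamE es (x - Y d w) t (path d w))" for n
  proof (rule ccontr)
    assume c: "\<not> ?thesis"
    from good_delta[OF t, of x] obtain N where N: "N \<in> null_sets lborel"
      "\<And>d. d \<notin> N \<Longrightarrow> 0 < d \<longrightarrow> d \<le> T \<longrightarrow> (AE w in M. LS (x - Y d w) t (path d w) \<le> LamE es (x - Y d w) t (path d w))"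
      by (rule AE_E3) auto
    have "{0<..<a n} \<subseteq> N"
    proof
      fix d assume d: "d \<in> {0<..<a n}"
      have "d \<le> T" using d aT[of n] t by auto
      then show "d \<in> N" using N(2)[of d] c d by auto
    qed
    then have "emeasure lborel {0<..<a n} \<le> emeasure lborel N" using N(1) by (intro emeasure_mono) auto
    also have "\<dots> = 0" using N(1) by auto
    finally show False using a0[of n] by simp
  qed
  then have "\<forall>n. \<exists>d. 0 < d \<and> d < a n \<and> (AE w in M. LS (x - Y d w) t (path d w) \<le> LamE es (x - Y d w) t (path d w))" by blast
  from choice[OF this] obtain d where d: "\<And>n. 0 < d n" "\<And>n. d n < a n" "\<And>n. AE w in M. LS (x - Y (d n) w) t (path (d n) w) \<le> LamE es (x - Y (d n) w) t (path (d n) w)"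
    by auto
  have d0: "0 \<le> d n" for n using d(1)[of n] by simp
  have dl: "d \<longlonglongrightarrow> 0"
  proof (rule tendsto_sandwich[OF _ _ tendsto_const])
    show "\<forall>\<^sub>F n in sequentially. 0 \<le> d n" "\<forall>\<^sub>F n in sequentially. d n \<le> a n" using d(1,2) by (auto intro!: always_eventually less_imp_le)
    have "(\<lambda>n. min (min (T - t) (1/2)) (T/2) * inverse (real (Suc n))) \<longlonglongrightarrow> min (min (T - t) (1/2)) (T/2) * 0"
      by (intro tendsto_mult tendsto_const LIMSEQ_inverse_real_of_nat)
    then show "a \<longlonglongrightarrow> 0" unfolding a_def[abs_def] divide_inverse of_nat_Suc by (simp only: add.commute mult_zero_right)
  qed
  have dT: "2 * d n \<le> T" "2 * d n \<le> 1" "t + d n \<le> T" "d n \<le> 1" for n using d(2)[of n] aT[of n] by auto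
  \<comment> \<open>The excess of the limsup over the limit, cut at 1 because nothing is known yet
    about integrability of \<open>LS\<close>. It is dominated by the limsup of the period before
    \<open>d n\<close> plus the growth of \<open>Lam\<close> between \<open>t\<close> and
    \<open>t + d n\<close>; the first, cut at 1 as well, and the second both have small
    mean.\<close>
  define V where "V w = min 1 (LS x t (path 0 w) - LamE es x t (path 0 w))" for w
  have [measurable]: "V \<in> borel_measurable M" unfolding V_def[abs_def] by measurable
  define \<Delta> where "\<Delta> n w = ennreal (Lam es x (t + d n) (path 0 w) - Lam es x t (path 0 w))" for n w
  have tT: "t \<le> T" using t by simp
  have tdp: "0 \<le> t + d n" for n using t d0[of n] by simp
  have E\<Delta>: "(\<integral>\<^sup>+w. \<Delta> n w \<partial>M) \<le> ennreal (occ_sup (d n))" for n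
  proof -
    have "(\<integral>\<^sup>+w. \<Delta> n w \<partial>M) = ennreal (\<integral>w. Lam es x (t + d n) (path 0 w) - Lam es x t (path 0 w) \<partial>M)"
      unfolding \<Delta>_def
    proof (rule nn_integral_eq_integral)
      show "integrable M (\<lambda>w. Lam es x (t + d n) (path 0 w) - Lam es x t (path 0 w))"
        by (intro Bochner_Integration.integrable_diff Lam_integrable t tT tdp dT)
      show "AE w in M. 0 \<le> Lam es x (t + d n) (path 0 w) - Lam es x t (path 0 w)"
        using Lam_mono_AE[OF t(1) _ dT(3)[of n], of x] d0[of n] by (auto elim: eventually_mono)
    qed
    also have "(\<integral>w. Lam es x (t + d n) (path 0 w) - Lam es x t (path 0 w) \<partial>M) = occ (t + d n) x - occ t x"
      using Lam_integrable[OF tdp[of n] dT(3)[of n], of x] Lam_integrable[OF t(1) tT, of x] Lam_mean[OF tdp[of n] dT(3)[of n], of x] Lam_mean[OF t(1) tT, of x] by simp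
    also have "ennreal \<dots> \<le> ennreal (occ_sup (d n))" using occ_add_le[OF t(1) d0[of n], of x] by (intro ennreal_leI) simp
    finally show ?thesis .
  qed
  have V_le: "AE w in M. V w \<le> min 1 (LS x (d n) (path 0 w)) + \<Delta> n w" for n
    using d(3)[of n] Lam_conv[OF t(1) tT, of x] Lam_conv[OF tdp[of n] dT(3)[of n], of x] Lam_mono_AE[OF t(1) _ dT(3)[of n], of x, OF le_add_same_cancel1[THEN iffD2, OF d0]] AE_space[of M]
  proof eventually_elim
    case (elim w)
    have "LS x t (path 0 w) \<le> LS x (d n) (path 0 w) + LS (x - Y (d n) w) t (path (d n) w)" by (rule LS_split_le(1)[OF elim(5) d0 t(1)])
    also have "\<dots> \<le> LS x (d n) (path 0 w) + LamE es x (t + d n) (path 0 w)"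
      by (intro add_left_mono order_trans[OF elim(1)] LS_split_le(2)[OF elim(5) d0 t(1)])
    also have "LamE es x (t + d n) (path 0 w) = LamE es x t (path 0 w) + \<Delta> n w"
    proof -
      have "ennreal (Lam es x (t + d n) (path 0 w)) = ennreal (Lam es x t (path 0 w) + (Lam es x (t + d n) (path 0 w) - Lam es x t (path 0 w)))" by simp
      also have "\<dots> = ennreal (Lam es x t (path 0 w)) + \<Delta> n w" unfolding \<Delta>_def using elim(4) by (intro ennreal_plus Lam_nonneg) simp
      finally show ?thesis using elim(2,3) by simp
    qed
    finally have "LS x t (path 0 w) \<le> LamE es x t (path 0 w) + (LS x (d n) (path 0 w) + \<Delta> n w)" by (simp only: add_ac)
    then have "LS x t (path 0 w) - LamE es x t (path 0 w) \<le> LS x (d n) (path 0 w) + \<Delta> n w"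
      using elim(2) by (simp add: ennreal_minus_le_iff)
    then have "V w \<le> min 1 (LS x (d n) (path 0 w) + \<Delta> n w)" unfolding V_def by (intro min.mono order_refl)
    also have "\<dots> \<le> min 1 (LS x (d n) (path 0 w)) + min 1 (\<Delta> n w)" by (rule ennreal_min_1_add_le)
    also have "\<dots> \<le> min 1 (LS x (d n) (path 0 w)) + \<Delta> n w" by (intro add_left_mono) simp
    finally show ?case .
  qed
  have EV: "(\<integral>\<^sup>+w. V w \<partial>M) \<le> (\<integral>\<^sup>+w. min 1 (LS x (d n) (path 0 w)) \<partial>M) + ennreal (occ_sup (d n))" for n
  proof -
    have [measurable]: "\<Delta> n \<in> borel_measurable M" unfolding \<Delta>_def[abs_def] by measurable
    have "(\<integral>\<^sup>+w. V w \<partial>M) \<le> (\<integral>\<^sup>+w. min 1 (LS x (d n) (path 0 w)) + \<Delta> n w \<partial>M)" by (rule nn_integral_mono_AE[OF V_le])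
    also have "\<dots> = (\<integral>\<^sup>+w. min 1 (LS x (d n) (path 0 w)) \<partial>M) + (\<integral>\<^sup>+w. \<Delta> n w \<partial>M)" by (rule nn_integral_add) measurable
    finally show ?thesis using E\<Delta>[of n] by (meson add_left_mono order_trans)
  qed
  have "(\<lambda>n. occ_sup (d n)) \<longlonglongrightarrow> 0" by (rule occ_sup_tendsto_0[OF dl d0 dT(4)])
  then have "(\<lambda>n. ennreal (occ_sup (d n))) \<longlonglongrightarrow> ennreal 0" by (rule tendsto_ennrealI)
  then have "(\<lambda>n. (\<integral>\<^sup>+w. min 1 (LS x (d n) (path 0 w)) \<partial>M) + ennreal (occ_sup (d n))) \<longlonglongrightarrow> 0 + ennreal 0"
    by (intro tendsto_add LS_small dl d dT)
  then have "(\<integral>\<^sup>+w. V w \<partial>M) \<le> 0 + ennreal 0" by (rule LIMSEQ_le_const) (use EV in blast)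
  then have "(\<integral>\<^sup>+w. V w \<partial>M) = 0" by simp
  then have "AE w in M. V w = 0" by (subst (asm) nn_integral_0_iff_AE) auto
  then show ?thesis using Lam_conv[OF t(1) tT, of x] AE_space[of M]
  proof eventually_elim
    case (elim w)
    have "LS x t (path 0 w) - LamE es x t (path 0 w) = 0" using elim(1) unfolding V_def by (auto simp: min_def split: if_splits)
    then have "LS x t (path 0 w) \<le> LamE es x t (path 0 w)" by (simp add: diff_eq_0_iff_ennreal)
    then show ?case using LamE_le_LS[OF path_space[OF elim(3)], of x t 0] elim(2) by simp
  qed
qed

end

section \<open>The martingale for a process started at the origin\<close>

context levy_occ begin

text \<open>For the averages the Markov property gives the increment exactly, as \<open>GF\<close>
  at the position at time \<open>s\<close>. The terms with averages pass to the limit in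
  \<open>L1\<close>, the new term by dominated convergence with the bound
  \<open>occ_sup\<close>.\<close>

lemma Lam_increment:
  assumes s: "0 \<le> s" "s \<le> t" "t \<le> T" and B: "B \<in> sets (Fil s)"
  shows "(\<integral>a. indicator B a * Lam es x t (path 0 a) \<partial>M)
    = (\<integral>a. indicator B a * Lam es x s (path 0 a) \<partial>M) + (\<integral>a. indicator B a * occ (t - s) (x - Y s a) \<partial>M)"
proof -
  define u where "u = t - s"
  have u: "0 \<le> u" and tu: "s + u = t" and t0: "0 \<le> t" and sT: "s \<le> T" using s by (auto simp: u_def)
  have BM[measurable]: "B \<in> sets M" using B Fil_sub[of s] by (auto simp: subalgebra_def)
  have Bf: "(\<lambda>a. indicator B a :: ennreal) \<in> borel_measurable (Fil s)" using B by measurable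
  note [measurable] = Y_meas[OF s(1)] occ_meas[OF u]
  have lim: "(\<lambda>n. \<integral>a. indicator B a * ar (es n) x r (path 0 a) \<partial>M) \<longlonglongrightarrow> (\<integral>a. indicator B a * Lam es x r (path 0 a) \<partial>M)"
    if r: "0 \<le> r" "r \<le> T" for r
  proof (rule tendsto_L1_int)
    show "integrable M (\<lambda>a. indicator B a * ar (es n) x r (path 0 a))" for n
      using integrable_mult_indicator[OF BM ar_integrable[OF es0[of n] r(1), of x]] by simp
    show "integrable M (\<lambda>a. indicator B a * Lam es x r (path 0 a))"
      using integrable_mult_indicator[OF BM Lam_integrable[OF r, of x]] by simp
    show "((\<lambda>n. \<integral>\<^sup>+a. ennreal (norm (indicator B a * ar (es n) x r (path 0 a) - indicator B a * Lam es x r (path 0 a))) \<partial>M) \<longlongrightarrow> 0) sequentially"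
    proof (rule tendsto_sandwich[OF _ _ tendsto_const])
      have "(\<lambda>n. ennreal (2 * (1/2)^n)) \<longlonglongrightarrow> ennreal (2 * 0)" by (intro tendsto_ennrealI tendsto_mult tendsto_const LIMSEQ_realpow_zero) auto
      then show "(\<lambda>n. ennreal (2 * (1/2)^n)) \<longlonglongrightarrow> 0" by simp
      show "\<forall>\<^sub>F n in sequentially. (\<integral>\<^sup>+a. ennreal (norm (indicator B a * ar (es n) x r (path 0 a) - indicator B a * Lam es x r (path 0 a))) \<partial>M) \<le> ennreal (2 * (1/2)^n)"
      proof (intro always_eventually allI)
        fix n
        have "(\<integral>\<^sup>+a. ennreal (norm (indicator B a * ar (es n) x r (path 0 a) - indicator B a * Lam es x r (path 0 a))) \<partial>M) \<le> (\<integral>\<^sup>+a. ennreal \<bar>ar (es n) x r (path 0 a) - Lam es x r (path 0 a)\<bar> \<partial>M)"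
          by (intro nn_integral_mono ennreal_leI) (simp split: split_indicator)
        also have "\<dots> \<le> ennreal (2 * (1/2)^n)" by (rule Lam_L1_nn[OF r es0 order_refl])
        finally show "(\<integral>\<^sup>+a. ennreal (norm (indicator B a * ar (es n) x r (path 0 a) - indicator B a * Lam es x r (path 0 a))) \<partial>M) \<le> ennreal (2 * (1/2)^n)" .
      qed
    qed simp
  qed
  define G where "G n v = enn2real (GF u (fe (es n) x) v)" for n v
  have G0: "0 \<le> G n v" for n v by (simp add: G_def)
  have Gle: "ennreal (G n v) = GF u (fe (es n) x) v" for n v
    unfolding G_def using GF_fe_sup[OF es0 u, of n x v] by (intro ennreal_enn2real) (auto simp: le_less_trans)
  have Gsup: "G n v \<le> occ_sup u" for n v
    using GF_fe_sup[OF es0 u, of n x v] occ_sup_nonneg[OF u] unfolding Gle[symmetric] by (simp only: ennreal_le_iff)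
  have [measurable]: "G n \<in> borel_measurable borel" for n
  proof -
    have "(\<lambda>w. ennreal (occ u (snd w)) * fe (es n) x (fst w + snd w)) \<in> borel_measurable (borel \<Otimes>\<^sub>M lborel)" by measurable
    from lborel.borel_measurable_nn_integral[of "\<lambda>v z. ennreal (occ u z) * fe (es n) x (v + z)"] this
    have "(\<lambda>v. \<integral>\<^sup>+z. ennreal (occ u z) * fe (es n) x (v + z) \<partial>lborel) \<in> borel_measurable borel" by (simp add: case_prod_beta)
    from borel_measurable_enn2real[OF this] show ?thesis unfolding G_def[abs_def] GF_def .
  qed
  have Gint: "integrable M (\<lambda>a. indicator B a * G n (Y s a))" for n
    using G0 Gsup occ_sup_nonneg[OF u] by (intro integrable_const_bound[where B="occ_sup u"]) (auto split: split_indicator)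
  have lim_G: "(\<lambda>n. \<integral>a. indicator B a * G n (Y s a) \<partial>M) \<longlonglongrightarrow> (\<integral>a. indicator B a * occ u (x - Y s a) \<partial>M)"
  proof (rule integral_dominated_convergence[where w="\<lambda>_. occ_sup u"])
    show "AE a in M. (\<lambda>n. indicator B a * G n (Y s a)) \<longlonglongrightarrow> indicator B a * occ u (x - Y s a)"
    proof (intro always_eventually allI tendsto_mult tendsto_const)
      fix a
      show "(\<lambda>n. G n (Y s a)) \<longlonglongrightarrow> occ u (x - Y s a)"
        unfolding G_def by (rule tendsto_enn2real[OF GF_tendsto[OF u] occ_nonneg[OF u]])
    qed
    show "AE a in M. norm (indicator B a * G n (Y s a)) \<le> occ_sup u" for n
      using G0 Gsup occ_sup_nonneg[OF u] by (auto split: split_indicator)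
  qed auto
  have nn: "(\<integral>\<^sup>+a. indicator B a * avg (es n) x r (path 0 a) \<partial>M) = ennreal (\<integral>a. indicator B a * ar (es n) x r (path 0 a) \<partial>M)" if r: "0 \<le> r" for n r
  proof -
    have "(\<integral>\<^sup>+a. indicator B a * avg (es n) x r (path 0 a) \<partial>M) = (\<integral>\<^sup>+a. ennreal (indicator B a * ar (es n) x r (path 0 a)) \<partial>M)"
      using r by (intro nn_integral_cong) (simp add: ar_avg[OF es0 r, symmetric] split: split_indicator)
    also have "\<dots> = ennreal (\<integral>a. indicator B a * ar (es n) x r (path 0 a) \<partial>M)"
      using integrable_mult_indicator[OF BM ar_integrable[OF es0[of n] r(1), of x]] ar_nonneg[of "es n" x r]
      by (intro nn_integral_eq_integral) (auto split: split_indicator)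
    finally show ?thesis .
  qed
  have id: "(\<integral>a. indicator B a * ar (es n) x t (path 0 a) \<partial>M) = (\<integral>a. indicator B a * ar (es n) x s (path 0 a) \<partial>M) + (\<integral>a. indicator B a * G n (Y s a) \<partial>M)" for n
  proof -
    have sh: "avg (es n) (x - Y s a) u (path s a) = (\<integral>\<^sup>+r. fe (es n) x (Y r a) * indicator {s..s+u} r \<partial>lborel)" if "a \<in> space M" for a
      using AF_path_shift[OF that s(1) fe_meas[of "es n" x], of u] by (simp add: avg_def fe_shift)
    have [measurable]: "(\<lambda>a. avg (es n) (x - Y s a) u (path s a)) \<in> borel_measurable M"
    proof -
      have "(\<lambda>a. (x - Y s a, path s a)) \<in> M \<rightarrow>\<^sub>M (borel \<Otimes>\<^sub>M PS)" using path_meas[OF s(1)] by measurable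
      from measurable_compose[OF this avg_meas2] show ?thesis by simp
    qed
    have [measurable]: "(\<lambda>a. avg (es n) x s (path 0 a)) \<in> borel_measurable M" by (rule measurable_compose[OF path_meas[OF order_refl] avg_meas])
    have "(\<integral>\<^sup>+a. indicator B a * avg (es n) x t (path 0 a) \<partial>M) = (\<integral>\<^sup>+a. indicator B a * avg (es n) x s (path 0 a) + indicator B a * avg (es n) (x - Y s a) u (path s a) \<partial>M)"
      using avg_split[OF _ s(1) u, of _ "es n" x] unfolding tu by (intro nn_integral_cong) (simp add: distrib_left)
    moreover have "\<dots> = (\<integral>\<^sup>+a. indicator B a * avg (es n) x s (path 0 a) \<partial>M) + (\<integral>\<^sup>+a. indicator B a * avg (es n) (x - Y s a) u (path s a) \<partial>M)"
      by (rule nn_integral_add) measurable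
    moreover have "(\<integral>\<^sup>+a. indicator B a * avg (es n) (x - Y s a) u (path s a) \<partial>M) = (\<integral>\<^sup>+a. indicator B a * (\<integral>\<^sup>+r. fe (es n) x (Y r a) * indicator {s..s+u} r \<partial>lborel) \<partial>M)"
      by (intro nn_integral_cong) (simp only: sh)
    moreover have "\<dots> = (\<integral>\<^sup>+a. indicator B a * GF u (fe (es n) x) (Y s a) \<partial>M)" by (rule AF_markov[OF s(1) u fe_meas Bf])
    moreover have "\<dots> = (\<integral>\<^sup>+a. ennreal (indicator B a * G n (Y s a)) \<partial>M)"
      by (intro nn_integral_cong) (simp add: Gle[symmetric] split: split_indicator)
    moreover have "\<dots> = ennreal (\<integral>a. indicator B a * G n (Y s a) \<partial>M)"
      using Gint G0 by (intro nn_integral_eq_integral) auto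
    ultimately have "ennreal (\<integral>a. indicator B a * ar (es n) x t (path 0 a) \<partial>M) = ennreal (\<integral>a. indicator B a * ar (es n) x s (path 0 a) \<partial>M) + ennreal (\<integral>a. indicator B a * G n (Y s a) \<partial>M)"
      by (simp only: nn[OF s(1)] nn[OF t0])
    moreover have "ennreal (\<integral>a. indicator B a * ar (es n) x s (path 0 a) \<partial>M) + ennreal (\<integral>a. indicator B a * G n (Y s a) \<partial>M)
      = ennreal ((\<integral>a. indicator B a * ar (es n) x s (path 0 a) \<partial>M) + (\<integral>a. indicator B a * G n (Y s a) \<partial>M))"
      using ar_nonneg G0 by (intro ennreal_plus[symmetric] Bochner_Integration.integral_nonneg mult_nonneg_nonneg) auto
    ultimately have "ennreal (\<integral>a. indicator B a * ar (es n) x t (path 0 a) \<partial>M) = ennreal ((\<integral>a. indicator B a * ar (es n) x s (path 0 a) \<partial>M) + (\<integral>a. indicator B a * G n (Y s a) \<partial>M))"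
      by (simp only:)
    then show ?thesis
      using ar_nonneg G0 by (subst (asm) ennreal_inj) (auto intro!: add_nonneg_nonneg Bochner_Integration.integral_nonneg mult_nonneg_nonneg)
  qed
  show ?thesis
    using LIMSEQ_unique[OF lim[OF t0 s(3)] tendsto_add[OF lim[OF s(1) sT] lim_G, folded id]] unfolding u_def .
qed

end

context levy_tan begin

text \<open>Conditioning on \<open>Fil s\<close> reduces this to \<open>h_mean\<close> at the point
  \<open>Z s w - x\<close>. The additional term is the one of \<open>Lam_increment\<close>, up to
  \<open>Y\<close> and \<open>Z\<close>, which agree almost surely; this is the cancellation behind
  the martingale.\<close>

lemma h_increment:
  assumes s: "0 \<le> s" "s \<le> t" and B: "B \<in> sets (Fil s)"
  shows "(\<integral>w. indicator B w * h (Z t w - x) \<partial>M)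
    = (\<integral>w. indicator B w * h (Z s w - x) \<partial>M) + (\<integral>w. indicator B w * occ (t - s) (x - Z s w) \<partial>M)"
proof -
  define u where "u = t - s"
  have u: "0 \<le> u" and tu: "s + u = t" and t0: "0 \<le> t" using s by (auto simp: u_def)
  have BM[measurable]: "B \<in> sets M" using B Fil_sub[of s] by (auto simp: subalgebra_def)
  note [measurable] = Z_meas[OF s(1)] Z_meas[OF t0] Z_meas[OF u] occ_meas[OF u] Z_Fil[OF s(1) order_refl]
  have hi: "integrable M (\<lambda>w. indicator B w * h (Z r w - x))" if "0 \<le> r" for r
    using integrable_mult_indicator[OF BM h_integrable[OF that, of "-x"]] by (simp add: algebra_simps)
  have oi: "integrable M (\<lambda>w. indicator B w * occ u (x - Z s w))"
    using occ_nonneg[OF u] occ_le_sup[OF u] occ_sup_nonneg[OF u] by (intro integrable_const_bound[where B="occ_sup u"]) (auto split: split_indicator)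
  have n: "(\<integral>\<^sup>+w. ennreal (indicator B w * h (Z r w - x)) \<partial>M) = ennreal (\<integral>w. indicator B w * h (Z r w - x) \<partial>M)" if "0 \<le> r" for r
    using hi[OF that] h_nonneg by (intro nn_integral_eq_integral) auto
  define g where "g = (\<lambda>(w, z). ennreal (indicator B w * h (Z s w - x + z)))"
  have g: "g \<in> borel_measurable (Fil s \<Otimes>\<^sub>M borel)"
    using B unfolding g_def case_prod_beta by measurable
  have "ennreal (\<integral>w. indicator B w * h (Z t w - x) \<partial>M) = (\<integral>\<^sup>+w. g (w, Z (s + u) w - Z s w) \<partial>M)"
    unfolding n[OF t0, symmetric] tu by (simp add: g_def)
  moreover have "\<dots> = (\<integral>\<^sup>+w. (\<integral>\<^sup>+w'. g (w, Z u w') \<partial>M) \<partial>M)" by (rule incr_nn[OF s(1) u g])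
  moreover have "\<dots> = (\<integral>\<^sup>+w. ennreal (indicator B w * h (Z s w - x) + indicator B w * occ u (x - Z s w)) \<partial>M)"
  proof (rule nn_integral_cong)
    fix w
    have "(\<integral>\<^sup>+w'. g (w, Z u w') \<partial>M) = ennreal (\<integral>w'. indicator B w * h (Z s w - x + Z u w') \<partial>M)"
      unfolding g_def case_prod_conv using h_integrable[OF u] h_nonneg by (intro nn_integral_eq_integral) auto
    also have "(\<integral>w'. indicator B w * h (Z s w - x + Z u w') \<partial>M) = indicator B w * (h (Z s w - x) + occ u (- (Z s w - x)))"
      using h_mean[OF u, of "Z s w - x"] by simp
    finally show "(\<integral>\<^sup>+w'. g (w, Z u w') \<partial>M) = ennreal (indicator B w * h (Z s w - x) + indicator B w * occ u (x - Z s w))"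
      by (simp add: distrib_left)
  qed
  moreover have "\<dots> = ennreal (\<integral>w. indicator B w * h (Z s w - x) + indicator B w * occ u (x - Z s w) \<partial>M)"
    using hi[OF s(1)] oi h_nonneg occ_nonneg[OF u] by (intro nn_integral_eq_integral) (auto intro!: add_nonneg_nonneg)
  moreover have "(\<integral>w. indicator B w * h (Z s w - x) + indicator B w * occ u (x - Z s w) \<partial>M) = (\<integral>w. indicator B w * h (Z s w - x) \<partial>M) + (\<integral>w. indicator B w * occ u (x - Z s w) \<partial>M)"
    by (rule Bochner_Integration.integral_add[OF hi[OF s(1)] oi])
  ultimately have "ennreal (\<integral>w. indicator B w * h (Z t w - x) \<partial>M) = ennreal ((\<integral>w. indicator B w * h (Z s w - x) \<partial>M) + (\<integral>w. indicator B w * occ u (x - Z s w) \<partial>M))"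
    by (simp only:)
  then show ?thesis unfolding u_def[symmetric]
    using h_nonneg occ_nonneg[OF u] by (subst (asm) ennreal_inj) (auto intro!: add_nonneg_nonneg Bochner_Integration.integral_nonneg mult_nonneg_nonneg)
qed

end

section \<open>The local time as a limsup of occupation averages\<close>

lemma enn2ereal_le_e2ennreal: "0 \<le> S \<Longrightarrow> enn2ereal a \<le> S \<longleftrightarrow> a \<le> e2ennreal S"
  by (metis enn2ereal_e2ennreal less_eq_ennreal.rep_eq)

text \<open>Passing from all real radii to rational ones loses nothing by \<open>avg_le_SS\<close>;
  the other direction holds since rational radii are among all radii. The upper ends
  \<open>1 / (n + 1)\<close> are cofinal at 0.\<close>

lemma Limsup_avg:
  assumes p: "p \<in> space PS" and t: "0 \<le> t"
  shows "Limsup (at_right 0) (\<lambda>\<epsilon>. ereal (ar \<epsilon> x t p)) = enn2ereal (LS x t p)"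
proof (rule antisym)
  let ?L = "Limsup (at_right 0) (\<lambda>\<epsilon>. ereal (ar \<epsilon> x t p))"
  have eq: "ereal (ar \<epsilon> x t p) = enn2ereal (avg \<epsilon> x t p)" if "0 < \<epsilon>" for \<epsilon>
    using ar_avg[OF that t, of x p, symmetric] ar_nonneg[of \<epsilon> x t p] by (simp add: enn2ereal_ennreal)
  have "?L \<le> enn2ereal (SS (1 / (real n + 1)) x t p)" for n
  proof (rule Limsup_bounded)
    have "\<forall>\<^sub>F \<epsilon> in at_right 0. \<epsilon> \<in> {0<..<1 / (real n + 1)}" by (rule eventually_at_right_real) simp
    then show "\<forall>\<^sub>F \<epsilon> in at_right 0. ereal (ar \<epsilon> x t p) \<le> enn2ereal (SS (1 / (real n + 1)) x t p)"
    proof eventually_elim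
      case (elim \<epsilon>)
      then show ?case using avg_le_SS[OF p, of \<epsilon> "1 / (real n + 1)" x t] eq[of \<epsilon>] by (simp add: less_eq_ennreal.rep_eq)
    qed
  qed
  then have "e2ennreal ?L \<le> SS (1 / (real n + 1)) x t p" for n
    using e2ennreal_mono[of ?L "enn2ereal (SS (1 / (real n + 1)) x t p)"] by (simp add: e2ennreal_enn2ereal)
  then have "e2ennreal ?L \<le> LS x t p" unfolding LS_def by (rule INF_greatest)
  then have "enn2ereal (e2ennreal ?L) \<le> enn2ereal (LS x t p)" by (simp add: less_eq_ennreal.rep_eq)
  then show "?L \<le> enn2ereal (LS x t p)" by (metis enn2ereal_e2ennreal enn2ereal_nonneg linear order_trans)
  show "enn2ereal (LS x t p) \<le> ?L"
    unfolding Limsup_def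
  proof (rule INF_greatest)
    fix P :: "real \<Rightarrow> bool" assume "P \<in> {P. eventually P (at_right 0)}"
    then obtain b where b: "0 < b" "\<And>e. 0 < e \<Longrightarrow> e < b \<Longrightarrow> P e" unfolding eventually_at_right_field by auto
    define S where "S = (SUP \<epsilon>\<in>Collect P. ereal (ar \<epsilon> x t p))"
    have up: "ereal (ar \<epsilon> x t p) \<le> S" if "P \<epsilon>" for \<epsilon> unfolding S_def by (rule SUP_upper) (use that in simp)
    have S0: "0 \<le> S" using up[OF b(2)[of "b/2"]] b(1) ar_nonneg[of "b/2" x t p] by (auto intro: order_trans[of 0 "ereal (ar (b/2) x t p)"])
    obtain n where n: "1 / (real n + 1) < b" using b(1) reals_Archimedean[of b] by (auto simp: inverse_eq_divide add.commute)
    have "SS (1 / (real n + 1)) x t p \<le> e2ennreal S" unfolding SS_def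
    proof (rule SUP_least)
      fix e assume "e \<in> \<rat> \<inter> {0<..<1 / (real n + 1)}"
      then have e: "0 < e" "e < b" using n by auto
      show "avg e x t p \<le> e2ennreal S" using up[OF b(2)[OF e]] unfolding eq[OF e(1)] enn2ereal_le_e2ennreal[OF S0] .
    qed
    moreover have "LS x t p \<le> SS (1 / (real n + 1)) x t p" unfolding LS_def by (rule INF_lower) simp
    ultimately have "LS x t p \<le> e2ennreal S" by (rule order_trans[rotated])
    then show "enn2ereal (LS x t p) \<le> (SUP \<epsilon>\<in>Collect P. ereal (ar \<epsilon> x t p))"
      unfolding S_def[symmetric] enn2ereal_le_e2ennreal[OF S0] .
  qed
qed

context levy0 begin

text \<open>Unlike \<open>path 0\<close>, this gives the local time at every \<open>\<omega>\<close>, also on the null event \<open>Z 0 \<omega> \<noteq> 0\<close>, as needed for the raw filtration.\<close>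

definition traj :: "'w \<Rightarrow> real \<Rightarrow> real" where "traj w = (\<lambda>u\<in>{0..}. Z u w)"

lemma traj_space: "traj w \<in> space PS" by (simp add: traj_def space_PiM)

lemma rg_traj: assumes w: "w \<in> space M" shows "rg (traj w) r = Z (max 0 r) w"
proof -
  have "rcont (traj w)" unfolding rcont_def
  proof (intro allI impI)
    fix r :: real assume r: "0 \<le> r"
    have "\<forall>\<^sub>F u in at_right r. Z u w = traj w u"
      using r unfolding eventually_at_right_field by (intro exI[of _ "r + 1"]) (auto simp: traj_def)
    from iffD1[OF tendsto_cong[OF this] Z_right[OF w r]] have "(traj w \<longlongrightarrow> Z r w) (at_right r)" .
    moreover have "traj w r = Z r w" using r by (simp add: traj_def)
    ultimately show "(traj w \<longlongrightarrow> traj w r) (at_right r)" by simp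
  qed
  from rg_eq[OF this] show ?thesis by (simp add: traj_def)
qed

lemma local_time_LS:
  assumes w: "w \<in> space M" and t: "0 \<le> t"
  shows "local_time Z x t w = enn2ereal (LS x t (traj w))"
proof -
  have m[measurable]: "(\<lambda>r. Z (max 0 r) w) \<in> borel_measurable borel"
    using measurable_compose[OF _ joint_meas, of "\<lambda>r. (r, w)" borel] w by simp
  have "1 / (2 * \<epsilon>) * (LBINT s:{0..t}. indicator {s. \<bar>Z s w - x\<bar> < \<epsilon>} s) = ar \<epsilon> x t (traj w)" if e: "0 < \<epsilon>" for \<epsilon>
  proof -
    let ?f = "\<lambda>s. indicator {x-\<epsilon><..<x+\<epsilon>} (Z (max 0 s) w) * indicator {0..t} s :: real"
    have I: "(LBINT s:{0..t}. indicator {s. \<bar>Z s w - x\<bar> < \<epsilon>} s) = (\<integral>s. ?f s \<partial>lborel)"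
      unfolding set_lebesgue_integral_def by (intro Bochner_Integration.integral_cong) (auto simp: indicator_def abs_less_iff max_def)
    have "integrable lborel (indicator {0..t} :: real \<Rightarrow> real)" using t by (intro integrable_real_indicator) auto
    then have i: "integrable lborel ?f" by (rule Bochner_Integration.integrable_bound) (auto split: split_indicator)
    have "AF (indicator {x-\<epsilon><..<x+\<epsilon>}) t (traj w) = (\<integral>\<^sup>+s. ennreal (?f s) \<partial>lborel)"
      unfolding AF_def by (intro nn_integral_cong) (auto simp: rg_traj[OF w] indicator_def)
    also have "\<dots> = ennreal (\<integral>s. ?f s \<partial>lborel)" by (rule nn_integral_eq_integral[OF i]) simp
    finally have "avg \<epsilon> x t (traj w) = ennreal (1 / (2*\<epsilon>) * (\<integral>s. ?f s \<partial>lborel))"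
      unfolding avg_nu[OF traj_space] using e by (simp only:, intro ennreal_mult[symmetric]) auto
    moreover have "0 \<le> 1 / (2*\<epsilon>) * (\<integral>s. ?f s \<partial>lborel)" using e by (intro mult_nonneg_nonneg Bochner_Integration.integral_nonneg) auto
    ultimately show ?thesis unfolding ar_def I by simp
  qed
  then have "\<forall>\<^sub>F \<epsilon> in at_right 0. ereal (1 / (2 * \<epsilon>) * (LBINT s:{0..t}. indicator {s. \<bar>Z s w - x\<bar> < \<epsilon>} s)) = ereal (ar \<epsilon> x t (traj w))"
    unfolding eventually_at_right_field by (intro exI[of _ 1]) auto
  then show ?thesis unfolding local_time_def Limsup_avg[OF traj_space t, symmetric] by (rule Limsup_eq)
qed

text \<open>Progressive measurability is used here: with the time clamped to \<open>{0..t}\<close>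
  the process is jointly measurable with respect to \<open>Fil t\<close>, so its time integral is
  measurable with respect to \<open>Fil t\<close>.\<close>

lemma avg_traj_Fil:
  assumes t: "0 \<le> t"
  shows "(\<lambda>v. avg e x t (traj v)) \<in> borel_measurable (Fil t)"
proof -
  have [measurable]: "(\<lambda>w. Z (max 0 (min t (fst w))) (snd w)) \<in> borel_measurable (borel \<Otimes>\<^sub>M Fil t)" using joint_meas_Fil[OF t] by (simp add: case_prod_beta)
  have "(\<lambda>w. (snd w, fst w)) \<in> (Fil t \<Otimes>\<^sub>M lborel) \<rightarrow>\<^sub>M (borel \<Otimes>\<^sub>M Fil t)" by measurable
  from measurable_compose[OF this joint_meas_Fil[OF t]]
  have [measurable]: "(\<lambda>w. Z (max 0 (min t (snd w))) (fst w)) \<in> borel_measurable (Fil t \<Otimes>\<^sub>M lborel)" by (simp add: case_prod_beta)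
  have "(\<lambda>w. fe e x (Z (max 0 (min t (snd w))) (fst w)) * (if 0 \<le> snd w \<and> snd w \<le> t then 1 else 0)) \<in> borel_measurable (Fil t \<Otimes>\<^sub>M lborel)"
    by measurable
  then have m: "(\<lambda>v. \<integral>\<^sup>+r. fe e x (Z (max 0 (min t r)) v) * (if 0 \<le> r \<and> r \<le> t then 1 else 0) \<partial>lborel) \<in> borel_measurable (Fil t)"
    by (intro lborel.borel_measurable_nn_integral) (simp add: case_prod_beta)
  have "avg e x t (traj v) = (\<integral>\<^sup>+r. fe e x (Z (max 0 (min t r)) v) * (if 0 \<le> r \<and> r \<le> t then 1 else 0) \<partial>lborel)" if "v \<in> space (Fil t)" for v
    unfolding avg_def AF_def using that by (intro nn_integral_cong) (auto simp: rg_traj indicator_def min_def)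
  from iffD2[OF measurable_cong[OF this] m] show ?thesis .
qed

lemma LS_traj_Fil:
  assumes t: "0 \<le> t"
  shows "(\<lambda>w. LS x t (traj w)) \<in> borel_measurable (Fil t)"
  unfolding LS_def SS_def
proof (rule borel_measurable_INF)
  show "(\<lambda>w. SUP e\<in>\<rat> \<inter> {0<..<1 / (real n + 1)}. avg e x t (traj w)) \<in> borel_measurable (Fil t)" for n
  proof (rule borel_measurable_SUP)
    show "countable (\<rat> \<inter> {0<..<1 / (real n + 1)})" using countable_rat by (rule countable_subset[rotated]) auto
  qed (rule avg_traj_Fil[OF t])
qed simp

lemma local_time_Fil:
  assumes t: "0 \<le> t"
  shows "(\<lambda>w. real_of_ereal (local_time Z x t w)) \<in> borel_measurable (Fil t)"
proof -
  have m: "(\<lambda>w. enn2real (LS x t (traj w))) \<in> borel_measurable (Fil t)" using LS_traj_Fil[OF t] by measurable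
  have "real_of_ereal (local_time Z x t w) = enn2real (LS x t (traj w))" if "w \<in> space (Fil t)" for w
    unfolding local_time_LS[OF that[unfolded space_Fil] t] enn2real_def ..
  from iffD2[OF measurable_cong[OF this] m] show ?thesis .
qed

lemma traj_path: "AE w in M. traj w = path 0 w"
  using Z_0 by eventually_elim (auto simp: traj_def path_def)

end

context levy_occ begin

lemma local_time_Lam:
  assumes t: "0 \<le> t" "t < T"
  shows "AE w in M. local_time Z x t w = ereal (Lam es x t (path 0 w))"
  using LS_eq_Lam[OF t, of x] traj_path AE_space[of M]
proof eventually_elim
  case (elim w)
  then show ?case using local_time_LS[OF elim(3) t(1), of x] Lam_nonneg[of es x t "path 0 w"] by (simp add: enn2ereal_ennreal)
qed

end

context levy_tan begin

text \<open>What \<open>N_tilde\<close> becomes once the limit in \<open>q\<close> is carried out.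
  Without that limit, adaptedness to the raw filtration can be read off.\<close>

definition N0 :: "real \<Rightarrow> real \<Rightarrow> 'a \<Rightarrow> real" where
  "N0 x t w = h (Z t w - x) - h (Z 0 w - x) - real_of_ereal (local_time Z x t w)"

lemma N0_Fil: assumes t: "0 \<le> t" shows "N0 x t \<in> borel_measurable (Fil t)"
proof -
  note [measurable] = Z_Fil[OF t order_refl] Z_Fil[OF order_refl t] local_time_Fil[OF t, of x]
  show ?thesis unfolding N0_def[abs_def] by measurable
qed

text \<open>The increments of \<open>h\<close> and of the local time have the same conditional mean.
  The sequence \<open>es\<close> and the horizon occur in the proof only: \<open>Lam\<close> is
  almost surely the local time, whichever sequence produced it.\<close>

lemma N0_increment:
  assumes s: "0 \<le> s" "s \<le> t"
  shows "integrable M (N0 x t)" "B \<in> sets (Fil s) \<Longrightarrow> (\<integral>w. indicator B w * N0 x t w \<partial>M) = (\<integral>w. indicator B w * N0 x s w \<partial>M)"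
    and "AE w in M. \<bar>local_time Z x t w\<bar> \<noteq> \<infinity>"
proof -
  \<comment> \<open>The horizon \<open>t + 1\<close> provides the strict inequality that
    \<open>local_time_Lam\<close> asks for.\<close>
  have t0: "0 \<le> t" and T: "0 \<le> t + 1" using s by auto
  obtain es where es: "\<And>n. 0 < es n" "decseq es" "es \<longlonglongrightarrow> 0"
    "\<And>k r x e. 0 \<le> r \<Longrightarrow> r \<le> t + 1 \<Longrightarrow> 0 < e \<Longrightarrow> e \<le> es k \<Longrightarrow> (\<integral>w. \<bar>ar e x r (path 0 w) - ar (es k) x r (path 0 w)\<bar> \<partial>M) \<le> (1/2)^k"
    using ex_seq[OF T] by blast
  interpret O: levy_occ M Z \<eta> "t + 1" es by unfold_locales (use T es in auto)
  have Lt: "AE w in M. local_time Z x r w = ereal (Lam es x r (path 0 w))" if "0 \<le> r" "r \<le> t" for r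
    by (rule O.local_time_Lam) (use that in auto)
  show "AE w in M. \<bar>local_time Z x t w\<bar> \<noteq> \<infinity>" using Lt[OF t0 order_refl] by eventually_elim simp
  define K where "K r w = h (Z r w - x) - h (Z 0 w - x) - Lam es x r (path 0 w)" for r w
  have hi: "integrable M (\<lambda>w. h (Z r w - x))" if "0 \<le> r" for r using h_integrable[OF that, of "-x"] by (simp add: algebra_simps)
  have Li: "integrable M (\<lambda>w. Lam es x r (path 0 w))" if "0 \<le> r" "r \<le> t" for r by (rule O.Lam_integrable) (use that in auto)
  have NK: "AE w in M. N0 x r w = K r w" if "0 \<le> r" "r \<le> t" for r
    using Lt[OF that] by eventually_elim (simp add: N0_def K_def)
  have Nm: "N0 x r \<in> borel_measurable M" if "0 \<le> r" for r by (rule measurable_from_subalg[OF Fil_sub N0_Fil[OF that]])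
  have Ki: "integrable M (K r)" if "0 \<le> r" "r \<le> t" for r
    unfolding K_def[abs_def] by (intro Bochner_Integration.integrable_diff hi Li that) simp
  have Km: "K r \<in> borel_measurable M" if "0 \<le> r" "r \<le> t" for r by (rule borel_measurable_integrable[OF Ki[OF that]])
  show "integrable M (N0 x t)" using integrable_cong_AE[OF Nm[OF t0] Km[OF t0 order_refl] NK[OF t0 order_refl]] Ki[OF t0 order_refl] by simp
  assume B: "B \<in> sets (Fil s)"
  have BM[measurable]: "B \<in> sets M" using B Fil_sub[of s] by (auto simp: subalgebra_def)
  have ii: "integrable M (\<lambda>w. indicator B w * f w)" if "integrable M f" for f :: "'a \<Rightarrow> real"
    using integrable_mult_indicator[OF BM that] by simp
  have IK: "(\<integral>w. indicator B w * N0 x r w \<partial>M) = (\<integral>w. indicator B w * h (Z r w - x) \<partial>M) - (\<integral>w. indicator B w * h (Z 0 w - x) \<partial>M) - (\<integral>w. indicator B w * Lam es x r (path 0 w) \<partial>M)"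
    if r: "0 \<le> r" "r \<le> t" for r
  proof -
    note [measurable] = Nm[OF r(1)] Km[OF r]
    have "(\<integral>w. indicator B w * N0 x r w \<partial>M) = (\<integral>w. indicator B w * K r w \<partial>M)"
      by (rule integral_cong_AE) (use NK[OF r] in \<open>auto elim: eventually_mono\<close>)
    also have "\<dots> = (\<integral>w. indicator B w * h (Z r w - x) - indicator B w * h (Z 0 w - x) - indicator B w * Lam es x r (path 0 w) \<partial>M)"
      by (simp add: K_def right_diff_distrib)
    also have "\<dots> = (\<integral>w. indicator B w * h (Z r w - x) \<partial>M) - (\<integral>w. indicator B w * h (Z 0 w - x) \<partial>M) - (\<integral>w. indicator B w * Lam es x r (path 0 w) \<partial>M)"
      using ii[OF hi[OF r(1)]] ii[OF hi[OF order_refl]] ii[OF Li[OF r]] by (simp only: Bochner_Integration.integral_diff Bochner_Integration.integrable_diff)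
    finally show ?thesis .
  qed
  have o: "(\<integral>w. indicator B w * occ (t - s) (x - Y s w) \<partial>M) = (\<integral>w. indicator B w * occ (t - s) (x - Z s w) \<partial>M)"
  proof -
    have ts: "0 \<le> t - s" using s by simp
    note [measurable] = Z_meas[OF s(1)] Y_meas[OF s(1)] occ_meas[OF ts]
    show ?thesis by (rule integral_cong_AE) (use Y_ae[OF s(1)] in \<open>auto elim: eventually_mono\<close>)
  qed
  have tT: "t \<le> t + 1" by simp
  show "(\<integral>w. indicator B w * N0 x t w \<partial>M) = (\<integral>w. indicator B w * N0 x s w \<partial>M)"
    unfolding IK[OF t0 order_refl] IK[OF s] O.Lam_increment[OF s tT B] h_increment[OF s B] o by simp
qed

lemma N0_martingale: "martingale M Fil (N0 x)"
  unfolding martingale_def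
proof (intro conjI allI impI)
  fix s t :: real assume st: "0 \<le> s \<and> s \<le> t"
  then have s: "0 \<le> s" "s \<le> t" by auto
  show "subalgebra (Fil t) (Fil s)" by (rule Fil_mono[OF s(2)])
  interpret F: sigma_finite_subalgebra M "Fil s"
    by (rule finite_measure_subalgebra_is_sigma_finite) (simp add: finite_measure_subalgebra_def finite_measure_subalgebra_axioms_def finite_measure_axioms Fil_sub)
  show "AE w in M. real_cond_exp M (Fil s) (N0 x t) w = N0 x s w"
  proof (rule F.real_cond_exp_charact)
    show "set_lebesgue_integral M A (N0 x t) = set_lebesgue_integral M A (N0 x s)" if "A \<in> sets (Fil s)" for A
      using N0_increment(2)[OF s that] by (simp add: set_lebesgue_integral_def)
    show "integrable M (N0 x t)" by (rule N0_increment(1)[OF s])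
    show "integrable M (N0 x s)" by (rule N0_increment(1)[OF s(1) order_refl])
    show "N0 x s \<in> borel_measurable (Fil s)" by (rule N0_Fil[OF s(1)])
  qed
qed (use Fil_sub N0_Fil N0_increment(1)[OF order_refl] in auto)

end

section \<open>Arbitrary starting points\<close>

context levy_sym begin

lemma res_bounded: "0 < q \<Longrightarrow> bounded (range (res q))"
proof -
  assume q: "0 < q"
  have "\<bar>res q z\<bar> \<le> (\<integral>u. norm (complex_of_real q / (of_real q - \<eta> u)) \<partial>lborel) / q" for z
    using q_res_bound[OF q, of z] q by (simp add: abs_mult pos_le_divide_eq mult.commute)
  then show ?thesis unfolding bounded_iff by auto
qed

text \<open>Tonelli and \<open>res_density\<close>, where the normalised exponential time accounts
  for the factor \<open>1 / q\<close>. The integrability facts are listed because the signed case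
  subtracts two instances.\<close>

lemma resolvent_res_nonneg:
  assumes q: "0 < q" and g[measurable]: "g \<in> borel_measurable borel" and g0: "\<And>y. 0 \<le> g y" and gC: "\<And>y. g y \<le> C"
  shows "integrable M (\<lambda>v. LBINT t:{0..}. exp (- q * t) * g (x + Z t v))"
    and "(\<integral>v. (LBINT t:{0..}. exp (- q * t) * g (x + Z t v)) \<partial>M) = (\<integral>y. g y * res q (y - x) \<partial>lborel)"
    and "integrable lborel (\<lambda>y. g y * res q (y - x))"
    and "v \<in> space M \<Longrightarrow> set_integrable lborel {0..} (\<lambda>t. exp (- q * t) * g (x + Z t v))"
proof -
  have C0: "0 \<le> C" using g0[of 0] gC[of 0] by simp
  have ed: "exponential_density q t = q * (exp (- q * t) * (if 0 \<le> t then 1 else 0))" for t by (simp add: exponential_density_def mult.commute)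
  have ei: "integrable lborel (\<lambda>t. exp (- q * t) * (if 0 \<le> t then 1 else 0))"
  proof -
    have "(\<integral>\<^sup>+t. ennreal (exponential_density q t) \<partial>lborel) = emeasure (density lborel (\<lambda>s. ennreal (exponential_density q s))) UNIV"
      by (subst emeasure_density) auto
    also have "\<dots> = 1" using prob_space.emeasure_space_1[OF prob_space_exponential_density[OF q]] by simp
    finally have "integrable lborel (exponential_density q)"
      using q by (intro integrableI_nonneg) (auto simp: exponential_density_def)
    from integrable_mult_left[OF this, of "1/q"] have "integrable lborel (\<lambda>t. exponential_density q t * (1/q))" .
    then show ?thesis unfolding ed using q by simp
  qed
  have J[measurable]: "(\<lambda>w. Z (max 0 (fst w)) (snd w)) \<in> borel_measurable (borel \<Otimes>\<^sub>M M)" using joint_meas by (simp add: case_prod_beta)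
  define k where "k v t = exp (- q * t) * (if 0 \<le> t then 1 else 0) * g (x + Z (max 0 t) v)" for v t
  have k0: "0 \<le> k v t" for v t using g0 by (simp add: k_def)
  have kC: "k v t \<le> C * (exp (- q * t) * (if 0 \<le> t then 1 else 0))" for v t
    using gC[of "x + Z (max 0 t) v"] by (cases "0 \<le> t") (simp_all add: k_def mult.commute)
  have km[measurable]: "(\<lambda>w. k (snd w) (fst w)) \<in> borel_measurable (borel \<Otimes>\<^sub>M M)" unfolding k_def by measurable
  have ki: "integrable lborel (k v)" if "v \<in> space M" for v
  proof (rule Bochner_Integration.integrable_bound)
    show "integrable lborel (\<lambda>t. C * (exp (- q * t) * (if 0 \<le> t then 1 else 0)))" using ei by (rule integrable_mult_right)
    show "k v \<in> borel_measurable lborel" using measurable_compose[OF _ km, of "\<lambda>t. (t, v)" borel] that by simp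
    show "AE t in lborel. norm (k v t) \<le> norm (C * (exp (- q * t) * (if 0 \<le> t then 1 else 0)))"
      using k0 kC C0 by (intro always_eventually allI) (simp only: real_norm_def abs_of_nonneg[OF k0], rule order_trans[OF kC abs_ge_self])
  qed
  have kind: "indicator {0..} t *\<^sub>R (exp (- q * t) * g (x + Z t v)) = k v t" for v t by (simp add: k_def indicator_def)
  show "set_integrable lborel {0..} (\<lambda>t. exp (- q * t) * g (x + Z t v))" if "v \<in> space M"
    unfolding set_integrable_def kind using ki[OF that] by simp
  have L: "(LBINT t:{0..}. exp (- q * t) * g (x + Z t v)) = (\<integral>t. k v t \<partial>lborel)" for v
    unfolding set_lebesgue_integral_def kind ..
  have mm[measurable]: "(\<lambda>v. \<integral>t. k v t \<partial>lborel) \<in> borel_measurable M"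
  proof -
    have "(\<lambda>w. (snd w, fst w)) \<in> (M \<Otimes>\<^sub>M lborel) \<rightarrow>\<^sub>M (borel \<Otimes>\<^sub>M M)" by measurable
    from measurable_compose[OF this km] have "case_prod k \<in> borel_measurable (M \<Otimes>\<^sub>M lborel)" by (simp add: case_prod_beta)
    then show ?thesis by (rule lborel.borel_measurable_lebesgue_integral)
  qed
  have nnk: "(\<integral>\<^sup>+v. ennreal (\<integral>t. k v t \<partial>lborel) \<partial>M) = (\<integral>\<^sup>+y. ennreal (g y * res q (y - x)) \<partial>lborel)"
  proof -
    interpret MLb: pair_sigma_finite lborel M ..
    have "(\<integral>\<^sup>+v. ennreal (\<integral>t. k v t \<partial>lborel) \<partial>M) = (\<integral>\<^sup>+v. (\<integral>\<^sup>+t. ennreal (k v t) \<partial>lborel) \<partial>M)"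
      using ki k0 by (intro nn_integral_cong nn_integral_eq_integral[symmetric]) auto
    moreover have "\<dots> = (\<integral>\<^sup>+t. (\<integral>\<^sup>+v. ennreal (k v t) \<partial>M) \<partial>lborel)"
      using MLb.Fubini'[of "\<lambda>t v. ennreal (k v t)"] km by (simp add: case_prod_beta)
    moreover have "\<dots> = (\<integral>\<^sup>+t. ennreal (1/q) * (ennreal (exponential_density q t) * (\<integral>\<^sup>+v. ennreal (g (x + Z (max 0 t) v)) \<partial>M)) \<partial>lborel)"
    proof (rule nn_integral_cong)
      fix t :: real
      have [measurable]: "Z (max 0 t) \<in> borel_measurable M" by (rule Z_meas) simp
      have "(\<integral>\<^sup>+v. ennreal (k v t) \<partial>M) = (\<integral>\<^sup>+v. ennreal (exp (- q * t) * (if 0 \<le> t then 1 else 0)) * ennreal (g (x + Z (max 0 t) v)) \<partial>M)"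
        unfolding k_def using g0 by (intro nn_integral_cong ennreal_mult) auto
      also have "\<dots> = ennreal (exp (- q * t) * (if 0 \<le> t then 1 else 0)) * (\<integral>\<^sup>+v. ennreal (g (x + Z (max 0 t) v)) \<partial>M)"
        by (rule nn_integral_cmult) measurable
      also have "ennreal (exp (- q * t) * (if 0 \<le> t then 1 else 0)) = ennreal (1/q) * ennreal (exponential_density q t)"
        unfolding ed using q by (subst ennreal_mult[symmetric]) auto
      finally show "(\<integral>\<^sup>+v. ennreal (k v t) \<partial>M) = ennreal (1/q) * (ennreal (exponential_density q t) * (\<integral>\<^sup>+v. ennreal (g (x + Z (max 0 t) v)) \<partial>M))"
        by (simp only: mult.assoc)
    qed
    moreover have "\<dots> = ennreal (1/q) * (\<integral>\<^sup>+t. ennreal (exponential_density q t) * (\<integral>\<^sup>+v. ennreal (g (x + Z (max 0 t) v)) \<partial>M) \<partial>lborel)"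
    proof (rule nn_integral_cmult)
      have "(\<lambda>w. ennreal (g (x + Z (max 0 (fst w)) (snd w)))) \<in> borel_measurable (borel \<Otimes>\<^sub>M M)" by measurable
      then have "(\<lambda>t. \<integral>\<^sup>+v. ennreal (g (x + Z (max 0 t) v)) \<partial>M) \<in> borel_measurable borel"
        using borel_measurable_nn_integral[of "\<lambda>t v. ennreal (g (x + Z (max 0 t) v))" borel] by (simp add: case_prod_beta)
      then show "(\<lambda>t. ennreal (exponential_density q t) * (\<integral>\<^sup>+v. ennreal (g (x + Z (max 0 t) v)) \<partial>M)) \<in> borel_measurable lborel" by measurable
    qed
    moreover have "\<dots> = ennreal (1/q) * (\<integral>\<^sup>+z. ennreal (q * res q z) * ennreal (g (x + z)) \<partial>lborel)"
      using res_density[OF q, of "\<lambda>z. ennreal (g (x + z))"] by simp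
    moreover have "\<dots> = (\<integral>\<^sup>+z. ennreal (1/q) * (ennreal (q * res q z) * ennreal (g (x + z))) \<partial>lborel)"
    proof (rule nn_integral_cmult[symmetric])
      have [measurable]: "res q \<in> borel_measurable borel" by (rule res_meas[OF q])
      have [measurable]: "(\<lambda>z. g (x + z)) \<in> borel_measurable borel" by measurable
      show "(\<lambda>z. ennreal (q * res q z) * ennreal (g (x + z))) \<in> borel_measurable lborel" by measurable
    qed
    moreover have "\<dots> = (\<integral>\<^sup>+z. ennreal (g (x + z) * res q (x + z - x)) \<partial>lborel)"
    proof (rule nn_integral_cong)
      fix z
      have "ennreal (q * res q z) * ennreal (g (x + z)) = ennreal (q * res q z * g (x + z))"
        using q res_nonneg[OF q] g0 by (intro ennreal_mult[symmetric]) auto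
      moreover have "ennreal (1/q) * ennreal (q * res q z * g (x + z)) = ennreal (1/q * (q * res q z * g (x + z)))"
        using q res_nonneg[OF q] g0 by (intro ennreal_mult[symmetric]) auto
      ultimately show "ennreal (1/q) * (ennreal (q * res q z) * ennreal (g (x + z))) = ennreal (g (x + z) * res q (x + z - x))"
        using q by (simp add: mult.commute)
    qed
    moreover have "\<dots> = (\<integral>\<^sup>+y. ennreal (g y * res q (y - x)) \<partial>lborel)"
      using nn_integral_real_affine[of "\<lambda>y. ennreal (g y * res q (y - x))" 1 x] res_meas[OF q] by simp
    ultimately show ?thesis by (simp only:)
  qed
  have I0: "0 \<le> (\<integral>t. k v t \<partial>lborel)" for v using k0 by simp
  have R0: "0 \<le> g y * res q (y - x)" for y using g0 res_nonneg[OF q] by simp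
  have "(\<integral>t. k v t \<partial>lborel) \<le> (\<integral>t. C * (exp (- q * t) * (if 0 \<le> t then 1 else 0)) \<partial>lborel)" if "v \<in> space M" for v
    using ki[OF that] kC ei by (intro integral_mono integrable_mult_right) auto
  then have Ii: "integrable M (\<lambda>v. \<integral>t. k v t \<partial>lborel)"
    using I0 by (intro integrable_const_bound[where B="\<integral>t. C * (exp (- q * t) * (if 0 \<le> t then 1 else 0)) \<partial>lborel"] mm) auto
  then show "integrable M (\<lambda>v. LBINT t:{0..}. exp (- q * t) * g (x + Z t v))" unfolding L .
  note [measurable] = res_meas[OF q]
  have "(\<integral>\<^sup>+y. ennreal (g y * res q (y - x)) \<partial>lborel) < \<infinity>"
    unfolding nnk[symmetric] using nn_integral_eq_integral[OF Ii] I0 by simp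
  then show Ri: "integrable lborel (\<lambda>y. g y * res q (y - x))"
    using R0 by (intro integrableI_nonneg) auto
  have "ennreal (\<integral>v. (\<integral>t. k v t \<partial>lborel) \<partial>M) = ennreal (\<integral>y. g y * res q (y - x) \<partial>lborel)"
    using nn_integral_eq_integral[OF Ii] nn_integral_eq_integral[OF Ri] I0 R0 nnk by simp
  then show "(\<integral>v. (LBINT t:{0..}. exp (- q * t) * g (x + Z t v)) \<partial>M) = (\<integral>y. g y * res q (y - x) \<partial>lborel)"
    unfolding L using I0 R0 by (subst (asm) ennreal_inj) auto
qed

lemma resolvent_res:
  assumes q: "0 < q" and f[measurable]: "f \<in> borel_measurable borel" and b: "bounded (range f)"
  shows "(\<integral>w. (LBINT t:{0..}. exp (- q * t) * f (x + Z t w)) \<partial>M) = (\<integral>y. f y * res q (y - x) \<partial>lborel)"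
proof -
  from b obtain C where C: "\<And>y. \<bar>f y\<bar> \<le> C" unfolding bounded_iff by auto
  have C0: "0 \<le> C" using C[of 0] by simp
  \<comment> \<open>Adding the bound \<open>C\<close> makes \<open>f\<close> nonnegative; the
    constant function \<open>C\<close> is subtracted afterwards.\<close>
  have f0: "0 \<le> f y + C" "f y + C \<le> 2 * C" for y using C[of y] by (auto simp: abs_le_iff)
  have fm: "(\<lambda>y. f y + C) \<in> borel_measurable borel" by measurable
  note 1 = resolvent_res_nonneg[where g="\<lambda>y. f y + C" and x=x, OF q fm f0]
  note 2 = resolvent_res_nonneg[where g="\<lambda>y. C" and C=C and x=x, OF q borel_measurable_const C0 order_refl]
  have s: "(LBINT t:{0..}. exp (- q * t) * f (x + Z t w)) = (LBINT t:{0..}. exp (- q * t) * (f (x + Z t w) + C)) - (LBINT t:{0..}. exp (- q * t) * C)"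
    if "w \<in> space M" for w
  proof -
    have "(LBINT t:{0..}. exp (- q * t) * f (x + Z t w)) = (LBINT t:{0..}. exp (- q * t) * (f (x + Z t w) + C) - exp (- q * t) * C)"
      by (simp add: distrib_left)
    also have "\<dots> = (LBINT t:{0..}. exp (- q * t) * (f (x + Z t w) + C)) - (LBINT t:{0..}. exp (- q * t) * C)"
      by (rule set_integral_diff(2)[OF 1(4)[OF that] 2(4)[OF that]])
    finally show ?thesis .
  qed
  have "(\<integral>w. (LBINT t:{0..}. exp (- q * t) * f (x + Z t w)) \<partial>M) = (\<integral>w. (LBINT t:{0..}. exp (- q * t) * (f (x + Z t w) + C)) - (LBINT t:{0..}. exp (- q * t) * C) \<partial>M)"
    by (intro Bochner_Integration.integral_cong refl s)
  also have "\<dots> = (\<integral>w. (LBINT t:{0..}. exp (- q * t) * (f (x + Z t w) + C)) \<partial>M) - (\<integral>w. (LBINT t:{0..}. exp (- q * t) * C) \<partial>M)"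
    by (rule Bochner_Integration.integral_diff[OF 1(1) 2(1)])
  also have "\<dots> = (\<integral>y. (f y + C) * res q (y - x) \<partial>lborel) - (\<integral>y. C * res q (y - x) \<partial>lborel)" unfolding 1(2) 2(2) ..
  also have "\<dots> = (\<integral>y. (f y + C) * res q (y - x) - C * res q (y - x) \<partial>lborel)"
    by (rule Bochner_Integration.integral_diff[OF 1(3) 2(3), symmetric])
  also have "\<dots> = (\<integral>y. f y * res q (y - x) \<partial>lborel)" by (simp add: distrib_right)
  finally show ?thesis .
qed

lemma res_integral: assumes q: "0 < q" shows "integrable lborel (res q)" "(\<integral>y. res q y \<partial>lborel) = 1 / q"
proof -
  have "integrable lborel (\<lambda>y. 1 * res q (y - 0))"
    by (rule resolvent_res_nonneg(3)[OF q, of _ 1]) auto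
  then show i: "integrable lborel (res q)" by simp
  have "ennreal (\<integral>y. q * res q y \<partial>lborel) = 1"
    using nn_integral_eq_integral[OF integrable_mult_right[OF i, of q]] q res_nonneg[OF q] res_total[OF q] by simp
  then have "q * (\<integral>y. res q y \<partial>lborel) = 1" by simp
  then show "(\<integral>y. res q y \<partial>lborel) = 1 / q" using q by (simp add: field_simps)
qed

end

lemma AE_lborel_continuous_zero:
  fixes d :: "real \<Rightarrow> real"
  assumes c: "continuous_on UNIV d" and ae: "AE x in lborel. d x = 0"
  shows "d z = 0"
proof (rule ccontr)
  assume n: "d z \<noteq> 0"
  have "open (d -` (- {0}))" using c by (intro open_vimage) auto
  moreover have "z \<in> d -` (- {0})" using n by simp
  ultimately obtain e where e: "0 < e" "ball z e \<subseteq> d -` (- {0})" by (rule openE)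
  have "AE x in lborel. x \<notin> {z<..<z+e}"
    using ae by eventually_elim (use e in \<open>auto simp: ball_def dist_real_def subset_eq\<close>)
  then have "{z<..<z+e} \<in> null_sets lborel" by (subst AE_iff_null_sets) auto
  then show False using e(1) by (simp add: null_sets_def)
qed

context levy_tan begin

text \<open>The bound of \<open>q * res q\<close> is uniform in space and independent of the path
  \<open>g\<close>, so the limit will hold at every outcome, not just almost surely.\<close>

lemma q_integral_tendsto:
  fixes t :: real and g :: "real \<Rightarrow> real"
  shows "((\<lambda>q. q * (LBINT s:{0..t}. res q (g s))) \<longlongrightarrow> 0) (at_right 0)"
proof (rule Lim_null_comparison)
  let ?C = "\<lambda>q. (\<integral>u. norm (complex_of_real q / (of_real q - \<eta> u)) \<partial>lborel)"
  show "((\<lambda>q. measure lborel {0..t} * ?C q) \<longlongrightarrow> 0) (at_right 0)"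
    using tendsto_mult[OF tendsto_const q_res_sup_tendsto_0, of "measure lborel {0..t}"] by simp
  have "\<forall>\<^sub>F q in at_right (0::real). 0 < q" by (rule eventually_at_right_less)
  then show "\<forall>\<^sub>F q in at_right 0. norm (q * (LBINT s:{0..t}. res q (g s))) \<le> measure lborel {0..t} * ?C q"
  proof eventually_elim
    case (elim q)
    have "norm (q * (LBINT s:{0..t}. res q (g s))) = norm (\<integral>s. indicator {0..t} s * (q * res q (g s)) \<partial>lborel)"
      unfolding set_lebesgue_integral_def by (subst Bochner_Integration.integral_mult_right_zero[symmetric]) (simp add: mult.left_commute)
    also have "\<dots> \<le> (\<integral>s. norm (indicator {0..t} s * (q * res q (g s))) \<partial>lborel)" by (rule integral_norm_bound)
    also have "\<dots> \<le> (\<integral>s. indicator {0..t} s * ?C q \<partial>lborel)"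
    proof (rule integral_mono')
      have "integrable lborel (indicator {0..t} :: real \<Rightarrow> real)"
        by (intro integrable_real_indicator) (auto simp: emeasure_lborel_Icc_eq)
      from integrable_mult_left[OF this, of "?C q"] show "integrable lborel (\<lambda>s. indicator {0..t} s * ?C q)" .
    qed (use q_res_bound[OF elim] in \<open>auto simp: indicator_def\<close>)
    also have "\<dots> = measure lborel {0..t} * ?C q" by simp
    finally show ?case .
  qed
qed

end

text \<open>Independence of finitely many functions of a random element says that their joint law is
  a product, and both sides of that equation are determined by the law of the element.\<close>

lemma indep_vars_law:
  assumes M: "prob_space M" and N: "prob_space N"
    and W[measurable]: "W \<in> M \<rightarrow>\<^sub>M S" and V[measurable]: "V \<in> N \<rightarrow>\<^sub>M S" and eq: "distr M S W = distr N S V"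
    and g: "\<And>i. g i \<in> borel_measurable S" and I: "finite I"
    and ind: "prob_space.indep_vars M (\<lambda>_. borel) (\<lambda>i w. g i (W w)) I"
  shows "prob_space.indep_vars N (\<lambda>_. borel) (\<lambda>i w. g i (V w) :: real) I"
proof (cases "I = {}")
  case True
  then show ?thesis using N by (simp add: prob_space.indep_vars_def prob_space.indep_sets_def)
next
  case False
  note [measurable] = g
  interpret M: prob_space M by (rule M)
  interpret N: prob_space N by (rule N)
  have G: "(\<lambda>p. \<lambda>i\<in>I. g i p) \<in> S \<rightarrow>\<^sub>M Pi\<^sub>M I (\<lambda>_. borel)" by (intro measurable_restrict g)
  have "distr M (Pi\<^sub>M I (\<lambda>_. borel)) (\<lambda>w. \<lambda>i\<in>I. g i (W w)) = Pi\<^sub>M I (\<lambda>i. distr M borel (\<lambda>w. g i (W w)))"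
    using ind by (subst (asm) M.indep_vars_iff_distr_eq_PiM'[OF False]) auto
  moreover have "distr M (Pi\<^sub>M I (\<lambda>_. borel)) (\<lambda>w. \<lambda>i\<in>I. g i (W w)) = distr (distr M S W) (Pi\<^sub>M I (\<lambda>_. borel)) (\<lambda>p. \<lambda>i\<in>I. g i p)"
    by (subst distr_distr[OF G W]) (simp add: comp_def)
  moreover have "distr N (Pi\<^sub>M I (\<lambda>_. borel)) (\<lambda>w. \<lambda>i\<in>I. g i (V w)) = distr (distr N S V) (Pi\<^sub>M I (\<lambda>_. borel)) (\<lambda>p. \<lambda>i\<in>I. g i p)"
    by (subst distr_distr[OF G V]) (simp add: comp_def)
  moreover have "distr M borel (\<lambda>w. g i (W w)) = distr N borel (\<lambda>w. g i (V w))" for i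
  proof -
    have "distr M borel (\<lambda>w. g i (W w)) = distr (distr M S W) borel (g i)" by (subst distr_distr[OF g W]) (simp add: comp_def)
    moreover have "distr N borel (\<lambda>w. g i (V w)) = distr (distr N S V) borel (g i)" by (subst distr_distr[OF g V]) (simp add: comp_def)
    ultimately show ?thesis by (simp only: eq)
  qed
  ultimately have "distr N (Pi\<^sub>M I (\<lambda>_. borel)) (\<lambda>w. \<lambda>i\<in>I. g i (V w)) = Pi\<^sub>M I (\<lambda>i. distr N borel (\<lambda>w. g i (V w)))"
    by (simp only: eq)
  then show ?thesis by (subst N.indep_vars_iff_distr_eq_PiM'[OF False]) auto
qed

text \<open>Independence and stationarity of the increments and the initial value are properties of
  the law on path space. Regularity of the paths is not, as it involves uncountably many times, so
  it is a separate assumption \<open>Vc\<close>.\<close>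

lemma levy_process_from_zero_law:
  assumes lz: "levy_process_from_zero M Z" and N: "prob_space N"
    and Vm: "\<And>t. 0 \<le> t \<Longrightarrow> V t \<in> borel_measurable N" and Vc: "\<And>w. w \<in> space N \<Longrightarrow> cadlag_path (\<lambda>t. V t w)"
    and eq: "distr N PS (\<lambda>w. \<lambda>t\<in>{0..}. V t w) = distr M PS (\<lambda>w. \<lambda>t\<in>{0..}. Z t w)"
  shows "levy_process_from_zero N V"
proof -
  have M: "prob_space M" and Zm: "\<And>t. 0 \<le> t \<Longrightarrow> Z t \<in> borel_measurable M" using lz unfolding levy_process_from_zero_def by auto
  have tV: "(\<lambda>w. \<lambda>t\<in>{0..}. V t w) \<in> N \<rightarrow>\<^sub>M PS" by (intro measurable_restrict Vm) auto
  have tZ: "(\<lambda>w. \<lambda>t\<in>{0..}. Z t w) \<in> M \<rightarrow>\<^sub>M PS" by (intro measurable_restrict Zm) auto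
  have law: "distr N borel (\<lambda>w. g (\<lambda>t\<in>{0..}. V t w)) = distr M borel (\<lambda>w. g (\<lambda>t\<in>{0..}. Z t w))"
    if g: "g \<in> borel_measurable PS" for g :: "(real \<Rightarrow> real) \<Rightarrow> real"
  proof -
    have "distr N borel (\<lambda>w. g (\<lambda>t\<in>{0..}. V t w)) = distr (distr N PS (\<lambda>w. \<lambda>t\<in>{0..}. V t w)) borel g" by (subst distr_distr[OF g tV]) (simp add: comp_def)
    moreover have "distr M borel (\<lambda>w. g (\<lambda>t\<in>{0..}. Z t w)) = distr (distr M PS (\<lambda>w. \<lambda>t\<in>{0..}. Z t w)) borel g" by (subst distr_distr[OF g tZ]) (simp add: comp_def)
    ultimately show ?thesis by (simp only: eq)
  qed
  have comp[measurable]: "(\<lambda>p. p t) \<in> borel_measurable PS" if "0 \<le> t" for t :: real using that by (intro measurable_component_singleton) auto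
  have incr: "distr N borel (\<lambda>w. V t w - V s w) = distr M borel (\<lambda>w. Z t w - Z s w)" if "0 \<le> s" "0 \<le> t" for s t
    using law[OF borel_measurable_diff[OF comp[OF that(2)] comp[OF that(1)]]] that by simp
  interpret L: levy0 M Z using M lz by (simp add: levy0_def levy0_axioms_def)
  show ?thesis unfolding levy_process_from_zero_def
  proof (intro conjI allI impI ballI)
    show "AE w in N. V 0 w = 0"
    proof -
      have "AE v in distr M borel (Z 0). v = 0" using L.Z_0 by (subst AE_distr_iff) (use Zm in auto)
      moreover have "distr N borel (V 0) = distr M borel (Z 0)" using law[OF comp[OF order_refl]] by simp
      ultimately have "AE v in distr N borel (V 0). v = 0" by (simp only:)
      then show ?thesis by (subst (asm) AE_distr_iff) (use Vm in auto)
    qed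
    fix r :: "nat \<Rightarrow> real" and n :: nat assume r: "0 \<le> r 0 \<and> incseq r"
    have t0: "0 \<le> r i" for i using r incseqD[of r 0 i] by auto
    have "prob_space.indep_vars N (\<lambda>_. borel) (\<lambda>i w. (\<lambda>i p. p (r (Suc i)) - p (r i)) i (\<lambda>t\<in>{0..}. V t w)) {..<n}"
    proof (rule indep_vars_law[OF M N tZ tV eq[symmetric]])
      show "prob_space.indep_vars M (\<lambda>_. borel) (\<lambda>i w. (\<lambda>i p. p (r (Suc i)) - p (r i)) i (\<lambda>t\<in>{0..}. Z t w)) {..<n}"
        using L.Z_incr[of r n] r t0 by simp
      show "(\<lambda>p. p (r (Suc i)) - p (r i)) \<in> borel_measurable PS" for i by (intro borel_measurable_diff comp t0)
    qed simp
    then show "prob_space.indep_vars N (\<lambda>_. borel) (\<lambda>i w. V (r (Suc i)) w - V (r i) w) {..<n}" using t0 by simp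
  next
    fix s t :: real assume st: "0 \<le> s \<and> s \<le> t"
    then show "distr N borel (\<lambda>w. V t w - V s w) = distr N borel (\<lambda>w. V (t - s) w - V 0 w)"
      using incr[of s t] incr[of 0 "t - s"] L.Z_stat[of s t] by simp
  qed (use N Vm Vc in auto)
qed

text \<open>Under \<open>P y\<close> the process \<open>X - y\<close> has the law of
  \<open>X\<close> under \<open>P 0\<close>. So all results for a start at 0 apply to it, and the
  second claim, used for the characteristic function, shows that the symbol is the same.\<close>

lemma levy_process_shift:
  assumes lp: "levy_process P X"
  shows "levy_process_from_zero (P y) (\<lambda>t w. X t w - y)"
    and "0 \<le> t \<Longrightarrow> f \<in> borel_measurable borel \<Longrightarrow> (\<integral>w. f (X t w - y) \<partial>P y) = (\<integral>w. f (X t w) \<partial>P 0 :: complex)"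
proof -
  have lz: "levy_process_from_zero (P 0) X" and S: "sets (P y) = sets (P 0)"
    and D: "distr (P y) PS (\<lambda>w. \<lambda>t\<in>{0..}. X t w) = distr (P 0) PS (\<lambda>w. \<lambda>t\<in>{0..}. y + X t w)"
    using lp unfolding levy_process_def by auto
  have P0: "prob_space (P 0)" and Xm: "\<And>t. 0 \<le> t \<Longrightarrow> X t \<in> borel_measurable (P 0)" and Xc: "\<And>w. w \<in> space (P 0) \<Longrightarrow> cadlag_path (\<lambda>t. X t w)"
    using lz unfolding levy_process_from_zero_def by auto
  have Xy: "X t \<in> borel_measurable (P y)" if "0 \<le> t" for t using Xm[OF that] unfolding measurable_cong_sets[OF S refl] .
  have sp: "space (P y) = space (P 0)" using S by (rule sets_eq_imp_space_eq)
  have m1: "(\<lambda>w. \<lambda>t\<in>{0..}. X t w) \<in> P y \<rightarrow>\<^sub>M PS" by (intro measurable_restrict Xy) auto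
  have m2: "(\<lambda>w. \<lambda>t\<in>{0..}. y + X t w) \<in> P 0 \<rightarrow>\<^sub>M PS" by (intro measurable_restrict borel_measurable_add borel_measurable_const Xm) auto
  have Py: "prob_space (P y)"
  proof (rule prob_space_distrD[OF m1])
    show "prob_space (distr (P y) PS (\<lambda>w. \<lambda>t\<in>{0..}. X t w))" unfolding D by (rule prob_space.prob_space_distr[OF P0 m2])
  qed
  have sh: "(\<lambda>p. \<lambda>t\<in>{0..}. p t - y) \<in> PS \<rightarrow>\<^sub>M PS"
    by (intro measurable_restrict borel_measurable_diff borel_measurable_const measurable_component_singleton)
  have eq: "distr (P y) PS (\<lambda>w. \<lambda>t\<in>{0..}. X t w - y) = distr (P 0) PS (\<lambda>w. \<lambda>t\<in>{0..}. X t w)"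
  proof -
    have "distr (P y) PS (\<lambda>w. \<lambda>t\<in>{0..}. X t w - y) = distr (distr (P y) PS (\<lambda>w. \<lambda>t\<in>{0..}. X t w)) PS (\<lambda>p. \<lambda>t\<in>{0..}. p t - y)"
      by (subst distr_distr[OF sh m1]) (auto simp: comp_def intro!: distr_cong)
    also have "\<dots> = distr (P 0) PS (\<lambda>w. \<lambda>t\<in>{0..}. X t w)"
      unfolding D by (subst distr_distr[OF sh m2]) (auto simp: comp_def intro!: distr_cong)
    finally show ?thesis .
  qed
  show "levy_process_from_zero (P y) (\<lambda>t w. X t w - y)"
  proof (rule levy_process_from_zero_law[OF lz Py _ _ eq])
    show "(\<lambda>w. X t w - y) \<in> borel_measurable (P y)" if "0 \<le> t" for t using Xy[OF that] by measurable
    fix w assume "w \<in> space (P y)"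
    then have c: "cadlag_path (\<lambda>t. X t w)" using Xc sp by simp
    show "cadlag_path (\<lambda>t. X t w - y)" unfolding cadlag_path_def
    proof (intro conjI allI impI)
      show "((\<lambda>t. X t w - y) \<longlongrightarrow> X t w - y) (at_right t)" if "0 \<le> t" for t
        using c that unfolding cadlag_path_def by (intro tendsto_diff tendsto_const) auto
      fix t :: real assume "0 < t"
      then obtain l where "((\<lambda>t. X t w) \<longlongrightarrow> l) (at_left t)" using c unfolding cadlag_path_def by auto
      then have "((\<lambda>t. X t w - y) \<longlongrightarrow> l - y) (at_left t)" by (intro tendsto_diff tendsto_const)
      then show "\<exists>l. ((\<lambda>t. X t w - y) \<longlongrightarrow> l) (at_left t)" ..
    qed
  qed
  assume t: "0 \<le> t" and f: "f \<in> borel_measurable borel"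
  have c: "(\<lambda>p. f (p t)) \<in> borel_measurable PS" using t by (intro measurable_compose[OF _ f] measurable_component_singleton) auto
  have m3: "(\<lambda>w. \<lambda>t\<in>{0..}. X t w - y) \<in> P y \<rightarrow>\<^sub>M PS" by (intro measurable_restrict borel_measurable_diff borel_measurable_const Xy) auto
  have m4: "(\<lambda>w. \<lambda>t\<in>{0..}. X t w) \<in> P 0 \<rightarrow>\<^sub>M PS" by (intro measurable_restrict Xm) auto
  show "(\<integral>w. f (X t w - y) \<partial>P y) = (\<integral>w. f (X t w) \<partial>P 0 :: complex)"
    using integral_distr[OF m3 c] integral_distr[OF m4 c] t unfolding eq by simp
qed

lemma natural_filtration_shift: "natural_filtration M (\<lambda>t w. X t w - y) = natural_filtration M X"
proof -
  have sub: "(\<Union>s\<in>{0..t}. {(\<lambda>w. X s w + c) -` A \<inter> space M | A. A \<in> sets borel}) \<subseteq> (\<Union>s\<in>{0..t}. {X s -` A \<inter> space M | A. A \<in> sets borel})"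
    for X :: "real \<Rightarrow> 'a \<Rightarrow> real" and c t
  proof (intro UN_mono order_refl subsetI)
    fix s B assume "B \<in> {(\<lambda>w. X s w + c) -` A \<inter> space M | A. A \<in> sets borel}"
    then obtain A where A: "A \<in> sets borel" "B = (\<lambda>w. X s w + c) -` A \<inter> space M" by auto
    have "(\<lambda>v. v + c) \<in> borel_measurable borel" by measurable
    from measurable_sets[OF this A(1)] have "(\<lambda>v. v + c) -` A \<in> sets borel" by simp
    moreover have "B = X s -` ((\<lambda>v. v + c) -` A) \<inter> space M" using A(2) by auto
    ultimately show "B \<in> {X s -` A \<inter> space M | A. A \<in> sets borel}" by blast
  qed
  have "(\<Union>s\<in>{0..t}. {(\<lambda>w. X s w - y) -` A \<inter> space M | A. A \<in> sets borel}) = (\<Union>s\<in>{0..t}. {X s -` A \<inter> space M | A. A \<in> sets borel})" for t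
    using sub[where t=t and X=X and c="-y"] sub[where t=t and X="\<lambda>s w. X s w - y" and c=y] by (simp add: order_antisym)
  then show ?thesis unfolding natural_filtration_def by (intro ext) simp
qed

lemma local_time_shift: "local_time (\<lambda>t w. X t w - y) (x - y) t w = local_time X x t w"
  by (simp add: local_time_def)

theorem theorem4p2:
  fixes P :: "real \<Rightarrow> 'w measure"
    and X :: "real \<Rightarrow> 'w \<Rightarrow> real"
    and \<eta> :: "real \<Rightarrow> complex"
  assumes levy: "levy_process P X"
    and symbol: "has_levy_symbol P X \<eta>"
    and A: "\<And>q::real. q > 0 \<Longrightarrow> integrable lborel (\<lambda>u. 1 / (complex_of_real q - \<eta> u))"
    and B: "set_integrable lborel {0..1} (\<lambda>u. \<bar>Im (complex_of_real u / \<eta> u)\<bar>)"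
  shows "\<forall>y x::real.
    (\<forall>t\<ge>0.
      (AE \<omega> in P y. \<exists>l::real. ((\<lambda>q. M_proc P X q x t \<omega>) \<longlongrightarrow> l) (at_right 0)) \<and>
      (AE \<omega> in P y. ereal (h_fun \<eta> (X t \<omega> - x)) =
         ereal (h_fun \<eta> (X 0 \<omega> - x)) + ereal (N_tilde P X x t \<omega>) + local_time X x t \<omega>)) \<and>
    martingale (P y) (natural_filtration (P y) X) (N_tilde P X x)"
proof -
  have tan: "levy_tan (P y) (\<lambda>t w. X t w - y) \<eta>" for y
  proof -
    have lz: "levy_process_from_zero (P y) (\<lambda>t w. X t w - y)" by (rule levy_process_shift(1)[OF levy])
    have chr: "(\<integral>w. iexp (u * (X t w - y)) \<partial>P y) = exp (of_real t * \<eta> u)" if "0 \<le> t" for t u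
      using levy_process_shift(2)[OF levy that, of "\<lambda>v. iexp (u * v)" y] symbol that unfolding has_levy_symbol_def by simp
    have "prob_space (P y)" using lz unfolding levy_process_from_zero_def by auto
    then show ?thesis
      unfolding levy_tan_def levy_sym_def levy0_def levy_tan_axioms_def levy_sym_axioms_def levy0_axioms_def
      using lz chr A B by auto
  qed
  define r where "r = levy_sym.res \<eta>"
  have dens: "resolvent_density P X q = r q" if q: "0 < q" for q
    unfolding resolvent_density_def
  proof (rule the_equality)
    interpret T: levy_tan "P 0" "\<lambda>t w. X t w - 0" \<eta> by (rule tan)
    have rc: "continuous_on UNIV (r q)" unfolding r_def using T.res_cont[OF q] by (simp add: continuous_on_eq_continuous_at)
    have ri: "integrable lborel (r q)" "(\<integral>y. r q y \<partial>lborel) = 1 / q" unfolding r_def by (rule T.res_integral[OF q])+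
    have id: "resolvent P X q f x = (\<integral>y. f y * r q (y - x) \<partial>lborel)" if f: "f \<in> borel_measurable borel" "bounded (range f)" for f x
    proof -
      \<comment> \<open>The resolvent at \<open>x\<close> is computed under \<open>P x\<close>,
        where \<open>X - x\<close> starts at 0; \<open>res\<close> is the same function for all
        these interpretations.\<close>
      interpret Tx: levy_tan "P x" "\<lambda>t w. X t w - x" \<eta> by (rule tan)
      show ?thesis using Tx.resolvent_res[OF q f, of x] by (simp add: resolvent_def r_def)
    qed
    show "bounded (range (r q)) \<and> continuous_on UNIV (r q) \<and> (\<forall>f x. f \<in> borel_measurable borel \<and> bounded (range f) \<longrightarrow> resolvent P X q f x = (\<integral>y. f y * r q (y - x) \<partial>lborel))"
      using T.res_bounded[OF q] rc id by (auto simp: r_def)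
    fix r' assume r': "bounded (range r') \<and> continuous_on UNIV r' \<and> (\<forall>f x. f \<in> borel_measurable borel \<and> bounded (range f) \<longrightarrow> resolvent P X q f x = (\<integral>y. f y * r' (y - x) \<partial>lborel))"
    then have r'm: "r' \<in> borel_measurable borel" by (intro borel_measurable_continuous_onI) auto
    have rm: "r q \<in> borel_measurable borel" using rc by (rule borel_measurable_continuous_onI)
    have eq: "(\<integral>y. f y * r' y \<partial>lborel) = (\<integral>y. f y * r q y \<partial>lborel)" if f: "f \<in> borel_measurable borel" "bounded (range f)" for f
      using r' id[OF f, of 0] f by auto
    have "(\<integral>y. 1 * r' y \<partial>lborel) = (\<integral>y. 1 * r q y \<partial>lborel)" by (rule eq) (auto simp: image_constant_conv)
    \<comment> \<open>The test function 1 forces the integral of \<open>r'\<close> to be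
      \<open>1 / q\<close>, whereas a non-integrable function would have Bochner integral 0; so
      \<open>r'\<close> is integrable.\<close>
    then have "(\<integral>y. r' y \<partial>lborel) \<noteq> 0" using ri q by simp
    then have r'i: "integrable lborel r'" using not_integrable_integral_eq by blast
    define d where "d y = r' y - r q y" for y
    have dm[measurable]: "d \<in> borel_measurable borel" unfolding d_def[abs_def] using r'm rm by measurable
    have di: "integrable lborel d" unfolding d_def[abs_def] by (intro Bochner_Integration.integrable_diff r'i ri)
    \<comment> \<open>The sign of \<open>d\<close> is a bounded Borel test function. Testing with it
      shows that the difference has \<open>L1\<close> norm 0, and continuity upgrades this to
      equality everywhere.\<close>
    have si: "integrable lborel (\<lambda>y. sgn (d y) * g y)" if "integrable lborel g" for g :: "real \<Rightarrow> real"
      by (rule Bochner_Integration.integrable_bound[OF that]) (use borel_measurable_integrable[OF that] in \<open>auto simp: abs_mult abs_sgn_eq\<close>)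
    have "(\<integral>y. \<bar>d y\<bar> \<partial>lborel) = (\<integral>y. sgn (d y) * r' y - sgn (d y) * r q y \<partial>lborel)"
    proof (intro Bochner_Integration.integral_cong refl)
      fix y
      have "sgn (d y) * (r' y - r q y) = \<bar>d y\<bar>" by (simp only: d_def abs_sgn mult.commute)
      then show "\<bar>d y\<bar> = sgn (d y) * r' y - sgn (d y) * r q y" by (simp only: right_diff_distrib)
    qed
    also have "\<dots> = (\<integral>y. sgn (d y) * r' y \<partial>lborel) - (\<integral>y. sgn (d y) * r q y \<partial>lborel)"
      by (intro Bochner_Integration.integral_diff si r'i ri)
    also have "\<dots> = 0"
    proof -
      have "bounded (range (\<lambda>y. sgn (d y)))" unfolding bounded_iff by (intro exI[of _ 1]) (auto simp: abs_sgn_eq)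
      moreover have "(\<lambda>y. sgn (d y)) \<in> borel_measurable borel" by measurable
      ultimately show ?thesis using eq by simp
    qed
    finally have "AE y in lborel. \<bar>d y\<bar> = 0"
      using integral_nonneg_eq_0_iff_AE[of lborel "\<lambda>y. \<bar>d y\<bar>"] di by auto
    then have ae: "AE y in lborel. d y = 0" by simp
    have "continuous_on UNIV d" unfolding d_def[abs_def] using r' rc by (intro continuous_on_diff) auto
    from AE_lborel_continuous_zero[OF this ae] show "r' = r q" by (intro ext) (simp add: d_def)
  qed
  show ?thesis
  proof (intro allI)
    fix y x :: real
    interpret T: levy_tan "P y" "\<lambda>t w. X t w - y" \<eta> by (rule tan)
    \<comment> \<open>The summand 0 is the limit of the integral term, kept so that the limit rules
      match term by term. The limit exists at every outcome, also where the local time is infinite,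
      since \<open>real_of_ereal\<close> is then 0.\<close>
    define l where "l t w = - (h_fun \<eta> (X t w - x) - h_fun \<eta> (X 0 w - x)) - 0 + real_of_ereal (local_time X x t w)" for t w
    have Ml: "((\<lambda>q. M_proc P X q x t w) \<longlongrightarrow> l t w) (at_right 0)" for t w
    proof (rule Lim_transform_eventually)
      show "((\<lambda>q. - (T.hq q (X t w - x) - T.hq q (X 0 w - x)) - q * (LBINT s:{0..t}. r q (- X s w + x)) + real_of_ereal (local_time X x t w)) \<longlongrightarrow> l t w) (at_right 0)"
        unfolding l_def r_def by (intro tendsto_add tendsto_diff tendsto_minus T.hq_tendsto T.q_integral_tendsto tendsto_const)
      have "\<forall>\<^sub>F q in at_right (0::real). 0 < q" by (rule eventually_at_right_less)
      then show "\<forall>\<^sub>F q in at_right 0. - (T.hq q (X t w - x) - T.hq q (X 0 w - x)) - q * (LBINT s:{0..t}. r q (- X s w + x)) + real_of_ereal (local_time X x t w) = M_proc P X q x t w"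
        by eventually_elim (simp add: M_proc_def dens T.hq_def r_def)
    qed
    have N: "N_tilde P X x t w = T.N0 (x - y) t w" for t w
      using tendsto_Lim[OF _ Ml[of t w]] by (simp add: N_tilde_def l_def T.N0_def local_time_shift)
    have mart: "martingale (P y) (natural_filtration (P y) X) (N_tilde P X x)"
      using T.N0_martingale[of "x - y"] unfolding natural_filtration_shift N[abs_def] by (simp add: N[abs_def, symmetric])
    \<comment> \<open>The identity is real arithmetic wherever the local time is finite, and this
      finiteness is the only almost sure ingredient.\<close>
    have dec: "AE w in P y. ereal (h_fun \<eta> (X t w - x)) = ereal (h_fun \<eta> (X 0 w - x)) + ereal (N_tilde P X x t w) + local_time X x t w" if t: "0 \<le> t" for t
      using T.N0_increment(3)[OF t order_refl, of "x - y"]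
    proof eventually_elim
      case (elim w)
      then obtain c where c: "local_time X x t w = ereal c" unfolding local_time_shift by (cases "local_time X x t w") auto
      show ?case unfolding N T.N0_def local_time_shift c by simp
    qed
    show "(\<forall>t\<ge>0. (AE w in P y. \<exists>l::real. ((\<lambda>q. M_proc P X q x t w) \<longlongrightarrow> l) (at_right 0)) \<and>
      (AE w in P y. ereal (h_fun \<eta> (X t w - x)) = ereal (h_fun \<eta> (X 0 w - x)) + ereal (N_tilde P X x t w) + local_time X x t w)) \<and>
      martingale (P y) (natural_filtration (P y) X) (N_tilde P X x)"
      using Ml dec mart by blast
  qed
qed

end
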